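(* Fix $\beta>0$ and an arbitrary constant $\alpha>0$, and consider parameters $\alpha_0\in[\alpha,\log2)$. (1) There is a finite constant $M_{\alpha,\beta}$, depending only on $\alpha$ and $\beta$, such that $$\limsup_{N\to\infty}\left(\frac{N\,\mathbb{P}_\beta[X_N\ge\alpha_0N]}{(\theta^{-1}(\alpha_0))^2}\exp(\Lambda_{N,\beta}^*(\alpha_0N))\right)\le M_{\alpha,\beta}.$$ (2) If $\alpha_0$ belongs to the interval $[\alpha,\alpha']$ with $\alpha'$ small enough, then we also have $$\liminf_{N\to\infty}\big(N\,\mathbb{P}_\beta[X_N\ge\alpha_0N]\exp(\Lambda_{N,\beta}^*(\alpha_0N))\big)\ge m_{\alpha,\alpha',\beta}$$ for some finite and strictly positive constant $m_{\alpha,\alpha',\beta}$ depending only on $\alpha$, $\alpha'$, $\beta$. (3) If $\beta=2$, then $$\Lambda_{N,2}^*(\alpha_0N)=N^2I(\theta^{-1}(\alpha_0))+\frac{\log N}{12}+O_\alpha(1).$$ Therefore, in this case, $$\limsup_{N\to\infty}\left(\frac{N^{\frac{13}{12}}\,\mathbb{P}_2[X_N\ge\alpha_0N]}{(\theta^{-1}(\alpha_0))^2}\exp\big(N^2I(\theta^{-1}(\alpha_0))\big)\right)\le M_\alpha<+\infty$$ for some constant $M_\alpha$ depending only on $\alpha$, and similarly, if $\alpha_0\in[\alpha,\alpha']$ with $\alpha'$ small enough, $$\liminf_{N\to\infty}\big(N^{\frac{13}{12}}\,\mathbb{P}_2[X_N\ge\alpha_0N]\exp(N^2I(\theta^{-1}(\alpha_0)))\big)\ge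 m_{\alpha,\alpha'}>0$$ for some constant $m_{\alpha,\alpha'}$ depending only on $\alpha$ and $\alpha'$. (4) If $\beta\ne2$, then $$\Lambda_{N,\beta}^*(\alpha_0N)=N^2\beta'\,I(\theta^{-1}(\alpha_0))+O_{\alpha_0,\beta}(N).$$ Therefore the sequence of random variables $(X_N/N)_{N\in\mathbb{N}}$ satisfies under $\mathbb{P}_\beta$ a principle of large deviations with speed $N^2$ and rate function $\beta'\,I\circ\theta^{-1}$.
   Context: Let $\beta'=\beta/2$. $\mathbb{P}_\beta$ is the circular $\beta$ ensemble of order $N$: the law on $N$-tuples $(e^{i\theta_1},\dots,e^{i\theta_N})$ of points of the unit circle with density proportional to $\prod_{1\le i<j\le N}|e^{i\theta_i}-e^{i\theta_j}|^\beta\,d\theta_1\cdots d\theta_N$; $\mathbb{E}_\beta$ is the expectation. $X_N=\sum_{i=1}^N\log|1-e^{i\theta_i}|$ is the real part of the logarithm of the characteristic polynomial at $1$ (its largest value is $N\log2$). $\Lambda_{N,\beta}(h)=\log\mathbb{E}_\beta[e^{hX_N}]$ and $\Lambda_{N,\beta}^*(a)=\sup_{h\in\mathbb{R}}(ah-\Lambda_{N,\beta}(h))$. $\theta(x)=(1+2x)\log(1+2x)-(1+x)\log(1+x)-x\log(4x)$ (with $\theta(0)=0$) is a continuous increasing bijection from $[0,\infty)$ to $[0,\log2)$ with inverse $\theta^{-1}$, and for $x>0$ $$I(x)=-\frac{1-4x^2}{2}\log(1+2x)-x^2\log(4x)+(1-x^2)\log(1+x).$$ Indices on $O(\cdot)$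 indicate the parameters on which the implied constants may depend. *)

theory Defs
  imports "HOL-Probability.Probability"
begin

section \<open>Extended logarithm and exponential\<close>

definition ln_ennreal :: "ennreal \<Rightarrow> ereal" where
  "ln_ennreal x = (if x = 0 then -\<infinity> else if x = \<infinity> then \<infinity> else ereal (ln (enn2real x)))"

definition exp_ereal :: "ereal \<Rightarrow> ereal" where
  "exp_ereal x = (if x = \<infinity> then \<infinity> else if x = -\<infinity> then 0 else ereal (exp (real_of_ereal x)))"


section \<open>Large deviation principles\<close>

text \<open>
  The usual (Varadhan) formulation for a sequence of Borel probability measures, with a lower
  semicontinuous rate function; the rate function is not required to have compact level sets.
\<close>

definition large_deviation_principle ::
    "(nat \<Rightarrow> 'a::topological_space measure) \<Rightarrow> (nat \<Rightarrow> real) \<Rightarrow> ('a \<Rightarrow> ereal) \<Rightarrow> bool" where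
  "large_deviation_principle \<mu> s J \<longleftrightarrow>
     filterlim s at_top sequentially \<and>
     (\<forall>x. 0 \<le> J x) \<and> (\<forall>c. closed {x. J x \<le> c}) \<and>
     (\<forall>A \<in> sets borel.
        - (INF x\<in>interior A. J x) \<le> liminf (\<lambda>N. ln_ennreal (emeasure (\<mu> N) A) / ereal (s N)) \<and>
        limsup (\<lambda>N. ln_ennreal (emeasure (\<mu> N) A) / ereal (s N)) \<le> - (INF x\<in>closure A. J x))"


section \<open>The circular beta ensemble\<close>

definition circle_measure :: "complex measure" where
  "circle_measure = distr (restrict_space lborel {0..<2 * pi}) borel cis"

definition cbe_weight :: "nat \<Rightarrow> real \<Rightarrow> (nat \<Rightarrow> complex) \<Rightarrow> real" where
  "cbe_weight N \<beta> z = (\<Prod>j<N. \<Prod>i<j. cmod (z i - z j) powr \<beta>)"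

text \<open>The points of the ensemble are indexed from \<open>0\<close> to \<open>N - 1\<close>.\<close>

definition cbe :: "nat \<Rightarrow> real \<Rightarrow> (nat \<Rightarrow> complex) measure" where
  "cbe N \<beta> =
     (let M = (\<Pi>\<^sub>M i\<in>{..<N}. circle_measure)
      in density M (\<lambda>z. ennreal (cbe_weight N \<beta> z) / (\<integral>\<^sup>+ y. ennreal (cbe_weight N \<beta> y) \<partial>M)))"

text \<open>
  Where some \<open>z i = 1\<close> the true value is \<open>-\<infinity>\<close>, whereas \<open>ln 0 = 0\<close> makes the sum below finite;
  these configurations form a null set.
\<close>

definition log_charpoly :: "nat \<Rightarrow> (nat \<Rightarrow> complex) \<Rightarrow> real" where
  "log_charpoly N z = (\<Sum>i<N. ln (cmod (1 - z i)))"

text \<open>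
  The exponential moment is infinite for \<open>h \<le> -1\<close> (and \<open>N \<ge> 1\<close>), so it is taken in the extended
  nonnegative reals and its logarithm in the extended reals.
\<close>

definition log_mgf :: "nat \<Rightarrow> real \<Rightarrow> real \<Rightarrow> ereal" where
  "log_mgf N \<beta> h = ln_ennreal (\<integral>\<^sup>+ z. ennreal (exp (h * log_charpoly N z)) \<partial>cbe N \<beta>)"

definition log_mgf_conj :: "nat \<Rightarrow> real \<Rightarrow> real \<Rightarrow> ereal" where
  "log_mgf_conj N \<beta> a = (SUP h::real. ereal (a * h) - log_mgf N \<beta> h)"

definition upper_tail :: "nat \<Rightarrow> real \<Rightarrow> real \<Rightarrow> real" where
  "upper_tail N \<beta> a = measure (cbe N \<beta>) {z \<in> space (cbe N \<beta>). log_charpoly N z \<ge> a}"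


subsection \<open>The ensemble is a probability measure\<close>

lemma sets_circle_measure [measurable_cong, simp]: "sets circle_measure = sets borel"
  by (simp add: circle_measure_def)

lemma cis_measurable_interval: "cis \<in> measurable (restrict_space lborel {0..<2 * pi}) borel"
proof -
  have "cis \<in> borel_measurable borel"
    by (intro borel_measurable_continuous_onI continuous_intros)
  then show ?thesis
    by (simp add: measurable_restrict_space1)
qed

lemma emeasure_circle_measure:
  assumes "A \<in> sets borel"
  shows "emeasure circle_measure A = emeasure lborel (cis -` A \<inter> {0..<2 * pi})"
  using assms cis_measurable_interval
  by (simp add: circle_measure_def emeasure_distr emeasure_restrict_space space_restrict_space)

lemma emeasure_circle_measure_UNIV: "emeasure circle_measure UNIV = ennreal (2 * pi)"
  by (simp add: emeasure_circle_measure)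

lemma finite_circle_measure: "finite_measure circle_measure"
  by (rule finite_measureI)
     (simp add: sets_eq_imp_space_eq[OF sets_circle_measure] emeasure_circle_measure_UNIV)

lemma cbe_weight_measurable [measurable]:
  "cbe_weight N \<beta> \<in> borel_measurable (\<Pi>\<^sub>M i\<in>{..<N}. circle_measure)"
  unfolding cbe_weight_def
proof (intro borel_measurable_prod)
  fix j i assume "j \<in> {..<N}" "i \<in> {..<j}"
  then have i: "i \<in> {..<N}" and j: "j \<in> {..<N}" by auto
  have [measurable]: "(\<lambda>z. z i) \<in> borel_measurable (\<Pi>\<^sub>M i\<in>{..<N}. circle_measure)"
    using measurable_component_singleton[OF i, of "\<lambda>_. circle_measure"]
    by (simp cong: measurable_cong_sets)
  have [measurable]: "(\<lambda>z. z j) \<in> borel_measurable (\<Pi>\<^sub>M i\<in>{..<N}. circle_measure)"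
    using measurable_component_singleton[OF j, of "\<lambda>_. circle_measure"]
    by (simp cong: measurable_cong_sets)
  show "(\<lambda>z. cmod (z i - z j) powr \<beta>) \<in> borel_measurable (\<Pi>\<^sub>M i\<in>{..<N}. circle_measure)"
    by measurable
qed

lemma log_charpoly_measurable [measurable]:
  "log_charpoly N \<in> borel_measurable (cbe N \<beta>)"
proof -
  have "log_charpoly N \<in> borel_measurable (\<Pi>\<^sub>M i\<in>{..<N}. circle_measure)"
    unfolding log_charpoly_def
  proof (intro borel_measurable_sum)
    fix i assume i: "i \<in> {..<N}"
    have [measurable]: "(\<lambda>z. z i) \<in> borel_measurable (\<Pi>\<^sub>M i\<in>{..<N}. circle_measure)"
      using measurable_component_singleton[OF i, of "\<lambda>_. circle_measure"]
      by (simp cong: measurable_cong_sets)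
    show "(\<lambda>z. ln (cmod (1 - z i))) \<in> borel_measurable (\<Pi>\<^sub>M i\<in>{..<N}. circle_measure)"
      by measurable
  qed
  then show ?thesis by (simp add: cbe_def Let_def)
qed

lemma emeasure_circle_measure_ball_pos:
  assumes "0 \<le> t" "t < 2 * pi" "0 < e"
  shows "0 < emeasure circle_measure (ball (cis t) e)"
proof -
  define d where "d = min e (2 * pi - t)"
  have d: "0 < d" "d \<le> e" "t + d \<le> 2 * pi" using assms by (auto simp: d_def)
  have "{t<..<t + d} \<subseteq> cis -` ball (cis t) e \<inter> {0..<2 * pi}"
  proof
    fix s assume s: "s \<in> {t<..<t + d}"
    have "norm (cis s - cis t) \<le> \<bar>s - t\<bar>"
    proof -
      have "cis s - cis t = cis t * (cis (s - t) - 1)"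
        by (simp add: algebra_simps cis_mult)
      then have "norm (cis s - cis t) = norm (exp (\<i> * of_real (s - t)) - 1)"
        by (simp add: norm_mult cis_conv_exp)
      also have "\<dots> = 2 * \<bar>sin ((s - t) / 2)\<bar>"
        by (rule dist_exp_i_1)
      also have "\<dots> \<le> \<bar>s - t\<bar>"
        using abs_sin_x_le_abs_x[of "(s - t) / 2"] by simp
      finally show ?thesis .
    qed
    then have "dist (cis t) (cis s) < e"
      using s d by (simp add: dist_norm norm_minus_commute)
    then show "s \<in> cis -` ball (cis t) e \<inter> {0..<2 * pi}"
      using s d assms by auto
  qed
  moreover have "cis -` ball (cis t) e \<inter> {0..<2 * pi} \<in> sets lborel"
  proof -
    have "cis \<in> borel_measurable borel"
      by (intro borel_measurable_continuous_onI continuous_intros)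
    then show ?thesis
      by (auto simp: measurable_def)
  qed
  ultimately have "emeasure lborel {t<..<t + d} \<le> emeasure circle_measure (ball (cis t) e)"
    by (subst emeasure_circle_measure) (auto intro!: emeasure_mono)
  moreover have "0 < emeasure lborel {t<..<t + d}" using d by simp
  ultimately show ?thesis by (rule less_le_trans[rotated])
qed

lemma prob_space_cbe:
  assumes "\<beta> > 0"
  shows "prob_space (cbe N \<beta>)"
proof -
  interpret C: finite_measure circle_measure by (rule finite_circle_measure)
  interpret P: finite_product_sigma_finite "\<lambda>_. circle_measure" "{..<N}"
    by unfold_locales auto
  define M where "M = (\<Pi>\<^sub>M i\<in>{..<N}. circle_measure)"
  define Z where "Z = (\<integral>\<^sup>+ y. ennreal (cbe_weight N \<beta> y) \<partial>M)"
  have w_M [measurable]: "cbe_weight N \<beta> \<in> borel_measurable M"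
    unfolding M_def by (rule cbe_weight_measurable)
  have w_nonneg: "0 \<le> cbe_weight N \<beta> z" for z
    unfolding cbe_weight_def by (intro prod_nonneg) auto
  have circle: "AE x in circle_measure. cmod x = 1"
    unfolding circle_measure_def
    by (subst AE_distr_iff[OF cis_measurable_interval]) auto
  have space_C: "space circle_measure = UNIV"
    by (simp add: sets_eq_imp_space_eq[OF sets_circle_measure])
  have space_M: "emeasure M (space M) = (\<Prod>i<N. ennreal (2 * pi))"
    unfolding M_def using P.measure_times[of "\<lambda>_. UNIV"]
    by (simp add: space_PiM space_C emeasure_circle_measure_UNIV)
  have fin_M: "emeasure M (space M) < \<infinity>"
    unfolding space_M by (simp add: ennreal_power less_top[symmetric])
  have null: "AE z in M. cmod (z i) = 1" if i: "i \<in> {..<N}" for i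
  proof (rule AE_I')
    let ?B = "\<lambda>j. if j = i then {x. cmod x \<noteq> 1} else UNIV"
    have meas: "{x::complex. cmod x \<noteq> 1} \<in> sets borel" by measurable
    have "emeasure circle_measure {x. cmod x \<noteq> 1} = 0"
      using circle meas by (subst (asm) AE_iff_measurable[OF _ refl]) (auto simp: space_C)
    moreover have "emeasure M (\<Pi>\<^sub>E j\<in>{..<N}. ?B j) = (\<Prod>j<N. emeasure circle_measure (?B j))"
      unfolding M_def using meas by (intro P.measure_times) auto
    ultimately have "emeasure M (\<Pi>\<^sub>E j\<in>{..<N}. ?B j) = 0"
      using i by (auto intro!: prod_zero)
    moreover have "(\<Pi>\<^sub>E j\<in>{..<N}. ?B j) \<in> sets M"
      unfolding M_def using meas by (intro sets_PiM_I_finite) auto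
    ultimately show "(\<Pi>\<^sub>E j\<in>{..<N}. ?B j) \<in> null_sets M" by blast
    show "{z \<in> space M. cmod (z i) \<noteq> 1} \<subseteq> (\<Pi>\<^sub>E j\<in>{..<N}. ?B j)"
      unfolding M_def by (auto simp: space_PiM PiE_iff space_C extensional_def)
  qed
  have "AE z in M. \<forall>i\<in>{..<N}. cmod (z i) = 1"
    using null by (intro AE_finite_allI) auto
  then have "AE z in M. ennreal (cbe_weight N \<beta> z) \<le> ennreal (\<Prod>j<N. \<Prod>i<j. 2 powr \<beta>)"
  proof eventually_elim
    case (elim z)
    have "cmod (z i - z j) \<le> 2" if "i < N" "j < N" for i j
      using norm_triangle_ineq4[of "z i" "z j"] elim that by simp
    then show ?case
      unfolding cbe_weight_def using assms
      by (intro ennreal_leI prod_mono conjI prod_nonneg powr_mono2) auto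
  qed
  then have "Z \<le> (\<integral>\<^sup>+ y. ennreal (\<Prod>j<N. \<Prod>i<j. 2 powr \<beta>) \<partial>M)"
    unfolding Z_def by (rule nn_integral_mono_AE)
  also have "\<dots> < \<infinity>"
    using fin_M by (simp add: ennreal_mult_less_top)
  finally have Z_fin: "Z < \<infinity>" .
  have Z_pos: "Z \<noteq> 0"
  proof
    assume "Z = 0"
    then have AE0: "AE z in M. cbe_weight N \<beta> z = 0"
      unfolding Z_def using w_nonneg
      by (subst (asm) nn_integral_0_iff_AE) (auto simp: ennreal_eq_0_iff antisym)
    define c where "c j = cis (real j / real N)" for j
    define e where
      "e = Min (insert 1 ((\<lambda>(i, j). dist (c i) (c j) / 2) ` {(i, j) \<in> {..<N} \<times> {..<N}. i \<noteq> j}))"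
    have le_pi: "real j / real N \<le> pi" if "j < N" for j
    proof -
      have "real j / real N \<le> 1" using that by simp
      then show ?thesis using pi_gt3 by linarith
    qed
    have c_neq: "c i \<noteq> c j" if "i < N" "j < N" "i \<noteq> j" for i j
    proof
      assume "c i = c j"
      then have "cos (real i / real N) = cos (real j / real N)"
        by (simp add: c_def complex_eq_iff)
      moreover have "0 \<le> real i / real N" "0 \<le> real j / real N" by simp_all
      ultimately have "real i / real N = real j / real N"
        using le_pi[OF \<open>i < N\<close>] le_pi[OF \<open>j < N\<close>] by (metis cos_inj_pi)
      then show False using that by simp
    qed
    have fin: "finite {(i, j) \<in> {..<N} \<times> {..<N}. i \<noteq> j}"
      by (rule finite_subset[of _ "{..<N} \<times> {..<N}"]) auto
    have e_pos: "0 < e"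
      unfolding e_def using fin c_neq by (subst Min_gr_iff) auto
    have e_le: "2 * e \<le> dist (c i) (c j)" if "i < N" "j < N" "i \<noteq> j" for i j
    proof -
      have "e \<le> dist (c i) (c j) / 2"
        unfolding e_def using fin that by (intro Min_le) (auto intro!: image_eqI[of _ _ "(i, j)"])
      then show ?thesis by simp
    qed
    define B where "B = (\<Pi>\<^sub>E j\<in>{..<N}. ball (c j) e)"
    have B_sets: "B \<in> sets M"
      unfolding B_def M_def by (intro sets_PiM_I_finite) auto
    have "emeasure M B = (\<Prod>j<N. emeasure circle_measure (ball (c j) e))"
      unfolding B_def M_def by (intro P.measure_times) auto
    also have "\<dots> \<noteq> 0"
    proof -
      have "0 < emeasure circle_measure (ball (c j) e)" if "j < N" for j
      proof -
        have "real j / real N < 1" using that by simp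
        also have "1 < 2 * pi" using pi_gt3 by linarith
        finally show ?thesis
          unfolding c_def using e_pos by (intro emeasure_circle_measure_ball_pos) auto
      qed
      then show ?thesis by (force simp: prod_zero_iff)
    qed
    finally have "emeasure M B \<noteq> 0" .
    moreover have "AE z in M. z \<notin> B"
      using AE0
    proof eventually_elim
      case (elim z)
      show ?case
      proof
        assume B: "z \<in> B"
        have "z i \<noteq> z j" if "i < N" "j < N" "i \<noteq> j" for i j
        proof
          assume eq: "z i = z j"
          have "dist (c i) (z i) < e" "dist (c j) (z j) < e"
            using B that by (auto simp: B_def PiE_iff)
          then have "dist (c i) (c j) < 2 * e"
            using dist_triangle2[of "c i" "c j" "z i"] eq by simp
          with e_le[OF that] show False by simp
        qed
        then have "0 < cbe_weight N \<beta> z"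
          unfolding cbe_weight_def by (intro prod_pos ballI) auto
        with elim show False by simp
      qed
    qed
    ultimately show False
      using AE_iff_null_sets[OF B_sets] by auto
  qed
  show ?thesis
  proof (rule prob_spaceI)
    have cbe_eq: "cbe N \<beta> = density M (\<lambda>z. ennreal (cbe_weight N \<beta> z) / Z)"
      by (simp add: cbe_def Let_def M_def Z_def)
    have "emeasure (cbe N \<beta>) (space (cbe N \<beta>)) = (\<integral>\<^sup>+ z. ennreal (cbe_weight N \<beta> z) / Z \<partial>M)"
      unfolding cbe_eq by (simp add: emeasure_density cong: nn_integral_cong)
    also have "\<dots> = Z / Z"
      by (subst nn_integral_divide) (auto simp: Z_def)
    also have "\<dots> = 1"
      using Z_pos Z_fin by (intro ennreal_divide_self) auto
    finally show "emeasure (cbe N \<beta>) (space (cbe N \<beta>)) = 1" .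
  qed
qed


section \<open>The limiting rate\<close>

text \<open>At \<open>0\<close> the formula gives \<open>theta 0 = 0\<close>, since \<open>0 * ln 0 = 0\<close>.\<close>

definition theta :: "real \<Rightarrow> real" where
  "theta x = (1 + 2 * x) * ln (1 + 2 * x) - (1 + x) * ln (1 + x) - x * ln (4 * x)"

definition theta_inv :: "real \<Rightarrow> real" where
  "theta_inv = the_inv_into {0..} theta"

definition rate_I :: "real \<Rightarrow> real" where
  "rate_I x = - ((1 - 4 * x\<^sup>2) / 2) * ln (1 + 2 * x) - x\<^sup>2 * ln (4 * x) + (1 - x\<^sup>2) * ln (1 + x)"

text \<open>
  \<open>\<beta>/2 * I \<circ> \<theta>\<inverse>\<close> only makes sense on \<open>[0, log 2)\<close>. A rate function lives on all of \<open>\<real>\<close>: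
  it vanishes on the negative half-line, because a negative value of \<open>log_charpoly N z / N\<close>
  costs only \<open>exp (- O(N))\<close> (one eigenvalue close to \<open>1\<close>), and it is infinite from the almost
  surely unattained maximal value \<open>log 2\<close> onwards. This is the only extension compatible with
  a large deviation principle of speed \<open>N\<^sup>2\<close>.
\<close>

definition cbe_rate :: "real \<Rightarrow> real \<Rightarrow> ereal" where
  "cbe_rate \<beta> a =
     (if a < 0 then 0 else if a < ln 2 then ereal (\<beta> / 2 * rate_I (theta_inv a)) else \<infinity>)"

end

theory Submission
  imports Defs "HOL-Complex_Analysis.Complex_Analysis" "HOL-Real_Asymp.Real_Asymp"
begin

text \<open>
  Integration by parts on the circle gives Aomoto's recursion for the Selberg--Morris integral,
  hence the ratio of the exponential moments at \<open>h + 2\<close> and \<open>h\<close>; together with convexity in \<open>h\<close>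
  this identifies the moments with a product of Gamma quotients, as in the Bohr--Mollerup theorem,
  and analytic continuation extends the formula to complex \<open>h\<close>.

  For \<open>0 < a < log 2\<close> tilt the ensemble by \<open>exp (h X)\<close>, with \<open>h\<close> of order \<open>N\<close> chosen such that \<open>X\<close>
  has mean \<open>a N\<close>. The tail probability times the exponential of the conjugate function becomes the
  integral of \<open>exp (- h Y) 1\<^bsub>Y \<ge> 0\<^esub>\<close> for \<open>Y = X - a N\<close>, which has bounded variance. The function
  \<open>exp (- y) 1\<^bsub>y \<ge> 0\<^esub>\<close> lies between two combinations of Cauchy kernels; their Fourier transforms are
  explicit, so that the Gaussian limit of the characteristic function of \<open>Y\<close> shows that the integral is
  of exact order \<open>1/N\<close>.

  The asymptotics of the conjugate function come from reading the derivative of the logarithmic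
  moment generating function as a Riemann sum for \<open>theta\<close>. For \<open>\<beta> = 2\<close> the Gamma products are Barnes
  functions, whose expansion yields the logarithmic term.

  In the large deviation principle, an interval in the negative half-line is reached by the tilt
  \<open>h = -1 + 1/N\<close>, close to the singularity of the moments, at a cost of only \<open>exp (- O(N))\<close>.
\<close>


section \<open>The Selberg--Morris recursion\<close>

text \<open>The recursion relates \<open>h\<close> and \<open>h + 2\<close> only, so it fixes the
  moments up to a factor of period 2 in \<open>h\<close>; convexity removes this factor because the
  increments of the logarithm over a step of length 2 converge as \<open>h\<close> grows. Aomoto's
  method multiplies the weight by the holomorphic factor \<open>1 - z\<close> at each point. The
  squared modulus takes a second such step on the conjugated weight, which is why complex weights
  occur.

  The local limit is needed on the scale \<open>1 / h\<close>, far below the standard deviation,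
  where convergence in law says nothing. In Fourier terms frequencies of order \<open>h\<close>
  matter. The bound from Gamma quotients is Gaussian up to \<open>h\<close> but saturates beyond,
  and the factor \<open>exp (- |t / h|)\<close> contributed by the Cauchy kernel supplies the
  missing decay.

  At \<open>h = 2 * b * x * N\<close> the derivative of the logarithmic moment generating function
  differs from \<open>N * theta x\<close> by \<open>O(1 + 1 / sqrt x)\<close>. This is singular at 0
  but integrable, so the function itself is controlled by integrating from 0, where it
  vanishes.\<close>

lemma space_circle_measure [simp]: "space circle_measure = UNIV"
  using sets_eq_imp_space_eq[OF sets_circle_measure] by simp

section \<open>Chord lengths and integrable powers of the distance on the circle\<close>

lemma sin_ge_half_self:
  assumes "0 \<le> t" "t \<le> pi / 2"
  shows "t / 2 \<le> sin t"
proof (cases "t \<le> pi / 3")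
  case True
  have "sin 0 - 0 / 2 \<le> sin t - t / 2"
  proof (rule DERIV_nonneg_imp_nondecreasing[of 0 t "\<lambda>t. sin t - t / 2"])
    fix x assume x: "0 \<le> x" "x \<le> t"
    have "cos (pi / 3) \<le> cos x"
      using x True pi_gt_zero by (intro cos_monotone_0_pi_le) auto
    then show "\<exists>y. ((\<lambda>t. sin t - t / 2) has_real_derivative y) (at x) \<and> 0 \<le> y"
      by (intro exI[of _ "cos x - 1 / 2"]) (auto intro!: derivative_eq_intros simp: cos_60)
  qed (use assms in auto)
  then show ?thesis by simp
next
  case False
  have "sin (pi / 3) \<le> sin t"
    using False assms by (intro sin_monotone_2pi_le) auto
  \<comment> \<open>Beyond \<open>pi / 3\<close> the sine is at least \<open>sqrt 3 / 2\<close>, and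
    \<open>1.6\<close> fits between \<open>pi / 2\<close> and \<open>sqrt 3\<close>.\<close>
  moreover have "t / 2 \<le> sqrt 3 / 2"
  proof -
    have "t \<le> 1.6" using assms pi_less_4 pi_approx by simp
    also have "\<dots> \<le> sqrt 3" by (rule real_le_rsqrt) (simp add: power2_eq_square)
    finally show ?thesis by simp
  qed
  ultimately show ?thesis by (simp add: sin_60)
qed

lemma cmod_cis_diff: "cmod (cis s - cis t) = 2 * \<bar>sin ((s - t) / 2)\<bar>"
proof -
  have "cis s - cis t = cis t * (cis (s - t) - 1)"
    by (simp add: algebra_simps cis_mult)
  then show ?thesis
    using dist_exp_i_1[of "s - t"] by (simp add: norm_mult cis_conv_exp)
qed

text \<open>The chord is twice the sine of half the shorter arc, and \<open>sin_ge_half_self\<close>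
  applies. Negative powers of the chord are then controlled by powers of arc lengths.\<close>

lemma cmod_cis_diff_ge:
  assumes "\<bar>y\<bar> \<le> 2 * pi" "y = s - t"
  shows "min \<bar>y\<bar> (2 * pi - \<bar>y\<bar>) / 2 \<le> cmod (cis s - cis t)"
proof -
  have e: "\<bar>sin (y / 2)\<bar> = sin (\<bar>y\<bar> / 2)"
  proof -
    have "0 \<le> sin (\<bar>y\<bar> / 2)" using assms by (intro sin_ge_zero) auto
    then show ?thesis by (cases "y \<ge> 0") auto
  qed
  have "min \<bar>y\<bar> (2 * pi - \<bar>y\<bar>) / 4 \<le> sin (\<bar>y\<bar> / 2)"
  proof (cases "\<bar>y\<bar> \<le> pi")
    case True
    then show ?thesis using sin_ge_half_self[of "\<bar>y\<bar> / 2"] by (simp add: min_def split: if_splits)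
  next
    case False
    have "sin (\<bar>y\<bar> / 2) = sin (pi - \<bar>y\<bar> / 2)" by simp
    then show ?thesis using False assms sin_ge_half_self[of "pi - \<bar>y\<bar> / 2"]
      by (auto simp: min_def field_simps)
  qed
  then show ?thesis using e assms by (simp add: cmod_cis_diff)
qed

lemma nn_integral_circle_measure:
  assumes [measurable]: "f \<in> borel_measurable borel"
  shows "(\<integral>\<^sup>+ z. f z \<partial>circle_measure) = (\<integral>\<^sup>+ t. f (cis t) * indicator {0..<2 * pi} t \<partial>lborel)"
  unfolding circle_measure_def
  by (subst nn_integral_distr[OF cis_measurable_interval])
     (auto simp: nn_integral_restrict_space)

lemma integral_circle_measure:
  fixes f :: "complex \<Rightarrow> 'a::{banach, second_countable_topology}"
  assumes [measurable]: "f \<in> borel_measurable borel"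
  shows "(\<integral> z. f z \<partial>circle_measure) = (\<integral> t. indicator {0..<2 * pi} t *\<^sub>R f (cis t) \<partial>lborel)"
  unfolding circle_measure_def
  by (subst integral_distr[OF cis_measurable_interval])
     (auto simp: integral_restrict_space)

lemma integrable_circle_measure_iff:
  fixes f :: "complex \<Rightarrow> 'a::{banach, second_countable_topology}"
  assumes [measurable]: "f \<in> borel_measurable borel"
  shows "integrable circle_measure f \<longleftrightarrow> set_integrable lborel {0..<2 * pi} (\<lambda>t. f (cis t))"
  unfolding circle_measure_def
  by (subst integrable_distr_eq[OF cis_measurable_interval])
     (auto simp: integrable_restrict_space set_integrable_def)

lemma nn_integral_abs_powr_finite:
  assumes "s > (-1::real)" "0 \<le> L"
  shows "(\<integral>\<^sup>+ t. ennreal (\<bar>t\<bar> powr s) * indicator {-L..L} t \<partial>lborel) < \<infinity>"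
proof -
  have "(\<lambda>t. t powr s) integrable_on {0..L}"
    by (rule integrable_on_powr_from_0) (use assms in auto)
  then have *: "(\<integral>\<^sup>+ t. ennreal (t powr s) * indicator {0..L} t \<partial>lborel) < \<infinity>"
  proof -
    assume int: "(\<lambda>t. t powr s) integrable_on {0..L}"
    let ?f = "\<lambda>t. if t \<in> {0..L} then t powr s else 0"
    have "(\<integral>\<^sup>+ t. ennreal (t powr s) * indicator {0..L} t \<partial>lborel) = (\<integral>\<^sup>+ t. ennreal (?f t) \<partial>lborel)"
      by (intro nn_integral_cong) (auto simp: indicator_def)
    also have "\<dots> = ennreal (integral {0..L} (\<lambda>t. t powr s))"
    proof (rule nn_integral_has_integral_lborel)
      show "(?f has_integral integral {0..L} (\<lambda>t. t powr s)) UNIV"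
        using int by (subst has_integral_restrict_UNIV) (rule integrable_integral)
    qed auto
    finally show ?thesis by simp
  qed
  have "(\<integral>\<^sup>+ t. ennreal (\<bar>t\<bar> powr s) * indicator {-L..L} t \<partial>lborel) \<le>
    (\<integral>\<^sup>+ t. ennreal (t powr s) * indicator {0..L} t + ennreal ((-t) powr s) * indicator {0..L} (-t) \<partial>lborel)"
    by (intro nn_integral_mono) (auto simp: indicator_def)
  also have "\<dots> = (\<integral>\<^sup>+ t. ennreal (t powr s) * indicator {0..L} t \<partial>lborel) + (\<integral>\<^sup>+ t. ennreal ((-t) powr s) * indicator {0..L} (-t) \<partial>lborel)"
    by (rule nn_integral_add) auto
  also have "(\<integral>\<^sup>+ t. ennreal ((-t) powr s) * indicator {0..L} (-t) \<partial>lborel) = (\<integral>\<^sup>+ t. ennreal (t powr s) * indicator {0..L} t \<partial>lborel)"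
    by (subst (2) nn_integral_real_affine[of _ "-1" 0]) auto
  finally show ?thesis using * by (auto simp: order_le_less_trans)
qed

text \<open>The constant must not depend on \<open>u\<close>: in \<open>integrable_H\<close> the
  role of \<open>u\<close> is played by another point of the ensemble, over which one integrates
  afterwards. For negative \<open>s\<close> the chord is replaced by half the shorter arc.\<close>

lemma nn_integral_cmod_powr_bound:
  assumes s: "s > (-1::real)"
  obtains K :: real where "K \<ge> 0"
    "\<And>u. cmod u = 1 \<Longrightarrow> (\<integral>\<^sup>+ z. ennreal (cmod (z - u) powr s) \<partial>circle_measure) \<le> ennreal K"
proof (cases "s \<ge> 0")
  case True
  show thesis
  proof (rule that[of "2 powr s * (2 * pi)"])
    fix u :: complex assume u: "cmod u = 1"
    have "(\<integral>\<^sup>+ z. ennreal (cmod (z - u) powr s) \<partial>circle_measure)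
        = (\<integral>\<^sup>+ t. ennreal (cmod (cis t - u) powr s) * indicator {0..<2 * pi} t \<partial>lborel)"
      by (rule nn_integral_circle_measure) measurable
    also have "\<dots> \<le> (\<integral>\<^sup>+ t. ennreal (2 powr s) * indicator {0..<2 * pi} t \<partial>lborel)"
    proof (intro nn_integral_mono mult_right_mono ennreal_leI powr_mono2 True)
      fix t show "cmod (cis t - u) \<le> 2"
        using norm_triangle_ineq4[of "cis t" u] u by simp
    qed auto
    also have "\<dots> = ennreal (2 powr s * (2 * pi))"
      by (simp add: nn_integral_cmult_indicator ennreal_mult)
    finally show "(\<integral>\<^sup>+ z. ennreal (cmod (z - u) powr s) \<partial>circle_measure) \<le> ennreal (2 powr s * (2 * pi))" .
  qed auto
next
  case False
  define I where "I = (\<integral>\<^sup>+ t. ennreal (\<bar>t\<bar> powr s) * indicator {-(4*pi)..4*pi} t \<partial>lborel)"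
  have I: "I < \<infinity>" unfolding I_def using s by (intro nn_integral_abs_powr_finite) auto
  have shift: "(\<integral>\<^sup>+ t. ennreal (\<bar>t + c\<bar> powr s) * indicator {-(4*pi)..4*pi} (t + c) \<partial>lborel) = I" for c
    unfolding I_def
    by (subst (2) nn_integral_real_affine[of _ 1 c]) (auto simp: add.commute)
  show thesis
  proof (rule that[of "enn2real (ennreal ((1/2) powr s) * (I + I + I))"])
    fix u :: complex assume u: "cmod u = 1"
    obtain p where p: "0 \<le> p" "p < 2 * pi" "u = cis p"
      using u by (metis Arg2pi_ge_0 Arg2pi_lt_2pi complex_norm_eq_1_exp_eq cis_conv_exp mult.commute is_Arg_def Arg2pi mult_1 of_real_1)
    have "(\<integral>\<^sup>+ z. ennreal (cmod (z - u) powr s) \<partial>circle_measure)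
        = (\<integral>\<^sup>+ t. ennreal (cmod (cis t - u) powr s) * indicator {0..<2 * pi} t \<partial>lborel)"
      by (rule nn_integral_circle_measure) measurable
    \<comment> \<open>The shorter arc from \<open>p\<close> to \<open>t\<close> is one of
      \<open>|t - p|\<close>, \<open>|t - p + 2 * pi|\<close>, \<open>|t - p - 2 * pi|\<close>. The
      sum of all three powers avoids a case distinction under the integral, and the window of radius
      \<open>4 * pi\<close> contains all three arguments.\<close>
    also have "\<dots> \<le> (\<integral>\<^sup>+ t. ennreal ((1/2) powr s) * (ennreal (\<bar>t + (-p)\<bar> powr s) * indicator {-(4*pi)..4*pi} (t + (-p))
       + ennreal (\<bar>t + (2*pi-p)\<bar> powr s) * indicator {-(4*pi)..4*pi} (t + (2*pi-p))
       + ennreal (\<bar>t + (-2*pi-p)\<bar> powr s) * indicator {-(4*pi)..4*pi} (t + (-2*pi-p))) \<partial>lborel)"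
    proof (intro nn_integral_mono)
      fix t
      define y where "y = t - p"
      show "ennreal (cmod (cis t - u) powr s) * indicator {0..<2 * pi} t \<le> ennreal ((1/2) powr s) * (ennreal (\<bar>t + (-p)\<bar> powr s) * indicator {-(4*pi)..4*pi} (t + (-p))
       + ennreal (\<bar>t + (2*pi-p)\<bar> powr s) * indicator {-(4*pi)..4*pi} (t + (2*pi-p))
       + ennreal (\<bar>t + (-2*pi-p)\<bar> powr s) * indicator {-(4*pi)..4*pi} (t + (-2*pi-p)))"
      proof (cases "t \<in> {0..<2 * pi} \<and> t \<noteq> p")
        case True
        have y: "\<bar>y\<bar> < 2 * pi" "y \<noteq> 0" using True p by (auto simp: y_def)
        have ge: "min \<bar>y\<bar> (2 * pi - \<bar>y\<bar>) / 2 \<le> cmod (cis t - u)"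
          unfolding p using y by (intro cmod_cis_diff_ge) (auto simp: y_def)
        have "cmod (cis t - u) powr s \<le> (min \<bar>y\<bar> (2 * pi - \<bar>y\<bar>) * (1/2)) powr s"
          using ge y False by (intro powr_mono2') auto
        also have "\<dots> = (1/2) powr s * (min \<bar>y\<bar> (2 * pi - \<bar>y\<bar>)) powr s"
          using y by (subst powr_mult) (auto simp: mult.commute)
        also have "(min \<bar>y\<bar> (2 * pi - \<bar>y\<bar>)) powr s \<le> \<bar>y\<bar> powr s + \<bar>y + 2*pi\<bar> powr s + \<bar>y - 2 * pi\<bar> powr s"
        proof -
          have "min \<bar>y\<bar> (2 * pi - \<bar>y\<bar>) \<in> {\<bar>y\<bar>, \<bar>y + 2*pi\<bar>, \<bar>y - 2*pi\<bar>}" using y by (auto simp: min_def)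
          moreover have "0 \<le> \<bar>y\<bar> powr s" "0 \<le> \<bar>y + 2*pi\<bar> powr s" "0 \<le> \<bar>y - 2 * pi\<bar> powr s" by simp_all
          ultimately show ?thesis by (smt (verit) insert_iff singletonD)
        qed
        finally have "cmod (cis t - u) powr s \<le> (1/2) powr s * (\<bar>y\<bar> powr s + \<bar>y + 2*pi\<bar> powr s + \<bar>y - 2 * pi\<bar> powr s)" by simp
        then have "ennreal (cmod (cis t - u) powr s) \<le> ennreal ((1/2) powr s * (\<bar>y\<bar> powr s + \<bar>y + 2*pi\<bar> powr s + \<bar>y - 2 * pi\<bar> powr s))"
          by (rule ennreal_leI)
        also have "\<dots> = ennreal ((1/2) powr s) * (ennreal (\<bar>y\<bar> powr s) + ennreal (\<bar>y + 2*pi\<bar> powr s) + ennreal (\<bar>y - 2 * pi\<bar> powr s))"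
          by (simp add: ennreal_mult)
        finally show ?thesis using True y p by (simp add: y_def algebra_simps indicator_def)
      next
        case False
        then show ?thesis
          by (cases "t \<in> {0..<2 * pi}") (auto simp: p)
      qed
    qed
    also have "\<dots> = ennreal ((1/2) powr s) * (I + I + I)"
    proof -
      have "(\<integral>\<^sup>+ t. ennreal ((1/2) powr s) * (ennreal (\<bar>t + a\<bar> powr s) * indicator {-(4*pi)..4*pi} (t + a)
       + ennreal (\<bar>t + b\<bar> powr s) * indicator {-(4*pi)..4*pi} (t + b)
       + ennreal (\<bar>t + c\<bar> powr s) * indicator {-(4*pi)..4*pi} (t + c)) \<partial>lborel) = ennreal ((1/2) powr s) * (I + I + I)" for a b c
        by (subst nn_integral_cmult, measurable) (subst nn_integral_add, measurable, subst nn_integral_add, measurable, simp add: shift)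
      then show ?thesis .
    qed
    also have "\<dots> = ennreal (enn2real (ennreal ((1/2) powr s) * (I + I + I)))"
      using I by (simp add: ennreal_mult_less_top)
    finally show "(\<integral>\<^sup>+ z. ennreal (cmod (z - u) powr s) \<partial>circle_measure) \<le> ennreal (enn2real (ennreal ((1/2) powr s) * (I + I + I)))" .
  qed auto
qed

lemma cis_inj_on: "inj_on cis {0<..<2 * pi}"
proof (rule inj_onI)
  fix s t assume st: "s \<in> {0<..<2 * pi}" "t \<in> {0<..<2 * pi}" "cis s = cis t"
  have "sin ((s - t) / 2) = 0" using cmod_cis_diff[of s t] st(3) by simp
  moreover have b: "0 < s" "s < 2 * pi" "0 < t" "t < 2 * pi" using st(1,2) by simp_all
  moreover have "- pi < (s - t) / 2" using b by simp
  moreover have "(s - t) / 2 < pi" using b by simp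
  ultimately have "(s - t) / 2 = 0" using sin_eq_0_pi by blast
  then show "s = t" by simp
qed

lemma cis_neq_1: "t \<in> {0<..<2 * pi} \<Longrightarrow> cis t \<noteq> 1"
proof
  assume t: "t \<in> {0<..<2 * pi}" "cis t = 1"
  have "cmod (cis t - cis 0) = 0" using t(2) by simp
  then have "sin (t / 2) = 0" unfolding cmod_cis_diff by simp
  moreover have "sin (t / 2) > 0" using t(1) by (intro sin_gt_zero) simp_all
  ultimately show False by linarith
qed

text \<open>The square \<open>q\<close> of the distance is a trigonometric polynomial in
  \<open>t\<close>, positive away from \<open>x\<close>, so the chain rule for
  \<open>q powr b\<close> avoids differentiating the modulus.\<close>

lemma cmod_cis_powr_has_derivative:
  assumes x: "cmod x = 1" and ne: "cis t \<noteq> x"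
  shows "((\<lambda>t. cmod (cis t - x) powr (2 * b)) has_real_derivative
     (cmod (cis t - x) powr (2 * b)) * (b * (2 * Im (cis t * cnj x) / (cmod (cis t - x))\<^sup>2))) (at t)"
proof -
  define q where "q t = 2 - 2 * (cos t * Re x + sin t * Im x)" for t
  have x2: "(Re x)\<^sup>2 + (Im x)\<^sup>2 = 1" using x by (simp add: cmod_def)
  have q: "(cmod (cis t - x))\<^sup>2 = q t" for t
  proof -
    have "(cmod (cis t - x))\<^sup>2 = (cos t)\<^sup>2 + (sin t)\<^sup>2 + ((Re x)\<^sup>2 + (Im x)\<^sup>2) - 2 * (cos t * Re x + sin t * Im x)"
      unfolding cmod_power2 by (simp add: power2_eq_square algebra_simps)
    then show ?thesis by (simp add: q_def x2)
  qed
  have eq: "cmod (cis t - x) powr (2 * b) = q t powr b" for t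
  proof -
    have "cmod (cis t - x) powr (2 * b) = (cmod (cis t - x) powr 2) powr b" by (simp only: powr_powr)
    also have "cmod (cis t - x) powr 2 = (cmod (cis t - x))\<^sup>2" by (cases "cis t = x") simp_all
    finally show ?thesis by (simp only: q)
  qed
  have pos: "q t > 0" unfolding q[symmetric] using ne by simp
  have "(q has_real_derivative 2 * Im (cis t * cnj x)) (at t)"
    unfolding q_def by (auto intro!: derivative_eq_intros simp: algebra_simps)
  from DERIV_chain2[OF has_real_derivative_powr[OF pos, of b] this]
  have "((\<lambda>t. q t powr b) has_real_derivative q t powr b * (b * (2 * Im (cis t * cnj x) / q t))) (at t)"
  proof (rule DERIV_cong)
    have "q t powr (b - 1) = q t powr b / q t"
      using pos by (simp add: powr_diff)
    then show "b * q t powr (b - 1) * (2 * Im (cis t * cnj x)) = q t powr b * (b * (2 * Im (cis t * cnj x) / q t))"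
      by (simp only:) simp
  qed
  then show ?thesis unfolding eq q .
qed

text \<open>Turns the logarithmic derivative of the squared distance into a rational function of
  \<open>z\<close> and \<open>x\<close>; in this form the poles cancel after symmetrization.\<close>

lemma unit_circle_quotient:
  assumes "cmod z = 1" "cmod x = 1" "z \<noteq> x"
  shows "complex_of_real (2 * Im (z * cnj x) / (cmod (z - x))\<^sup>2) = \<i> * (z + x) / (z - x)"
proof -
  have "\<i> * (z + x) / (z - x) = \<i> * ((z + x) * cnj (z - x)) / ((z - x) * cnj (z - x))"
    using assms by simp
  also have "(z - x) * cnj (z - x) = complex_of_real ((cmod (z - x))\<^sup>2)"
    by (simp only: complex_norm_square)
  also have "(z + x) * cnj (z - x) = z * cnj z - x * cnj x - (z * cnj x - cnj (z * cnj x))"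
    by (simp add: algebra_simps)
  also have "z * cnj z = 1" using assms(1) complex_norm_square[of z] by simp
  also have "x * cnj x = 1" using assms(2) complex_norm_square[of x] by simp
  also have "1 - 1 - (z * cnj x - cnj (z * cnj x)) = - (2 * \<i> * Im (z * cnj x))"
    by (subst complex_diff_cnj) simp
  also have "\<i> * - (2 * \<i> * Im (z * cnj x)) = complex_of_real (2 * Im (z * cnj x))"
    by (simp add: complex_eq_iff)
  finally show ?thesis by simp
qed

lemma cis_has_vector_derivative: "(cis has_vector_derivative \<i> * cis t) (at t)"
proof -
  have "((\<lambda>z. exp (\<i> * z)) has_field_derivative \<i> * exp (\<i> * complex_of_real t)) (at (complex_of_real t))"
    by (auto intro!: derivative_eq_intros)
  from has_vector_derivative_real_field[OF this] show ?thesis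
    by (simp add: cis_conv_exp[abs_def])
qed

lemma isCont_cis: "isCont cis t"
  using has_vector_derivative_continuous[OF cis_has_vector_derivative] .

text \<open>
  A weight of the form \<open>(1 - z) powr ((\<sigma> + m) / 2) * (1 - 1/z) powr ((\<sigma> - m) / 2)\<close>, up to a constant.
\<close>

locale circle_weight =
  fixes w :: "complex \<Rightarrow> complex" and b \<sigma> m :: real
  assumes b_pos: "b > 0" and \<sigma>_gt: "\<sigma> > -1"
    and w_measurable [measurable]: "w \<in> borel_measurable borel"
    and norm_w: "\<And>z. cmod z = 1 \<Longrightarrow> cmod (w z) = cmod (1 - z) powr \<sigma>"
    and a_pos: "1 + (\<sigma> + m) / 2 > 0"
    and w_deriv: "\<And>t. t \<in> {0<..<2 * pi} \<Longrightarrow> ((\<lambda>t. w (cis t)) has_vector_derivative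
      (\<i> * w (cis t) * (\<sigma> / 2 * (cis t + 1) / (cis t - 1) + m / 2))) (at t)"
begin

text \<open>Up to the factor \<open>\<i>\<close>, the integrand is the derivative in
  \<open>t\<close> of \<open>(z - 1) * w z\<close> times the product, at \<open>z = cis t\<close>.
  The factor \<open>z - 1\<close> makes this function vanish at both ends of the interval although
  \<open>w\<close> may blow up there, because \<open>\<sigma> + 1 > 0\<close>.\<close>

lemma integral_by_parts:
  assumes J: "finite J" "\<And>j. j \<in> J \<Longrightarrow> cmod (x j) = 1"
  shows "(\<integral> z. w z * of_real (\<Prod>j\<in>J. cmod (z - x j) powr (2 * b)) *
     (z + \<sigma> / 2 * (z + 1) + m / 2 * (z - 1) + b * (\<Sum>j\<in>J. (z - 1) * (z + x j) / (z - x j))) \<partial>circle_measure) = 0"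
proof -
  define g where "g z = w z * of_real (\<Prod>j\<in>J. cmod (z - x j) powr (2 * b)) *
     (z + \<sigma> / 2 * (z + 1) + m / 2 * (z - 1) + b * (\<Sum>j\<in>J. (z - 1) * (z + x j) / (z - x j)))" for z :: complex
  have g_meas [measurable]: "g \<in> borel_measurable borel" unfolding g_def[abs_def] by measurable
  define P where "P t = (\<Prod>j\<in>J. cmod (cis t - x j) powr (2 * b))" for t
  define G where "G t = (cis t - 1) * w (cis t)" for t
  define F where "F t = G t * complex_of_real (P t)" for t
  \<comment> \<open>The product need not be differentiable where \<open>cis t\<close> meets some
    \<open>x j\<close>. Injectivity of \<open>cis\<close> leaves finitely many such points, which
    the fundamental theorem tolerates.\<close>
  define S where "S = {t \<in> {0<..<2 * pi}. cis t \<in> x ` J}"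
  have finS: "finite S"
  proof -
    have "finite (cis -` (x ` J) \<inter> {0<..<2 * pi})"
      using J cis_inj_on by (intro finite_vimage_IntI) auto
    then show ?thesis by (rule finite_subset[rotated]) (auto simp: S_def)
  qed
  have normG: "norm (G t) = cmod (1 - cis t) powr (1 + \<sigma>)" for t
    by (cases "cis t = 1") (auto simp: G_def norm_mult norm_w powr_add norm_minus_commute)
  have contG: "continuous_on {0..2 * pi} G"
    unfolding continuous_on_def
  proof
    fix t assume t: "t \<in> {0..2 * pi}"
    show "(G \<longlongrightarrow> G t) (at t within {0..2 * pi})"
    proof (cases "t \<in> {0<..<2 * pi}")
      case True
      have "isCont (\<lambda>t. w (cis t)) t"
        using has_vector_derivative_continuous[OF w_deriv[OF True]] .
      then have "isCont G t" unfolding G_def by (intro continuous_intros isCont_cis)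
      then have "G \<midarrow>t\<rightarrow> G t" by (simp add: isCont_def)
      then show ?thesis by (rule tendsto_within_subset) simp
    next
      case False
      then have "t = 0 \<or> t = 2 * pi"
        using t by (metis atLeastAtMost_iff greaterThanLessThan_iff order_le_less)
      then have c1: "cis t = 1" by (elim disjE) simp_all
      \<comment> \<open>At the ends only the modulus of \<open>w\<close> is controlled, which
        suffices because the limit is 0.\<close>
      have "continuous_on {0..2 * pi} (\<lambda>t. cmod (1 - cis t) powr (1 + \<sigma>))"
        using \<sigma>_gt by (intro continuous_on_powr' continuous_intros) auto
      then have "((\<lambda>t. cmod (1 - cis t) powr (1 + \<sigma>)) \<longlongrightarrow> cmod (1 - cis t) powr (1 + \<sigma>)) (at t within {0..2 * pi})"
        using t by (simp add: continuous_on_def)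
      then have "((\<lambda>t. norm (G t)) \<longlongrightarrow> 0) (at t within {0..2 * pi})"
        using \<sigma>_gt by (simp add: normG c1)
      then have "(G \<longlongrightarrow> 0) (at t within {0..2 * pi})" by (rule tendsto_norm_zero_cancel)
      moreover have "G t = 0" using c1 by (simp add: G_def)
      ultimately show ?thesis by simp
    qed
  qed
  have contP: "continuous_on {0..2 * pi} P"
    unfolding P_def by (intro continuous_on_prod continuous_on_powr' continuous_intros) (use b_pos in simp)
  have contF: "continuous_on {0..2 * pi} F"
    unfolding F_def by (intro continuous_intros contG contP)
  have derivF: "(F has_vector_derivative \<i> * g (cis t)) (at t)" if t: "t \<in> {0<..<2 * pi} - S" for t
  proof -
    have ne: "cis t \<noteq> x j" if "j \<in> J" for j using t that by (auto simp: S_def)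
    have ne1: "cis t \<noteq> 1" using t cis_neq_1 by auto
    have dP: "(P has_real_derivative (P t * (\<Sum>j\<in>J. b * (2 * Im (cis t * cnj (x j)) / (cmod (cis t - x j))\<^sup>2)))) (at t)"
    proof -
      have "(P has_real_derivative (P t * (\<Sum>j\<in>J. (cmod (cis t - x j) powr (2 * b) * (b * (2 * Im (cis t * cnj (x j)) / (cmod (cis t - x j))\<^sup>2))) / (cmod (cis t - x j) powr (2 * b))))) (at t)"
        unfolding P_def[abs_def]
      proof (rule has_field_derivative_prod')
        fix j assume j: "j \<in> J"
        show "cmod (cis t - x j) powr (2 * b) \<noteq> 0" using ne[OF j] by simp
        show "((\<lambda>t. cmod (cis t - x j) powr (2 * b)) has_real_derivative cmod (cis t - x j) powr (2 * b) *
          (b * (2 * Im (cis t * cnj (x j)) / (cmod (cis t - x j))\<^sup>2))) (at t)"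
          by (rule cmod_cis_powr_has_derivative[OF J(2)[OF j] ne[OF j]])
      qed
      moreover have "(\<Sum>j\<in>J. (cmod (cis t - x j) powr (2 * b) * (b * (2 * Im (cis t * cnj (x j)) / (cmod (cis t - x j))\<^sup>2))) / (cmod (cis t - x j) powr (2 * b)))
         = (\<Sum>j\<in>J. b * (2 * Im (cis t * cnj (x j)) / (cmod (cis t - x j))\<^sup>2))"
        by (rule sum.cong) (use ne in auto)
      ultimately show ?thesis by simp
    qed
    have dP': "((\<lambda>t. complex_of_real (P t)) has_vector_derivative of_real (P t) * (b * \<i> * (\<Sum>j\<in>J. (cis t + x j) / (cis t - x j)))) (at t)"
    proof -
      have "complex_of_real (\<Sum>j\<in>J. b * (2 * Im (cis t * cnj (x j)) / (cmod (cis t - x j))\<^sup>2)) = b * \<i> * (\<Sum>j\<in>J. (cis t + x j) / (cis t - x j))"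
        unfolding of_real_sum sum_distrib_left
      proof (rule sum.cong)
        fix j assume "j \<in> J"
        then show "complex_of_real (b * (2 * Im (cis t * cnj (x j)) / (cmod (cis t - x j))\<^sup>2)) = b * \<i> * ((cis t + x j) / (cis t - x j))"
          using unit_circle_quotient[of "cis t" "x j"] J ne by (simp only: of_real_mult) (simp add: mult_ac)
      qed simp
      with has_vector_derivative_of_real[OF dP, where 'a=complex]
      show ?thesis by (simp only: of_real_mult)
    qed
    have dz: "((\<lambda>t. cis t - 1) has_vector_derivative \<i> * cis t) (at t)"
      using has_vector_derivative_diff[OF cis_has_vector_derivative has_vector_derivative_const] by simp
    have "(F has_vector_derivative
        G t * (of_real (P t) * (b * \<i> * (\<Sum>j\<in>J. (cis t + x j) / (cis t - x j)))) +
        ((cis t - 1) * (\<i> * w (cis t) * (\<sigma> / 2 * (cis t + 1) / (cis t - 1) + m / 2)) + \<i> * cis t * w (cis t)) * of_real (P t)) (at t)"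
      unfolding F_def G_def
      using t by (intro has_vector_derivative_mult dP' dz w_deriv) auto
    moreover have "G t * (of_real (P t) * (b * \<i> * (\<Sum>j\<in>J. (cis t + x j) / (cis t - x j)))) +
        ((cis t - 1) * (\<i> * w (cis t) * (\<sigma> / 2 * (cis t + 1) / (cis t - 1) + m / 2)) + \<i> * cis t * w (cis t)) * of_real (P t) = \<i> * g (cis t)"
    proof -
      have "(cis t - 1) * (\<i> * w (cis t) * (\<sigma> / 2 * (cis t + 1) / (cis t - 1) + m / 2)) = \<i> * w (cis t) * (\<sigma> / 2 * (cis t + 1) + m / 2 * (cis t - 1))"
        using ne1 by (simp add: field_simps)
      moreover have "(\<Sum>j\<in>J. (cis t - 1) * (cis t + x j) / (cis t - x j)) = (cis t - 1) * (\<Sum>j\<in>J. (cis t + x j) / (cis t - x j))"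
        by (simp add: sum_distrib_left)
      ultimately show ?thesis unfolding G_def g_def P_def by (simp only:) (simp add: algebra_simps)
    qed
    ultimately show ?thesis by simp
  qed
  have "((\<lambda>t. \<i> * g (cis t)) has_integral (F (2 * pi) - F 0)) {0..2 * pi}"
    by (rule fundamental_theorem_of_calculus_interior_strong[OF finS]) (use derivF contF in auto)
  then have "((\<lambda>t. \<i> * g (cis t)) has_integral 0) {0..2 * pi}"
    by (simp add: F_def G_def)
  from has_integral_mult_right[OF this, of "- \<i>"]
  have "((\<lambda>t. g (cis t)) has_integral 0) {0..2 * pi}" by simp
  then have "((\<lambda>t. if t \<in> {0..2 * pi} then g (cis t) else 0) has_integral 0) UNIV"
    by (simp only: has_integral_restrict_UNIV)
  \<comment> \<open>The endpoint \<open>2 * pi\<close> is dropped to match the half-open interval in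
    \<open>circle_measure\<close>.\<close>
  then have "((\<lambda>t. if t \<in> {0..<2 * pi} then g (cis t) else 0) has_integral 0) UNIV"
    by (rule has_integral_spike_finite[of "{2 * pi}", rotated 2]) auto
  then have hi: "((\<lambda>t. g (cis t)) has_integral 0) {0..<2 * pi}"
    by (simp only: has_integral_restrict_UNIV)
  have "integral\<^sup>L circle_measure g = 0"
  \<comment> \<open>The fundamental theorem yields a gauge integral. Where \<open>g\<close> is not
    Lebesgue integrable its Bochner integral is 0 by convention, so the identity holds in either
    case.\<close>
  proof (cases "integrable circle_measure g")
    case True
    have "set_integrable lborel {0..<2 * pi} (\<lambda>t. g (cis t))"
      using True by (subst (asm) integrable_circle_measure_iff) auto
    from set_borel_integral_eq_integral(2)[OF this] hi
    have "(LINT t:{0..<2 * pi}|lborel. g (cis t)) = 0"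
      by (simp add: integral_unique)
    then show ?thesis
      by (subst integral_circle_measure) (auto simp: set_lebesgue_integral_def)
  qed (simp add: not_integrable_integral_eq)
  then show ?thesis unfolding g_def[abs_def] .
qed

end

section \<open>The product measure on the torus, symmetry and integrability of the weight\<close>

abbreviation CM :: "nat set \<Rightarrow> (nat \<Rightarrow> complex) measure" where
  "CM I \<equiv> \<Pi>\<^sub>M i\<in>I. circle_measure"

interpretation circ: finite_measure circle_measure by (rule finite_circle_measure)
interpretation circs: product_sigma_finite "\<lambda>_::nat. circle_measure" by unfold_locales

lemma component_measurable [measurable]: "i \<in> I \<Longrightarrow> (\<lambda>z. z i) \<in> borel_measurable (CM I)"
  using measurable_component_singleton[of i I "\<lambda>_. circle_measure"]
  by (simp cong: measurable_cong_sets)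

lemma AE_circle_measure: "AE z in circle_measure. cmod z = 1"
  unfolding circle_measure_def
  by (subst AE_distr_iff[OF cis_measurable_interval]) auto

lemma AE_circle_measure_neq: "AE z in circle_measure. z \<noteq> 1"
proof -
  have "emeasure circle_measure {1} = emeasure lborel (cis -` {1} \<inter> {0..<2 * pi})"
    by (rule emeasure_circle_measure) auto
  also have "cis -` {1} \<inter> {0..<2 * pi} = {0}"
    using cis_neq_1 by (force simp: order_le_less)
  finally have "emeasure circle_measure {1} = 0" by simp
  then show ?thesis by (intro AE_I[of _ _ "{1}"]) auto
qed

lemma AE_CM_component:
  assumes I: "finite I" "i \<in> I" and P: "AE z in circle_measure. P z"
  shows "AE x in CM I. P (x i)"
proof -
  obtain A where A: "A \<in> sets circle_measure" "emeasure circle_measure A = 0" "{z. \<not> P z} \<subseteq> A"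
    using P by (auto simp: eventually_ae_filter null_sets_def)
  let ?B = "\<lambda>j. if j = i then A else UNIV"
  have meas: "?B j \<in> sets circle_measure" for j using A by auto
  have "emeasure (CM I) (\<Pi>\<^sub>E j\<in>I. ?B j) = (\<Prod>j\<in>I. emeasure circle_measure (?B j))"
    using meas I by (intro circs.emeasure_PiM) auto
  also have "\<dots> = 0"
    using I A by (auto intro!: prod_zero)
  finally have "(\<Pi>\<^sub>E j\<in>I. ?B j) \<in> null_sets (CM I)"
    using meas I by (auto intro!: sets_PiM_I_finite simp del: sets_circle_measure)
  moreover have "{x \<in> space (CM I). \<not> P (x i)} \<subseteq> (\<Pi>\<^sub>E j\<in>I. ?B j)"
    using A by (auto simp: space_PiM PiE_iff extensional_def)
  ultimately show ?thesis by (rule AE_I')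
qed

lemma AE_CM_unit: "finite I \<Longrightarrow> AE x in CM I. \<forall>i\<in>I. cmod (x i) = 1 \<and> x i \<noteq> 1"
  by (intro AE_finite_allI AE_conjI AE_CM_component AE_circle_measure AE_circle_measure_neq)

text \<open>Integration by parts and the control of poles both regard the integrand as a function of
  a single point, so the factors that contain it are collected first.\<close>

lemma cbe_weight_isolate:
  assumes i: "i < N"
  shows "cbe_weight N \<beta> x = (\<Prod>j\<in>{..<N} - {i}. cmod (x i - x j) powr \<beta>) *
     (\<Prod>j\<in>{..<N} - {i}. \<Prod>k\<in>{..<j} - {i}. cmod (x k - x j) powr \<beta>)"
proof -
  define f where "f k j = cmod (x k - x j) powr \<beta>" for k j
  have sym: "f k j = f j k" for k j by (simp add: f_def norm_minus_commute)
  have "cbe_weight N \<beta> x = (\<Prod>j<N. \<Prod>k<j. f k j)" by (simp add: cbe_weight_def f_def)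
  also have "\<dots> = (\<Prod>k<i. f k i) * (\<Prod>j\<in>{..<N} - {i}. \<Prod>k<j. f k j)"
    using i by (subst prod.remove[of _ i]) auto
  also have "(\<Prod>j\<in>{..<N} - {i}. \<Prod>k<j. f k j) = (\<Prod>j\<in>{..<N} - {i}. (if i < j then f i j else 1) * (\<Prod>k\<in>{..<j} - {i}. f k j))"
  proof (rule prod.cong)
    fix j assume "j \<in> {..<N} - {i}"
    show "(\<Prod>k<j. f k j) = (if i < j then f i j else 1) * (\<Prod>k\<in>{..<j} - {i}. f k j)"
      by (cases "i < j") (auto simp: prod.remove[of "{..<j}" i])
  qed simp
  also have "\<dots> = (\<Prod>j\<in>{..<N} - {i}. if i < j then f i j else 1) * (\<Prod>j\<in>{..<N} - {i}. \<Prod>k\<in>{..<j} - {i}. f k j)"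
    by (rule prod.distrib)
  also have "(\<Prod>j\<in>{..<N} - {i}. if i < j then f i j else 1) = (\<Prod>j\<in>{i<..<N}. f i j)"
    by (subst prod.inter_filter[symmetric]) (auto intro!: prod.cong)
  also have "(\<Prod>k<i. f k i) * ((\<Prod>j\<in>{i<..<N}. f i j) * (\<Prod>j\<in>{..<N} - {i}. \<Prod>k\<in>{..<j} - {i}. f k j))
     = ((\<Prod>k<i. f i k) * (\<Prod>j\<in>{i<..<N}. f i j)) * (\<Prod>j\<in>{..<N} - {i}. \<Prod>k\<in>{..<j} - {i}. f k j)"
    by (simp add: sym mult.assoc)
  also have "(\<Prod>k<i. f i k) * (\<Prod>j\<in>{i<..<N}. f i j) = (\<Prod>j\<in>{..<N} - {i}. f i j)"
    using i by (subst prod.union_disjoint[symmetric]) (auto intro!: prod.cong)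
  finally show ?thesis by (simp add: f_def)
qed

lemma cbe_weight_nonneg: "0 \<le> cbe_weight N \<beta> x"
  unfolding cbe_weight_def by (intro prod_nonneg) auto

text \<open>The weight runs over pairs \<open>i < j\<close>, which hides its symmetry. Its square
  runs over all pairs of distinct indices, where a permutation is a mere reindexing; nonnegativity
  then returns to the weight in \<open>cbe_weight_swap\<close>.\<close>

lemma cbe_weight_square:
  "(cbe_weight N \<beta> x)\<^sup>2 = (\<Prod>(k, j)\<in>{(k, j). k < N \<and> j < N \<and> k \<noteq> j}. cmod (x k - x j) powr \<beta>)"
proof -
  let ?f = "\<lambda>(k, j). cmod (x k - x j) powr \<beta>"
  have e: "cbe_weight N \<beta> x = prod ?f {(k, j). k < N \<and> j < N \<and> k < j}"
  proof -
    have "cbe_weight N \<beta> x = (\<Prod>j\<in>{..<N}. \<Prod>k\<in>{..<j}. (case (j, k) of (j, k) \<Rightarrow> ?f (k, j)))"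
      by (simp add: cbe_weight_def)
    also have "\<dots> = prod (\<lambda>(j, k). ?f (k, j)) (SIGMA j:{..<N}. {..<j})"
      by (subst prod.Sigma) (auto intro!: prod.cong)
    also have "\<dots> = prod ?f {(k, j). k < N \<and> j < N \<and> k < j}"
      by (rule prod.reindex_bij_witness[of _ "\<lambda>(k, j). (j, k)" "\<lambda>(j, k). (k, j)"]) auto
    finally show ?thesis .
  qed
  have e': "cbe_weight N \<beta> x = prod ?f {(k, j). k < N \<and> j < N \<and> j < k}"
    unfolding e
    by (rule prod.reindex_bij_witness[of _ "\<lambda>(k, j). (j, k)" "\<lambda>(j, k). (k, j)"]) (auto simp: norm_minus_commute)
  have fin: "finite {(k, j). k < N \<and> j < N \<and> k < j}" "finite {(k, j). k < N \<and> j < N \<and> j < k}"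
    by (rule finite_subset[of _ "{..<N} \<times> {..<N}"]; auto)+
  have "(cbe_weight N \<beta> x)\<^sup>2 = prod ?f {(k, j). k < N \<and> j < N \<and> k < j} * prod ?f {(k, j). k < N \<and> j < N \<and> j < k}"
    unfolding power2_eq_square by (subst e, subst e') (rule refl)
  also have "\<dots> = prod ?f ({(k, j). k < N \<and> j < N \<and> k < j} \<union> {(k, j). k < N \<and> j < N \<and> j < k})"
    using fin by (subst prod.union_disjoint) auto
  also have "{(k, j). k < N \<and> j < N \<and> k < j} \<union> {(k, j). k < N \<and> j < N \<and> j < k} = {(k, j). k < N \<and> j < N \<and> k \<noteq> j}"
    by auto
  finally show ?thesis .
qed

lemma transpose_less: "i < N \<Longrightarrow> j < N \<Longrightarrow> Transposition.transpose i j k < N \<longleftrightarrow> k < (N::nat)"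
  by (auto simp: Transposition.transpose_def)

lemma transpose_inj: "Transposition.transpose i j k = Transposition.transpose i j l \<longleftrightarrow> k = l"
  by (metis transpose_involutory)

lemma cbe_weight_swap:
  assumes "i < N" "j < N"
  shows "cbe_weight N \<beta> (\<lambda>k. x (Transposition.transpose i j k)) = cbe_weight N \<beta> x"
proof -
  let ?t = "Transposition.transpose i j"
  have "(cbe_weight N \<beta> (\<lambda>k. x (?t k)))\<^sup>2 = (cbe_weight N \<beta> x)\<^sup>2"
    unfolding cbe_weight_square
    by (rule prod.reindex_bij_witness[of _ "\<lambda>(k, l). (?t k, ?t l)" "\<lambda>(k, l). (?t k, ?t l)"])
       (use assms in \<open>auto simp: transpose_less transpose_inj\<close>)
  then show ?thesis using cbe_weight_nonneg by (metis power2_eq_iff_nonneg)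
qed

lemma cbe_weight_coincide:
  assumes "i < N" "j < N" "i \<noteq> j" "x i = x j"
  shows "cbe_weight N \<beta> x = 0"
  unfolding cbe_weight_isolate[OF assms(1)] using assms by (auto intro!: prod_zero)

lemma distr_swap:
  assumes "i < N" "j < N"
  shows "distr (CM {..<N}) (CM {..<N}) (\<lambda>x k. x (Transposition.transpose i j k)) = CM {..<N}"
proof (rule circs.PiM_eqI)
  let ?t = "Transposition.transpose i j"
  have m: "(\<lambda>x k. x (?t k)) \<in> measurable (CM {..<N}) (CM {..<N})"
  proof (rule measurable_PiM_single')
    show "(\<lambda>x k. x (?t k)) \<in> space (CM {..<N}) \<rightarrow> {..<N} \<rightarrow>\<^sub>E space circle_measure"
      using assms by (auto simp: space_PiM PiE_iff extensional_def transpose_less)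
    show "(\<lambda>x. x (?t k)) \<in> measurable (CM {..<N}) circle_measure" if "k \<in> {..<N}" for k
      using that assms by (intro measurable_component_singleton) (auto simp: transpose_less)
  qed
  show "finite {..<N}" by simp
  show "sets (distr (CM {..<N}) (CM {..<N}) (\<lambda>x k. x (?t k))) = sets (CM {..<N})" by simp
  fix A :: "nat \<Rightarrow> complex set" assume A: "\<And>i. i \<in> {..<N} \<Longrightarrow> A i \<in> sets circle_measure"
  have "emeasure (distr (CM {..<N}) (CM {..<N}) (\<lambda>x k. x (?t k))) (Pi\<^sub>E {..<N} A)
    = emeasure (CM {..<N}) ((\<lambda>x k. x (?t k)) -` Pi\<^sub>E {..<N} A \<inter> space (CM {..<N}))"
    using A by (intro emeasure_distr m sets_PiM_I_finite) auto
  also have "(\<lambda>x k. x (?t k)) -` Pi\<^sub>E {..<N} A \<inter> space (CM {..<N}) = (\<Pi>\<^sub>E k\<in>{..<N}. A (?t k))"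
  proof (intro set_eqI iffI)
    fix x assume x: "x \<in> (\<lambda>x k. x (?t k)) -` Pi\<^sub>E {..<N} A \<inter> space (CM {..<N})"
    have "x k \<in> A (?t k)" if "k < N" for k
    proof -
      have "?t k \<in> {..<N}" using that assms by (simp add: transpose_less)
      then have "x (?t (?t k)) \<in> A (?t k)" using x by blast
      then show ?thesis by simp
    qed
    then show "x \<in> (\<Pi>\<^sub>E k\<in>{..<N}. A (?t k))"
      using x by (auto simp: space_PiM PiE_iff)
  next
    fix x assume x: "x \<in> (\<Pi>\<^sub>E k\<in>{..<N}. A (?t k))"
    have "x (?t k) \<in> A k" if "k < N" for k
    proof -
      have "?t k \<in> {..<N}" using that assms by (simp add: transpose_less)
      then have "x (?t k) \<in> A (?t (?t k))" using x by blast
      then show ?thesis by simp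
    qed
    moreover have "x (?t k) = undefined" if "\<not> k < N" for k
      using x that assms by (auto simp: PiE_iff extensional_def transpose_less)
    ultimately show "x \<in> (\<lambda>x k. x (?t k)) -` Pi\<^sub>E {..<N} A \<inter> space (CM {..<N})"
      using x by (auto simp: space_PiM PiE_iff extensional_def)
  qed
  also have "emeasure (CM {..<N}) (\<Pi>\<^sub>E k\<in>{..<N}. A (?t k)) = (\<Prod>k<N. emeasure circle_measure (A (?t k)))"
    using A assms by (intro circs.emeasure_PiM) (auto simp: transpose_less)
  also have "\<dots> = (\<Prod>k<N. emeasure circle_measure (A k))"
    by (rule prod.reindex_bij_witness[of _ ?t ?t]) (use assms in \<open>auto simp: transpose_less\<close>)
  finally show "emeasure (distr (CM {..<N}) (CM {..<N}) (\<lambda>x k. x (?t k))) (Pi\<^sub>E {..<N} A) = (\<Prod>i\<in>{..<N}. emeasure circle_measure (A i))" .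
qed

lemma swap_measurable:
  assumes "i < N" "j < N"
  shows "(\<lambda>x k. x (Transposition.transpose i j k)) \<in> measurable (CM {..<N}) (CM {..<N})"
proof (rule measurable_PiM_single')
  show "(\<lambda>x k. x (Transposition.transpose i j k)) \<in> space (CM {..<N}) \<rightarrow> {..<N} \<rightarrow>\<^sub>E space circle_measure"
    using assms by (auto simp: space_PiM PiE_iff extensional_def transpose_less)
  show "(\<lambda>x. x (Transposition.transpose i j k)) \<in> measurable (CM {..<N}) circle_measure" if "k \<in> {..<N}" for k
    using that assms by (intro measurable_component_singleton) (auto simp: transpose_less)
qed

lemma integral_swap:
  fixes f :: "(nat \<Rightarrow> complex) \<Rightarrow> 'a::{banach, second_countable_topology}"
  assumes "i < N" "j < N" and f: "f \<in> borel_measurable (CM {..<N})"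
  shows "(\<integral> x. f (\<lambda>k. x (Transposition.transpose i j k)) \<partial>CM {..<N}) = (\<integral> x. f x \<partial>CM {..<N})"
  by (subst (2) distr_swap[OF assms(1,2), symmetric]) (rule integral_distr[OF swap_measurable[OF assms(1,2)] f, symmetric])

lemma integrable_swap:
  fixes f :: "(nat \<Rightarrow> complex) \<Rightarrow> 'a::{banach, second_countable_topology}"
  assumes "i < N" "j < N" and f: "integrable (CM {..<N}) f"
  shows "integrable (CM {..<N}) (\<lambda>x. f (\<lambda>k. x (Transposition.transpose i j k)))"
  using integrable_distr[OF swap_measurable[OF assms(1,2)], of f] f distr_swap[OF assms(1,2)] by simp

lemma borel_measurable_circle: "f \<in> borel_measurable borel \<Longrightarrow> f \<in> borel_measurable circle_measure"
  by (simp cong: measurable_cong_sets)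

lemma integrable_cmod_powr:
  assumes "s > -1"
  shows "integrable circle_measure (\<lambda>z. cmod (1 - z) powr s)"
proof (rule integrableI_nonneg)
  obtain K where "(\<integral>\<^sup>+ z. ennreal (cmod (z - 1) powr s) \<partial>circle_measure) \<le> ennreal K"
    using nn_integral_cmod_powr_bound[OF assms] by (metis norm_one)
  then show "(\<integral>\<^sup>+ z. ennreal (cmod (1 - z) powr s) \<partial>circle_measure) < \<infinity>"
    by (simp add: norm_minus_commute order_le_less_trans)
  show "(\<lambda>z. cmod (1 - z) powr s) \<in> borel_measurable circle_measure"
    by (rule borel_measurable_circle) auto
qed simp

lemma integrable_prod_cmod_powr:
  assumes "s > -1" "finite I"
  shows "integrable (CM I) (\<lambda>x. \<Prod>i\<in>I. cmod (1 - x i) powr s)"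
  using assms by (intro circs.product_integrable_prod integrable_cmod_powr) auto

lemma integrable_CM_dominated:
  fixes f :: "(nat \<Rightarrow> complex) \<Rightarrow> 'a::{banach, second_countable_topology}"
  assumes s: "s > -1" and f: "f \<in> borel_measurable (CM {..<N})"
    and bd: "\<And>x. (\<And>i. i < N \<Longrightarrow> cmod (x i) = 1) \<Longrightarrow> norm (f x) \<le> C * (\<Prod>i<N. cmod (1 - x i) powr s)"
  shows "integrable (CM {..<N}) f"
proof (rule Bochner_Integration.integrable_bound)
  show "integrable (CM {..<N}) (\<lambda>x. C * (\<Prod>i<N. cmod (1 - x i) powr s))"
    using s by (intro integrable_mult_right integrable_prod_cmod_powr) auto
  show "AE x in CM {..<N}. norm (f x) \<le> norm (C * (\<Prod>i<N. cmod (1 - x i) powr s))"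
    using AE_CM_unit[of "{..<N}", OF finite_lessThan]
  proof eventually_elim
    case (elim x)
    then have "norm (f x) \<le> C * (\<Prod>i<N. cmod (1 - x i) powr s)" by (intro bd) auto
    then show ?case by simp
  qed
qed (rule f)

lemma cmod_diff_le_2: "cmod x = 1 \<Longrightarrow> cmod y = 1 \<Longrightarrow> cmod (x - y) \<le> 2"
  using norm_triangle_ineq4[of x y] by simp

lemma cbe_weight_le:
  assumes "\<And>i. i < N \<Longrightarrow> cmod (x i) = 1" "\<beta> > 0"
  shows "cbe_weight N \<beta> x \<le> (\<Prod>j<N. \<Prod>i<j. 2 powr \<beta>)"
  unfolding cbe_weight_def using assms
  by (intro prod_mono conjI prod_nonneg powr_mono2 ballI cmod_diff_le_2) auto

text \<open>The one factor that is kept exact compensates the pole \<open>1 / (x i - x j)\<close> in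
  \<open>integrable_H\<close>.\<close>

lemma cbe_weight_le_pair:
  assumes x: "\<And>i. i < N \<Longrightarrow> cmod (x i) = 1" and \<beta>: "\<beta> > 0" and ij: "i < N" "j < N" "i \<noteq> j"
  shows "cbe_weight N \<beta> x \<le> cmod (x i - x j) powr \<beta> *
     ((\<Prod>k\<in>{..<N} - {i} - {j}. 2 powr \<beta>) * (\<Prod>j\<in>{..<N} - {i}. \<Prod>k\<in>{..<j} - {i}. 2 powr \<beta>))"
proof -
  have "cbe_weight N \<beta> x = cmod (x i - x j) powr \<beta> * ((\<Prod>k\<in>{..<N} - {i} - {j}. cmod (x i - x k) powr \<beta>) *
     (\<Prod>j\<in>{..<N} - {i}. \<Prod>k\<in>{..<j} - {i}. cmod (x k - x j) powr \<beta>))"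
    unfolding cbe_weight_isolate[OF ij(1)] using ij by (subst prod.remove[of _ j]) (auto simp: mult.assoc)
  also have "\<dots> \<le> cmod (x i - x j) powr \<beta> * ((\<Prod>k\<in>{..<N} - {i} - {j}. 2 powr \<beta>) * (\<Prod>j\<in>{..<N} - {i}. \<Prod>k\<in>{..<j} - {i}. 2 powr \<beta>))"
    using ij x \<beta>
    by (intro mult_left_mono mult_mono prod_mono conjI prod_nonneg powr_mono2 ballI cmod_diff_le_2 mult_nonneg_nonneg) auto
  finally show ?thesis .
qed

section \<open>Aomoto's recursion for integrals of monomials\<close>

context circle_weight
begin

definition W :: "nat \<Rightarrow> (nat \<Rightarrow> complex) \<Rightarrow> complex" where
  "W N x = (\<Prod>i<N. w (x i)) * of_real (cbe_weight N (2 * b) x)"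

text \<open>Aomoto's integrals: the weight with a monomial inserted. By symmetry they depend on the
  size of \<open>T\<close> only (\<open>J_card\<close>).\<close>

definition J :: "nat \<Rightarrow> nat set \<Rightarrow> complex" where
  "J N T = (\<integral> x. W N x * (\<Prod>l\<in>T. x l) \<partial>CM {..<N})"

text \<open>One of the terms with a pole that integration by parts in \<open>x i\<close> produces,
  combined with the monomial of \<open>T\<close>.\<close>

definition H :: "nat \<Rightarrow> nat set \<Rightarrow> nat \<Rightarrow> nat \<Rightarrow> (nat \<Rightarrow> complex) \<Rightarrow> complex" where
  "H N T i j x = W N x * (\<Prod>l\<in>T. x l) * ((x i - 1) * (x i + x j) / (x i - x j))"

lemma W_measurable [measurable]: "W N \<in> borel_measurable (CM {..<N})"
  unfolding W_def by measurable

lemma H_measurable: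
  assumes "T \<subseteq> {..<N}" "i < N" "j < N"
  shows "H N T i j \<in> borel_measurable (CM {..<N})"
proof -
  have [measurable]: "(\<lambda>x. \<Prod>l\<in>T. x l) \<in> borel_measurable (CM {..<N})"
    using assms by (intro borel_measurable_prod component_measurable) auto
  have [measurable]: "(\<lambda>x. x i) \<in> borel_measurable (CM {..<N})" "(\<lambda>x. x j) \<in> borel_measurable (CM {..<N})"
    using assms by (auto intro: component_measurable)
  show ?thesis unfolding H_def by measurable
qed

lemma norm_prod_unit: "(\<And>i. i < N \<Longrightarrow> cmod (x i) = 1) \<Longrightarrow> T \<subseteq> {..<N} \<Longrightarrow> cmod (\<Prod>l\<in>T. x l) = 1"
  unfolding prod_norm[symmetric] by (intro prod.neutral) auto

lemma norm_prod_w: "(\<And>i. i < N \<Longrightarrow> cmod (x i) = 1) \<Longrightarrow> cmod (\<Prod>i<N. w (x i)) = (\<Prod>i<N. cmod (1 - x i) powr \<sigma>)"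
  unfolding prod_norm[symmetric] by (intro prod.cong) (auto simp: norm_w)

lemma integrable_W_times:
  assumes f: "f \<in> borel_measurable (CM {..<N})"
    and bd: "\<And>x. (\<And>i. i < N \<Longrightarrow> cmod (x i) = 1) \<Longrightarrow> norm (f x) \<le> C"
  shows "integrable (CM {..<N}) (\<lambda>x. W N x * f x)"
proof (rule integrable_CM_dominated[OF \<sigma>_gt])
  show "(\<lambda>x. W N x * f x) \<in> borel_measurable (CM {..<N})" using f by measurable
  fix x :: "nat \<Rightarrow> complex" assume x: "\<And>i. i < N \<Longrightarrow> cmod (x i) = 1"
  have "norm (W N x * f x) = (\<Prod>i<N. cmod (1 - x i) powr \<sigma>) * cbe_weight N (2 * b) x * norm (f x)"
    using norm_prod_w[of N x, OF x] cbe_weight_nonneg[of N "2 * b" x] by (simp add: W_def norm_mult)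
  also have "\<dots> \<le> (\<Prod>i<N. cmod (1 - x i) powr \<sigma>) * (\<Prod>j<N. \<Prod>i<j. 2 powr (2 * b)) * C"
    using b_pos cbe_weight_le[of N x "2 * b", OF x] bd[OF x] cbe_weight_nonneg[of N "2 * b" x]
    by (intro mult_mono mult_nonneg_nonneg prod_nonneg) auto
  finally show "norm (W N x * f x) \<le> ((\<Prod>j<N. \<Prod>i<j. 2 powr (2 * b)) * C) * (\<Prod>i<N. cmod (1 - x i) powr \<sigma>)"
    by (simp add: mult_ac)
qed

lemma integrable_J:
  assumes "T \<subseteq> {..<N}"
  shows "integrable (CM {..<N}) (\<lambda>x. W N x * (\<Prod>l\<in>T. x l))"
  by (rule integrable_W_times[of _ _ 1])
     (use assms norm_prod_unit[of N _ T] in \<open>auto intro!: borel_measurable_prod component_measurable\<close>)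

text \<open>The weight lowers the pole to \<open>cmod (x i - x j) powr (2 * b - 1)\<close>, whose
  exponent exceeds -1, and integrating over \<open>x i\<close> first gives a bound uniform in
  \<open>x j\<close>. The singularity of \<open>w\<close> at \<open>x i = 1\<close> does not
  interfere, because the factor \<open>x i - 1\<close> raises its exponent to
  \<open>\<sigma> + 1\<close>.\<close>

lemma integrable_H:
  assumes T: "T \<subseteq> {..<N}" and ij: "i < N" "j < N" "i \<noteq> j"
  shows "integrable (CM {..<N}) (H N T i j)"
proof -
  define I where "I = {..<N} - {i}"
  have I: "finite I" "i \<notin> I" "{..<N} = insert i I" "j \<in> I" using ij by (auto simp: I_def)
  define D where "D = (\<Prod>k\<in>{..<N} - {i} - {j}. 2 powr (2 * b)) * (\<Prod>j\<in>{..<N} - {i}. \<Prod>k\<in>{..<j} - {i}. 2 powr (2 * b))"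
  have D: "D \<ge> 0" unfolding D_def by (intro mult_nonneg_nonneg prod_nonneg) auto
  define E where "E = D * (2 * 2 powr (\<sigma> + 1))"
  define g where "g x = cmod (x i - x j) powr (2 * b - 1) * (\<Prod>l\<in>I. cmod (1 - x l) powr \<sigma>)" for x :: "nat \<Rightarrow> complex"
  have g_nonneg: "g x \<ge> 0" for x unfolding g_def by (intro mult_nonneg_nonneg prod_nonneg) auto
  have [measurable]: "(\<lambda>x. x i) \<in> borel_measurable (CM {..<N})" "(\<lambda>x. x j) \<in> borel_measurable (CM {..<N})"
    "(\<lambda>x. x j) \<in> borel_measurable (CM I)"
    using ij I by (auto intro: component_measurable)
  have [measurable]: "(\<lambda>x. \<Prod>l\<in>I. cmod (1 - x l) powr \<sigma>) \<in> borel_measurable (CM {..<N})"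
    unfolding I(3) by measurable
  have [measurable]: "(\<lambda>x. \<Prod>l\<in>I. cmod (1 - x l) powr \<sigma>) \<in> borel_measurable (CM I)"
    by measurable
  have g_meas [measurable]: "g \<in> borel_measurable (CM {..<N})" unfolding g_def[abs_def] by measurable
  have "integrable (CM {..<N}) g"
  proof (rule integrableI_nonneg)
    obtain K where K: "K \<ge> 0" "\<And>u. cmod u = 1 \<Longrightarrow> (\<integral>\<^sup>+ z. ennreal (cmod (z - u) powr (2 * b - 1)) \<partial>circle_measure) \<le> ennreal K"
      using nn_integral_cmod_powr_bound[of "2 * b - 1"] b_pos by auto
    have "(\<integral>\<^sup>+ x. ennreal (g x) \<partial>CM {..<N}) = (\<integral>\<^sup>+ x. (\<integral>\<^sup>+ y. ennreal (g (x(i := y))) \<partial>circle_measure) \<partial>CM I)"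
      unfolding I(3) by (rule circs.product_nn_integral_insert) (use I in \<open>auto simp flip: I(3)\<close>)
    also have "\<dots> \<le> (\<integral>\<^sup>+ x. ennreal K * ennreal (\<Prod>l\<in>I. cmod (1 - x l) powr \<sigma>) \<partial>CM I)"
    proof (rule nn_integral_mono_AE)
      show "AE x in CM I. (\<integral>\<^sup>+ y. ennreal (g (x(i := y))) \<partial>circle_measure) \<le> ennreal K * ennreal (\<Prod>l\<in>I. cmod (1 - x l) powr \<sigma>)"
        using AE_CM_unit[OF I(1)]
      proof eventually_elim
        case (elim x)
        have "g (x(i := y)) = cmod (y - x j) powr (2 * b - 1) * (\<Prod>l\<in>I. cmod (1 - x l) powr \<sigma>)" for y
        proof -
          have "(\<Prod>l\<in>I. cmod (1 - (x(i := y)) l) powr \<sigma>) = (\<Prod>l\<in>I. cmod (1 - x l) powr \<sigma>)"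
            using I by (intro prod.cong) auto
          then show ?thesis using ij by (simp add: g_def)
        qed
        then have "(\<integral>\<^sup>+ y. ennreal (g (x(i := y))) \<partial>circle_measure) = (\<integral>\<^sup>+ y. ennreal (cmod (y - x j) powr (2 * b - 1)) * ennreal (\<Prod>l\<in>I. cmod (1 - x l) powr \<sigma>) \<partial>circle_measure)"
          by (simp add: ennreal_mult prod_nonneg)
        also have "\<dots> = (\<integral>\<^sup>+ y. ennreal (cmod (y - x j) powr (2 * b - 1)) \<partial>circle_measure) * ennreal (\<Prod>l\<in>I. cmod (1 - x l) powr \<sigma>)"
          by (rule nn_integral_multc) (rule borel_measurable_circle, auto)
        also have "\<dots> \<le> ennreal K * ennreal (\<Prod>l\<in>I. cmod (1 - x l) powr \<sigma>)"
          using elim I by (intro mult_right_mono K) auto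
        finally show ?case .
      qed
    qed
    also have "\<dots> = ennreal K * (\<integral>\<^sup>+ x. ennreal (\<Prod>l\<in>I. cmod (1 - x l) powr \<sigma>) \<partial>CM I)"
      by (rule nn_integral_cmult) measurable
    also have "\<dots> < \<infinity>"
      using integrable_prod_cmod_powr[OF \<sigma>_gt I(1)]
      by (subst (asm) integrable_iff_bounded) (auto simp: ennreal_mult_less_top prod_nonneg abs_prod)
    finally show "(\<integral>\<^sup>+ x. ennreal (g x) \<partial>CM {..<N}) < \<infinity>" .
  qed (auto simp: g_nonneg)
  then have Eg: "integrable (CM {..<N}) (\<lambda>x. E * g x)" by simp
  show ?thesis
  proof (rule Bochner_Integration.integrable_bound[OF Eg])
    show "H N T i j \<in> borel_measurable (CM {..<N})" using T ij by (intro H_measurable)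
    show "AE x in CM {..<N}. norm (H N T i j x) \<le> norm (E * g x)"
      using AE_CM_unit[of "{..<N}", OF finite_lessThan]
    proof eventually_elim
      case (elim x)
      then have x: "\<And>i. i < N \<Longrightarrow> cmod (x i) = 1" by auto
      show ?case
      proof (cases "x i = x j")
        case True
        then show ?thesis using cbe_weight_coincide[OF ij True] by (simp add: H_def W_def)
      next
        case False
        have pw: "cmod (x i - x j) powr (2 * b) / cmod (x i - x j) = cmod (x i - x j) powr (2 * b - 1)"
          using False by (simp add: powr_diff)
        have "norm (H N T i j x) = (\<Prod>i<N. cmod (1 - x i) powr \<sigma>) * cbe_weight N (2 * b) x * (cmod (1 - x i) * cmod (x i + x j) / cmod (x i - x j))"
          using norm_prod_w[of N x, OF x] norm_prod_unit[of N x T, OF x T] cbe_weight_nonneg[of N "2 * b" x]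
          by (simp add: H_def W_def norm_mult norm_divide norm_minus_commute)
        also have "(\<Prod>i<N. cmod (1 - x i) powr \<sigma>) = cmod (1 - x i) powr \<sigma> * (\<Prod>l\<in>I. cmod (1 - x l) powr \<sigma>)"
          unfolding I(3) using I by simp
        also have "cmod (1 - x i) powr \<sigma> * (\<Prod>l\<in>I. cmod (1 - x l) powr \<sigma>) * cbe_weight N (2 * b) x * (cmod (1 - x i) * cmod (x i + x j) / cmod (x i - x j))
          = (cmod (1 - x i) powr (\<sigma> + 1) * cmod (x i + x j)) * (\<Prod>l\<in>I. cmod (1 - x l) powr \<sigma>) * (cbe_weight N (2 * b) x / cmod (x i - x j))"
          by (cases "x i = 1") (simp_all add: powr_add)
        also have "\<dots> \<le> (2 powr (\<sigma> + 1) * 2) * (\<Prod>l\<in>I. cmod (1 - x l) powr \<sigma>) * (cmod (x i - x j) powr (2 * b) * D / cmod (x i - x j))"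
        proof (intro mult_mono divide_right_mono mult_nonneg_nonneg prod_nonneg powr_mono2 divide_nonneg_nonneg)
          show "cmod (1 - x i) \<le> 2" using x ij by (intro cmod_diff_le_2) auto
          show "cmod (x i + x j) \<le> 2" using norm_triangle_ineq[of "x i" "x j"] x ij by simp
          show "cbe_weight N (2 * b) x \<le> cmod (x i - x j) powr (2 * b) * D"
            unfolding D_def using cbe_weight_le_pair[of N x "2 * b" i j, OF x _ ij] b_pos by simp
        qed (use \<sigma>_gt D cbe_weight_nonneg in auto)
        also have "\<dots> = E * g x"
          unfolding E_def g_def pw[symmetric] by (simp add: mult_ac)
        finally show ?thesis using g_nonneg[of x] D by (simp add: E_def abs_mult)
      qed
    qed
  qed
qed

lemma W_swap: "i < N \<Longrightarrow> j < N \<Longrightarrow> W N (\<lambda>k. x (Transposition.transpose i j k)) = W N x"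
proof -
  assume ij: "i < N" "j < N"
  have "(\<Prod>k<N. w (x (Transposition.transpose i j k))) = (\<Prod>k<N. w (x k))"
    by (rule prod.reindex_bij_witness[of _ "Transposition.transpose i j" "Transposition.transpose i j"])
       (use ij in \<open>auto simp: transpose_less\<close>)
  then show ?thesis using cbe_weight_swap[OF ij] by (simp add: W_def)
qed

lemma prod_swap_fixed: "i \<notin> R \<Longrightarrow> j \<notin> R \<Longrightarrow> (\<Prod>l\<in>R. x (Transposition.transpose i j l)) = (\<Prod>l\<in>R. x l)"
  by (intro prod.cong refl) (metis transpose_apply_other)

lemma J_swap:
  assumes R: "R \<subseteq> {..<N}" and i: "i < N" "i \<notin> R" and j: "j < N" "j \<notin> R"
  shows "J N (insert i R) = J N (insert j R)"
proof -
  have fin: "finite R" using R finite_subset by blast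
  have "(\<integral> x. W N x * (\<Prod>l\<in>insert j R. x l) \<partial>CM {..<N}) = (\<integral> x. W N (\<lambda>k. x (Transposition.transpose i j k)) *
      (\<Prod>l\<in>insert j R. x (Transposition.transpose i j l)) \<partial>CM {..<N})"
    by (rule integral_swap[OF i(1) j(1), symmetric]) (use R j in \<open>auto intro!: borel_measurable_integrable integrable_J\<close>)
  also have "(\<lambda>x. W N (\<lambda>k. x (Transposition.transpose i j k)) * (\<Prod>l\<in>insert j R. x (Transposition.transpose i j l)))
    = (\<lambda>x. W N x * (\<Prod>l\<in>insert i R. x l))"
    using fin i j by (auto simp: W_swap prod_swap_fixed)
  finally show ?thesis by (simp add: J_def)
qed

text \<open>Exchanging \<open>x i\<close> and \<open>x j\<close> preserves the measure, so twice the
  integral is that of the symmetrized integrand, whose pole has cancelled by hypothesis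
  \<open>e\<close>. What remains are two integrals of monomials that differ by the same exchange.
  \<open>R\<close> is the part of the monomial free of \<open>x i\<close> and
  \<open>x j\<close>.\<close>

lemma integral_H_half:
  assumes T: "T \<subseteq> {..<N}" and ij: "i < N" "j < N" "i \<noteq> j" and R: "R \<subseteq> {..<N}" "i \<notin> R" "j \<notin> R"
    and e: "\<And>x. H N T i j x + H N T i j (\<lambda>k. x (Transposition.transpose i j k)) = W N x * (\<Prod>l\<in>R. x l) * (x i + x j)"
  shows "(\<integral> x. H N T i j x \<partial>CM {..<N}) = J N (insert i R)"
proof -
  have fin: "finite R" using R finite_subset by blast
  note int = integrable_H[OF T ij]
  have "2 * (\<integral> x. H N T i j x \<partial>CM {..<N}) = (\<integral> x. H N T i j x \<partial>CM {..<N}) + (\<integral> x. H N T i j (\<lambda>k. x (Transposition.transpose i j k)) \<partial>CM {..<N})"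
    using integral_swap[OF ij(1,2) borel_measurable_integrable[OF int]] by simp
  also have "\<dots> = (\<integral> x. H N T i j x + H N T i j (\<lambda>k. x (Transposition.transpose i j k)) \<partial>CM {..<N})"
    by (rule Bochner_Integration.integral_add[symmetric, OF int integrable_swap[OF ij(1,2) int]])
  also have "\<dots> = (\<integral> x. W N x * (\<Prod>l\<in>insert i R. x l) + W N x * (\<Prod>l\<in>insert j R. x l) \<partial>CM {..<N})"
    unfolding e using fin R by (intro Bochner_Integration.integral_cong) (auto simp: algebra_simps)
  also have "\<dots> = J N (insert i R) + J N (insert j R)"
    unfolding J_def using R ij by (intro Bochner_Integration.integral_add integrable_J) auto
  also have "J N (insert j R) = J N (insert i R)"
    using R ij by (intro J_swap) auto
  finally show ?thesis by simp
qed

text \<open>The symmetrized quotient without and with a monomial factor from the other point, that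
  is for \<open>j\<close> outside and inside \<open>T\<close>. In both cases the numerator is
  divisible by \<open>a - c\<close>.\<close>

lemma quotient_antisym:
  "(a::complex) \<noteq> c \<Longrightarrow> (a - 1) * (a + c) / (a - c) + (c - 1) * (c + a) / (c - a) = a + c"
  "(a::complex) \<noteq> c \<Longrightarrow> c * ((a - 1) * (a + c) / (a - c)) + a * ((c - 1) * (c + a) / (c - a)) = a + c"
proof -
  assume ne: "a \<noteq> c"
  have e: "x / (c - a) = - (x / (a - c))" for x
    using minus_divide_right[of x "a - c"] by simp
  have "(a - 1) * (a + c) / (a - c) + (c - 1) * (c + a) / (c - a) = ((a - 1) * (a + c) - (c - 1) * (c + a)) / (a - c)"
    unfolding e by (simp add: diff_divide_distrib)
  also have "(a - 1) * (a + c) - (c - 1) * (c + a) = (a + c) * (a - c)" by (simp add: algebra_simps)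
  finally show "(a - 1) * (a + c) / (a - c) + (c - 1) * (c + a) / (c - a) = a + c" using ne by simp
  have "c * ((a - 1) * (a + c) / (a - c)) + a * ((c - 1) * (c + a) / (c - a)) = (c * ((a - 1) * (a + c)) - a * ((c - 1) * (c + a))) / (a - c)"
    unfolding e by (simp add: diff_divide_distrib)
  also have "c * ((a - 1) * (a + c)) - a * ((c - 1) * (c + a)) = (a + c) * (a - c)" by (simp add: algebra_simps)
  finally show "c * ((a - 1) * (a + c) / (a - c)) + a * ((c - 1) * (c + a) / (c - a)) = a + c" using ne by simp
qed

lemma integral_H_greater:
  assumes "n < j" "j < N"
  shows "(\<integral> x. H N {..<n} n j x \<partial>CM {..<N}) = J N {..<Suc n}"
proof -
  have "(\<integral> x. H N {..<n} n j x \<partial>CM {..<N}) = J N (insert n {..<n})"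
  proof (rule integral_H_half)
    fix x :: "nat \<Rightarrow> complex"
    show "H N {..<n} n j x + H N {..<n} n j (\<lambda>k. x (Transposition.transpose n j k)) = W N x * (\<Prod>l<n. x l) * (x n + x j)"
    proof (cases "x n = x j")
      case True
      then have "W N x = 0" using cbe_weight_coincide[of n N j x] assms by (simp add: W_def)
      then show ?thesis using assms by (simp add: H_def W_swap)
    next
      case False
      have "H N {..<n} n j x + H N {..<n} n j (\<lambda>k. x (Transposition.transpose n j k)) =
        W N x * (\<Prod>l<n. x l) * ((x n - 1) * (x n + x j) / (x n - x j) + (x j - 1) * (x j + x n) / (x j - x n))"
        using assms by (simp add: H_def W_swap prod_swap_fixed algebra_simps)
      then show ?thesis by (simp only: quotient_antisym(1)[OF False])
    qed
  qed (use assms in auto)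
  then show ?thesis by (simp add: lessThan_Suc)
qed

lemma integral_H_less:
  assumes "j < n" "n < N"
  shows "(\<integral> x. H N {..<n} n j x \<partial>CM {..<N}) = J N {..<n}"
proof -
  define R where "R = {..<n} - {j}"
  have R: "{..<n} = insert j R" "j \<notin> R" "n \<notin> R" "finite R" "R \<subseteq> {..<N}" using assms by (auto simp: R_def)
  have "(\<integral> x. H N {..<n} n j x \<partial>CM {..<N}) = J N (insert n R)"
  proof (rule integral_H_half)
    fix x :: "nat \<Rightarrow> complex"
    show "H N {..<n} n j x + H N {..<n} n j (\<lambda>k. x (Transposition.transpose n j k)) = W N x * (\<Prod>l\<in>R. x l) * (x n + x j)"
    proof (cases "x n = x j")
      case True
      then have "W N x = 0" using cbe_weight_coincide[of n N j x] assms by (simp add: W_def)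
      then show ?thesis using assms by (simp add: H_def W_swap)
    next
      case False
      have "H N {..<n} n j x + H N {..<n} n j (\<lambda>k. x (Transposition.transpose n j k)) =
        W N x * (\<Prod>l\<in>R. x l) * (x j * ((x n - 1) * (x n + x j) / (x n - x j)) + x n * ((x j - 1) * (x j + x n) / (x j - x n)))"
        using assms R by (simp add: H_def W_swap prod_swap_fixed algebra_simps)
      then show ?thesis by (simp only: quotient_antisym(2)[OF False])
    qed
  qed (use assms R in auto)
  also have "\<dots> = J N (insert j R)" using assms R by (intro J_swap) auto
  finally show ?thesis using R by simp
qed

text \<open>Integration by parts in \<open>x n\<close> of the weight times the monomial of the
  points before it. After symmetrization each of the \<open>N - n - 1\<close> later points
  contributes \<open>J N {..<Suc n}\<close>, and each of the \<open>n\<close> earlier ones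
  \<open>J N {..<n}\<close>.\<close>

lemma J_rec:
  assumes n: "n < N"
  shows "(1 + \<sigma> / 2 + m / 2 + b * real (N - Suc n)) * J N {..<Suc n} + (\<sigma> / 2 - m / 2 + b * real n) * J N {..<n} = 0"
proof -
  define I where "I = {..<N} - {n}"
  have I: "finite I" "n \<notin> I" "{..<N} = insert n I" using n by (auto simp: I_def)
  define G where "G x = W N x * (\<Prod>l<n. x l) * (x n + \<sigma> / 2 * (x n + 1) + m / 2 * (x n - 1) +
      b * (\<Sum>j\<in>I. (x n - 1) * (x n + x j) / (x n - x j)))" for x :: "nat \<Rightarrow> complex"
  have G_eq: "G x = (1 + \<sigma> / 2 + m / 2) * (W N x * (\<Prod>l<Suc n. x l)) + (\<sigma> / 2 - m / 2) * (W N x * (\<Prod>l<n. x l))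
     + b * (\<Sum>j\<in>I. H N {..<n} n j x)" for x
  proof -
    have sum_eq: "(\<Sum>j\<in>I. H N {..<n} n j x) = W N x * (\<Prod>l<n. x l) * (\<Sum>j\<in>I. (x n - 1) * (x n + x j) / (x n - x j))"
      unfolding H_def sum_distrib_left ..
    have alg: "P * (z + s * (z + 1) + t * (z - 1) + b' * S) = (1 + s + t) * (P * z) + (s - t) * P + b' * (P * S)"
      for P z s t b' S :: complex by (simp add: algebra_simps)
    show ?thesis unfolding G_def sum_eq alg by (simp only: prod.lessThan_Suc mult.assoc of_real_add of_real_diff of_real_1)
  qed
  have int1: "integrable (CM {..<N}) (\<lambda>x. W N x * (\<Prod>l<Suc n. x l))" "integrable (CM {..<N}) (\<lambda>x. W N x * (\<Prod>l<n. x l))"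
    using n by (auto intro!: integrable_J simp del: prod.lessThan_Suc)
  have int2: "integrable (CM {..<N}) (\<lambda>x. H N {..<n} n j x)" if "j \<in> I" for j
    using n that by (intro integrable_H) (auto simp: I_def)
  have intG: "integrable (CM {..<N}) G"
    unfolding G_eq[abs_def] using int1 int2
    by (intro Bochner_Integration.integrable_add integrable_mult_right Bochner_Integration.integrable_sum) auto
  have "(\<integral> x. G x \<partial>CM {..<N}) = (1 + \<sigma> / 2 + m / 2) * J N {..<Suc n} + (\<sigma> / 2 - m / 2) * J N {..<n}
     + b * (\<Sum>j\<in>I. (\<integral> x. H N {..<n} n j x \<partial>CM {..<N}))"
    unfolding G_eq J_def using int1 int2
    by (simp add: Bochner_Integration.integral_sum del: prod.lessThan_Suc)
  also have "(\<Sum>j\<in>I. (\<integral> x. H N {..<n} n j x \<partial>CM {..<N})) = (\<Sum>j\<in>{..<n}. J N {..<n}) + (\<Sum>j\<in>{n<..<N}. J N {..<Suc n})"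
  proof -
    have "I = {..<n} \<union> {n<..<N}" using n by (auto simp: I_def)
    then have "(\<Sum>j\<in>I. (\<integral> x. H N {..<n} n j x \<partial>CM {..<N})) = (\<Sum>j\<in>{..<n}. (\<integral> x. H N {..<n} n j x \<partial>CM {..<N})) + (\<Sum>j\<in>{n<..<N}. (\<integral> x. H N {..<n} n j x \<partial>CM {..<N}))"
      by (simp only:) (rule sum.union_disjoint, auto)
    then show ?thesis using n by (simp add: integral_H_greater integral_H_less)
  qed
  also have "\<dots> = real n * J N {..<n} + real (N - Suc n) * J N {..<Suc n}" by simp
  finally have 1: "(\<integral> x. G x \<partial>CM {..<N}) = (1 + \<sigma> / 2 + m / 2 + b * real (N - Suc n)) * J N {..<Suc n} + (\<sigma> / 2 - m / 2 + b * real n) * J N {..<n}"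
    by (simp add: algebra_simps)
  \<comment> \<open>Fubini with \<open>x n\<close> innermost: up to a factor \<open>c\<close> free
    of \<open>x n\<close>, the inner integral is the one in
    \<open>integral_by_parts\<close>.\<close>
  have "(\<integral> x. G x \<partial>CM {..<N}) = (\<integral> x. (\<integral> y. G (x(n := y)) \<partial>circle_measure) \<partial>CM I)"
    using circs.product_integral_insert[OF I(1,2), of G] intG I by simp
  also have "\<dots> = 0"
  proof (rule integral_eq_zero_AE)
    show "AE x in CM I. (\<integral> y. G (x(n := y)) \<partial>circle_measure) = 0"
      using AE_CM_unit[OF I(1)]
    proof eventually_elim
      case (elim x)
      define c where "c = (\<Prod>i\<in>I. w (x i)) * of_real (\<Prod>j\<in>I. \<Prod>k\<in>{..<j} - {n}. cmod (x k - x j) powr (2 * b)) * (\<Prod>l<n. x l)"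
      have "G (x(n := y)) = c * (w y * of_real (\<Prod>j\<in>I. cmod (y - x j) powr (2 * b)) *
        (y + \<sigma> / 2 * (y + 1) + m / 2 * (y - 1) + b * (\<Sum>j\<in>I. (y - 1) * (y + x j) / (y - x j))))" for y :: complex
      proof -
        have p1: "(\<Prod>j\<in>I. cmod ((x(n := y)) n - (x(n := y)) j) powr (2 * b)) = (\<Prod>j\<in>I. cmod (y - x j) powr (2 * b))"
          by (rule prod.cong) (use I in auto)
        have p2: "(\<Prod>j\<in>I. \<Prod>k\<in>{..<j} - {n}. cmod ((x(n := y)) k - (x(n := y)) j) powr (2 * b)) = (\<Prod>j\<in>I. \<Prod>k\<in>{..<j} - {n}. cmod (x k - x j) powr (2 * b))"
        proof (rule prod.cong)
          fix j assume "j \<in> I"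
          then have "j \<noteq> n" using I by auto
          then show "(\<Prod>k\<in>{..<j} - {n}. cmod ((x(n := y)) k - (x(n := y)) j) powr (2 * b)) = (\<Prod>k\<in>{..<j} - {n}. cmod (x k - x j) powr (2 * b))"
            by (intro prod.cong) auto
        qed simp
        have "cbe_weight N (2 * b) (x(n := y)) = (\<Prod>j\<in>I. cmod (y - x j) powr (2 * b)) * (\<Prod>j\<in>I. \<Prod>k\<in>{..<j} - {n}. cmod (x k - x j) powr (2 * b))"
          unfolding cbe_weight_isolate[OF n] I_def[symmetric] p1 p2 ..
        moreover have "(\<Prod>i<N. w ((x(n := y)) i)) = w y * (\<Prod>i\<in>I. w (x i))"
        proof -
          have "(\<Prod>i\<in>I. w ((x(n := y)) i)) = (\<Prod>i\<in>I. w (x i))"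
            using I(2) by (intro prod.cong) auto
          then show ?thesis unfolding I(3) using I(1,2) by simp
        qed
        moreover have "(\<Prod>l<n. (x(n := y)) l) = (\<Prod>l<n. x l)" by (intro prod.cong) auto
        moreover have "(\<Sum>j\<in>I. ((x(n := y)) n - 1) * ((x(n := y)) n + (x(n := y)) j) / ((x(n := y)) n - (x(n := y)) j)) = (\<Sum>j\<in>I. (y - 1) * (y + x j) / (y - x j))"
          using I(2) by (intro sum.cong) auto
        ultimately show ?thesis
          unfolding G_def W_def c_def by (simp only: fun_upd_same of_real_mult mult_ac)
      qed
      then have "(\<integral> y. G (x(n := y)) \<partial>circle_measure) = c * 0"
        using integral_by_parts[OF I(1), of x] elim by (simp only: integral_mult_right_zero)
      then show ?case by simp
    qed
  qed
  finally show ?thesis using 1 by simp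
qed

end

lemma sum_Pow_card:
  fixes g :: "nat \<Rightarrow> complex"
  shows "(\<Sum>T\<in>Pow {..<N}. g (card T)) = (\<Sum>k\<le>N. of_nat (N choose k) * g k)"
proof -
  have "(\<Sum>T\<in>Pow {..<N}. g (card T)) = (\<Sum>k\<le>N. \<Sum>T\<in>{T \<in> Pow {..<N}. card T = k}. g (card T))"
  proof (rule sum.group[symmetric])
    show "card ` Pow {..<N} \<subseteq> {..N}"
      using card_mono[OF finite_lessThan, of _ N] by fastforce
  qed auto
  also have "\<dots> = (\<Sum>k\<le>N. of_nat (N choose k) * g k)"
  proof (rule sum.cong)
    fix k
    have "(\<Sum>T\<in>{T \<in> Pow {..<N}. card T = k}. g (card T)) = of_nat (card {T \<in> Pow {..<N}. card T = k}) * g k"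
      by (simp add: sum.cong)
    also have "card {T \<in> Pow {..<N}. card T = k} = N choose k"
      using n_subsets[of "{..<N}" k] by (simp add: Pow_def)
    finally show "(\<Sum>T\<in>{T \<in> Pow {..<N}. card T = k}. g (card T)) = of_nat (N choose k) * g k" .
  qed simp
  finally show ?thesis .
qed

section \<open>Closed form of the integrals and the shift of the weight\<close>

context circle_weight
begin

text \<open>Induction on the number of elements of \<open>T\<close> outside the initial segment:
  \<open>J_swap\<close> trades one of them for a missing smaller index.\<close>

lemma J_card:
  assumes "T \<subseteq> {..<N}"
  shows "J N T = J N {..<card T}"
  using assms
proof (induction "card (T - {..<card T})" arbitrary: T rule: less_induct)
  case less
  have fin: "finite T" using less.prems finite_subset by blast
  show ?case
  proof (cases "T - {..<card T} = {}")
    case True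
    then have "T \<subseteq> {..<card T}" by blast
    then have "T = {..<card T}" by (intro card_subset_eq) auto
    then show ?thesis by simp
  next
    case False
    then obtain j where j: "j \<in> T" "j \<notin> {..<card T}" by blast
    have "\<not> {..<card T} \<subseteq> T"
    proof
      assume "{..<card T} \<subseteq> T"
      then have "{..<card T} = T" using fin by (intro card_subset_eq) auto
      then show False using j by auto
    qed
    then obtain i where i: "i < card T" "i \<notin> T" by blast
    define R where "R = T - {j}"
    have R: "T = insert j R" "j \<notin> R" "i \<notin> R" "finite R" using j i fin by (auto simp: R_def)
    have jN: "j < N" using j less.prems by auto
    then have iN: "i < N" using i j by simp
    have c: "card (insert i R) = card T" using R i by simp
    have "J N T = J N (insert i R)"
      unfolding R(1) using R less.prems jN iN by (intro J_swap) auto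
    also have "\<dots> = J N {..<card (insert i R)}"
    proof (rule less.hyps)
      have "insert i R - {..<card (insert i R)} = (T - {..<card T}) - {j}"
        unfolding c using R i by auto
      moreover have "card (T - {..<card T} - {j}) < card (T - {..<card T})"
        by (rule card_Diff1_less) (use j fin in auto)
      ultimately show "card (insert i R - {..<card (insert i R)}) < card (T - {..<card T})"
        by (simp only:)
      show "insert i R \<subseteq> {..<N}" using iN less.prems by (auto simp: R_def)
    qed
    finally show ?thesis by (simp add: c)
  qed
qed

text \<open>\<open>A\<close> and \<open>B\<close> normalize the recursion to \<open>J_Suc\<close>,
  so that its solution is a ratio of Pochhammer symbols. Their sum is
  \<open>(1 + \<sigma>) / b\<close>, independent of \<open>m\<close>.\<close>

definition A :: complex where "A = of_real ((1 + (\<sigma> + m) / 2) / b)"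
definition B :: complex where "B = of_real (((\<sigma> - m) / 2) / b)"

lemma A_plus_nonzero: "A + of_nat n \<noteq> 0"
proof -
  have "A + of_nat n = of_real ((1 + (\<sigma> + m) / 2) / b + real n)" by (simp add: A_def)
  moreover have "(1 + (\<sigma> + m) / 2) / b + real n > 0" by (intro add_pos_nonneg divide_pos_pos a_pos b_pos) simp
  ultimately show ?thesis by (metis of_real_eq_0_iff less_irrefl)
qed

lemma pochhammer_A_nonzero: "pochhammer A n \<noteq> 0"
  using A_plus_nonzero by (auto simp: pochhammer_prod)

lemma J_Suc:
  assumes "n < N"
  shows "J N {..<Suc n} * (A + of_nat (N - Suc n)) = - (B + of_nat n) * J N {..<n}"
proof -
  have b0: "complex_of_real b \<noteq> 0" using b_pos by simp
  have e1: "1 + \<sigma> / 2 + m / 2 + b * real (N - Suc n) = complex_of_real b * (A + of_nat (N - Suc n))"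
    using b0 by (simp add: A_def field_simps)
  have e2: "\<sigma> / 2 - m / 2 + b * real n = complex_of_real b * (B + of_nat n)"
    using b0 by (simp add: B_def field_simps)
  have "complex_of_real b * ((A + of_nat (N - Suc n)) * J N {..<Suc n} + (B + of_nat n) * J N {..<n}) = 0"
    using J_rec[OF assms] unfolding e1 e2 by (simp add: algebra_simps)
  then have "(A + of_nat (N - Suc n)) * J N {..<Suc n} + (B + of_nat n) * J N {..<n} = 0"
    using b0 by simp
  then have "(A + of_nat (N - Suc n)) * J N {..<Suc n} = - ((B + of_nat n) * J N {..<n})"
    by (simp only: eq_neg_iff_add_eq_0)
  then show ?thesis by (simp only: mult.commute[of "J N {..<Suc n}"] minus_mult_left)
qed

text \<open>The steps of the recursion consume the factors of \<open>pochhammer A N\<close> from the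
  largest downwards; \<open>pochhammer A (N - k)\<close> is what is left after \<open>k\<close> of
  them.\<close>

lemma J_closed:
  assumes "k \<le> N"
  shows "pochhammer A N * ((-1) ^ k * J N {..<k}) = pochhammer B k * pochhammer A (N - k) * J N {}"
  using assms
proof (induction k)
  case (Suc k)
  have Nk: "N - k = Suc (N - Suc k)" using Suc.prems by simp
  have ne: "A + of_nat (N - Suc k) \<noteq> 0" by (rule A_plus_nonzero)
  have "(pochhammer A N * ((-1) ^ Suc k * J N {..<Suc k})) * (A + of_nat (N - Suc k)) =
     pochhammer A N * ((-1) ^ Suc k * (J N {..<Suc k} * (A + of_nat (N - Suc k))))" by (simp only: mult.assoc)
  also have "\<dots> = (pochhammer A N * ((-1) ^ k * J N {..<k})) * (B + of_nat k)"
    using Suc.prems by (subst J_Suc) (auto simp: algebra_simps)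
  also have "\<dots> = pochhammer B k * (pochhammer A (N - Suc k) * (A + of_nat (N - Suc k))) * J N {} * (B + of_nat k)"
    using Suc by (simp add: Nk pochhammer_Suc)
  also have "\<dots> = (pochhammer B (Suc k) * pochhammer A (N - Suc k) * J N {}) * (A + of_nat (N - Suc k))"
    by (simp add: pochhammer_Suc mult_ac)
  finally show ?case using ne by (simp only: mult_cancel_right) simp
qed simp

text \<open>Expanding the product over subsets gives binomially weighted integrals over initial
  segments. In Pochhammer form these are summed by the Chu-Vandermonde identity,
  \<open>pochhammer_binomial_sum\<close>.\<close>

theorem integral_W_shift:
  "(\<integral> x. W N x * (\<Prod>i<N. 1 - x i) \<partial>CM {..<N}) =
     of_real (\<Prod>j<N. (1 + \<sigma> + real j * b) / (1 + (\<sigma> + m) / 2 + real j * b)) * (\<integral> x. W N x \<partial>CM {..<N})"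
proof -
  have ex: "W N x * (\<Prod>i<N. 1 - x i) = (\<Sum>T\<in>Pow {..<N}. (-1) ^ card T * (W N x * (\<Prod>l\<in>T. x l)))" for x
  proof -
    have "(\<Prod>i<N. 1 - x i) = (\<Prod>i<N. (- x i) + 1)" by simp
    also have "\<dots> = (\<Sum>T\<in>Pow {..<N}. (\<Prod>l\<in>T. - x l) * (\<Prod>l\<in>{..<N} - T. 1))"
      by (rule prod_add) simp
    also have "\<dots> = (\<Sum>T\<in>Pow {..<N}. (-1) ^ card T * (\<Prod>l\<in>T. x l))"
      by (simp add: prod_uminus)
    finally show ?thesis by (simp add: sum_distrib_left mult_ac)
  qed
  have "(\<integral> x. W N x * (\<Prod>i<N. 1 - x i) \<partial>CM {..<N}) = (\<Sum>T\<in>Pow {..<N}. (-1) ^ card T * J N T)"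
    unfolding ex J_def by (subst Bochner_Integration.integral_sum) (auto intro!: integrable_J)
  also have "\<dots> = (\<Sum>T\<in>Pow {..<N}. (-1) ^ card T * J N {..<card T})"
    using J_card by (intro sum.cong) auto
  also have "\<dots> = (\<Sum>k\<le>N. of_nat (N choose k) * ((-1) ^ k * J N {..<k}))"
    by (rule sum_Pow_card)
  finally have "pochhammer A N * (\<integral> x. W N x * (\<Prod>i<N. 1 - x i) \<partial>CM {..<N})
    = (\<Sum>k\<le>N. of_nat (N choose k) * (pochhammer A N * ((-1) ^ k * J N {..<k})))"
    by (simp add: sum_distrib_left mult_ac)
  also have "\<dots> = (\<Sum>k\<le>N. of_nat (N choose k) * pochhammer B k * pochhammer A (N - k)) * J N {}"
    unfolding sum_distrib_right by (intro sum.cong) (auto simp: J_closed)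
  also have "\<dots> = pochhammer (B + A) N * J N {}"
    by (simp add: pochhammer_binomial_sum)
  finally have "(\<integral> x. W N x * (\<Prod>i<N. 1 - x i) \<partial>CM {..<N}) = pochhammer (B + A) N / pochhammer A N * J N {}"
    using pochhammer_A_nonzero by (simp add: field_simps)
  also have "pochhammer (B + A) N / pochhammer A N = of_real (\<Prod>j<N. (1 + \<sigma> + real j * b) / (1 + (\<sigma> + m) / 2 + real j * b))"
  proof -
    have "pochhammer (B + A) N / pochhammer A N = (\<Prod>j<N. (B + A + of_nat j) / (A + of_nat j))"
      by (simp add: pochhammer_prod prod_dividef atLeast0LessThan)
    also have "\<dots> = (\<Prod>j<N. complex_of_real ((1 + \<sigma> + real j * b) / (1 + (\<sigma> + m) / 2 + real j * b)))"
    proof (rule prod.cong)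
      fix j
      have ba: "B + A + of_nat j = complex_of_real ((1 + \<sigma> + real j * b) / b)"
      proof -
        have "B + A + of_nat j = complex_of_real (((\<sigma> - m) / 2) / b + (1 + (\<sigma> + m) / 2) / b + real j)" by (simp add: A_def B_def)
        also have "((\<sigma> - m) / 2) / b + (1 + (\<sigma> + m) / 2) / b + real j = (1 + \<sigma> + real j * b) / b"
          using b_pos by (simp add: field_simps)
        finally show ?thesis .
      qed
      have aa: "A + of_nat j = complex_of_real ((1 + (\<sigma> + m) / 2 + real j * b) / b)"
      proof -
        have "A + of_nat j = complex_of_real ((1 + (\<sigma> + m) / 2) / b + real j)" by (simp add: A_def)
        also have "(1 + (\<sigma> + m) / 2) / b + real j = (1 + (\<sigma> + m) / 2 + real j * b) / b"
          using b_pos by (simp add: field_simps)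
        finally show ?thesis .
      qed
      show "(B + A + of_nat j) / (A + of_nat j) = complex_of_real ((1 + \<sigma> + real j * b) / (1 + (\<sigma> + m) / 2 + real j * b))"
        unfolding ba aa using b_pos by (simp flip: of_real_divide)
    qed simp
    finally show ?thesis by simp
  qed
  finally show ?thesis by (simp add: J_def)
qed

end

section \<open>Two concrete weights and the step from \<open>h\<close> to
  \<open>h + 2\<close>\<close>

lemma cmod_1_minus_powr_has_vector_derivative:
  assumes "t \<in> {0<..<2 * pi}"
  shows "((\<lambda>t. complex_of_real (cmod (1 - cis t) powr s)) has_vector_derivative
     (\<i> * of_real (cmod (1 - cis t) powr s) * (s / 2 * (cis t + 1) / (cis t - 1)))) (at t)"
proof -
  have ne: "cis t \<noteq> 1" using assms by (rule cis_neq_1)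
  have "((\<lambda>t. cmod (cis t - 1) powr (2 * (s / 2))) has_real_derivative
     (cmod (cis t - 1) powr (2 * (s / 2))) * (s / 2 * (2 * Im (cis t * cnj 1) / (cmod (cis t - 1))\<^sup>2))) (at t)"
    using ne by (intro cmod_cis_powr_has_derivative) auto
  note d = has_vector_derivative_of_real[OF this, where 'a=complex]
  have "((\<lambda>t. complex_of_real (cmod (cis t - 1) powr (2 * (s / 2)))) has_vector_derivative
     of_real (cmod (cis t - 1) powr (2 * (s / 2))) * (of_real (s / 2) * (\<i> * (cis t + 1) / (cis t - 1)))) (at t)"
  proof -
    have q: "complex_of_real (2 * Im (cis t * cnj 1) / (cmod (cis t - 1))\<^sup>2) = \<i> * (cis t + 1) / (cis t - 1)"
      by (rule unit_circle_quotient) (use ne in auto)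
    show ?thesis using d by (simp only: of_real_mult q)
  qed
  then show ?thesis by (simp add: norm_minus_commute mult_ac)
qed

lemma circle_weight_plain:
  assumes "b > 0" "h > -1"
  shows "circle_weight (\<lambda>z. complex_of_real (cmod (1 - z) powr h)) b h 0"
proof
  show "((\<lambda>t. complex_of_real (cmod (1 - cis t) powr h)) has_vector_derivative
      \<i> * complex_of_real (cmod (1 - cis t) powr h) * ((h / 2) * (cis t + 1) / (cis t - 1) + (0::real) / 2)) (at t)"
    if "t \<in> {0<..<2 * pi}" for t
    using cmod_1_minus_powr_has_vector_derivative[OF that, of h] by simp
qed (use assms in auto)

text \<open>On the circle \<open>1 - cnj z\<close> equals \<open>1 - 1 / z\<close>: this factor adds
  1 to \<open>\<sigma>\<close> and moves the asymmetry \<open>m\<close> from 0 to -1.\<close>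

lemma circle_weight_cnj:
  assumes "b > 0" "h > -1"
  shows "circle_weight (\<lambda>z. complex_of_real (cmod (1 - z) powr h) * (1 - cnj z)) b (h + 1) (-1)"
proof
  have [measurable]: "(\<lambda>z. cnj z) \<in> borel_measurable borel"
    by (intro borel_measurable_continuous_onI continuous_intros)
  show "(\<lambda>z. complex_of_real (cmod (1 - z) powr h) * (1 - cnj z)) \<in> borel_measurable borel"
    by measurable
  show "cmod (complex_of_real (cmod (1 - z) powr h) * (1 - cnj z)) = cmod (1 - z) powr (h + 1)" if "cmod z = 1" for z
  proof -
    have "cmod (1 - cnj z) = cmod (1 - z)" by (metis complex_cnj_diff complex_cnj_one complex_mod_cnj)
    then show ?thesis by (cases "z = 1") (auto simp: norm_mult powr_add)
  qed
  show "((\<lambda>t. complex_of_real (cmod (1 - cis t) powr h) * (1 - cnj (cis t))) has_vector_derivative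
      \<i> * (complex_of_real (cmod (1 - cis t) powr h) * (1 - cnj (cis t))) * (((h + 1) / 2) * (cis t + 1) / (cis t - 1) + (-1::real) / 2)) (at t)"
    if t: "t \<in> {0<..<2 * pi}" for t
  proof -
    have ne: "cis t \<noteq> 1" using t by (rule cis_neq_1)
    have dc: "((\<lambda>t. 1 - cnj (cis t)) has_vector_derivative \<i> * cnj (cis t)) (at t)"
    proof -
      have "((\<lambda>t. cnj (cis t)) has_vector_derivative cnj (\<i> * cis t)) (at t)"
        by (rule bounded_linear.has_vector_derivative[OF bounded_linear_cnj cis_has_vector_derivative])
      from has_vector_derivative_diff[OF has_vector_derivative_const[of 1] this] show ?thesis by simp
    qed
    have "((\<lambda>t. complex_of_real (cmod (1 - cis t) powr h) * (1 - cnj (cis t))) has_vector_derivative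
       complex_of_real (cmod (1 - cis t) powr h) * (\<i> * cnj (cis t)) +
       (\<i> * of_real (cmod (1 - cis t) powr h) * (h / 2 * (cis t + 1) / (cis t - 1))) * (1 - cnj (cis t))) (at t)"
      using has_vector_derivative_mult[OF cmod_1_minus_powr_has_vector_derivative[OF t, of h] dc] by simp
    \<comment> \<open>Since \<open>z * cnj z = 1\<close> on the circle, the derivative of the
      conjugated factor is that factor times a multiple of \<open>1 / (z - 1)\<close>, as the
      logarithmic derivative in \<open>w_deriv\<close> demands.\<close>
    moreover have "cnj (cis t) = (1 - cnj (cis t)) * (1 / (cis t - 1))"
    proof -
      have "cis t * cnj (cis t) = 1" by (simp add: cis_cnj cis_mult)
      then have "cnj (cis t) * (cis t - 1) = 1 - cnj (cis t)" by (simp add: algebra_simps)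
      then show ?thesis using ne by (simp add: field_simps)
    qed
    moreover have "1 / (cis t - 1) = (cis t + 1) / (cis t - 1) / 2 - 1 / 2"
      using ne by (simp add: field_simps)
    ultimately have "((\<lambda>t. complex_of_real (cmod (1 - cis t) powr h) * (1 - cnj (cis t))) has_vector_derivative
       complex_of_real (cmod (1 - cis t) powr h) * (\<i> * ((1 - cnj (cis t)) * ((cis t + 1) / (cis t - 1) / 2 - 1 / 2))) +
       (\<i> * of_real (cmod (1 - cis t) powr h) * (h / 2 * (cis t + 1) / (cis t - 1))) * (1 - cnj (cis t))) (at t)"
      by metis
    moreover have "P * (\<i> * (Q * (R / 2 - 1 / 2))) + (\<i> * P * (h' / 2 * R)) * Q = \<i> * (P * Q) * ((h' + 1) / 2 * R + (-1) / 2)"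
      for P Q R h' :: complex by (simp add: field_simps)
    ultimately show ?thesis by (simp only: times_divide_eq_right[symmetric] of_real_add of_real_1 of_real_minus of_real_divide of_real_numeral)
  qed
qed (use assms in auto)

definition Mi :: "nat \<Rightarrow> real \<Rightarrow> real \<Rightarrow> real" where
  "Mi N b h = (\<integral> x. (\<Prod>i<N. cmod (1 - x i) powr h) * cbe_weight N (2 * b) x \<partial>CM {..<N})"

text \<open>\<open>integral_W_shift\<close> is used twice. Multiplying by all \<open>1 - x i\<close>
  gives a complex integrand whose integral is real, hence equal to the integral of the conjugate.
  That conjugate is a weight of the second kind, and a second multiplication turns it into the
  weight for \<open>h + 2\<close>, since \<open>(1 - cnj z) * (1 - z)\<close> is the squared
  modulus.\<close>

lemma Mi_plus_2:
  assumes b: "b > 0" and h: "h > -1"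
  shows "Mi N b (h + 2) = (\<Prod>j<N. (1 + h + real j * b) * (2 + h + real j * b) / (1 + h / 2 + real j * b)\<^sup>2) * Mi N b h"
proof -
  interpret p: circle_weight "\<lambda>z. complex_of_real (cmod (1 - z) powr h)" b h 0
    using b h by (rule circle_weight_plain)
  interpret c: circle_weight "\<lambda>z. complex_of_real (cmod (1 - z) powr h) * (1 - cnj z)" b "h + 1" "-1"
    using b h by (rule circle_weight_cnj)
  define r1 where "r1 = (\<Prod>j<N. (1 + h + real j * b) / (1 + h / 2 + real j * b))"
  define r2 where "r2 = (\<Prod>j<N. (2 + h + real j * b) / (1 + h / 2 + real j * b))"
  have pW: "p.W N x = of_real ((\<Prod>i<N. cmod (1 - x i) powr h) * cbe_weight N (2 * b) x)" for x
    by (simp add: p.W_def)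
  have cW: "c.W N x = cnj (p.W N x * (\<Prod>i<N. 1 - x i))" for x
    by (simp add: p.W_def c.W_def prod.distrib)
  have 1: "(\<integral> x. p.W N x * (\<Prod>i<N. 1 - x i) \<partial>CM {..<N}) = of_real (r1 * Mi N b h)"
    using p.integral_W_shift[of N] unfolding r1_def Mi_def pW integral_complex_of_real by simp
  have 2: "(\<integral> x. c.W N x \<partial>CM {..<N}) = of_real (r1 * Mi N b h)"
    unfolding cW Bochner_Integration.integral_cnj 1 by simp
  have 3: "(\<integral> x. c.W N x * (\<Prod>i<N. 1 - x i) \<partial>CM {..<N}) = of_real (r2 * (r1 * Mi N b h))"
    using c.integral_W_shift[of N] unfolding 2 r2_def by (simp add: add_ac)
  have 4: "c.W N x * (\<Prod>i<N. 1 - x i) = of_real ((\<Prod>i<N. cmod (1 - x i) powr (h + 2)) * cbe_weight N (2 * b) x)" for x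
  proof -
    have "complex_of_real (cmod (1 - z) powr h) * (1 - cnj z) * (1 - z) = of_real (cmod (1 - z) powr (h + 2))" for z
    proof -
      have "(1 - cnj z) * (1 - z) = of_real ((cmod (1 - z))\<^sup>2)"
        by (simp only: complex_norm_square) simp
      then show ?thesis by (cases "z = 1") (auto simp: powr_add mult.assoc)
    qed
    then have "(\<Prod>i<N. complex_of_real (cmod (1 - x i) powr h) * (1 - cnj (x i)) * (1 - x i)) = (\<Prod>i<N. of_real (cmod (1 - x i) powr (h + 2)))"
      by simp
    moreover have "c.W N x * (\<Prod>i<N. 1 - x i) = (\<Prod>i<N. complex_of_real (cmod (1 - x i) powr h) * (1 - cnj (x i)) * (1 - x i)) * of_real (cbe_weight N (2 * b) x)"
      unfolding c.W_def prod.distrib by (simp only: mult_ac)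
    ultimately show ?thesis by (simp only: of_real_mult of_real_prod)
  qed
  have "of_real (Mi N b (h + 2)) = complex_of_real (r2 * (r1 * Mi N b h))"
    using 3 unfolding 4 integral_complex_of_real Mi_def .
  then have "Mi N b (h + 2) = r1 * r2 * Mi N b h" by (simp only: of_real_eq_iff mult_ac)
  also have "r1 * r2 = (\<Prod>j<N. (1 + h + real j * b) * (2 + h + real j * b) / (1 + h / 2 + real j * b)\<^sup>2)"
    unfolding r1_def r2_def by (simp add: prod.distrib[symmetric] power2_eq_square)
  finally show ?thesis .
qed


section \<open>The logarithmic moment generating function\<close>

lemma sums_le_telescope:
  fixes f a :: "nat \<Rightarrow> real"
  assumes "f sums s" "\<And>k. f k \<le> a k - a (Suc k)" "a \<longlonglongrightarrow> 0"
  shows "s \<le> a 0"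
  using sums_le[OF assms(2) assms(1) telescope_sums'[OF assms(3)]] by simp

lemma sums_ge_telescope:
  fixes f a :: "nat \<Rightarrow> real"
  assumes "f sums s" "\<And>k. a k - a (Suc k) \<le> f k" "a \<longlonglongrightarrow> 0"
  shows "a 0 \<le> s"
  using sums_le[OF assms(2) telescope_sums'[OF assms(3)] assms(1)] by simp

lemma Polygamma_1_sums:
  "u > (0::real) \<Longrightarrow> (\<lambda>k. 1 / (u + real k)\<^sup>2) sums Polygamma 1 u"
  using Polygamma_LIMSEQ[of u 1] by (simp add: power2_eq_square inverse_eq_divide numeral_2_eq_2)

lemma Polygamma_1_nonneg: "u > (0::real) \<Longrightarrow> 0 \<le> Polygamma 1 u"
  using sums_le[OF _ sums_zero Polygamma_1_sums[of u]] by simp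

text \<open>\<open>1 / (x + 1)\<^sup>2\<close> is at most \<open>1 / x - 1 / (x + 1)\<close>, which
  telescopes; the extra \<open>1 / u\<^sup>2\<close> pays for the first term of the series.\<close>

lemma Polygamma_1_le:
  assumes u: "u > (0::real)"
  shows "Polygamma 1 u \<le> 1 / u + 1 / u\<^sup>2"
proof -
  have "Polygamma 1 u \<le> 1 / (u + real 0) + 1 / (u + real 0)\<^sup>2"
  proof (rule sums_le_telescope[OF Polygamma_1_sums[OF u], where a = "\<lambda>k. 1 / (u + real k) + 1 / (u + real k)\<^sup>2"])
    fix k :: nat
    define x where "x = u + real k"
    have x: "x > 0" using u by (simp add: x_def)
    have "1 / (x + 1)\<^sup>2 \<le> 1 / (x * (x + 1))"
      using x by (intro divide_left_mono) (auto simp: power2_eq_square)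
    also have "\<dots> = 1 / x - 1 / (x + 1)" using x by (simp add: field_simps)
    finally have "1 / x\<^sup>2 \<le> (1 / x + 1 / x\<^sup>2) - (1 / (x + 1) + 1 / (x + 1)\<^sup>2)" by simp
    then show "1 / (u + real k)\<^sup>2 \<le> 1 / (u + real k) + 1 / (u + real k)\<^sup>2 - (1 / (u + real (Suc k)) + 1 / (u + real (Suc k))\<^sup>2)"
      by (simp add: x_def add_ac)
  next
    show "(\<lambda>k. 1 / (u + real k) + 1 / (u + real k)\<^sup>2) \<longlonglongrightarrow> 0" by real_asymp
  qed
  then show ?thesis by simp
qed

text \<open>A quantitative decrease, from which the variance of the tilted law gets its lower bound
  in \<open>Lam2_ge\<close>. Termwise, \<open>1 / x\<^sup>2 - 1 / y\<^sup>2\<close> is at least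
  \<open>2 * (y - x) / y ^ 3\<close>, and \<open>2 / y ^ 3\<close> dominates the telescoping
  difference of \<open>1 / y\<^sup>2\<close>.\<close>

lemma Polygamma_1_diff_ge:
  assumes u: "0 < u" "u \<le> (v::real)"
  shows "(v - u) / v\<^sup>2 \<le> Polygamma 1 u - Polygamma 1 v"
proof -
  have v: "0 < v" using u by simp
  have "(v - u) * (1 / (v + real 0)\<^sup>2) \<le> Polygamma 1 u - Polygamma 1 v"
  proof (rule sums_ge_telescope[OF sums_diff[OF Polygamma_1_sums[OF u(1)] Polygamma_1_sums[OF v]],
        where a = "\<lambda>k. (v - u) * (1 / (v + real k)\<^sup>2)"])
    fix k :: nat
    define x y where "x = u + real k" "y = v + real k"
    have x: "0 < x" "x \<le> y" "0 < y" using u by (simp_all add: x_y_def)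
    have "1 / y\<^sup>2 - 1 / (y + 1)\<^sup>2 \<le> 2 / y ^ 3"
    proof -
      have "1 / y\<^sup>2 - 1 / (y + 1)\<^sup>2 = (2 * y + 1) / (y\<^sup>2 * (y + 1)\<^sup>2)"
        using x by (simp add: divide_simps) (simp add: power2_eq_square algebra_simps)
      also have "\<dots> \<le> 2 / y ^ 3"
        using x by (simp add: divide_simps) (simp add: power2_eq_square power3_eq_cube algebra_simps)
      finally show ?thesis .
    qed
    then have "(y - x) * (1 / y\<^sup>2 - 1 / (y + 1)\<^sup>2) \<le> (y - x) * (2 / y ^ 3)"
      using x by (intro mult_left_mono) auto
    also have "\<dots> \<le> (y - x) * ((x + y) / (x\<^sup>2 * y\<^sup>2))"
    proof (rule mult_left_mono)
      have "2 * (x\<^sup>2 * y\<^sup>2) \<le> (x + y) * y ^ 3"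
      proof -
        have "x * x \<le> x * y" "x * y \<le> y * y" using x by (auto intro: mult_left_mono mult_right_mono)
        then have "2 * (x * x) \<le> (x + y) * y" by (simp add: algebra_simps)
        then have "2 * (x * x) * y\<^sup>2 \<le> (x + y) * y * y\<^sup>2" by (intro mult_right_mono) auto
        then show ?thesis by (simp add: power2_eq_square power3_eq_cube mult_ac)
      qed
      then show "2 / y ^ 3 \<le> (x + y) / (x\<^sup>2 * y\<^sup>2)" using x by (simp add: divide_simps)
    qed (use x in simp)
    also have "\<dots> = 1 / x\<^sup>2 - 1 / y\<^sup>2"
      using x by (simp add: divide_simps) (simp add: power2_eq_square algebra_simps)
    finally show "(v - u) * (1 / (v + real k)\<^sup>2) - (v - u) * (1 / (v + real (Suc k))\<^sup>2) \<le> 1 / (u + real k)\<^sup>2 - 1 / (v + real k)\<^sup>2"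
      by (simp add: x_y_def algebra_simps)
  next
    show "(\<lambda>k. (v - u) * (1 / (v + real k)\<^sup>2)) \<longlonglongrightarrow> 0" by real_asymp
  qed
  then show ?thesis by simp
qed

lemma Polygamma_1_antimono: "0 < u \<Longrightarrow> u \<le> (v::real) \<Longrightarrow> Polygamma 1 v \<le> Polygamma 1 u"
  using Polygamma_1_diff_ge[of u v] by (smt (verit) divide_nonneg_nonneg zero_le_power2)

text \<open>Since \<open>norm (z + k)\<close> is at least \<open>Re z + k\<close>, the series is
  dominated by its real counterpart, which is compared with a telescoping sum. The bound depends on
  \<open>Re z\<close> alone.\<close>

lemma norm_Polygamma_2_le:
  assumes "Re z > 0"
  shows "norm (Polygamma 2 z :: complex) \<le> 2 / Re z ^ 3 + 1 / (Re z)\<^sup>2"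
proof -
  define u where "u = Re z"
  have u: "u > 0" using assms by (simp add: u_def)
  have z0: "z \<noteq> 0" using assms by auto
  have s: "(\<lambda>k. inverse ((z + of_nat k) ^ 3)) sums (- Polygamma 2 z / 2)"
    using Polygamma_LIMSEQ[of z 2] z0 by (simp add: numeral_3_eq_3 eval_nat_numeral)
  have bd: "norm (inverse ((z + of_nat k) ^ 3)) \<le> 1 / (u + real k) ^ 3" for k
  proof -
    have "u + real k \<le> norm (z + of_nat k)"
      using complex_Re_le_cmod[of "z + of_nat k"] by (simp add: u_def)
    then have "1 / norm (z + of_nat k) ^ 3 \<le> 1 / (u + real k) ^ 3"
      using u by (intro divide_left_mono power_mono mult_pos_pos zero_less_power) auto
    then show ?thesis by (simp add: norm_inverse norm_power inverse_eq_divide norm_divide)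
  qed
  have tel: "(\<lambda>k. (1 / (u + real k)\<^sup>2 + 2 / (u + real k) ^ 3) - (1 / (u + real (Suc k))\<^sup>2 + 2 / (u + real (Suc k)) ^ 3)) sums
      ((1 / (u + real 0)\<^sup>2 + 2 / (u + real 0) ^ 3) - 0)"
    by (rule telescope_sums') real_asymp
  have le: "2 / (u + real k) ^ 3 \<le> (1 / (u + real k)\<^sup>2 + 2 / (u + real k) ^ 3) - (1 / (u + real (Suc k))\<^sup>2 + 2 / (u + real (Suc k)) ^ 3)" for k
  proof -
    define x where "x = u + real k"
    have x: "x > 0" using u by (simp add: x_def)
    have "2 / (x + 1) ^ 3 \<le> (2 * x + 1) / (x\<^sup>2 * (x + 1)\<^sup>2)"
      using x by (simp add: divide_simps) (simp add: power2_eq_square power3_eq_cube algebra_simps)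
    also have "\<dots> = 1 / x\<^sup>2 - 1 / (x + 1)\<^sup>2"
      using x by (simp add: divide_simps) (simp add: power2_eq_square algebra_simps)
    finally show ?thesis by (simp add: x_def add_ac)
  qed
  have sm: "summable (\<lambda>k. 2 / (u + real k) ^ 3)"
    by (rule summable_comparison_test'[OF sums_summable[OF tel], of 0]) (use le u in auto)
  have "norm (- Polygamma 2 z / 2) \<le> (\<Sum>k. 1 / (u + real k) ^ 3)"
  proof -
    have sm1: "summable (\<lambda>k. 1 / (u + real k) ^ 3)" using summable_mult[OF sm, of "1/2"] by simp
    show ?thesis using s sm1 bd by (metis (no_types, lifting) norm_suminf_le sums_unique)
  qed
  moreover have "2 * (\<Sum>k. 1 / (u + real k) ^ 3) = (\<Sum>k. 2 / (u + real k) ^ 3)"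
    using summable_mult[OF sm, of "1/2"] by (subst suminf_mult[symmetric]) auto
  moreover have "(\<Sum>k. 2 / (u + real k) ^ 3) \<le> (1 / (u + real 0)\<^sup>2 + 2 / (u + real 0) ^ 3) - 0"
    using suminf_le[OF le sm sums_summable[OF tel]] sums_unique[OF tel] by simp
  ultimately show ?thesis by (simp add: u_def norm_divide)
qed

lemma ln_Gamma_real_plus1: "u > (0::real) \<Longrightarrow> ln_Gamma (u + 1) = ln u + ln_Gamma u"
proof -
  assume u: "u > 0"
  then have "u \<notin> \<int>\<^sub>\<le>\<^sub>0" by (auto dest: nonpos_Ints_nonpos)
  then have "Gamma (u + 1) = u * Gamma u" by (rule Gamma_plus1)
  then show ?thesis using u by (simp add: ln_Gamma_real_pos ln_mult_pos)
qed

text \<open>By the mean value theorem \<open>ln u\<close> is a value of \<open>Digamma\<close>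
  between \<open>u\<close> and \<open>u + 1\<close>; monotonicity and the recurrence give the two
  sides.\<close>

lemma Digamma_real_bounds:
  assumes u: "u > (0::real)"
  shows "Digamma u \<le> ln u" "ln u - 1 / u \<le> Digamma u"
proof -
  obtain \<xi> where \<xi>: "u < \<xi>" "\<xi> < u + 1" "ln_Gamma (u + 1) - ln_Gamma u = (u + 1 - u) * Digamma \<xi>"
    using MVT2[of u "u + 1" ln_Gamma Digamma] u by (force intro!: has_field_derivative_ln_Gamma_real)
  then have e: "ln u = Digamma \<xi>" using ln_Gamma_real_plus1[OF u] by simp
  show "Digamma u \<le> ln u" unfolding e using \<xi> u by (intro Digamma_real_mono) auto
  have "Digamma \<xi> \<le> Digamma (u + 1)" using \<xi> u by (intro Digamma_real_mono) auto
  also have "\<dots> = Digamma u + 1 / u" using u by (simp add: Digamma_plus1)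
  finally show "ln u - 1 / u \<le> Digamma u" by (simp add: e)
qed

lemma ln_Gamma_real_duplication:
  assumes x: "x > (0::real)"
  shows "ln_Gamma x + ln_Gamma (x + 1 / 2) = (1 - 2 * x) * ln 2 + ln (sqrt pi) + ln_Gamma (2 * x)"
proof -
  have ni: "complex_of_real y \<notin> \<int>\<^sub>\<le>\<^sub>0" if "y > 0" for y
    using that by (auto elim!: nonpos_Ints_cases simp: complex_eq_iff)
  have "Gamma (complex_of_real x) * Gamma (complex_of_real (x + 1/2)) =
      exp ((1 - 2 * complex_of_real x) * of_real (ln 2)) * of_real (sqrt pi) * Gamma (2 * complex_of_real x)"
    using Gamma_legendre_duplication[of "complex_of_real x"] ni[of x] ni[of "x + 1/2"] x by simp
  then have "complex_of_real (Gamma x * Gamma (x + 1/2)) = complex_of_real (exp ((1 - 2 * x) * ln 2) * sqrt pi * Gamma (2 * x))"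
    using Gamma_complex_of_real[of x] Gamma_complex_of_real[of "x + 1/2"] Gamma_complex_of_real[of "2 * x"]
    by (simp only: of_real_mult of_real_diff of_real_1 of_real_numeral exp_of_real[symmetric])
  then have "Gamma x * Gamma (x + 1/2) = exp ((1 - 2 * x) * ln 2) * sqrt pi * Gamma (2 * x)"
    by (simp only: of_real_eq_iff)
  then have "ln (Gamma x * Gamma (x + 1/2)) = ln (exp ((1 - 2 * x) * ln 2) * sqrt pi * Gamma (2 * x))" by simp
  then show ?thesis
    using x by (simp add: ln_mult_pos ln_Gamma_real_pos)
qed

lemma Digamma_real_duplication:
  assumes x: "x > (0::real)"
  shows "Digamma x + Digamma (x + 1 / 2) = 2 * Digamma (2 * x) - 2 * ln 2"
proof -
  have d1: "((\<lambda>x. ln_Gamma x + ln_Gamma (x + 1 / 2)) has_real_derivative Digamma x + Digamma (x + 1 / 2)) (at x)"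
    using x by (auto intro!: derivative_eq_intros)
  have "((\<lambda>x. (1 - 2 * x) * ln 2 + ln (sqrt pi) + ln_Gamma (2 * x)) has_real_derivative 2 * Digamma (2 * x) - 2 * ln 2) (at x)"
    using x by (auto intro!: derivative_eq_intros)
  then have "((\<lambda>x. ln_Gamma x + ln_Gamma (x + 1 / 2)) has_real_derivative 2 * Digamma (2 * x) - 2 * ln 2) (at x)"
  proof (rule DERIV_cong_ev[THEN iffD1, rotated -1])
    show "\<forall>\<^sub>F y in nhds x. (1 - 2 * y) * ln 2 + ln (sqrt pi) + ln_Gamma (2 * y) = ln_Gamma y + ln_Gamma (y + 1 / 2)"
      using eventually_nhds_in_open[OF open_greaterThan, of x 0] x
      by (auto elim!: eventually_mono simp: ln_Gamma_real_duplication)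
  qed auto
  from DERIV_unique[OF d1 this] show ?thesis .
qed

text \<open>
  In \<open>Lam\<close> the term \<open>ln_Gamma (1 + j b + h)\<close> of the usual formula (\<open>Lam_standard\<close>) is split by the
  duplication formula, so that every argument contains \<open>h / 2\<close>.
\<close>

definition ee :: "real \<Rightarrow> nat \<Rightarrow> real" where "ee b j = (1 + real j * b) / 2"

definition Lam :: "nat \<Rightarrow> real \<Rightarrow> real \<Rightarrow> real" where
  "Lam N b h = (\<Sum>j<N. h * ln 2 + (ln_Gamma (ee b j + h / 2) + ln_Gamma (ee b j + 1 / 2 + h / 2) - 2 * ln_Gamma (2 * ee b j + h / 2))
     - (ln_Gamma (ee b j) + ln_Gamma (ee b j + 1 / 2) - 2 * ln_Gamma (2 * ee b j)))"

definition Lam1 :: "nat \<Rightarrow> real \<Rightarrow> real \<Rightarrow> real" where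
  "Lam1 N b h = (\<Sum>j<N. ln 2 + (Digamma (ee b j + h / 2) + Digamma (ee b j + 1 / 2 + h / 2)) / 2 - Digamma (2 * ee b j + h / 2))"

definition Lam2 :: "nat \<Rightarrow> real \<Rightarrow> real \<Rightarrow> real" where
  "Lam2 N b h = (\<Sum>j<N. (Polygamma 1 (ee b j + h / 2) + Polygamma 1 (ee b j + 1 / 2 + h / 2) - 2 * Polygamma 1 (2 * ee b j + h / 2)) / 4)"

lemma ee_ge: "b > 0 \<Longrightarrow> 1 / 2 \<le> ee b j" by (simp add: ee_def)

lemma ee_pos: assumes "b > 0" "h > -1" shows "0 < ee b j + h / 2" "0 < ee b j + 1 / 2 + h / 2" "0 < 2 * ee b j + h / 2"
  using ee_ge[OF assms(1), of j] assms(2) by (simp_all add: field_simps)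

lemma Lam_0: "Lam N b 0 = 0" by (simp add: Lam_def)

text \<open>The duplication formula, differentiated. Once \<open>Lam1\<close> is identified with the
  tilted mean in \<open>m1_eq\<close>, this says that \<open>X\<close> is centred.\<close>

lemma Lam1_0: assumes "b > 0" shows "Lam1 N b 0 = 0"
proof -
  have "ln 2 + (Digamma (ee b j) + Digamma (ee b j + 1 / 2)) / 2 - Digamma (2 * ee b j) = 0" for j
    using Digamma_real_duplication[of "ee b j"] ee_ge[OF assms, of j] by (simp add: diff_divide_distrib)
  then show ?thesis by (simp add: Lam1_def)
qed

lemma Lam_has_derivative:
  assumes "b > 0" "h > -1"
  shows "(Lam N b has_real_derivative Lam1 N b h) (at h)"
  unfolding Lam_def[abs_def] Lam1_def using ee_pos[OF assms]
  by (intro DERIV_sum) (auto intro!: derivative_eq_intros simp: field_simps)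

lemma Lam1_has_derivative:
  assumes "b > 0" "h > -1"
  shows "(Lam1 N b has_real_derivative Lam2 N b h) (at h)"
  unfolding Lam1_def[abs_def] Lam2_def
proof (rule DERIV_sum)
  fix j
  note p = ee_pos[OF assms, of j]
  have d: "((\<lambda>h. Digamma (c + h / 2)) has_real_derivative Polygamma 1 (c + h / 2) / 2) (at h)" if "c + h / 2 > 0" for c
  proof -
    have "c + h / 2 \<notin> \<int>\<^sub>\<le>\<^sub>0" using that by (auto dest: nonpos_Ints_nonpos)
    then show ?thesis by (auto intro!: derivative_eq_intros)
  qed
  show "((\<lambda>h. ln 2 + (Digamma (ee b j + h / 2) + Digamma (ee b j + 1 / 2 + h / 2)) / 2 - Digamma (2 * ee b j + h / 2)) has_real_derivative
     (Polygamma 1 (ee b j + h / 2) + Polygamma 1 (ee b j + 1 / 2 + h / 2) - 2 * Polygamma 1 (2 * ee b j + h / 2)) / 4) (at h)"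
    by (rule DERIV_cong[OF DERIV_diff[OF DERIV_add[OF DERIV_const DERIV_cdivide[OF DERIV_add[OF d[OF p(1)] d[OF p(2)]]]] d[OF p(3)]]])
      (simp add: field_simps)
qed

lemma Lam2_nonneg:
  assumes "b > 0" "h > -1"
  shows "0 \<le> Lam2 N b h"
  unfolding Lam2_def
proof (rule sum_nonneg)
  fix j
  note p = ee_pos[OF assms, of j]
  have "Polygamma 1 (2 * ee b j + h / 2) \<le> Polygamma 1 (ee b j + h / 2)"
    "Polygamma 1 (2 * ee b j + h / 2) \<le> Polygamma 1 (ee b j + 1 / 2 + h / 2)"
    using p ee_ge[OF assms(1), of j] by (intro Polygamma_1_antimono; simp)+
  then show "0 \<le> (Polygamma 1 (ee b j + h / 2) + Polygamma 1 (ee b j + 1 / 2 + h / 2) - 2 * Polygamma 1 (2 * ee b j + h / 2)) / 4"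
    by simp
qed

lemma Lam1_mono:
  assumes "b > 0" "h > -1" "h \<le> h'"
  shows "Lam1 N b h \<le> Lam1 N b h'"
proof (rule DERIV_nonneg_imp_nondecreasing[OF assms(3)])
  fix x assume "h \<le> x"
  then show "\<exists>y. (Lam1 N b has_real_derivative y) (at x) \<and> 0 \<le> y"
    using Lam1_has_derivative[of b x N] Lam2_nonneg[of b x N] assms by (intro exI[of _ "Lam2 N b x"]) auto
qed

lemma Lam_convex:
  assumes "b > 0"
  shows "convex_on {-1<..} (Lam N b)"
proof (rule f''_ge0_imp_convex)
  fix x :: real assume x: "x \<in> {-1<..}"
  show "(Lam N b has_real_derivative Lam1 N b x) (at x)" using x assms by (intro Lam_has_derivative) auto
  show "(Lam1 N b has_real_derivative Lam2 N b x) (at x)" using x assms by (intro Lam1_has_derivative) auto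
  show "0 \<le> Lam2 N b x" using x assms by (intro Lam2_nonneg) auto
qed auto

text \<open>In the summand \<open>j\<close> the third Polygamma argument exceeds the first by
  \<open>ee b j\<close>, which is at least \<open>j * b / 2\<close>, so
  \<open>Polygamma_1_diff_ge\<close> yields a multiple of \<open>j * b\<close> over the square of
  the largest argument. Summing over \<open>j\<close> produces \<open>N * (N - 1)\<close>.\<close>

lemma Lam2_ge:
  assumes b: "b > 0" and h: "h > -1"
  shows "b / 16 * (real N * (real N - 1)) / (1 + real N * b + h / 2)\<^sup>2 \<le> Lam2 N b h"
proof -
  have "real j * b / 8 / (1 + real N * b + h / 2)\<^sup>2 \<le>
     (Polygamma 1 (ee b j + h / 2) + Polygamma 1 (ee b j + 1 / 2 + h / 2) - 2 * Polygamma 1 (2 * ee b j + h / 2)) / 4" if j: "j < N" for j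
  proof -
    note p = ee_pos[OF assms, of j]
    have e2: "2 * ee b j = 1 + real j * b" by (simp add: ee_def)
    have "real j * b \<le> real N * b" using j b by (intro mult_right_mono) auto
    then have le: "2 * ee b j + h / 2 \<le> 1 + real N * b + h / 2" unfolding e2 by simp
    have "real j * b / 2 / (1 + real N * b + h / 2)\<^sup>2 \<le> ee b j / (2 * ee b j + h / 2)\<^sup>2"
      using p le b ee_ge[OF b, of j] by (intro frac_le power_mono) (auto simp: ee_def)
    also have "\<dots> \<le> Polygamma 1 (ee b j + h / 2) - Polygamma 1 (2 * ee b j + h / 2)"
      using Polygamma_1_diff_ge[OF p(1), of "2 * ee b j + h / 2"] ee_ge[OF b, of j] by simp
    finally have 1: "real j * b / 2 / (1 + real N * b + h / 2)\<^sup>2 \<le> Polygamma 1 (ee b j + h / 2) - Polygamma 1 (2 * ee b j + h / 2)" .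
    have "Polygamma 1 (2 * ee b j + h / 2) \<le> Polygamma 1 (ee b j + 1 / 2 + h / 2)"
      using p ee_ge[OF b, of j] by (intro Polygamma_1_antimono) auto
    with 1 have "real j * b / 2 / (1 + real N * b + h / 2)\<^sup>2 \<le> Polygamma 1 (ee b j + h / 2) + Polygamma 1 (ee b j + 1 / 2 + h / 2) - 2 * Polygamma 1 (2 * ee b j + h / 2)"
      by simp
    then show ?thesis by (simp add: field_simps)
  qed
  then have "(\<Sum>j<N. real j * b / 8 / (1 + real N * b + h / 2)\<^sup>2) \<le> Lam2 N b h"
    unfolding Lam2_def by (intro sum_mono) auto
  moreover have "(\<Sum>j<N. real j * b / 8 / (1 + real N * b + h / 2)\<^sup>2) = b / 16 * (real N * (real N - 1)) / (1 + real N * b + h / 2)\<^sup>2"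
  proof -
    have S: "(\<Sum>j<N. real j) = real N * (real N - 1) / 2" by (induction N) (auto simp: field_simps)
    show ?thesis
      by (simp only: sum_divide_distrib[symmetric] sum_distrib_right[symmetric] S) (simp add: field_simps)
  qed
  ultimately show ?thesis by simp
qed

text \<open>The negative term is dropped, and the other two are largest when \<open>ee b j\<close>
  is removed from their arguments.\<close>

lemma Lam2_le:
  assumes b: "b > 0" and h: "h > 0"
  shows "Lam2 N b h \<le> real N / 2 * (2 / h + 4 / h\<^sup>2)"
proof -
  have "(Polygamma 1 (ee b j + h / 2) + Polygamma 1 (ee b j + 1 / 2 + h / 2) - 2 * Polygamma 1 (2 * ee b j + h / 2)) / 4 \<le> 1 / 2 * (2 / h + 4 / h\<^sup>2)" for j
  proof -
    have p: "0 < ee b j + h / 2" "0 < ee b j + 1 / 2 + h / 2" "0 < 2 * ee b j + h / 2" using ee_pos[of b h j] b h by auto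
    have "Polygamma 1 (ee b j + h / 2) \<le> Polygamma 1 (h / 2)" "Polygamma 1 (ee b j + 1 / 2 + h / 2) \<le> Polygamma 1 (h / 2)"
      using h ee_ge[OF b, of j] by (intro Polygamma_1_antimono; simp)+
    moreover have "Polygamma 1 (h / 2) \<le> 2 / h + 4 / h\<^sup>2"
      using Polygamma_1_le[of "h / 2"] h by (simp add: power_divide)
    moreover note Polygamma_1_nonneg[OF p(3)]
    ultimately show ?thesis by simp
  qed
  then have "Lam2 N b h \<le> (\<Sum>j<N. 1 / 2 * (2 / h + 4 / h\<^sup>2))"
    unfolding Lam2_def by (intro sum_mono) auto
  then show ?thesis by simp
qed

text \<open>Every Gamma argument contains \<open>h / 2\<close> and therefore moves by one, so the
  functional equation applies. The result is the logarithm of the ratio in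
  \<open>Mi_plus_2\<close>.\<close>

lemma Lam_plus_2:
  assumes b: "b > 0" and h: "h > -1"
  shows "Lam N b (h + 2) = Lam N b h + (\<Sum>j<N. ln ((1 + h + real j * b) * (2 + h + real j * b) / (1 + h / 2 + real j * b)\<^sup>2))"
  unfolding Lam_def sum.distrib[symmetric]
proof (rule sum.cong)
  fix j
  note p = ee_pos[OF assms, of j]
  have s: "c + (h + 2) / 2 = (c + h / 2) + 1" for c by (simp add: field_simps)
  have q: "(1 + h + real j * b) = 2 * (ee b j + h / 2)" "2 + h + real j * b = 2 * (ee b j + 1 / 2 + h / 2)"
    "1 + h / 2 + real j * b = 2 * ee b j + h / 2" by (simp_all add: ee_def field_simps)
  show "(h + 2) * ln 2 + (ln_Gamma (ee b j + (h + 2) / 2) + ln_Gamma (ee b j + 1 / 2 + (h + 2) / 2) - 2 * ln_Gamma (2 * ee b j + (h + 2) / 2)) -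
         (ln_Gamma (ee b j) + ln_Gamma (ee b j + 1 / 2) - 2 * ln_Gamma (2 * ee b j)) =
         h * ln 2 + (ln_Gamma (ee b j + h / 2) + ln_Gamma (ee b j + 1 / 2 + h / 2) - 2 * ln_Gamma (2 * ee b j + h / 2)) -
         (ln_Gamma (ee b j) + ln_Gamma (ee b j + 1 / 2) - 2 * ln_Gamma (2 * ee b j)) +
         ln ((1 + h + real j * b) * (2 + h + real j * b) / (1 + h / 2 + real j * b)\<^sup>2)"
  proof -
    have l: "ln (2 * A * (2 * B) / C\<^sup>2) = (ln 2 + ln A) + (ln 2 + ln B) - 2 * ln C" if "0 < A" "0 < B" "0 < C" for A B C :: real
    proof -
      have "ln (2 * A * (2 * B) / C\<^sup>2) = ln (2 * A * (2 * B)) - ln (C\<^sup>2)" using that by (intro ln_divide_pos) auto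
      also have "ln (2 * A * (2 * B)) = ln (2 * A) + ln (2 * B)" using that by (intro ln_mult_pos) auto
      finally show ?thesis using that by (simp add: ln_mult_pos ln_realpow)
    qed
    show ?thesis
      unfolding s q l[OF p] ln_Gamma_real_plus1[OF p(1)] ln_Gamma_real_plus1[OF p(2)] ln_Gamma_real_plus1[OF p(3)]
      by (simp add: algebra_simps)
  qed
qed simp

text \<open>This form is used where the arguments should advance in unit steps
  (\<open>b = 1\<close>), and near \<open>h = -1\<close>, where the pole of a single Gamma factor
  becomes visible.\<close>

lemma Lam_standard:
  assumes b: "b > 0" and h: "h > -1"
  shows "Lam N b h = (\<Sum>j<N. ln_Gamma (1 + real j * b) + ln_Gamma (1 + real j * b + h) - 2 * ln_Gamma (1 + real j * b + h / 2))"
  unfolding Lam_def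
proof (rule sum.cong)
  fix j
  note p = ee_pos[OF assms, of j] and p0 = ee_ge[OF b, of j]
  have q: "ln_Gamma (ee b j + h / 2) + ln_Gamma (ee b j + 1 / 2 + h / 2) = (1 - (1 + real j * b + h)) * ln 2 + ln (sqrt pi) + ln_Gamma (1 + real j * b + h)"
    using ln_Gamma_real_duplication[OF p(1)] by (simp add: ee_def algebra_simps add_divide_distrib)
  have q0: "ln_Gamma (ee b j) + ln_Gamma (ee b j + 1 / 2) = (1 - (1 + real j * b)) * ln 2 + ln (sqrt pi) + ln_Gamma (1 + real j * b)"
    using ln_Gamma_real_duplication[of "ee b j"] p0 by (simp add: ee_def algebra_simps add_divide_distrib)
  have e2: "2 * ee b j = 1 + real j * b" by (simp add: ee_def)
  show "h * ln 2 + (ln_Gamma (ee b j + h / 2) + ln_Gamma (ee b j + 1 / 2 + h / 2) - 2 * ln_Gamma (2 * ee b j + h / 2)) -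
         (ln_Gamma (ee b j) + ln_Gamma (ee b j + 1 / 2) - 2 * ln_Gamma (2 * ee b j)) =
     ln_Gamma (1 + real j * b) + ln_Gamma (1 + real j * b + h) - 2 * ln_Gamma (1 + real j * b + h / 2)"
    unfolding q q0 e2 by (simp add: algebra_simps)
qed simp

text \<open>\<open>Lam1\<close> tends to \<open>N * ln 2\<close>, the maximum of \<open>X\<close>,
  so every level below it is exceeded. The Digamma bounds replace \<open>Lam1\<close> by an
  elementary minorant \<open>f\<close>.\<close>

lemma Lam1_tendsto:
  assumes b: "b > 0" and a: "a < real N * ln 2"
  obtains h where "h > 0" "a < Lam1 N b h"
proof -
  define f where "f h = (\<Sum>j<N. ln 2 + ((ln (ee b j + h / 2) - 1 / (ee b j + h / 2)) + (ln (ee b j + 1 / 2 + h / 2) - 1 / (ee b j + 1 / 2 + h / 2))) / 2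
     - ln (2 * ee b j + h / 2))" for h
  have "(f \<longlongrightarrow> (\<Sum>j<N. ln 2)) at_top"
    unfolding f_def
  proof (rule tendsto_sum)
    fix j
    show "((\<lambda>h. ln 2 + ((ln (ee b j + h / 2) - 1 / (ee b j + h / 2)) + (ln (ee b j + 1 / 2 + h / 2) - 1 / (ee b j + 1 / 2 + h / 2))) / 2
     - ln (2 * ee b j + h / 2)) \<longlongrightarrow> ln 2) at_top" by real_asymp
  qed
  then have "\<forall>\<^sub>F h in at_top. a < f h" using a by (intro order_tendstoD) auto
  moreover have "\<forall>\<^sub>F h in at_top. (h::real) > 0" by (rule eventually_gt_at_top)
  ultimately have "\<forall>\<^sub>F h in at_top. h > 0 \<and> a < f h" by eventually_elim auto
  then obtain h where h: "h > 0" "a < f h" using eventually_happens'[OF trivial_limit_at_top_linorder] by blast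
  have "f h \<le> Lam1 N b h"
    unfolding f_def Lam1_def
  proof (rule sum_mono)
    fix j
    have p: "0 < ee b j + h / 2" "0 < ee b j + 1 / 2 + h / 2" "0 < 2 * ee b j + h / 2" using ee_pos[of b h j] b h by auto
    show "ln 2 + ((ln (ee b j + h / 2) - 1 / (ee b j + h / 2)) + (ln (ee b j + 1 / 2 + h / 2) - 1 / (ee b j + 1 / 2 + h / 2))) / 2
     - ln (2 * ee b j + h / 2) \<le> ln 2 + (Digamma (ee b j + h / 2) + Digamma (ee b j + 1 / 2 + h / 2)) / 2 - Digamma (2 * ee b j + h / 2)"
      using Digamma_real_bounds(2)[OF p(1)] Digamma_real_bounds(2)[OF p(2)] Digamma_real_bounds(1)[OF p(3)]
      by (intro diff_mono add_mono divide_right_mono order_refl) auto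
  qed
  with h show thesis by (intro that[of h]) auto
qed

section \<open>Continuation to complex arguments and bounds on vertical lines\<close>

definition LamC :: "nat \<Rightarrow> real \<Rightarrow> complex \<Rightarrow> complex" where
  "LamC N b z = (\<Sum>j<N. z * of_real (ln 2) + (ln_Gamma (of_real (ee b j) + z / 2) + ln_Gamma (of_real (ee b j + 1 / 2) + z / 2) - 2 * ln_Gamma (of_real (2 * ee b j) + z / 2))
     - of_real (ln_Gamma (ee b j) + ln_Gamma (ee b j + 1 / 2) - 2 * ln_Gamma (2 * ee b j)))"

definition LamC1 :: "nat \<Rightarrow> real \<Rightarrow> complex \<Rightarrow> complex" where
  "LamC1 N b z = (\<Sum>j<N. of_real (ln 2) + (Digamma (of_real (ee b j) + z / 2) + Digamma (of_real (ee b j + 1 / 2) + z / 2)) / 2 - Digamma (of_real (2 * ee b j) + z / 2))"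

definition LamC2 :: "nat \<Rightarrow> real \<Rightarrow> complex \<Rightarrow> complex" where
  "LamC2 N b z = (\<Sum>j<N. (Polygamma 1 (of_real (ee b j) + z / 2) + Polygamma 1 (of_real (ee b j + 1 / 2) + z / 2) - 2 * Polygamma 1 (of_real (2 * ee b j) + z / 2)) / 4)"

definition LamC3 :: "nat \<Rightarrow> real \<Rightarrow> complex \<Rightarrow> complex" where
  "LamC3 N b z = (\<Sum>j<N. (Polygamma 2 (of_real (ee b j) + z / 2) + Polygamma 2 (of_real (ee b j + 1 / 2) + z / 2) - 2 * Polygamma 2 (of_real (2 * ee b j) + z / 2)) / 8)"

lemma LamC_of_real:
  assumes "b > 0" "h > -1"
  shows "LamC N b (of_real h) = of_real (Lam N b h)"
proof -
  have e: "complex_of_real c + of_real h / 2 = of_real (c + h / 2)" for c by simp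
  show ?thesis
    unfolding LamC_def Lam_def e of_real_sum
  proof (intro sum.cong refl)
    fix j
    note p = ee_pos[OF assms, of j]
    show "complex_of_real h * complex_of_real (ln 2) +
         (ln_Gamma (complex_of_real (ee b j + h / 2)) + ln_Gamma (complex_of_real (ee b j + 1 / 2 + h / 2)) - 2 * ln_Gamma (complex_of_real (2 * ee b j + h / 2))) -
         complex_of_real (ln_Gamma (ee b j) + ln_Gamma (ee b j + 1 / 2) - 2 * ln_Gamma (2 * ee b j)) =
      complex_of_real (h * ln 2 + (ln_Gamma (ee b j + h / 2) + ln_Gamma (ee b j + 1 / 2 + h / 2) - 2 * ln_Gamma (2 * ee b j + h / 2)) -
         (ln_Gamma (ee b j) + ln_Gamma (ee b j + 1 / 2) - 2 * ln_Gamma (2 * ee b j)))"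
      unfolding ln_Gamma_complex_of_real[OF p(1)] ln_Gamma_complex_of_real[OF p(2)] ln_Gamma_complex_of_real[OF p(3)]
      by (simp only: of_real_add of_real_diff of_real_mult of_real_numeral)
  qed
qed

lemma LamC1_of_real:
  assumes "b > 0" "h > -1"
  shows "LamC1 N b (of_real h) = of_real (Lam1 N b h)"
proof -
  have e: "complex_of_real c + of_real h / 2 = of_real (c + h / 2)" for c by simp
  have D: "Digamma (complex_of_real x) = of_real (Digamma x)" if "x > 0" for x
    using that by (intro Polygamma_of_real) auto
  have "complex_of_real (ln 2) + (Digamma (complex_of_real (ee b j + h / 2)) + Digamma (complex_of_real (ee b j + 1 / 2 + h / 2))) / 2 - Digamma (complex_of_real (2 * ee b j + h / 2))
     = of_real (ln 2 + (Digamma (ee b j + h / 2) + Digamma (ee b j + 1 / 2 + h / 2)) / 2 - Digamma (2 * ee b j + h / 2))" for j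
    unfolding D[OF ee_pos(1)[OF assms, of j]] D[OF ee_pos(2)[OF assms, of j]] D[OF ee_pos(3)[OF assms, of j]]
    by (simp only: of_real_add of_real_diff of_real_mult of_real_divide of_real_numeral)
  then show ?thesis
    unfolding LamC1_def Lam1_def e of_real_sum by (intro sum.cong refl) blast
qed

lemma LamC2_of_real:
  assumes "b > 0" "h > -1"
  shows "LamC2 N b (of_real h) = of_real (Lam2 N b h)"
proof -
  have e: "complex_of_real c + of_real h / 2 = of_real (c + h / 2)" for c by simp
  have D: "Polygamma 1 (complex_of_real x) = of_real (Polygamma 1 x)" if "x > 0" for x
    using that by (intro Polygamma_of_real) auto
  have "(Polygamma 1 (complex_of_real (ee b j + h / 2)) + Polygamma 1 (complex_of_real (ee b j + 1 / 2 + h / 2)) - 2 * Polygamma 1 (complex_of_real (2 * ee b j + h / 2))) / 4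
     = of_real ((Polygamma 1 (ee b j + h / 2) + Polygamma 1 (ee b j + 1 / 2 + h / 2) - 2 * Polygamma 1 (2 * ee b j + h / 2)) / 4)" for j
    unfolding D[OF ee_pos(1)[OF assms, of j]] D[OF ee_pos(2)[OF assms, of j]] D[OF ee_pos(3)[OF assms, of j]]
    by (simp only: of_real_add of_real_diff of_real_mult of_real_divide of_real_numeral)
  then show ?thesis
    unfolding LamC2_def Lam2_def e of_real_sum by (intro sum.cong refl) blast
qed

lemma ee_complex:
  assumes "b > 0" "Re z > -1"
  shows "Re (of_real (ee b j) + z / 2) > 0" "Re (of_real (ee b j + 1 / 2) + z / 2) > 0" "Re (of_real (2 * ee b j) + z / 2) > 0"
  using ee_pos[OF assms, of j] by simp_all

lemma Re_pos_not_nonpos: "Re z > 0 \<Longrightarrow> z \<notin> \<int>\<^sub>\<le>\<^sub>0" "Re z > 0 \<Longrightarrow> z \<notin> \<real>\<^sub>\<le>\<^sub>0"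
  by (auto elim!: nonpos_Ints_cases simp: complex_nonpos_Reals_iff)

lemma ln_Gamma_shift_derivative:
  assumes "Re (c + z / 2) > 0"
  shows "((\<lambda>z. ln_Gamma (c + z / 2)) has_field_derivative Digamma (c + z / 2) / 2) (at z)"
  using Re_pos_not_nonpos[OF assms] by (auto intro!: derivative_eq_intros)

lemma Polygamma_shift_derivative:
  assumes "Re (c + z / 2) > 0"
  shows "((\<lambda>z. Polygamma n (c + z / 2)) has_field_derivative Polygamma (Suc n) (c + z / 2) / 2) (at z)"
  using Re_pos_not_nonpos[OF assms] by (auto intro!: derivative_eq_intros)

lemma LamC_has_derivative:
  assumes "b > 0" "Re z > -1"
  shows "(LamC N b has_field_derivative LamC1 N b z) (at z)"
  unfolding LamC_def[abs_def] LamC1_def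
proof (rule DERIV_sum)
  fix j
  note p = ee_complex[OF assms, of j]
  show "((\<lambda>z. z * complex_of_real (ln 2) + (ln_Gamma (of_real (ee b j) + z / 2) + ln_Gamma (of_real (ee b j + 1 / 2) + z / 2) - 2 * ln_Gamma (of_real (2 * ee b j) + z / 2))
     - of_real (ln_Gamma (ee b j) + ln_Gamma (ee b j + 1 / 2) - 2 * ln_Gamma (2 * ee b j))) has_field_derivative
     of_real (ln 2) + (Digamma (of_real (ee b j) + z / 2) + Digamma (of_real (ee b j + 1 / 2) + z / 2)) / 2 - Digamma (of_real (2 * ee b j) + z / 2)) (at z)"
    by (rule DERIV_cong[OF DERIV_diff[OF DERIV_add[OF DERIV_cmult_right[OF DERIV_ident] DERIV_diff[OF DERIV_add[OF ln_Gamma_shift_derivative[OF p(1)] ln_Gamma_shift_derivative[OF p(2)]]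
      DERIV_cmult[OF ln_Gamma_shift_derivative[OF p(3)]]]] DERIV_const]]) (simp add: field_simps)
qed

lemma LamC1_has_derivative:
  assumes "b > 0" "Re z > -1"
  shows "(LamC1 N b has_field_derivative LamC2 N b z) (at z)"
  unfolding LamC1_def[abs_def] LamC2_def
proof (rule DERIV_sum)
  fix j
  note p = ee_complex[OF assms, of j]
  show "((\<lambda>z. complex_of_real (ln 2) + (Digamma (of_real (ee b j) + z / 2) + Digamma (of_real (ee b j + 1 / 2) + z / 2)) / 2 - Digamma (of_real (2 * ee b j) + z / 2)) has_field_derivative
     (Polygamma 1 (of_real (ee b j) + z / 2) + Polygamma 1 (of_real (ee b j + 1 / 2) + z / 2) - 2 * Polygamma 1 (of_real (2 * ee b j) + z / 2)) / 4) (at z)"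
    by (rule DERIV_cong[OF DERIV_diff[OF DERIV_add[OF DERIV_const DERIV_cdivide[OF DERIV_add[OF Polygamma_shift_derivative[OF p(1)] Polygamma_shift_derivative[OF p(2)]]]]
      Polygamma_shift_derivative[OF p(3)]]]) (simp add: field_simps)
qed

lemma LamC2_has_derivative:
  assumes "b > 0" "Re z > -1"
  shows "(LamC2 N b has_field_derivative LamC3 N b z) (at z)"
  unfolding LamC2_def[abs_def] LamC3_def
proof (rule DERIV_sum)
  fix j
  note p = ee_complex[OF assms, of j]
  show "((\<lambda>z. (Polygamma 1 (complex_of_real (ee b j) + z / 2) + Polygamma 1 (of_real (ee b j + 1 / 2) + z / 2) - 2 * Polygamma 1 (of_real (2 * ee b j) + z / 2)) / 4) has_field_derivative
     (Polygamma 2 (of_real (ee b j) + z / 2) + Polygamma 2 (of_real (ee b j + 1 / 2) + z / 2) - 2 * Polygamma 2 (of_real (2 * ee b j) + z / 2)) / 8) (at z)"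
    by (rule DERIV_cong[OF DERIV_cdivide[OF DERIV_diff[OF DERIV_add[OF Polygamma_shift_derivative[OF p(1)] Polygamma_shift_derivative[OF p(2)]]
      DERIV_cmult[OF Polygamma_shift_derivative[OF p(3)]]]]]) (simp add: field_simps numeral_2_eq_2)
qed

lemma LamC_holomorphic:
  assumes "b > 0"
  shows "LamC N b holomorphic_on {z. Re z > -1}"
proof -
  have "open {z. Re z > -1}" by (rule open_halfspace_Re_gt)
  then show ?thesis using LamC_has_derivative[OF assms] by (auto simp: holomorphic_on_open)
qed

text \<open>Uniform on vertical lines, as the Taylor expansion in the imaginary direction requires,
  and of order \<open>1 / N\<close> when \<open>h\<close> is of order \<open>N\<close>.\<close>

lemma norm_LamC3_le:
  assumes b: "b > 0" and h: "Re z = h" "h > 0"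
  shows "norm (LamC3 N b z) \<le> real N * (8 / h ^ 3 + 2 / h\<^sup>2)"
proof -
  have P: "norm (Polygamma 2 (of_real c + z / 2)) \<le> 16 / h ^ 3 + 4 / h\<^sup>2" if "c \<ge> 0" for c
  proof -
    have r: "Re (of_real c + z / 2) = c + h / 2" using h by simp
    have "norm (Polygamma 2 (of_real c + z / 2)) \<le> 2 / (c + h / 2) ^ 3 + 1 / (c + h / 2)\<^sup>2"
      using norm_Polygamma_2_le[of "of_real c + z / 2"] r h that by simp
    also have "\<dots> \<le> 2 / (h / 2) ^ 3 + 1 / (h / 2)\<^sup>2"
      using h that by (intro add_mono divide_left_mono power_mono mult_pos_pos) auto
    finally show ?thesis by (simp add: power_divide)
  qed
  have "norm ((Polygamma 2 (of_real (ee b j) + z / 2) + Polygamma 2 (of_real (ee b j + 1 / 2) + z / 2) - 2 * Polygamma 2 (of_real (2 * ee b j) + z / 2)) / 8) \<le> 8 / h ^ 3 + 2 / h\<^sup>2" for j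
  proof -
    have e: "ee b j \<ge> 0" using ee_ge[OF b, of j] by simp
    have "norm (Polygamma 2 (of_real (ee b j) + z / 2) + Polygamma 2 (of_real (ee b j + 1 / 2) + z / 2) - 2 * Polygamma 2 (of_real (2 * ee b j) + z / 2))
      \<le> norm (Polygamma 2 (of_real (ee b j) + z / 2)) + norm (Polygamma 2 (of_real (ee b j + 1 / 2) + z / 2)) + norm (2 * Polygamma 2 (of_real (2 * ee b j) + z / 2))"
      by (rule order_trans[OF norm_triangle_ineq4 add_right_mono[OF norm_triangle_ineq]])
    also have "\<dots> \<le> (16 / h ^ 3 + 4 / h\<^sup>2) + (16 / h ^ 3 + 4 / h\<^sup>2) + 2 * (16 / h ^ 3 + 4 / h\<^sup>2)"
      unfolding norm_mult norm_numeral using e by (intro add_mono mult_left_mono P) auto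
    finally show ?thesis by (simp add: norm_divide)
  qed
  then have "norm (LamC3 N b z) \<le> (\<Sum>j<N. 8 / h ^ 3 + 2 / h\<^sup>2)"
    unfolding LamC3_def by (intro order_trans[OF norm_sum] sum_mono) auto
  then show ?thesis by simp
qed

text \<open>Expansion along the vertical line through \<open>h\<close>, a convex set on which the
  third derivative is bounded. The remainder in \<open>complex_Taylor\<close> is divided by
  \<open>fact 2\<close>, not \<open>fact 3\<close>, whence the 2 in the bound.\<close>

lemma LamC_taylor:
  assumes b: "b > 0" and h: "h > 0"
  shows "norm (LamC N b (Complex h t) - (of_real (Lam N b h) + \<i> * of_real (t * Lam1 N b h) - of_real (Lam2 N b h * t\<^sup>2 / 2)))
     \<le> real N * (8 / h ^ 3 + 2 / h\<^sup>2) * \<bar>t\<bar> ^ 3 / 2"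
proof -
  define S where "S = {z. Re z = h}"
  define f where "f i = (if i = (0::nat) then LamC N b else if i = 1 then LamC1 N b else if i = 2 then LamC2 N b else LamC3 N b)" for i
  have "norm (f 0 (Complex h t) - (\<Sum>i\<le>2. f i (of_real h) * (Complex h t - of_real h) ^ i / fact i))
     \<le> real N * (8 / h ^ 3 + 2 / h\<^sup>2) * norm (Complex h t - of_real h) ^ Suc 2 / fact 2"
  proof (rule complex_Taylor[where S = S])
    show "convex S" unfolding S_def convex_def by (auto simp flip: distrib_right)
    fix i x assume x: "x \<in> S" "i \<le> (2::nat)"
    then have "Re x > -1" using h by (simp add: S_def)
    then have "(f i has_field_derivative f (Suc i) x) (at x)"
      using x LamC_has_derivative[OF b, of x N] LamC1_has_derivative[OF b, of x N] LamC2_has_derivative[OF b, of x N]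
      by (auto simp: f_def le_Suc_eq numeral_2_eq_2)
    then show "(f i has_field_derivative f (Suc i) x) (at x within S)" by (rule has_field_derivative_at_within)
  next
    fix x assume "x \<in> S"
    then show "cmod (f (Suc 2) x) \<le> real N * (8 / h ^ 3 + 2 / h\<^sup>2)"
      using norm_LamC3_le[OF b _ h] by (simp add: f_def S_def)
  qed (auto simp: S_def)
  moreover have "Complex h t - of_real h = \<i> * of_real t" by (simp add: complex_eq_iff)
  moreover have "(\<Sum>i\<le>2. f i (of_real h) * (\<i> * of_real t) ^ i / fact i) = of_real (Lam N b h) + \<i> * of_real (t * Lam1 N b h) - of_real (Lam2 N b h * t\<^sup>2 / 2)"
    using h by (simp add: f_def numeral_2_eq_2 LamC_of_real[OF b] LamC1_of_real[OF b] LamC2_of_real[OF b] power2_eq_square algebra_simps)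
  ultimately show ?thesis by (simp add: f_def norm_mult)
qed

text \<open>Euler's limit writes \<open>norm (Gamma (Complex c t)) / Gamma c\<close> as the infinite
  product of \<open>1 / sqrt (1 + t\<^sup>2 / (c + k)\<^sup>2)\<close>. In the quotient for
  \<open>u\<close> and \<open>v\<close> each factor is at most an exponential of the difference of
  \<open>1 / (u + k)\<^sup>2\<close> and \<open>1 / (v + k)\<^sup>2\<close>, and these differences
  add up to Polygamma values.\<close>

lemma norm_Gamma_quotient_le:
  assumes u: "0 < u" "u \<le> v" and s: "0 < s" "s \<le> u"
  shows "(norm (Gamma (Complex u t)) / Gamma u) / (norm (Gamma (Complex v t)) / Gamma v)
     \<le> exp (- (t\<^sup>2 / (1 + t\<^sup>2 / s\<^sup>2)) * (Polygamma 1 u - Polygamma 1 v) / 2)"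
proof -
  define \<kappa> where "\<kappa> = t\<^sup>2 / (1 + t\<^sup>2 / s\<^sup>2)"
  have v: "0 < v" using u by simp
  define p where "p c n = (\<Prod>k\<le>n. sqrt (1 + t\<^sup>2 * (1 / (c + real k)\<^sup>2)))" for c and n :: nat
  have p_pos: "p c n > 0" for c n unfolding p_def by (intro prod_pos ballI) (simp add: add_pos_nonneg)
  have q: "norm (Gamma_series (Complex c t) n) / Gamma_series c n = 1 / p c n" if c: "c > 0" for c n
  proof -
    have "norm (Complex c t + of_nat k) = (c + real k) * sqrt (1 + t\<^sup>2 * (1 / (c + real k)\<^sup>2))" for k
    proof -
      have "norm (Complex c t + of_nat k) = sqrt ((c + real k)\<^sup>2 + t\<^sup>2)" by (simp add: cmod_def)
      also have "(c + real k)\<^sup>2 + t\<^sup>2 = (c + real k)\<^sup>2 * (1 + t\<^sup>2 * (1 / (c + real k)\<^sup>2))"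
        using c by (simp add: algebra_simps)
      finally show ?thesis using c by (simp add: real_sqrt_mult)
    qed
    then have "norm (pochhammer (Complex c t) (n + 1)) = pochhammer c (n + 1) * p c n"
      by (simp add: pochhammer_prod prod_norm[symmetric] prod.distrib p_def atLeast0_atMost_Suc[symmetric] atLeast0AtMost atLeastLessThanSuc_atLeastAtMost del: prod.op_ivl_Suc)
    moreover have "pochhammer c (n + 1) > 0" using c by (rule pochhammer_pos)
    moreover have "norm (exp (Complex c t * of_real (ln (real n)))) = exp (c * ln (real n))" by (simp add: norm_exp_eq_Re)
    ultimately show ?thesis using p_pos[of c n]
      by (simp add: Gamma_series_def norm_divide norm_mult)
  qed
  have lim: "(\<lambda>n. 1 / p c n) \<longlonglongrightarrow> norm (Gamma (Complex c t)) / Gamma c" if c: "c > 0" for c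
    unfolding q[OF c, symmetric] using Gamma_real_pos[OF c] by (intro tendsto_intros Gamma_series_LIMSEQ) simp
  have nz: "norm (Gamma (Complex c t)) / Gamma c \<noteq> 0" if "c > 0" for c
    using that Gamma_real_pos[OF that, THEN less_imp_neq, THEN not_sym] Gamma_eq_zero_iff[of "Complex c t"] Re_pos_not_nonpos(1)[of "Complex c t"] by simp
  have L1: "(\<lambda>n. (1 / p u n) / (1 / p v n)) \<longlonglongrightarrow> (norm (Gamma (Complex u t)) / Gamma u) / (norm (Gamma (Complex v t)) / Gamma v)"
    by (intro tendsto_divide lim u v nz)
  have le: "(1 / p u n) / (1 / p v n) \<le> exp (- \<kappa> / 2 * (\<Sum>k\<le>n. 1 / (u + real k)\<^sup>2 - 1 / (v + real k)\<^sup>2))" for n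
  proof -
    have "(1 / p u n) / (1 / p v n) = (\<Prod>k\<le>n. sqrt (1 + t\<^sup>2 * (1 / (v + real k)\<^sup>2)) / sqrt (1 + t\<^sup>2 * (1 / (u + real k)\<^sup>2)))"
      by (simp add: p_def prod_dividef)
    also have "\<dots> \<le> (\<Prod>k\<le>n. exp (- \<kappa> / 2 * (1 / (u + real k)\<^sup>2 - 1 / (v + real k)\<^sup>2)))"
    proof (rule prod_mono)
      fix k
      define x y where "x = 1 / (u + real k)\<^sup>2" "y = 1 / (v + real k)\<^sup>2"
      have xy: "0 \<le> y" "y \<le> x" "x \<le> 1 / s\<^sup>2"
        using u s v by (auto simp: x_y_def intro!: divide_left_mono power_mono mult_pos_pos)
      \<comment> \<open>All factors share the one rate \<open>\<kappa>\<close>, because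
        \<open>x\<close> never exceeds \<open>1 / s\<^sup>2\<close>.\<close>
      have kx: "\<kappa> \<le> t\<^sup>2 / (1 + t\<^sup>2 * x)"
        unfolding \<kappa>_def using xy mult_left_mono[OF xy(3), of "t\<^sup>2"]
        by (intro divide_left_mono mult_pos_pos add_pos_nonneg) auto
      have pos: "1 + t\<^sup>2 * x > 0" using xy by (intro add_pos_nonneg) auto
      have "(1 + t\<^sup>2 * y) / (1 + t\<^sup>2 * x) = 1 - t\<^sup>2 / (1 + t\<^sup>2 * x) * (x - y)"
        using pos by (simp add: field_simps)
      also have "\<dots> \<le> 1 - \<kappa> * (x - y)" using mult_right_mono[OF kx, of "x - y"] xy by simp
      also have "\<dots> \<le> exp (- \<kappa> * (x - y))" using exp_ge_add_one_self[of "- \<kappa> * (x - y)"] by simp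
      finally have "sqrt ((1 + t\<^sup>2 * y) / (1 + t\<^sup>2 * x)) \<le> sqrt (exp (- \<kappa> * (x - y)))" by (rule real_sqrt_le_mono)
      also have "\<dots> = exp (- \<kappa> / 2 * (x - y))"
      proof -
        have "exp (- \<kappa> * (x - y)) = (exp (- \<kappa> / 2 * (x - y)))\<^sup>2" by (simp add: power2_eq_square exp_add[symmetric])
        then show ?thesis by simp
      qed
      finally show "0 \<le> sqrt (1 + t\<^sup>2 * (1 / (v + real k)\<^sup>2)) / sqrt (1 + t\<^sup>2 * (1 / (u + real k)\<^sup>2)) \<and>
        sqrt (1 + t\<^sup>2 * (1 / (v + real k)\<^sup>2)) / sqrt (1 + t\<^sup>2 * (1 / (u + real k)\<^sup>2)) \<le> exp (- \<kappa> / 2 * (1 / (u + real k)\<^sup>2 - 1 / (v + real k)\<^sup>2))"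
        by (simp add: x_y_def real_sqrt_divide)
    qed
    also have "\<dots> = exp (- \<kappa> / 2 * (\<Sum>k\<le>n. 1 / (u + real k)\<^sup>2 - 1 / (v + real k)\<^sup>2))"
      by (simp only: exp_sum[symmetric, OF finite_atMost] sum_distrib_left)
    finally show ?thesis .
  qed
  have L2: "(\<lambda>n. exp (- \<kappa> / 2 * (\<Sum>k\<le>n. 1 / (u + real k)\<^sup>2 - 1 / (v + real k)\<^sup>2))) \<longlonglongrightarrow> exp (- \<kappa> / 2 * (Polygamma 1 u - Polygamma 1 v))"
    using sums_diff[OF Polygamma_1_sums[OF u(1)] Polygamma_1_sums[OF v]]
    by (intro tendsto_intros) (simp add: sums_def_le)
  have "(norm (Gamma (Complex u t)) / Gamma u) / (norm (Gamma (Complex v t)) / Gamma v) \<le> exp (- \<kappa> / 2 * (Polygamma 1 u - Polygamma 1 v))"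
    by (rule LIMSEQ_le[OF L1 L2]) (use le in blast)
  then show ?thesis by (simp add: \<kappa>_def)
qed

text \<open>Each of the two numerator Gammas in a summand is paired with one of the two equal
  denominator Gammas, and \<open>norm_Gamma_quotient_le\<close> is applied to every pair with
  \<open>s = h / 2\<close>. The exponents add up to the variance \<open>Lam2\<close>.\<close>

lemma norm_exp_LamC_le:
  assumes b: "b > 0" and h: "h > 0"
  shows "norm (exp (LamC N b (Complex h t) - of_real (Lam N b h))) \<le> exp (- Lam2 N b h * (t\<^sup>2 / (1 + t\<^sup>2 / h\<^sup>2)) / 2)"
proof -
  define s \<tau> where "s = h / 2" "\<tau> = t / 2"
  have z: "complex_of_real c + Complex h t / 2 = Complex (c + s) \<tau>" for c by (simp add: s_\<tau>_def complex_eq_iff)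
  have s: "s > 0" using h by (simp add: s_\<tau>_def)
  define r where "r c = norm (Gamma (Complex (c + s) \<tau>)) / Gamma (c + s)" for c
  have ng: "exp (ln_Gamma (Complex (c + s) \<tau>)) = Gamma (Complex (c + s) \<tau>)" if "c \<ge> 0" for c
    using that s Re_pos_not_nonpos(1)[of "Complex (c + s) \<tau>"] by (simp add: Gamma_complex_altdef)
  have er: "exp (Re (ln_Gamma (Complex (c + s) \<tau>)) - ln_Gamma (c + s)) = r c" if "c \<ge> 0" for c
  proof -
    have "exp (Re (ln_Gamma (Complex (c + s) \<tau>))) = norm (Gamma (Complex (c + s) \<tau>))"
      using norm_exp_eq_Re[of "ln_Gamma (Complex (c + s) \<tau>)"] ng[OF that] by simp
    moreover have "exp (ln_Gamma (c + s)) = Gamma (c + s)" using that s by (simp add: Gamma_real_pos_exp)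
    ultimately show ?thesis by (simp add: exp_diff r_def)
  qed
  have r_pos: "r c > 0" if "c \<ge> 0" for c using er[OF that] by (metis exp_gt_zero)
  define \<kappa> where "\<kappa> = \<tau>\<^sup>2 / (1 + \<tau>\<^sup>2 / s\<^sup>2)"
  have \<kappa>: "\<kappa> = (t\<^sup>2 / (1 + t\<^sup>2 / h\<^sup>2)) / 4" by (simp add: \<kappa>_def s_\<tau>_def power_divide)
  have "norm (exp (LamC N b (Complex h t) - of_real (Lam N b h))) = exp (Re (LamC N b (Complex h t)) - Lam N b h)"
    by (simp add: norm_exp_eq_Re)
  also have "Re (LamC N b (Complex h t)) - Lam N b h = (\<Sum>j<N. (Re (ln_Gamma (Complex (ee b j + s) \<tau>)) - ln_Gamma (ee b j + s)) +
     (Re (ln_Gamma (Complex (ee b j + 1 / 2 + s) \<tau>)) - ln_Gamma (ee b j + 1 / 2 + s)) - 2 * (Re (ln_Gamma (Complex (2 * ee b j + s) \<tau>)) - ln_Gamma (2 * ee b j + s)))"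
    unfolding LamC_def Lam_def z Re_sum sum_subtractf[symmetric]
    by (intro sum.cong refl) (simp add: s_\<tau>_def(1)[symmetric] algebra_simps)
  also have "exp \<dots> = (\<Prod>j<N. r (ee b j) * r (ee b j + 1 / 2) / (r (2 * ee b j))\<^sup>2)"
    unfolding exp_sum[OF finite_lessThan]
  proof (rule prod.cong)
    fix j
    have e: "ee b j \<ge> 0" using ee_ge[OF b, of j] by simp
    show "exp ((Re (ln_Gamma (Complex (ee b j + s) \<tau>)) - ln_Gamma (ee b j + s)) +
     (Re (ln_Gamma (Complex (ee b j + 1 / 2 + s) \<tau>)) - ln_Gamma (ee b j + 1 / 2 + s)) - 2 * (Re (ln_Gamma (Complex (2 * ee b j + s) \<tau>)) - ln_Gamma (2 * ee b j + s)))
     = r (ee b j) * r (ee b j + 1 / 2) / (r (2 * ee b j))\<^sup>2"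
      using e by (simp only: exp_diff[of "_ + _"] exp_add exp_double er add_nonneg_nonneg mult_nonneg_nonneg)
  qed simp
  also have "\<dots> \<le> (\<Prod>j<N. exp (- (2 * \<kappa>) * ((Polygamma 1 (ee b j + s) + Polygamma 1 (ee b j + 1 / 2 + s) - 2 * Polygamma 1 (2 * ee b j + s)) / 4)))"
  proof (rule prod_mono)
    fix j
    have e: "ee b j \<ge> 1 / 2" using ee_ge[OF b, of j] .
    have 1: "r (ee b j) / r (2 * ee b j) \<le> exp (- \<kappa> * (Polygamma 1 (ee b j + s) - Polygamma 1 (2 * ee b j + s)) / 2)"
      unfolding r_def \<kappa>_def using e s by (intro norm_Gamma_quotient_le) auto
    have 2: "r (ee b j + 1 / 2) / r (2 * ee b j) \<le> exp (- \<kappa> * (Polygamma 1 (ee b j + 1 / 2 + s) - Polygamma 1 (2 * ee b j + s)) / 2)"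
      unfolding r_def \<kappa>_def using e s by (intro norm_Gamma_quotient_le) auto
    have rp: "r (ee b j) > 0" "r (ee b j + 1 / 2) > 0" "r (2 * ee b j) > 0" using e by (intro r_pos; simp)+
    have "r (ee b j) * r (ee b j + 1 / 2) / (r (2 * ee b j))\<^sup>2 = (r (ee b j) / r (2 * ee b j)) * (r (ee b j + 1 / 2) / r (2 * ee b j))"
      by (simp add: power2_eq_square)
    also have "\<dots> \<le> exp (- \<kappa> * (Polygamma 1 (ee b j + s) - Polygamma 1 (2 * ee b j + s)) / 2) * exp (- \<kappa> * (Polygamma 1 (ee b j + 1 / 2 + s) - Polygamma 1 (2 * ee b j + s)) / 2)"
      using rp by (intro mult_mono 1 2) auto
    also have "\<dots> = exp (- (2 * \<kappa>) * ((Polygamma 1 (ee b j + s) + Polygamma 1 (ee b j + 1 / 2 + s) - 2 * Polygamma 1 (2 * ee b j + s)) / 4))"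
      unfolding exp_add[symmetric] by (simp add: field_simps)
    finally show "0 \<le> r (ee b j) * r (ee b j + 1 / 2) / (r (2 * ee b j))\<^sup>2 \<and> r (ee b j) * r (ee b j + 1 / 2) / (r (2 * ee b j))\<^sup>2 \<le>
       exp (- (2 * \<kappa>) * ((Polygamma 1 (ee b j + s) + Polygamma 1 (ee b j + 1 / 2 + s) - 2 * Polygamma 1 (2 * ee b j + s)) / 4))"
      using rp by simp
  qed
  also have "\<dots> = exp (- (2 * \<kappa>) * Lam2 N b h)"
    unfolding exp_sum[OF finite_lessThan, symmetric] sum_distrib_left[symmetric] Lam2_def s_\<tau>_def(1) ..
  also have "- (2 * \<kappa>) * Lam2 N b h = - Lam2 N b h * (t\<^sup>2 / (1 + t\<^sup>2 / h\<^sup>2)) / 2"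
  proof -
    have "- (2 * k) * L = - L * K / 2" if "k = K / 4" for k K L :: real using that by simp
    from this[OF \<kappa>] show ?thesis .
  qed
  finally show ?thesis .
qed


section \<open>Moments of the ensemble\<close>

lemma convex_on_supporting_lines:
  fixes f m :: "real \<Rightarrow> real"
  assumes S: "convex S" and sup: "\<And>x y. x \<in> S \<Longrightarrow> y \<in> S \<Longrightarrow> f x + m x * (y - x) \<le> f y"
  shows "convex_on S f"
proof (rule convex_onI[OF _ S])
  fix t x y :: real assume t: "0 < t" "t < 1" and xy: "x \<in> S" "y \<in> S"
  define c where "c = (1 - t) *\<^sub>R x + t *\<^sub>R y"
  have c: "c \<in> S" unfolding c_def using S t xy by (intro convexD) auto
  have "(1 - t) * (f c + m c * (x - c)) + t * (f c + m c * (y - c)) \<le> (1 - t) * f x + t * f y"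
    using t sup[OF c xy(1)] sup[OF c xy(2)] by (intro add_mono mult_left_mono) auto
  moreover have "(1 - t) * (f c + m c * (x - c)) + t * (f c + m c * (y - c)) = f c"
    unfolding c_def by (simp add: algebra_simps)
  ultimately show "f ((1 - t) *\<^sub>R x + t *\<^sub>R y) \<le> (1 - t) * f x + t * f y" by (simp add: c_def)
qed

text \<open>Monotonicity of secant slopes over \<open>[x - 2, x]\<close>, \<open>[x, x + y]\<close>
  and \<open>[x, x + 2]\<close>. For the second inequality \<open>x\<close> is written as a convex
  combination of \<open>x + y\<close> and \<open>x - 2\<close>.\<close>

lemma convex_step_bounds:
  fixes f :: "real \<Rightarrow> real"
  assumes f: "convex_on {-1<..} f" and x: "x \<ge> 2" and y: "0 \<le> y" "y \<le> 2"
  shows "f (x + y) - f x \<le> y / 2 * (f (x + 2) - f x)" "y / 2 * (f x - f (x - 2)) \<le> f (x + y) - f x"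
proof -
  have "f ((1 - y / 2) *\<^sub>R x + (y / 2) *\<^sub>R (x + 2)) \<le> (1 - y / 2) * f x + (y / 2) * f (x + 2)"
    using x y by (intro convex_onD[OF f]) auto
  moreover have "(1 - y / 2) *\<^sub>R x + (y / 2) *\<^sub>R (x + 2) = x + y" by (simp add: field_simps)
  ultimately have "f (x + y) \<le> (1 - y / 2) * f x + (y / 2) * f (x + 2)" by (simp only:)
  then show "f (x + y) - f x \<le> y / 2 * (f (x + 2) - f x)" by (simp add: field_simps)
  define t where "t = y / (y + 2)"
  have t: "0 \<le> t" "t \<le> 1" using y by (auto simp: t_def)
  have "f ((1 - t) *\<^sub>R (x + y) + t *\<^sub>R (x - 2)) \<le> (1 - t) * f (x + y) + t * f (x - 2)"
    using x y t by (intro convex_onD[OF f]) auto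
  moreover have "(1 - t) *\<^sub>R (x + y) + t *\<^sub>R (x - 2) = x"
  proof -
    have "t * (y + 2) = y" using y by (simp add: t_def)
    then show ?thesis by (simp add: algebra_simps)
  qed
  ultimately have "f x \<le> (1 - t) * f (x + y) + t * f (x - 2)" by simp
  then have "(y + 2) * f x \<le> (y + 2) * ((1 - t) * f (x + y) + t * f (x - 2))" using y by (intro mult_left_mono) auto
  also have "\<dots> = ((y + 2) - (y + 2) * t) * f (x + y) + ((y + 2) * t) * f (x - 2)" by (simp add: algebra_simps)
  also have "(y + 2) * t = y" using y by (simp add: t_def)
  also have "((y + 2) - y) * f (x + y) + y * f (x - 2) = 2 * f (x + y) + y * f (x - 2)" by simp
  finally show "y / 2 * (f x - f (x - 2)) \<le> f (x + y) - f x" by (simp add: algebra_simps)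
qed

text \<open>The difference of the two functions has period 2, so its value at \<open>y\<close> can
  be read off arbitrarily far out. There the increments of both functions are squeezed between the
  same two secant slopes, and the gap between these slopes tends to \<open>L - L\<close>, up to the
  factor coming from the step length.\<close>

lemma convex_shift_unique:
  fixes A B r :: "real \<Rightarrow> real"
  assumes A: "convex_on {-1<..} A" and B: "convex_on {-1<..} B"
    and rA: "\<And>h. h > -1 \<Longrightarrow> A (h + 2) = A h + r h" and rB: "\<And>h. h > -1 \<Longrightarrow> B (h + 2) = B h + r h"
    and r: "(r \<longlongrightarrow> L) at_top" and zero: "A 0 = B 0" and h: "h > -1"
  shows "A h = B h"
proof -
  define D where "D h = A h - B h" for h
  have D2: "D (h + 2) = D h" if "h > -1" for h using rA[OF that] rB[OF that] by (simp add: D_def)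
  have Dn: "D (y + 2 * real n) = D y" if "y > -1" for y n
  proof (induction n)
    case (Suc n)
    have "D (y + 2 * real (Suc n)) = D ((y + 2 * real n) + 2)" by (simp add: algebra_simps)
    also have "\<dots> = D (y + 2 * real n)" using that by (intro D2) (simp add: add_pos_nonneg add.commute less_le_trans[of "-1" y])
    finally show ?case using Suc by simp
  qed simp
  have base: "D y = 0" if y: "0 \<le> y" "y \<le> 2" for y
  proof -
    have bd: "\<bar>D y\<bar> \<le> y / 2 * (r (2 * real n + 2) - r (2 * real n))" for n
    proof -
      define x where "x = 2 * real n + 2"
      have x: "x \<ge> 2" by (simp add: x_def)
      have e: "D y = (A (x + y) - A x) - (B (x + y) - B x)"
        using Dn[of y "Suc n"] Dn[of 0 "Suc n"] y zero by (simp add: D_def x_def algebra_simps)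
      have rs: "A (x + 2) - A x = r x" "A x - A (x - 2) = r (x - 2)" "B (x + 2) - B x = r x" "B x - B (x - 2) = r (x - 2)"
        using rA[of x] rB[of x] rA[of "x - 2"] rB[of "x - 2"] x by auto
      have "\<bar>(A (x + y) - A x) - (B (x + y) - B x)\<bar> \<le> y / 2 * r x - y / 2 * r (x - 2)"
        using convex_step_bounds[OF A x y] convex_step_bounds[OF B x y] unfolding rs by linarith
      moreover have "2 * real n + 2 = x" "2 * real n = x - 2" by (simp_all add: x_def)
      ultimately show ?thesis unfolding e by (simp only: right_diff_distrib)
    qed
    have lim: "(\<lambda>n. y / 2 * (r (2 * real n + 2) - r (2 * real n))) \<longlonglongrightarrow> y / 2 * (L - L)"
    proof (intro tendsto_intros)
      show "(\<lambda>n. r (2 * real n + 2)) \<longlonglongrightarrow> L" by (rule filterlim_compose[OF r]) real_asymp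
      show "(\<lambda>n. r (2 * real n)) \<longlonglongrightarrow> L" by (rule filterlim_compose[OF r]) real_asymp
    qed
    have "\<bar>D y\<bar> \<le> y / 2 * (L - L)" by (rule LIMSEQ_le_const[OF lim]) (use bd in blast)
    then show ?thesis by simp
  qed
  have "D h = 0"
  proof (cases "h < 0")
    case True
    then have "D (h + 2) = 0" using h by (intro base) auto
    then show ?thesis using D2[OF h] by simp
  next
    case False
    define n where "n = nat \<lfloor>h / 2\<rfloor>"
    define y where "y = h - 2 * real n"
    have fl: "real n = of_int \<lfloor>h / 2\<rfloor>" using False by (simp add: n_def)
    have "0 \<le> y" "y \<le> 2" using floor_correct[of "h / 2"] unfolding y_def fl by (simp_all add: field_simps)
    then show ?thesis using base Dn[of y n] by (simp add: y_def)
  qed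
  then show ?thesis by (simp add: D_def)
qed

section \<open>Exponential moments of the ensemble\<close>

locale cbe_ensemble =
  fixes N :: nat and \<beta> :: real
  assumes \<beta>: "\<beta> > 0"
begin

abbreviation "b \<equiv> \<beta> / 2"
abbreviation "P \<equiv> cbe N \<beta>"
abbreviation "X \<equiv> log_charpoly N"

lemma b_pos: "b > 0" using \<beta> by simp

sublocale prob_space "cbe N \<beta>" using \<beta> by (rule prob_space_cbe)

definition Z :: ennreal where "Z = (\<integral>\<^sup>+ y. ennreal (cbe_weight N \<beta> y) \<partial>CM {..<N})"
definition Zr :: real where "Zr = enn2real Z"

lemma Z: "Z = ennreal Zr" "Zr > 0"
proof -
  have c: "cbe N \<beta> = density (CM {..<N}) (\<lambda>z. ennreal (cbe_weight N \<beta> z) / Z)"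
    by (simp add: cbe_def Let_def Z_def)
  have "1 = emeasure (cbe N \<beta>) (space (cbe N \<beta>))" by (rule emeasure_space_1[symmetric])
  also have "\<dots> = (\<integral>\<^sup>+ z. ennreal (cbe_weight N \<beta> z) / Z \<partial>CM {..<N})"
    unfolding c by (simp add: emeasure_density cong: nn_integral_cong)
  also have "\<dots> = Z / Z" by (subst nn_integral_divide) (auto simp: Z_def)
  finally have "Z \<noteq> 0" "Z \<noteq> \<infinity>" by (auto simp: divide_ennreal_def)
  then show "Z = ennreal Zr" "Zr > 0"
    by (auto simp: Zr_def enn2real_positive_iff less_top[symmetric] zero_less_iff_neq_zero)
qed

lemma cbe_eq: "cbe N \<beta> = density (CM {..<N}) (\<lambda>z. ennreal (cbe_weight N \<beta> z / Zr))"
proof -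
  have "ennreal (cbe_weight N \<beta> z) / Z = ennreal (cbe_weight N \<beta> z / Zr)" for z
    using Z cbe_weight_nonneg by (simp add: divide_ennreal)
  then show ?thesis by (simp add: cbe_def Let_def Z_def[symmetric])
qed

lemma sets_cbe [measurable_cong]: "sets P = sets (CM {..<N})" by (simp add: cbe_eq)

lemma AE_cbe_unit: "AE x in P. \<forall>i<N. cmod (x i) = 1 \<and> x i \<noteq> 1"
  unfolding cbe_eq by (subst AE_density) (use AE_CM_unit[of "{..<N}"] in \<open>auto elim!: eventually_mono\<close>)

lemma exp_X: "(\<forall>i<N. cmod (x i) = 1 \<and> x i \<noteq> 1) \<Longrightarrow> exp (h * X x) = (\<Prod>i<N. cmod (1 - x i) powr h)"
  by (auto simp: log_charpoly_def powr_def exp_sum[symmetric] sum_distrib_left intro!: prod.cong)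

lemma AE_exp_X: "AE x in P. exp (h * X x) = (\<Prod>i<N. cmod (1 - x i) powr h)"
  using AE_cbe_unit by (rule eventually_mono) (rule exp_X)

lemma X_meas [measurable]: "X \<in> borel_measurable P" by (rule log_charpoly_measurable)

lemma prod_meas: "(\<lambda>x. \<Prod>i<N. cmod (1 - x i) powr h) \<in> borel_measurable (CM {..<N})"
  by (intro borel_measurable_prod) (auto intro!: component_measurable)

lemma integrable_exp_X:
  assumes h: "h > -1"
  shows "integrable P (\<lambda>x. exp (h * X x))"
proof -
  have "integrable (CM {..<N}) (\<lambda>x. (cbe_weight N \<beta> x / Zr) *\<^sub>R (\<Prod>i<N. cmod (1 - x i) powr h))"
  proof (rule integrable_CM_dominated[OF h])
    show "(\<lambda>x. (cbe_weight N \<beta> x / Zr) *\<^sub>R (\<Prod>i<N. cmod (1 - x i) powr h)) \<in> borel_measurable (CM {..<N})"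
      using prod_meas cbe_weight_measurable by measurable
    fix x :: "nat \<Rightarrow> complex" assume x: "\<And>i. i < N \<Longrightarrow> cmod (x i) = 1"
    show "norm ((cbe_weight N \<beta> x / Zr) *\<^sub>R (\<Prod>i<N. cmod (1 - x i) powr h)) \<le> (\<Prod>j<N. \<Prod>i<j. 2 powr \<beta>) / Zr * (\<Prod>i<N. cmod (1 - x i) powr h)"
      using cbe_weight_le[OF x \<beta>] cbe_weight_nonneg[of N \<beta> x] Z(2)
      by (simp add: abs_mult abs_prod divide_right_mono mult_right_mono prod_nonneg)
  qed
  then have "integrable P (\<lambda>x. \<Prod>i<N. cmod (1 - x i) powr h)"
    unfolding cbe_eq using prod_meas Z(2) by (subst integrable_density) (auto simp: cbe_weight_nonneg)
  then show ?thesis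
    by (rule integrable_cong_AE_imp) (use AE_exp_X[of h] in \<open>auto elim: eventually_mono\<close>)
qed

definition E :: "real \<Rightarrow> real" where "E h = (\<integral> x. exp (h * X x) \<partial>P)"

lemma E_eq: "E h = Mi N b h / Zr"
proof -
  have [measurable]: "(\<lambda>x. \<Prod>i<N. cmod (1 - x i) powr h) \<in> borel_measurable P"
    using prod_meas by measurable
  have "E h = (\<integral> x. (\<Prod>i<N. cmod (1 - x i) powr h) \<partial>P)"
    unfolding E_def by (rule integral_cong_AE) (use AE_exp_X[of h] in auto)
  also have "\<dots> = (\<integral> x. (cbe_weight N \<beta> x / Zr) *\<^sub>R (\<Prod>i<N. cmod (1 - x i) powr h) \<partial>CM {..<N})"
    unfolding cbe_eq using prod_meas Z(2) by (subst integral_density) (auto simp: cbe_weight_nonneg)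
  also have "\<dots> = (\<integral> x. ((\<Prod>i<N. cmod (1 - x i) powr h) * cbe_weight N (2 * b) x) / Zr \<partial>CM {..<N})"
    by (simp add: mult_ac)
  also have "\<dots> = Mi N b h / Zr" unfolding Mi_def by simp
  finally show ?thesis .
qed

lemma E_plus_2: "h > -1 \<Longrightarrow> E (h + 2) = (\<Prod>j<N. (1 + h + real j * b) * (2 + h + real j * b) / (1 + h / 2 + real j * b)\<^sup>2) * E h"
  using Mi_plus_2[OF b_pos, of h N] by (simp add: E_eq)

lemma E_0: "E 0 = 1" by (simp add: E_def prob_space)

lemma E_pos: assumes "h > -1" shows "E h > 0"
proof -
  have "E h \<noteq> 0"
  proof
    assume "E h = 0"
    then have "AE x in P. exp (h * X x) = 0"
      using integral_nonneg_eq_0_iff_AE[OF integrable_exp_X[OF assms]] by (simp add: E_def)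
    then show False by simp
  qed
  moreover have "E h \<ge> 0" unfolding E_def by (intro integral_nonneg_AE) auto
  ultimately show ?thesis by simp
qed

lemma integrable_X_exp_X:
  assumes h: "h > -1"
  shows "integrable P (\<lambda>x. X x * exp (h * X x))"
proof -
  \<comment> \<open>Half the distance from \<open>h\<close> to -1, so that \<open>h + d\<close> and
    \<open>h - d\<close> both remain admissible.\<close>
  define d where "d = (h + 1) / 2"
  have d: "d > 0" "h - d > -1" "h + d > -1" using h by (auto simp: d_def field_simps)
  have "integrable P (\<lambda>x. (exp ((h + d) * X x) + exp ((h - d) * X x)) / d)"
    using d by (intro integrable_divide Bochner_Integration.integrable_add integrable_exp_X)
  then show ?thesis
  proof (rule Bochner_Integration.integrable_bound)
    show "AE x in P. norm (X x * exp (h * X x)) \<le> norm ((exp ((h + d) * X x) + exp ((h - d) * X x)) / d)"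
    proof (rule AE_I2)
      fix x
      have "d * \<bar>X x\<bar> \<le> exp (d * \<bar>X x\<bar>)" using exp_ge_add_one_self[of "d * \<bar>X x\<bar>"] by linarith
      also have "\<dots> \<le> exp (d * X x) + exp (- d * X x)" by (cases "X x \<ge> 0") auto
      finally have "d * \<bar>X x\<bar> * exp (h * X x) \<le> (exp (d * X x) + exp (- d * X x)) * exp (h * X x)"
        by (intro mult_right_mono) auto
      also have "\<dots> = exp ((h + d) * X x) + exp ((h - d) * X x)"
        by (simp add: algebra_simps exp_add[symmetric] exp_diff)
      finally show "norm (X x * exp (h * X x)) \<le> norm ((exp ((h + d) * X x) + exp ((h - d) * X x)) / d)"
        using d by (simp add: abs_mult field_simps)
    qed
  qed measurable
qed

definition m1 :: "real \<Rightarrow> real" where "m1 h = (\<integral> x. X x * exp (h * X x) \<partial>P) / E h"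

text \<open>Jensen's inequality for the law tilted by \<open>h0\<close>, obtained from
  \<open>1 + u \<le> exp u\<close>. Integrability at \<open>h\<close> appears as a hypothesis
  instead of \<open>h > -1\<close>, so that \<open>log_mgf_ge\<close> can treat every real
  \<open>h\<close>.\<close>

lemma E_tangent:
  assumes h0: "h0 > -1" and int: "integrable P (\<lambda>x. exp (h * X x))"
  shows "E h0 * exp ((h - h0) * m1 h0) \<le> (\<integral> x. exp (h * X x) \<partial>P)"
proof -
  define m where "m = m1 h0"
  have "(\<integral> x. exp ((h - h0) * m) * ((1 - (h - h0) * m) * exp (h0 * X x) + (h - h0) * (X x * exp (h0 * X x))) \<partial>P) \<le> (\<integral> x. exp (h * X x) \<partial>P)"
  proof (rule integral_mono)
    show "integrable P (\<lambda>x. exp ((h - h0) * m) * ((1 - (h - h0) * m) * exp (h0 * X x) + (h - h0) * (X x * exp (h0 * X x))))"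
      by (intro integrable_mult_right Bochner_Integration.integrable_add integrable_exp_X[OF h0] integrable_X_exp_X[OF h0])
    fix x
    have "1 + (h - h0) * (X x - m) \<le> exp ((h - h0) * (X x - m))" by (rule exp_ge_add_one_self)
    then have "exp ((h - h0) * m) * exp (h0 * X x) * (1 + (h - h0) * (X x - m)) \<le> exp ((h - h0) * m) * exp (h0 * X x) * exp ((h - h0) * (X x - m))"
      by (intro mult_left_mono) auto
    also have "\<dots> = exp (h * X x)" by (simp add: exp_add[symmetric] algebra_simps)
    finally show "exp ((h - h0) * m) * ((1 - (h - h0) * m) * exp (h0 * X x) + (h - h0) * (X x * exp (h0 * X x))) \<le> exp (h * X x)"
      by (simp add: algebra_simps)
  qed (rule int)
  also have "(\<integral> x. exp ((h - h0) * m) * ((1 - (h - h0) * m) * exp (h0 * X x) + (h - h0) * (X x * exp (h0 * X x))) \<partial>P)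
    = exp ((h - h0) * m) * ((1 - (h - h0) * m) * E h0 + (h - h0) * (m * E h0))"
    using integrable_exp_X[OF h0] integrable_X_exp_X[OF h0] E_pos[OF h0] by (simp add: E_def[symmetric] m_def m1_def)
  finally show ?thesis by (simp add: m_def algebra_simps)
qed

lemma ln_E_convex: "convex_on {-1<..} (\<lambda>h. ln (E h))"
proof (rule convex_on_supporting_lines[where m = m1])
  fix x y :: real assume xy: "x \<in> {-1<..}" "y \<in> {-1<..}"
  have "ln (E x * exp ((y - x) * m1 x)) \<le> ln (E y)"
    using E_tangent[of x y] integrable_exp_X[of y] E_pos[of x] E_pos[of y] xy by (simp add: E_def[symmetric])
  then show "ln (E x) + m1 x * (y - x) \<le> ln (E y)"
    using E_pos[of x] xy by (simp add: ln_mult_pos mult.commute)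
qed auto

theorem E_formula:
  assumes h: "h > -1"
  shows "E h = exp (Lam N b h)"
proof -
  define r where "r h = (\<Sum>j<N. ln ((1 + h + real j * b) * (2 + h + real j * b) / (1 + h / 2 + real j * b)\<^sup>2))" for h
  have "ln (E h) = Lam N b h"
  proof (rule convex_shift_unique[where r = r and A = "\<lambda>h. ln (E h)" and B = "Lam N b" and L = "\<Sum>j<N. ln 4"])
    show "(r \<longlongrightarrow> (\<Sum>j<N. ln 4)) at_top"
      unfolding r_def
    proof (rule tendsto_sum)
      fix j
      have "((\<lambda>h. ln ((1 + h + real j * b) * (2 + h + real j * b) / (1 + h / 2 + real j * b)\<^sup>2)) \<longlongrightarrow> ln (inverse ((1 / 2)\<^sup>2))) at_top"
        by real_asymp
      moreover have "inverse ((1 / 2)\<^sup>2) = (4::real)" by (simp add: power2_eq_square)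
      ultimately show "((\<lambda>h. ln ((1 + h + real j * b) * (2 + h + real j * b) / (1 + h / 2 + real j * b)\<^sup>2)) \<longlongrightarrow> ln 4) at_top"
        by simp
    qed
    fix h :: real assume h: "h > -1"
    have pos: "(1 + h + real j * b) * (2 + h + real j * b) / (1 + h / 2 + real j * b)\<^sup>2 > 0" for j
    proof -
      have "real j * b \<ge> 0" using b_pos by simp
      then have "1 + h + real j * b > 0" "2 + h + real j * b > 0" "1 + h / 2 + real j * b > 0" using h by (simp_all add: field_simps)
      then show ?thesis by simp
    qed
    have "ln (\<Prod>j<N. (1 + h + real j * b) * (2 + h + real j * b) / (1 + h / 2 + real j * b)\<^sup>2) = r h"
      unfolding r_def by (rule ln_prod) (simp, metis pos less_irrefl)
    then show "ln (E (h + 2)) = ln (E h) + r h"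
      using E_pos[OF h] pos by (simp only: E_plus_2[OF h]) (subst ln_mult_pos, auto intro!: prod_pos)
    show "Lam N b (h + 2) = Lam N b h + r h"
      using Lam_plus_2[OF b_pos h] by (simp add: r_def)
  qed (use h in \<open>auto simp: ln_E_convex Lam_convex[OF b_pos] E_0 Lam_0\<close>)
  then show ?thesis using E_pos[OF h] by (metis exp_ln)
qed

definition F :: "complex \<Rightarrow> complex" where "F z = (\<integral> x. exp (z * of_real (X x)) \<partial>P)"

text \<open>Differentiation under the integral. On a ball around \<open>z\<close> the derivative of
  the integrand is dominated by its values at the real parts \<open>Re z + d\<close> and
  \<open>Re z - d\<close>; the first serves \<open>X \<ge> 0\<close>, the second
  \<open>X < 0\<close>.\<close>

lemma F_derivative:
  assumes z: "Re z > -1"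
  shows "(F has_field_derivative (\<integral> x. of_real (X x) * exp (z * of_real (X x)) \<partial>P)) (at z)"
proof -
  define d where "d = (Re z + 1) / 2"
  have d: "d > 0" "Re z - d > -1" "Re z + d > -1" using z by (auto simp: d_def field_simps)
  define g where "g x = \<bar>X x * exp ((Re z + d) * X x)\<bar> + \<bar>X x * exp ((Re z - d) * X x)\<bar>" for x
  have int_g: "integrable P g"
    unfolding g_def using d by (intro Bochner_Integration.integrable_add integrable_abs integrable_X_exp_X)
  have nb: "\<bar>X x\<bar> * exp (Re w * X x) \<le> g x" if w: "w \<in> ball z d" for w x
  proof -
    have "\<bar>Re w - Re z\<bar> \<le> d" using w abs_Re_le_cmod[of "w - z"] by (simp add: dist_norm norm_minus_commute)
    then have rw: "Re z - d \<le> Re w" "Re w \<le> Re z + d" by linarith+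
    have "exp (Re w * X x) \<le> exp ((Re z + d) * X x) + exp ((Re z - d) * X x)"
    proof (cases "X x \<ge> 0")
      case True
      then have "exp (Re w * X x) \<le> exp ((Re z + d) * X x)" using rw by (simp add: mult_right_mono)
      then show ?thesis by (simp add: add_increasing2)
    next
      case False
      then have "exp (Re w * X x) \<le> exp ((Re z - d) * X x)" using rw by (simp add: mult_right_mono_neg)
      then show ?thesis by (simp add: add_increasing)
    qed
    then have "\<bar>X x\<bar> * exp (Re w * X x) \<le> \<bar>X x\<bar> * (exp ((Re z + d) * X x) + exp ((Re z - d) * X x))" by (intro mult_left_mono) auto
    then show ?thesis by (simp add: g_def abs_mult algebra_simps)
  qed
  have int_exp: "integrable P (\<lambda>x. exp (w * of_real (X x)))" if "Re w > -1" for w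
  proof (rule Bochner_Integration.integrable_bound[OF integrable_exp_X[OF that]])
    show "AE x in P. norm (exp (w * complex_of_real (X x))) \<le> norm (exp (Re w * X x))"
      by (simp add: norm_exp_eq_Re)
  qed measurable
  have ball_Re: "Re w > -1" if "w \<in> ball z d" for w
    using that abs_Re_le_cmod[of "w - z"] d by (simp add: dist_norm norm_minus_commute)
  have "((\<lambda>w. (F w - F z) / (w - z)) \<longlongrightarrow> (\<integral> x. of_real (X x) * exp (z * of_real (X x)) \<partial>P)) (at z within ball z d)"
    unfolding tendsto_at_iff_sequentially comp_def
  proof (intro allI impI)
    fix S assume S: "\<forall>i. S i \<in> ball z d - {z}" "S \<longlonglongrightarrow> z"
    have "(\<lambda>i. \<integral> x. (exp (S i * of_real (X x)) - exp (z * of_real (X x))) / (S i - z) \<partial>P) \<longlonglongrightarrow> (\<integral> x. of_real (X x) * exp (z * of_real (X x)) \<partial>P)"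
    proof (rule integral_dominated_convergence[OF _ _ int_g])
      show "AE x in P. (\<lambda>i. (exp (S i * of_real (X x)) - exp (z * of_real (X x))) / (S i - z)) \<longlonglongrightarrow> of_real (X x) * exp (z * of_real (X x))"
      proof (rule AE_I2)
        fix x
        have "((\<lambda>w. exp (w * of_real (X x))) has_field_derivative of_real (X x) * exp (z * of_real (X x))) (at z)"
          by (auto intro!: derivative_eq_intros)
        then have "((\<lambda>w. (exp (w * of_real (X x)) - exp (z * of_real (X x))) / (w - z)) \<longlongrightarrow> of_real (X x) * exp (z * of_real (X x))) (at z)"
          by (simp add: has_field_derivative_iff)
        then show "(\<lambda>i. (exp (S i * of_real (X x)) - exp (z * of_real (X x))) / (S i - z)) \<longlonglongrightarrow> of_real (X x) * exp (z * of_real (X x))"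
          using S unfolding tendsto_at_iff_sequentially comp_def by blast
      qed
      show "AE x in P. norm ((exp (S i * of_real (X x)) - exp (z * of_real (X x))) / (S i - z)) \<le> g x" for i
      proof (rule AE_I2)
        fix x
        have "norm (exp (S i * of_real (X x)) - exp (z * of_real (X x))) \<le> g x * norm (S i - z)"
        proof (rule field_differentiable_bound[of "ball z d" "\<lambda>w. exp (w * of_real (X x))" "\<lambda>w. of_real (X x) * exp (w * of_real (X x))"])
          fix w assume w: "w \<in> ball z d"
          show "((\<lambda>w. exp (w * of_real (X x))) has_field_derivative of_real (X x) * exp (w * of_real (X x))) (at w within ball z d)"
            by (auto intro!: derivative_eq_intros)
          show "cmod (of_real (X x) * exp (w * of_real (X x))) \<le> g x"
            using nb[OF w] by (simp add: norm_mult norm_exp_eq_Re)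
        qed (use S d in auto)
        moreover have "S i - z \<noteq> 0" using S by auto
        ultimately show "norm ((exp (S i * of_real (X x)) - exp (z * of_real (X x))) / (S i - z)) \<le> g x"
          by (simp add: norm_divide divide_le_eq)
      qed
    qed measurable
    moreover have "(\<integral> x. (exp (S i * of_real (X x)) - exp (z * of_real (X x))) / (S i - z) \<partial>P) = (F (S i) - F z) / (S i - z)" for i
    proof -
      have "Re (S i) > -1" using S by (intro ball_Re) auto
      then show ?thesis using int_exp[of "S i"] int_exp[OF z] by (simp add: F_def)
    qed
    ultimately show "(\<lambda>i. (F (S i) - F z) / (S i - z)) \<longlonglongrightarrow> (\<integral> x. of_real (X x) * exp (z * of_real (X x)) \<partial>P)" by (simp only:)
  qed
  then have "(F has_field_derivative (\<integral> x. of_real (X x) * exp (z * of_real (X x)) \<partial>P)) (at z within ball z d)"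
    by (simp add: has_field_derivative_iff)
  then show ?thesis using d by (simp add: at_within_open[of z "ball z d"])
qed

lemma F_of_real: "h > -1 \<Longrightarrow> F (of_real h) = of_real (exp (Lam N b h))"
proof -
  assume h: "h > -1"
  have "F (of_real h) = (\<integral> x. complex_of_real (exp (h * X x)) \<partial>P)"
    unfolding F_def by (simp add: exp_of_real[symmetric])
  also have "\<dots> = of_real (E h)" unfolding E_def by (rule integral_complex_of_real)
  finally show ?thesis by (simp only: E_formula[OF h])
qed

theorem F_formula:
  assumes z: "Re z > -1"
  shows "F z = exp (LamC N b z)"
proof -
  define S where "S = {z. Re z > -1}"
  have op: "open S" unfolding S_def by (rule open_halfspace_Re_gt)
  have hol: "(\<lambda>z. F z - exp (LamC N b z)) holomorphic_on S"
    unfolding S_def using F_derivative op[unfolded S_def] LamC_holomorphic[OF b_pos]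
    by (intro holomorphic_intros) (auto simp: holomorphic_on_open)
  have "F z - exp (LamC N b z) = 0"
  proof (rule analytic_continuation[OF hol op, of "complex_of_real ` {-1<..}" 1])
    show "connected S" unfolding S_def by (intro convex_connected convex_halfspace_Re_gt)
    show "(1::complex) islimpt complex_of_real ` {-1<..}"
      unfolding islimpt_approachable
    proof (intro allI impI)
      fix e :: real assume e: "e > 0"
      show "\<exists>x'\<in>complex_of_real ` {-1<..}. x' \<noteq> 1 \<and> dist x' 1 < e"
      proof (intro bexI[of _ "complex_of_real (1 + e / 2)"] conjI)
        show "complex_of_real (1 + e / 2) \<noteq> 1" using e by (simp add: complex_eq_iff)
        have "dist (complex_of_real (1 + e / 2)) (of_real 1) = dist (1 + e / 2) (1::real)" by (rule dist_of_real)
        also have "\<dots> < e" using e by (simp add: dist_real_def)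
        finally show "dist (complex_of_real (1 + e / 2)) 1 < e" by simp
        show "complex_of_real (1 + e / 2) \<in> complex_of_real ` {-1<..}" using e by (intro imageI) simp
      qed
    qed
    show "F w - exp (LamC N b w) = 0" if "w \<in> complex_of_real ` {-1<..}" for w
      using that F_of_real LamC_of_real[OF b_pos] by (auto simp: exp_of_real)
  qed (use z in \<open>auto simp: S_def\<close>)
  then show ?thesis by simp
qed

text \<open>The derivative of \<open>F\<close> is computed once under the integral and once from the
  closed formula.\<close>

lemma m1_eq:
  assumes h: "h > -1"
  shows "m1 h = Lam1 N b h"
proof -
  have "(F has_field_derivative (\<integral> x. of_real (X x) * exp (of_real h * of_real (X x)) \<partial>P)) (at (of_real h))"
    using h by (intro F_derivative) auto
  moreover have "(F has_field_derivative exp (LamC N b (of_real h)) * LamC1 N b (of_real h)) (at (of_real h))"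
  proof (rule has_field_derivative_transform_within_open)
    show "((\<lambda>z. exp (LamC N b z)) has_field_derivative exp (LamC N b (of_real h)) * LamC1 N b (of_real h)) (at (of_real h))"
      using h LamC_has_derivative[OF b_pos, of "of_real h" N] by (auto intro!: DERIV_fun_exp)
    show "open {z. Re z > -1}" by (rule open_halfspace_Re_gt)
    show "complex_of_real h \<in> {z. Re z > -1}" using h by simp
    show "exp (LamC N b y) = F y" if "y \<in> {z. Re z > -1}" for y using that by (simp add: F_formula)
  qed
  ultimately have "(\<integral> x. of_real (X x) * exp (of_real h * of_real (X x)) \<partial>P) = exp (LamC N b (of_real h)) * LamC1 N b (of_real h)"
    by (rule DERIV_unique)
  also have "(\<lambda>x. complex_of_real (X x) * exp (of_real h * of_real (X x))) = (\<lambda>x. complex_of_real (X x * exp (h * X x)))"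
    by (simp add: exp_of_real[symmetric])
  also have "exp (LamC N b (of_real h)) * LamC1 N b (of_real h) = of_real (E h * Lam1 N b h)"
    using h by (simp add: LamC_of_real[OF b_pos] LamC1_of_real[OF b_pos] E_formula exp_of_real)
  finally have "(\<integral> x. X x * exp (h * X x) \<partial>P) = E h * Lam1 N b h"
    unfolding integral_complex_of_real of_real_eq_iff .
  then show ?thesis using E_pos[OF h] by (simp add: m1_def)
qed

lemma log_mgf_eq: "h > -1 \<Longrightarrow> log_mgf N \<beta> h = ereal (Lam N b h)"
proof -
  assume h: "h > -1"
  have "(\<integral>\<^sup>+ x. ennreal (exp (h * X x)) \<partial>P) = ennreal (E h)"
    unfolding E_def using integrable_exp_X[OF h] by (intro nn_integral_eq_integral) auto
  then show ?thesis
    using E_pos[OF h] E_formula[OF h] by (simp add: log_mgf_def ln_ennreal_def)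
qed

text \<open>Valid also where the moment is infinite. This is what lets the supremum over all reals
  in \<open>log_mgf_conj\<close> be evaluated at the saddle point.\<close>

lemma log_mgf_ge:
  assumes h0: "h0 > -1"
  shows "ereal (Lam N b h0 + (h - h0) * Lam1 N b h0) \<le> log_mgf N \<beta> h"
proof (cases "integrable P (\<lambda>x. exp (h * X x))")
  case True
  define I where "I = (\<integral> x. exp (h * X x) \<partial>P)"
  have nn: "(\<integral>\<^sup>+ x. ennreal (exp (h * X x)) \<partial>P) = ennreal I"
    unfolding I_def using True by (intro nn_integral_eq_integral) auto
  have le: "exp (Lam N b h0 + (h - h0) * Lam1 N b h0) \<le> I"
    using E_tangent[OF h0 True] by (simp add: I_def E_formula[OF h0] m1_eq[OF h0] exp_add)
  then have I: "I > 0" by (rule less_le_trans[rotated]) simp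
  then have "log_mgf N \<beta> h = ereal (ln I)"
    using nn by (simp add: log_mgf_def ln_ennreal_def)
  moreover have "Lam N b h0 + (h - h0) * Lam1 N b h0 \<le> ln I"
    using le I by (simp add: ln_ge_iff)
  ultimately show ?thesis by simp
next
  case False
  have "(\<integral>\<^sup>+ x. ennreal (exp (h * X x)) \<partial>P) = \<infinity>"
  proof (rule ccontr)
    assume "(\<integral>\<^sup>+ x. ennreal (exp (h * X x)) \<partial>P) \<noteq> \<infinity>"
    then have "integrable P (\<lambda>x. exp (h * X x))" by (intro integrableI_nonneg) (auto simp: less_top)
    with False show False by simp
  qed
  then show ?thesis by (simp add: log_mgf_def ln_ennreal_def)
qed

lemma AE_X_le: "AE x in P. X x \<le> real N * ln 2"
  using AE_cbe_unit
proof (rule eventually_mono)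
  fix x assume x: "\<forall>i<N. cmod (x i) = 1 \<and> x i \<noteq> 1"
  have "X x \<le> (\<Sum>i<N. ln 2)"
    unfolding log_charpoly_def using x cmod_diff_le_2[of 1] by (intro sum_mono) auto
  then show "X x \<le> real N * ln 2" by simp
qed

end


section \<open>The limiting rate\<close>

definition theta' :: "real \<Rightarrow> real" where "theta' x = 2 * ln (1 + 2 * x) - ln (1 + x) - ln (4 * x)"

lemma DERIV_ln_comp:
  assumes "(u has_real_derivative d) (at x)" "u x > 0"
  shows "((\<lambda>x. ln (u x)) has_real_derivative d / u x) (at x)"
  using assms by (auto intro!: derivative_eq_intros simp: divide_inverse)

lemma xlnx_has_derivative:
  assumes "(u has_real_derivative d) (at x)" "u x > 0"
  shows "((\<lambda>x. u x * ln (u x)) has_real_derivative d * ln (u x) + d) (at x)"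
  by (rule DERIV_cong[OF DERIV_mult[OF assms(1) DERIV_ln_comp[OF assms]]])
     (use assms(2) in simp)

lemma theta_has_derivative:
  assumes "x > 0"
  shows "(theta has_real_derivative theta' x) (at x)"
proof -
  have 1: "((\<lambda>x. (1 + 2 * x) * ln (1 + 2 * x)) has_real_derivative 2 * ln (1 + 2 * x) + 2) (at x)"
    using assms by (intro xlnx_has_derivative) (auto intro!: derivative_eq_intros)
  have 2: "((\<lambda>x. (1 + x) * ln (1 + x)) has_real_derivative 1 * ln (1 + x) + 1) (at x)"
    using assms by (intro xlnx_has_derivative) (auto intro!: derivative_eq_intros)
  have 3: "((\<lambda>x. ln (4 * x)) has_real_derivative 4 / (4 * x)) (at x)"
    using assms by (intro DERIV_ln_comp) (auto intro!: derivative_eq_intros)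
  show ?thesis
    unfolding theta_def[abs_def] theta'_def
    by (rule DERIV_cong[OF DERIV_diff[OF DERIV_diff[OF 1 2] DERIV_mult[OF DERIV_ident 3]]]) (use assms in simp)
qed

text \<open>\<open>(1 + 2 * x)\<^sup>2\<close> exceeds \<open>4 * x * (1 + x)\<close> by exactly
  1.\<close>

lemma theta'_ge: assumes "x > 0" shows "0 < theta' x"
proof -
  have "ln ((1 + x) * (4 * x)) < ln ((1 + 2 * x)\<^sup>2)"
    using assms by (subst ln_less_cancel_iff) (auto simp: power2_eq_square algebra_simps intro!: add_pos_pos mult_pos_pos)
  then show ?thesis using assms by (simp add: theta'_def ln_mult_pos ln_realpow)
qed

lemma theta_0 [simp]: "theta 0 = 0" by (simp add: theta_def)

lemma theta_continuous: "continuous_on {0..} theta"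
  unfolding continuous_on_eq_continuous_within
proof
  fix x :: real assume "x \<in> {0..}"
  show "continuous (at x within {0..}) theta"
  proof (cases "x = 0")
    case True
    have "(theta \<longlongrightarrow> 0) (at_right 0)" unfolding theta_def by real_asymp
    then show ?thesis by (simp add: True continuous_within at_within_Ici_at_right)
  next
    case False
    then have "x > 0" using \<open>x \<in> {0..}\<close> by simp
    then have "isCont theta x" by (rule DERIV_isCont[OF theta_has_derivative])
    then show ?thesis by (rule continuous_at_imp_continuous_at_within)
  qed
qed

lemma theta_strict_mono:
  assumes "0 \<le> x" "x < y"
  shows "theta x < theta y"
proof (rule DERIV_pos_imp_increasing_open[OF assms(2)])
  fix z assume "x < z" "z < y"
  then show "\<exists>d. (theta has_real_derivative d) (at z) \<and> 0 < d"
    using theta_has_derivative[of z] theta'_ge[of z] assms by auto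
next
  show "continuous_on {x..y} theta" using assms by (intro continuous_on_subset[OF theta_continuous]) auto
qed

lemma theta_mono_iff: "0 \<le> x \<Longrightarrow> 0 \<le> y \<Longrightarrow> theta x < theta y \<longleftrightarrow> x < y"
  using theta_strict_mono[of x y] theta_strict_mono[of y x] by (cases x y rule: linorder_cases) auto

text \<open>For large \<open>x\<close> the logarithms in \<open>theta\<close> and
  \<open>rate_I\<close> cancel to leading order. Collecting them into one logarithm of a number
  close to 1 makes the behaviour at infinity visible.\<close>

lemma ln_quotient_identity:
  assumes "(x::real) > 0"
  shows "ln (1 + 1 / (4 * x * (1 + x))) = 2 * ln (1 + 2 * x) - ln (4 * x) - ln (1 + x)"
proof -
  have "1 + 1 / (4 * x * (1 + x)) = (1 + 2 * x)\<^sup>2 / ((4 * x) * (1 + x))"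
    using assms by (simp add: divide_simps add_pos_pos) (simp add: power2_eq_square algebra_simps)
  then have "ln (1 + 1 / (4 * x * (1 + x))) = ln ((1 + 2 * x)\<^sup>2 / ((4 * x) * (1 + x)))" by simp
  also have "\<dots> = ln ((1 + 2 * x)\<^sup>2) - ln ((4 * x) * (1 + x))" using assms by (intro ln_divide_pos) auto
  also have "ln ((4 * x) * (1 + x)) = ln (4 * x) + ln (1 + x)" using assms by (intro ln_mult_pos) auto
  also have "ln ((1 + 2 * x)\<^sup>2) = 2 * ln (1 + 2 * x)" using assms by (simp add: ln_realpow)
  finally show ?thesis by simp
qed

lemma theta_tendsto: "(theta \<longlongrightarrow> ln 2) at_top"
proof -
  have "((\<lambda>x::real. x * ln (1 + 1 / (4 * x * (1 + x))) + ln ((1 + 2 * x) / (1 + x))) \<longlongrightarrow> ln 2) at_top" by real_asymp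
  moreover have "\<forall>\<^sub>F x in at_top. x * ln (1 + 1 / (4 * x * (1 + x))) + ln ((1 + 2 * x) / (1 + x)) = theta x"
    using eventually_gt_at_top[of 0]
  proof eventually_elim
    case (elim x)
    have "x * ln (1 + 1 / (4 * x * (1 + x))) + ln ((1 + 2 * x) / (1 + x))
      = x * (2 * ln (1 + 2 * x) - ln (4 * x) - ln (1 + x)) + (ln (1 + 2 * x) - ln (1 + x))"
      using elim by (simp only: ln_quotient_identity[OF elim]) (simp add: ln_divide_pos)
    also have "\<dots> = theta x" by (simp add: theta_def algebra_simps)
    finally show ?case .
  qed
  ultimately show ?thesis by (rule Lim_transform_eventually)
qed

lemma theta_less: assumes "0 \<le> x" shows "theta x < ln 2"
proof -
  have "theta (x + 1) \<le> ln 2"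
  proof (rule tendsto_lowerbound[OF theta_tendsto])
    show "\<forall>\<^sub>F y in at_top. theta (x + 1) \<le> theta y"
      using eventually_gt_at_top[of "x + 1"] 
    proof eventually_elim
      case (elim y)
      then show ?case using theta_strict_mono[of "x + 1" y] assms by simp
    qed
  qed simp
  then show ?thesis using theta_strict_mono[of x "x + 1"] assms by simp
qed

lemma theta_inj: "inj_on theta {0..}"
  by (rule inj_onI) (metis atLeast_iff less_irrefl linorder_neqE_linordered_idom theta_strict_mono)

lemma theta_image: assumes "0 \<le> a" "a < ln 2" shows "a \<in> theta ` {0..}"
proof -
  have "\<forall>\<^sub>F y in at_top. a < theta y" using theta_tendsto assms by (intro order_tendstoD) auto
  then have "\<forall>\<^sub>F y in at_top. a < theta y \<and> 0 \<le> y" using eventually_ge_at_top[of 0] by eventually_elim auto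
  then obtain y where y: "a < theta y" "0 \<le> y" using eventually_happens'[OF trivial_limit_at_top_linorder] by blast
  have "\<exists>x\<ge>0. x \<le> y \<and> theta x = a"
    using y assms by (intro IVT') (auto intro: continuous_on_subset[OF theta_continuous])
  then show ?thesis by auto
qed

lemma theta_inv:
  assumes "0 \<le> a" "a < ln 2"
  shows "0 \<le> theta_inv a" "theta (theta_inv a) = a"
  unfolding theta_inv_def using theta_image[OF assms] theta_inj
  by (auto intro: f_the_inv_into_f) (use the_inv_into_into[OF theta_inj, of a "{0..}"] in auto)

lemma theta_inv_theta: "0 \<le> x \<Longrightarrow> theta_inv (theta x) = x"
  unfolding theta_inv_def using theta_inj by (intro the_inv_into_f_f) auto

lemma theta_inv_strict_mono:
  assumes "0 \<le> a" "a < c" "c < ln 2"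
  shows "theta_inv a < theta_inv c"
  using theta_inv[of a] theta_inv[of c] theta_mono_iff[of "theta_inv a" "theta_inv c"] assms by auto

lemma theta_inv_0 [simp]: "theta_inv 0 = 0" using theta_inv_theta[of 0] by simp

lemma theta_inv_pos: "0 < a \<Longrightarrow> a < ln 2 \<Longrightarrow> 0 < theta_inv a"
  using theta_inv_strict_mono[of 0 a] by simp

text \<open>As a function of the level \<open>theta x\<close>, the rate has slope
  \<open>2 * x\<close>. It is therefore the Legendre transform, in parametric form and with dual
  variable \<open>2 * x\<close>, of the function \<open>FF\<close> below.\<close>

lemma rate_I_has_derivative:
  assumes "x > 0"
  shows "(rate_I has_real_derivative 2 * x * theta' x) (at x)"
proof -
  have l1: "((\<lambda>x. ln (1 + 2 * x)) has_real_derivative 2 / (1 + 2 * x)) (at x)"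
    using assms by (intro DERIV_ln_comp) (auto intro!: derivative_eq_intros)
  have l2: "((\<lambda>x. ln (1 + x)) has_real_derivative 1 / (1 + x)) (at x)"
    using assms by (intro DERIV_ln_comp) (auto intro!: derivative_eq_intros)
  have l3: "((\<lambda>x. ln (4 * x)) has_real_derivative 4 / (4 * x)) (at x)"
    using assms by (intro DERIV_ln_comp) (auto intro!: derivative_eq_intros)
  have p1: "((\<lambda>x. - ((1 - 4 * x\<^sup>2) / 2)) has_real_derivative 4 * x) (at x)"
    "((\<lambda>x. x\<^sup>2) has_real_derivative 2 * x) (at x)" "((\<lambda>x. 1 - x\<^sup>2) has_real_derivative - 2 * x) (at x)"
    by (auto intro!: derivative_eq_intros)
  have e1: "- ((1 - 4 * x\<^sup>2) / 2) * (2 / (1 + 2 * x)) = 2 * x - 1"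
    using assms by (simp add: divide_simps) (simp add: power2_eq_square algebra_simps)
  have e2: "x\<^sup>2 * (4 / (4 * x)) = x" using assms by (simp add: power2_eq_square)
  have e3: "(1 - x\<^sup>2) * (1 / (1 + x)) = 1 - x"
    using assms by (simp add: divide_simps) (simp add: power2_eq_square algebra_simps)
  have "(rate_I has_real_derivative (4 * x * ln (1 + 2 * x) + 2 / (1 + 2 * x) * (- ((1 - 4 * x\<^sup>2) / 2)))
     - (2 * x * ln (4 * x) + 4 / (4 * x) * x\<^sup>2) + (- 2 * x * ln (1 + x) + 1 / (1 + x) * (1 - x\<^sup>2))) (at x)"
    unfolding rate_I_def[abs_def]
    by (rule DERIV_add[OF DERIV_diff[OF DERIV_mult[OF p1(1) l1] DERIV_mult[OF p1(2) l3]] DERIV_mult[OF p1(3) l2]])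
  moreover have "(4 * x * ln (1 + 2 * x) + 2 / (1 + 2 * x) * (- ((1 - 4 * x\<^sup>2) / 2)))
     - (2 * x * ln (4 * x) + 4 / (4 * x) * x\<^sup>2) + (- 2 * x * ln (1 + x) + 1 / (1 + x) * (1 - x\<^sup>2)) = 2 * x * theta' x"
    unfolding mult.commute[of "2 / (1 + 2 * x)"] mult.commute[of "4 / (4 * x)"] mult.commute[of "1 / (1 + x)"] e1 e2 e3
    by (simp add: theta'_def algebra_simps)
  ultimately show ?thesis by simp
qed

lemma rate_I_0 [simp]: "rate_I 0 = 0" by (simp add: rate_I_def)

lemma rate_I_continuous: "continuous_on {0..} rate_I"
  unfolding continuous_on_eq_continuous_within
proof
  fix x :: real assume "x \<in> {0..}"
  show "continuous (at x within {0..}) rate_I"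
  proof (cases "x = 0")
    case True
    have "(rate_I \<longlongrightarrow> 0) (at_right 0)" unfolding rate_I_def by real_asymp
    then show ?thesis by (simp add: True continuous_within at_within_Ici_at_right)
  next
    case False
    then have "x > 0" using \<open>x \<in> {0..}\<close> by simp
    then have "isCont rate_I x" by (rule DERIV_isCont[OF rate_I_has_derivative])
    then show ?thesis by (rule continuous_at_imp_continuous_at_within)
  qed
qed

lemma rate_I_strict_mono:
  assumes "0 \<le> x" "x < y"
  shows "rate_I x < rate_I y"
proof (rule DERIV_pos_imp_increasing_open[OF assms(2)])
  fix z assume "x < z" "z < y"
  then show "\<exists>d. (rate_I has_real_derivative d) (at z) \<and> 0 < d"
    using rate_I_has_derivative[of z] theta'_ge[of z] assms by auto
next
  show "continuous_on {x..y} rate_I" using assms by (intro continuous_on_subset[OF rate_I_continuous]) auto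
qed

lemma rate_I_nonneg: "0 \<le> x \<Longrightarrow> 0 \<le> rate_I x"
  using rate_I_strict_mono[of 0 x] by (cases "x = 0") auto

lemma rate_I_at_top: "filterlim rate_I at_top at_top"
proof -
  have "filterlim (\<lambda>x::real. x\<^sup>2 * ln (1 + 1 / (4 * x * (1 + x))) + (ln (1 + x) - ln (1 + 2 * x) / 2)) at_top at_top" by real_asymp
  moreover have "\<forall>\<^sub>F x in at_top. x\<^sup>2 * ln (1 + 1 / (4 * x * (1 + x))) + (ln (1 + x) - ln (1 + 2 * x) / 2) = rate_I x"
    using eventually_gt_at_top[of 0]
  proof eventually_elim
    case (elim x)
    have "x\<^sup>2 * ln (1 + 1 / (4 * x * (1 + x))) + (ln (1 + x) - ln (1 + 2 * x) / 2)
      = x\<^sup>2 * (2 * ln (1 + 2 * x) - ln (4 * x) - ln (1 + x)) + (ln (1 + x) - ln (1 + 2 * x) / 2)"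
      by (simp only: ln_quotient_identity[OF elim])
    also have "\<dots> = rate_I x" unfolding rate_I_def by algebra
    finally show ?case .
  qed
  ultimately show ?thesis by (rule filterlim_cong[OF refl refl, THEN iffD1, rotated])
qed

text \<open>The limit of \<open>Lam N b (2 * b * x * N) / (b * N\<^sup>2)\<close>, see
  \<open>Lam_FF_bound\<close>.\<close>

definition FF :: "real \<Rightarrow> real" where "FF x = 2 * x * theta x - rate_I x"

lemma FF_has_derivative: "x > 0 \<Longrightarrow> (FF has_real_derivative 2 * theta x) (at x)"
  unfolding FF_def[abs_def]
  by (auto intro!: derivative_eq_intros theta_has_derivative rate_I_has_derivative simp: algebra_simps)

lemma FF_continuous: "continuous_on {0..} FF"
  unfolding FF_def[abs_def] by (intro continuous_intros theta_continuous rate_I_continuous)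

section \<open>Comparison of the moment generating function with its limit\<close>

lemma sum_inverse_sqrt_le: "(\<Sum>j<N. 1 / sqrt (real j + 1)) \<le> 2 * sqrt (real N)"
proof (induction N)
  case (Suc N)
  have "1 / sqrt (real N + 1) \<le> 2 * sqrt (real N + 1) - 2 * sqrt (real N)"
  proof -
    have key: "1 / u \<le> 2 * u - 2 * v" if uv: "0 < u" "u\<^sup>2 = v\<^sup>2 + 1" for u v :: real
    proof -
      have "2 * u * v \<le> u\<^sup>2 + v\<^sup>2" by (rule sum_squares_bound)
      then have "1 \<le> (2 * u - 2 * v) * u" using uv(2) by (simp only: left_diff_distrib power2_eq_square) (simp add: mult_ac)
      then show ?thesis using uv(1) by (simp only: divide_le_eq if_True)
    qed
    show ?thesis by (rule key) simp_all
  qed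
  then show ?case using Suc by (simp add: add.commute)
qed simp

text \<open>The Riemann sum of a decreasing function whose total variation is at most ln 2.\<close>

lemma theta_riemann_sum:
  assumes N: "N \<ge> 1" and y: "y > 0"
  shows "\<bar>(\<Sum>j<N. ln (2 * y + real j / N) - ln (y + real j / N)) - real N * theta y\<bar> \<le> ln 2"
proof -
  define k where "k t = ln (2 * y + t) - ln (y + t)" for t
  \<comment> \<open>A primitive of \<open>k\<close> whose increment over \<open>[0, 1]\<close> is
    \<open>theta y\<close>.\<close>
  define K where "K t = (2 * y + t) * ln (2 * y + t) - (y + t) * ln (y + t)" for t
  have dK: "(K has_real_derivative k t) (at t)" if "t \<ge> 0" for t
  proof -
    have "((\<lambda>t. (2 * y + t) * ln (2 * y + t)) has_real_derivative 1 * ln (2 * y + t) + 1) (at t)"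
      using that y by (intro xlnx_has_derivative[of "\<lambda>t. 2 * y + t"]) (auto intro!: derivative_eq_intros)
    moreover have "((\<lambda>t. (y + t) * ln (y + t)) has_real_derivative 1 * ln (y + t) + 1) (at t)"
      using that y by (intro xlnx_has_derivative[of "\<lambda>t. y + t"]) (auto intro!: derivative_eq_intros)
    ultimately show ?thesis
      unfolding K_def k_def by (rule DERIV_cong[OF DERIV_diff]) simp
  qed
  have k_anti: "k t \<le> k s" if "0 \<le> s" "s \<le> t" for s t
  proof -
    have "(2 * y + t) / (y + t) \<le> (2 * y + s) / (y + s)" using that y by (simp add: divide_simps) (simp add: algebra_simps)
    then have "ln ((2 * y + t) / (y + t)) \<le> ln ((2 * y + s) / (y + s))"
      using that y by (subst ln_le_cancel_iff) auto
    then show ?thesis using that y by (simp add: k_def ln_divide_pos)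
  qed
  have k0: "k 0 = ln 2" using y by (simp add: k_def ln_mult_pos)
  have k1: "k 1 \<ge> 0" using y by (simp add: k_def)
  \<comment> \<open>The mean value theorem puts the increment of \<open>K\<close> over one cell
    between the values of \<open>k\<close> at its ends, so the sum and the integral differ by at
    most \<open>k 0 - k 1\<close>.\<close>
  have step: "real N * (K (real (Suc j) / N) - K (real j / N)) \<le> k (real j / N)" "k (real (Suc j) / N) \<le> real N * (K (real (Suc j) / N) - K (real j / N))" for j
  proof -
    have lt: "real j / N < real (Suc j) / N" using N by (simp add: divide_strict_right_mono)
    obtain z where z: "real j / N < z" "z < real (Suc j) / N" "K (real (Suc j) / N) - K (real j / N) = (real (Suc j) / N - real j / N) * k z"
      using MVT2[OF lt, of K k] dK by (metis divide_nonneg_nonneg of_nat_0_le_iff order_trans)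
    have "(real (Suc j) / N - real j / N) = 1 / N" by (simp add: diff_divide_distrib[symmetric])
    then have e: "real N * (K (real (Suc j) / N) - K (real j / N)) = k z" using z(3) N by simp
    have z0: "0 \<le> real j / N" by simp
    show "real N * (K (real (Suc j) / N) - K (real j / N)) \<le> k (real j / N)" "k (real (Suc j) / N) \<le> real N * (K (real (Suc j) / N) - K (real j / N))"
      unfolding e using z z0 by (intro k_anti; linarith)+
  qed
  have tel: "(\<Sum>j<N. real N * (K (real (Suc j) / N) - K (real j / N))) = real N * (K 1 - K 0)"
    using N sum_lessThan_telescope[of "\<lambda>j. K (real j / N)" N] by (simp add: sum_distrib_left[symmetric])
  have l4: "ln 4 = 2 * ln (2::real)" using ln_realpow[of "2::real" 2] by simp
  have th: "K 1 - K 0 = theta y"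
    using y by (simp add: K_def theta_def ln_mult_pos l4 algebra_simps)
  have "real N * theta y \<le> (\<Sum>j<N. k (real j / N))"
    unfolding th[symmetric] tel[symmetric] by (intro sum_mono step)
  moreover have "(\<Sum>j<N. k (real (Suc j) / N)) \<le> real N * theta y"
    unfolding th[symmetric] tel[symmetric] by (intro sum_mono step)
  moreover have "(\<Sum>j<N. k (real j / N)) - (\<Sum>j<N. k (real (Suc j) / N)) = k 0 - k 1"
    using sum_lessThan_telescope'[of "\<lambda>j. k (real j / N)" N] N by (simp add: sum_subtractf)
  ultimately show ?thesis using k0 k1 by (simp add: k_def[symmetric])
qed

text \<open>The constant of \<open>Lam1_theta_bound\<close>: the numerator bounds the error of one
  summand, the denominator comes from the arithmetic-geometric mean inequality used there.\<close>

definition KK :: "real \<Rightarrow> real" where "KK b = (2 * (1 + b) / b + 2) / sqrt (min 1 b * b)"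

lemma KK_pos: "b > 0 \<Longrightarrow> KK b > 0" unfolding KK_def by (intro divide_pos_pos add_pos_pos) auto

lemma divide_le_divide: "0 < p \<Longrightarrow> 0 < q \<Longrightarrow> c * q \<le> k * p \<Longrightarrow> c / p \<le> k / (q::real)"
  by (simp add: field_simps)

text \<open>With \<open>s = h / 2\<close>, replacing Digamma by \<open>ln\<close> costs at most
  \<open>C / (1 + j * b + s)\<close> in the summand \<open>j\<close>. Splitting this denominator by
  the arithmetic-geometric mean inequality leaves a sum of \<open>1 / sqrt (j + 1)\<close>, of order
  \<open>sqrt N\<close>, which the factor \<open>1 / sqrt s\<close> compensates.\<close>

lemma Lam1_theta_bound:
  assumes b: "b > 0" and N: "N \<ge> 1" and y: "y > 0"
  shows "\<bar>Lam1 N b (2 * b * y * N) - real N * theta y\<bar> \<le> KK b / sqrt y + ln 2"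
proof -
  define s where "s = b * y * N"
  have s: "s > 0" using b N y by (simp add: s_def)
  define C where "C = 2 * (1 + b) / b + 2"
  define m where "m = min 1 b"
  have m: "m > 0" using b by (simp add: m_def)
  have C: "C > 0" unfolding C_def using b by (intro add_pos_pos divide_pos_pos) auto
  define trm where "trm j = ln 2 + (Digamma (ee b j + s) + Digamma (ee b j + 1 / 2 + s)) / 2 - Digamma (2 * ee b j + s)" for j
  define T where "T j = ln (2 * y + real j / N) - ln (y + real j / N)" for j
  have T_eq: "T j = ln (2 * s + j * b) - ln (s + j * b)" for j
  proof -
    have "2 * s + j * b = (b * N) * (2 * y + real j / N)" "s + j * b = (b * N) * (y + real j / N)"
      using N by (simp_all add: s_def field_simps)
    moreover have "2 * y + real j / N > 0" "y + real j / N > 0" "b * N > 0" using y b N by (simp_all add: add_pos_nonneg)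
    ultimately show ?thesis by (simp only: ln_mult_pos T_def)
  qed
  have err: "\<bar>trm j - T j\<bar> \<le> C / (1 + j * b + s)" for j :: nat
  proof -
    have e: "ee b j \<ge> 1 / 2" using ee_ge[OF b, of j] .
    have e2: "2 * ee b j = 1 + j * b" by (simp add: ee_def)
    have p: "0 < ee b j + s" "0 < ee b j + 1 / 2 + s" "0 < 2 * ee b j + s" using e s by auto
    have mono: "Digamma (ee b j + s) \<le> Digamma (ee b j + 1 / 2 + s)" using p by (intro Digamma_real_mono) auto
    have jb: "real j * b \<ge> 0" using b by simp
    have inv: "1 / (ee b j + s) \<le> 2 / (1 + j * b + s)"
      using e s e2 jb by (simp add: divide_simps)
    have jb1: "1 + j * b \<le> (1 + b) / b * (j * b)" if "j \<ge> 1"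
    proof -
      have "1 \<le> real j" using that by simp
      then show ?thesis using b by (simp add: field_simps)
    qed
    have l2: "ln 2 + ln (ee b j + 1 / 2 + s) = ln (2 * s + j * b + 2)" "ln 2 + ln (ee b j + s) = ln (2 * s + j * b + 1)"
      using p by (simp_all add: ln_mult_pos[symmetric] ee_def) (simp_all add: field_simps)
    have lower: "T j - trm j \<le> C / (1 + j * b + s)"
    proof -
      have "trm j \<ge> ln 2 + ln (ee b j + s) - 1 / (ee b j + s) - ln (2 * ee b j + s)"
        using mono Digamma_real_bounds(2)[OF p(1)] Digamma_real_bounds(1)[OF p(3)] by (simp add: trm_def field_simps)
      then have tr: "trm j \<ge> ln (2 * s + j * b + 1) - 1 / (ee b j + s) - ln (1 + j * b + s)" by (simp add: l2 e2)
      show ?thesis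
      \<comment> \<open>For \<open>j = 0\<close> the ratio of \<open>1 + s\<close> to
        \<open>s\<close> is unbounded as \<open>s\<close> tends to 0. But then \<open>T j\<close> is
        exactly \<open>ln 2\<close>, and only two Digamma values at distance \<open>1 / 2\<close>
        are left to compare.\<close>
      proof (cases "j = 0")
        case True
        have "trm j = ln 2 + (Digamma (1 / 2 + s) - Digamma (1 + s)) / 2" by (simp add: trm_def True ee_def field_simps)
        moreover have "T j = ln 2" using T_eq[of j] True s by (simp add: ln_mult_pos)
        moreover have "Digamma (1 + s) - Digamma (1 / 2 + s) \<le> 2 * (2 / (1 + s))"
        proof -
          have "Digamma (1 + s) - Digamma (1 / 2 + s) \<le> ln (1 + s) - ln (1 / 2 + s) + 1 / (1 / 2 + s)"
            using Digamma_real_bounds(1)[of "1 + s"] Digamma_real_bounds(2)[of "1 / 2 + s"] s by simp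
          also have "ln (1 + s) - ln (1 / 2 + s) \<le> ((1 + s) - (1 / 2 + s)) / (1 / 2 + s)"
            using s by (intro ln_diff_le; simp)
          also have "((1 + s) - (1 / 2 + s)) / (1 / 2 + s) + 1 / (1 / 2 + s) = (3 / 2) / (1 / 2 + s)" using s by (simp add: field_simps)
          also have "\<dots> \<le> 2 * (2 / (1 + s))" using s by (simp add: divide_simps)
          finally show ?thesis by simp
        qed
        moreover have "2 / (1 + s) \<le> C / (1 + s)" using s b by (intro divide_right_mono) (auto simp: C_def)
        ultimately show ?thesis using True by (simp add: field_simps)
      next
        case False
        then have j: "j \<ge> 1" by simp
        have jbp: "s + j * b > 0" using s jb by simp
        have "T j - trm j \<le> (ln (2 * s + j * b) - ln (2 * s + j * b + 1)) + (ln (1 + j * b + s) - ln (s + j * b)) + 1 / (ee b j + s)"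
          using tr by (simp add: T_eq)
        also have "ln (2 * s + j * b) - ln (2 * s + j * b + 1) \<le> 0" using s jb by simp
        also have "ln (1 + j * b + s) - ln (s + j * b) \<le> (1 + j * b + s - (s + j * b)) / (s + j * b)"
          using jbp by (intro ln_diff_le; simp)
        also have "(1 + j * b + s - (s + j * b)) / (s + j * b) = 1 / (s + j * b)" by simp
        also have "1 / (s + j * b) \<le> ((1 + b) / b) / (1 + j * b + s)"
        proof -
          have "1 + j * b + s \<le> (1 + b) / b * (j * b) + (1 + b) / b * s"
            using jb1[OF j] s b by (intro add_mono) (auto simp: field_simps)
          then have "1 * (1 + j * b + s) \<le> (1 + b) / b * (s + j * b)" by (simp add: algebra_simps)
          moreover have "0 < 1 + j * b + s" using jb s by simp
          ultimately show ?thesis using jbp by (intro divide_le_divide)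
        qed
        also note inv
        finally have "T j - trm j \<le> ((1 + b) / b + 2) / (1 + j * b + s)" by (simp add: add_divide_distrib)
        also have "\<dots> \<le> C / (1 + j * b + s)" using b s jb by (intro divide_right_mono) (auto simp: C_def field_simps)
        finally show ?thesis .
      qed
    qed
    have upper: "trm j - T j \<le> C / (1 + j * b + s)"
    proof (cases "j = 0")
      case True
      have "trm j \<le> ln 2"
        using Digamma_real_mono[of "1 / 2 + s" "1 + s"] s by (simp add: trm_def True ee_def add.commute field_simps)
      moreover have "T j = ln 2" using T_eq[of j] True s by (simp add: ln_mult_pos)
      moreover have "0 \<le> C / (1 + j * b + s)" using C s jb by (intro divide_nonneg_nonneg) auto
      ultimately show ?thesis by simp
    next
      case False
      then have j: "j \<ge> 1" by simp
      have jbp: "2 * s + j * b > 0" "s + j * b > 0" using s jb by auto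
      have "trm j \<le> ln 2 + ln (ee b j + 1 / 2 + s) - ln (2 * ee b j + s) + 1 / (2 * ee b j + s)"
        using mono Digamma_real_bounds(1)[OF p(2)] Digamma_real_bounds(2)[OF p(3)] by (simp add: trm_def field_simps)
      then have "trm j - T j \<le> (ln (2 * s + j * b + 2) - ln (2 * s + j * b)) + (ln (s + j * b) - ln (1 + j * b + s)) + 1 / (1 + j * b + s)"
        by (simp add: T_eq l2 e2)
      also have "ln (s + j * b) - ln (1 + j * b + s) \<le> 0" using jbp by simp
      also have "ln (2 * s + j * b + 2) - ln (2 * s + j * b) \<le> (2 * s + j * b + 2 - (2 * s + j * b)) / (2 * s + j * b)"
        using jbp by (intro ln_diff_le; simp)
      also have "(2 * s + j * b + 2 - (2 * s + j * b)) / (2 * s + j * b) = 2 / (2 * s + j * b)" by simp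
      also have "2 / (2 * s + j * b) \<le> (2 * (1 + b) / b) / (1 + j * b + s)"
      proof -
        have "1 + j * b + s \<le> (1 + b) / b * (j * b) + (1 + b) / b * (2 * s)"
          using jb1[OF j] s b by (intro add_mono) (auto simp: field_simps)
        then have "1 + j * b + s \<le> (1 + b) / b * (2 * s + j * b)" by (simp only: distrib_left)
        then have "2 * (1 + j * b + s) \<le> 2 * ((1 + b) / b * (2 * s + j * b))" by (rule mult_left_mono) simp
        also have "\<dots> = (2 * (1 + b) / b) * (2 * s + j * b)" by simp
        finally have "2 * (1 + j * b + s) \<le> (2 * (1 + b) / b) * (2 * s + j * b)" .
        moreover have "0 < 1 + j * b + s" using jb s by simp
        ultimately show ?thesis using jbp(1) by (intro divide_le_divide)
      qed
      finally have "trm j - T j \<le> (2 * (1 + b) / b + 1) / (1 + j * b + s)" by (simp add: add_divide_distrib)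
      also have "\<dots> \<le> C / (1 + j * b + s)" using b s jb by (intro divide_right_mono) (auto simp: C_def)
      finally show ?thesis .
    qed
    show ?thesis using lower upper by (simp add: abs_le_iff)
  qed
  have each: "C / (1 + j * b + s) \<le> C / (2 * sqrt (m * s)) * (1 / sqrt (real j + 1))" for j :: nat
  proof -
    have 1: "m * (real j + 1) \<le> 1 + j * b"
    proof -
      have "m * real j \<le> b * real j" "m \<le> 1" by (auto simp: m_def intro: mult_right_mono)
      then show ?thesis by (simp add: algebra_simps)
    qed
    have "2 * sqrt ((m * (real j + 1)) * s) \<le> m * (real j + 1) + s"
      using arith_geo_mean_sqrt[of "m * (real j + 1)" s] m s by simp
    also have "\<dots> \<le> 1 + j * b + s" using 1 by simp
    finally have "2 * sqrt (m * s) * sqrt (real j + 1) \<le> 1 + j * b + s" by (simp add: real_sqrt_mult mult_ac)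
    moreover have "0 < 2 * sqrt (m * s) * sqrt (real j + 1)" using m s by simp
    ultimately have "C / (1 + j * b + s) \<le> C / (2 * sqrt (m * s) * sqrt (real j + 1))"
      using C by (intro frac_le) simp_all
    then show ?thesis by simp
  qed
  have "\<bar>(\<Sum>j<N. trm j) - (\<Sum>j<N. T j)\<bar> \<le> (\<Sum>j<N. C / (2 * sqrt (m * s)) * (1 / sqrt (real j + 1)))"
    unfolding sum_subtractf[symmetric] by (intro order_trans[OF sum_abs] sum_mono order_trans[OF err each])
  also have "\<dots> = C / (2 * sqrt (m * s)) * (\<Sum>j<N. 1 / sqrt (real j + 1))" by (simp only: sum_distrib_left)
  also have "\<dots> \<le> C / (2 * sqrt (m * s)) * (2 * sqrt (real N))"
    using C m s by (intro mult_left_mono sum_inverse_sqrt_le) auto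
  also have "\<dots> = KK b / sqrt y"
  proof -
    have K: "KK b = C / sqrt (m * b)" by (simp only: KK_def C_def m_def)
    show ?thesis unfolding K s_def using N y b m by (simp add: real_sqrt_mult mult_ac)
  qed
  finally have "\<bar>(\<Sum>j<N. trm j) - (\<Sum>j<N. T j)\<bar> \<le> KK b / sqrt y" .
  moreover have "Lam1 N b (2 * b * y * N) = (\<Sum>j<N. trm j)"
  proof -
    have "2 * b * y * N / 2 = s" by (simp add: s_def)
    then show ?thesis by (simp only: Lam1_def trm_def)
  qed
  ultimately show ?thesis using theta_riemann_sum[OF N y] by (simp add: T_def)
qed

text \<open>\<open>B\<close> is the integral from 0 of the bound in \<open>Lam1_theta_bound\<close>,
  the singularity \<open>1 / sqrt y\<close> being integrable. Since \<open>D\<close> and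
  \<open>B\<close> vanish at 0, monotonicity of \<open>B - D\<close> and \<open>B + D\<close> does
  the integration.\<close>

lemma Lam_FF_bound:
  assumes b: "b > 0" and N: "N \<ge> 1" and x: "x \<ge> 0"
  shows "\<bar>Lam N b (2 * b * x * N) - (real N)\<^sup>2 * b * FF x\<bar> \<le> 2 * b * real N * (2 * KK b * sqrt x + x * ln 2)"
proof (cases "x = 0")
  case True
  then show ?thesis by (simp add: Lam_0 FF_def)
next
  case False
  then have x0: "x > 0" using x by simp
  define D where "D y = Lam N b (2 * b * y * N) - (real N)\<^sup>2 * b * FF y" for y
  define B where "B y = 2 * b * real N * (2 * KK b * sqrt y + y * ln 2)" for y
  define D' where "D' y = 2 * b * real N * (Lam1 N b (2 * b * y * N) - real N * theta y)" for y
  define B' where "B' y = 2 * b * real N * (KK b / sqrt y + ln 2)" for y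
  have dD: "(D has_real_derivative D' y) (at y)" if "y > 0" for y
  proof -
    have "2 * b * y * N > -1" using b that by (simp add: less_le_trans[of "-1" 0])
    then have L: "((\<lambda>y. Lam N b (2 * b * y * N)) has_real_derivative Lam1 N b (2 * b * y * N) * (2 * b * N)) (at y)"
      by (intro DERIV_chain2[where f = "Lam N b" and g = "\<lambda>y. 2 * b * y * N"] Lam_has_derivative[OF b])
         (auto intro!: derivative_eq_intros)
    show ?thesis
      unfolding D_def[abs_def] D'_def
      by (rule DERIV_cong[OF DERIV_diff[OF L DERIV_cmult[OF FF_has_derivative[OF that]]]])
         (simp add: algebra_simps power2_eq_square)
  qed
  have dB: "(B has_real_derivative B' y) (at y)" if "y > 0" for y
    unfolding B_def[abs_def] B'_def using that by (auto intro!: derivative_eq_intros simp: field_simps)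
  have le: "\<bar>D' y\<bar> \<le> B' y" if "y > 0" for y
    unfolding D'_def B'_def abs_mult using Lam1_theta_bound[OF b N that] b by (intro mult_mono) auto
  have contD: "continuous_on {0..x} D"
    unfolding D_def[abs_def]
  proof (intro continuous_intros)
    show "continuous_on {0..x} (\<lambda>y. Lam N b (2 * b * y * real N))"
    proof (rule continuous_on_compose2[of "{0..}" "Lam N b"])
      show "continuous_on {0..} (Lam N b)"
        using DERIV_isCont[OF Lam_has_derivative[OF b]] by (intro continuous_at_imp_continuous_on ballI) simp
    qed (use b in \<open>auto intro!: continuous_intros\<close>)
    show "continuous_on {0..x} FF" by (rule continuous_on_subset[OF FF_continuous]) auto
  qed
  have contB: "continuous_on {0..x} B" unfolding B_def[abs_def] by (intro continuous_intros)
  have z: "D 0 = 0" "B 0 = 0" by (simp_all add: D_def B_def Lam_0 FF_def)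
  have "B 0 - D 0 \<le> B x - D x"
  proof (rule DERIV_nonneg_imp_increasing_open[OF x])
    fix y assume y: "0 < y" "y < x"
    show "\<exists>d. ((\<lambda>y. B y - D y) has_real_derivative d) (at y) \<and> 0 \<le> d"
      using le[OF y(1)] by (intro exI[of _ "B' y - D' y"] conjI DERIV_diff dB dD y) auto
  qed (intro continuous_intros contB contD)
  moreover have "B 0 + D 0 \<le> B x + D x"
  proof (rule DERIV_nonneg_imp_increasing_open[OF x])
    fix y assume y: "0 < y" "y < x"
    show "\<exists>d. ((\<lambda>y. B y + D y) has_real_derivative d) (at y) \<and> 0 \<le> d"
      using le[OF y(1)] by (intro exI[of _ "B' y + D' y"] conjI DERIV_add dB dD y) auto
  qed (intro continuous_intros contB contD)
  ultimately have "\<bar>D x\<bar> \<le> B x" using z by (simp add: abs_le_iff)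
  then show ?thesis by (simp add: D_def B_def)
qed

section \<open>The saddle point and the conjugate function\<close>

lemma Lam1_solution:
  assumes b: "b > 0" and N: "N \<ge> 1" and a: "0 \<le> a" "a < ln 2"
  shows "\<exists>h\<ge>0. Lam1 N b h = a * real N"
proof -
  have "a * real N < real N * ln 2" using N a by simp
  then obtain h where h: "h > 0" "a * real N < Lam1 N b h" using Lam1_tendsto[OF b] by blast
  have "\<exists>x\<ge>0. x \<le> h \<and> Lam1 N b x = a * real N"
  proof (rule IVT')
    show "Lam1 N b 0 \<le> a * real N" using a by (simp add: Lam1_0[OF b])
    show "continuous_on {0..h} (Lam1 N b)"
      using DERIV_isCont[OF Lam1_has_derivative[OF b]] by (intro continuous_at_imp_continuous_on ballI) simp
  qed (use h in auto)
  then show ?thesis by blast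
qed

definition hsol :: "nat \<Rightarrow> real \<Rightarrow> real \<Rightarrow> real" where
  "hsol N b a = (SOME h. h \<ge> 0 \<and> Lam1 N b h = a * real N)"

lemma hsol:
  assumes "b > 0" "N \<ge> 1" "0 \<le> a" "a < ln 2"
  shows "0 \<le> hsol N b a" "Lam1 N b (hsol N b a) = a * real N"
  using someI_ex[OF Lam1_solution[OF assms, unfolded Bex_def]] by (simp_all add: hsol_def)

text \<open>\<open>Lam1 N b (2 * b * y * N)\<close> is \<open>N * theta y\<close> up to a bounded
  error, hence for large \<open>N\<close> on a definite side of \<open>a * N\<close>; monotonicity
  of \<open>Lam1\<close> then locates the saddle point.\<close>

lemma hsol_eventually:
  assumes b: "b > 0" and a: "0 < a" "a < ln 2" and y: "0 < y1" "y1 < theta_inv a" "theta_inv a < y2"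
  shows "\<forall>\<^sub>F N in sequentially. 2 * b * y1 * real N \<le> hsol N b a \<and> hsol N b a \<le> 2 * b * y2 * real N"
proof -
  define x where "x = theta_inv a"
  have x: "0 \<le> x" "theta x = a" unfolding x_def using a by (auto intro: theta_inv)
  have t1: "theta y1 < a" and t2: "a < theta y2"
    using theta_strict_mono[of y1 x] theta_strict_mono[of x y2] y x by (auto simp: x_def)
  have e1: "\<forall>\<^sub>F N in sequentially. KK b / sqrt y1 + ln 2 < (a - theta y1) * real N"
    using t1 by real_asymp
  have e2: "\<forall>\<^sub>F N in sequentially. KK b / sqrt y2 + ln 2 < (theta y2 - a) * real N"
    using t2 by real_asymp
  show ?thesis
    using e1 e2 eventually_ge_at_top[of 1]
  proof eventually_elim
    case (elim N)
    note h = hsol[OF b elim(3), of a]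
    have "Lam1 N b (2 * b * y1 * N) < a * real N"
      using Lam1_theta_bound[OF b elim(3) y(1)] elim(1) by (simp add: abs_le_iff algebra_simps)
    then have 1: "\<not> hsol N b a < 2 * b * y1 * N"
      using Lam1_mono[OF b, of "hsol N b a" "2 * b * y1 * N" N] h a by auto
    have "a * real N < Lam1 N b (2 * b * y2 * N)"
      using Lam1_theta_bound[OF b elim(3), of y2] elim(2) y x by (simp add: abs_le_iff algebra_simps x_def)
    moreover have "2 * b * y2 * N > -1" using b y x by (simp add: less_le_trans[of "-1" 0] x_def)
    ultimately have 2: "\<not> 2 * b * y2 * N < hsol N b a"
      using Lam1_mono[OF b, of "2 * b * y2 * N" "hsol N b a" N] h a by auto
    show ?case using 1 2 by simp
  qed
qed

text \<open>The asymptotics handle all but finitely many \<open>N\<close>, and a maximum over the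
  remaining ones is absorbed in \<open>C\<close> because \<open>N \<ge> 1\<close>.\<close>

lemma hsol_linear_bound:
  assumes b: "b > 0" and a: "0 < a" "a < ln 2"
  shows "\<exists>C. \<forall>N\<ge>1. hsol N b a \<le> C * real N"
proof -
  define x where "x = theta_inv a"
  have x: "x > 0" unfolding x_def by (rule theta_inv_pos[OF a])
  obtain N0 where N0: "\<And>N. N \<ge> N0 \<Longrightarrow> hsol N b a \<le> 2 * b * (2 * x) * real N"
    using hsol_eventually[OF b a, of "x / 2" "2 * x"] x by (auto simp: x_def eventually_sequentially)
  define C where "C = Max (insert (2 * b * (2 * x)) ((\<lambda>N. hsol N b a) ` {..N0}))"
  have C1: "2 * b * (2 * x) \<le> C" unfolding C_def by (intro Max_ge) auto
  have C2: "hsol N b a \<le> C" if "N \<le> N0" for N unfolding C_def using that by (intro Max_ge) auto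
  have C0: "C \<ge> 0" using C1 b x by (meson mult_nonneg_nonneg less_imp_le order_trans zero_le_numeral)
  have "hsol N b a \<le> C * real N" if N: "N \<ge> 1" for N
  proof (cases "N \<ge> N0")
    case True
    have "2 * b * (2 * x) * real N \<le> C * real N" using C1 by (intro mult_right_mono) auto
    then show ?thesis using N0[OF True] by simp
  next
    case False
    have "C * 1 \<le> C * real N" using N C0 by (intro mult_left_mono) auto
    then show ?thesis using C2[of N] False by simp
  qed
  then show ?thesis by blast
qed

text \<open>The conjugate at level \<open>a * N\<close>, evaluated at the saddle point;
  \<open>log_mgf_conj_eq\<close> identifies it with the supremum over all real
  \<open>h\<close>.\<close>

definition Lam_conj :: "nat \<Rightarrow> real \<Rightarrow> real \<Rightarrow> real" where
  "Lam_conj N b a = a * real N * hsol N b a - Lam N b (hsol N b a)"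

lemma Lam_supporting:
  assumes b: "b > 0" and h: "h0 > -1" "h > -1"
  shows "Lam N b h0 + (h - h0) * Lam1 N b h0 \<le> Lam N b h"
proof -
  have "Lam1 N b h0 * (h - h0) \<le> Lam N b h - Lam N b h0"
  proof (rule convex_on_imp_above_tangent[OF Lam_convex[OF b]])
    show "connected ({-1<..} :: real set)" by (intro convex_connected) auto
    show "h0 \<in> interior {-1<..}" using h by (simp add: interior_open)
    show "h \<in> {-1<..}" using h by simp
    show "(Lam N b has_real_derivative Lam1 N b h0) (at h0 within {-1<..})"
      using Lam_has_derivative[OF b h(1)] by (rule has_field_derivative_at_within)
  qed
  then show ?thesis by (simp add: algebra_simps)
qed

lemma Lam_conj_ge:
  assumes "b > 0" "N \<ge> 1" "0 \<le> a" "a < ln 2" "h > -1"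
  shows "a * real N * h - Lam N b h \<le> Lam_conj N b a"
  using Lam_supporting[of b "hsol N b a" h N] hsol[of b N a] assms by (simp add: Lam_conj_def algebra_simps)

text \<open>The saddle point is compared with the explicit \<open>h0 = 2 * b * x * N\<close>. From
  below any trial value will do. From above, the supporting line at \<open>h0\<close> costs the
  product of \<open>h - h0\<close>, of order \<open>N\<close>, and the bounded error of
  \<open>Lam1\<close> at \<open>h0\<close>.\<close>

lemma Lam_conj_asymp:
  assumes b: "b > 0" and a: "0 < a" "a < ln 2"
  shows "\<exists>C. \<forall>N\<ge>1. \<bar>Lam_conj N b a - (real N)\<^sup>2 * b * rate_I (theta_inv a)\<bar> \<le> C * real N"
proof -
  define x where "x = theta_inv a"
  have x: "x > 0" unfolding x_def by (rule theta_inv_pos[OF a])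
  have th: "theta x = a" unfolding x_def using a by (intro theta_inv) auto
  obtain C0 where C0: "\<And>N. N \<ge> 1 \<Longrightarrow> hsol N b a \<le> C0 * real N" using hsol_linear_bound[OF b a] by blast
  define E1 where "E1 = 2 * b * (2 * KK b * sqrt x + x * ln 2)"
  define E2 where "E2 = KK b / sqrt x + ln 2"
  have E2: "E2 \<ge> 0" using KK_pos[OF b] x by (simp add: E2_def)
  define C where "C = E1 + (\<bar>C0\<bar> + 2 * b * x) * E2"
  have "\<bar>Lam_conj N b a - (real N)\<^sup>2 * b * rate_I x\<bar> \<le> C * real N" if N: "N \<ge> 1" for N
  proof -
    define h0 where "h0 = 2 * b * x * N"
    define h where "h = hsol N b a"
    have h0: "h0 > -1" "h0 \<ge> 0" using b x by (simp_all add: h0_def less_le_trans[of "-1" 0])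
    have h: "0 \<le> h" "Lam1 N b h = a * real N" "h \<le> C0 * real N"
      unfolding h_def using hsol[OF b N, of a] a C0[OF N] by auto
    have g0: "\<bar>(a * real N * h0 - Lam N b h0) - (real N)\<^sup>2 * b * rate_I x\<bar> \<le> E1 * real N"
    proof -
      have "(a * real N * h0 - Lam N b h0) - (real N)\<^sup>2 * b * rate_I x = - (Lam N b h0 - (real N)\<^sup>2 * b * FF x)"
        by (simp add: FF_def th h0_def algebra_simps power2_eq_square)
      then show ?thesis using Lam_FF_bound[OF b N, of x] x by (simp add: h0_def E1_def algebra_simps)
    qed
    have lo: "a * real N * h0 - Lam N b h0 \<le> Lam_conj N b a" using a h0 by (intro Lam_conj_ge b N) auto
    have d: "\<bar>a * real N - Lam1 N b h0\<bar> \<le> E2"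
      using Lam1_theta_bound[OF b N x] by (simp add: h0_def th E2_def abs_minus_commute algebra_simps)
    have "Lam_conj N b a \<le> (a * real N * h0 - Lam N b h0) + (h - h0) * (a * real N - Lam1 N b h0)"
      using Lam_supporting[OF b h0(1), of h N] h unfolding Lam_conj_def h_def[symmetric] by (simp add: algebra_simps)
    also have "(h - h0) * (a * real N - Lam1 N b h0) \<le> ((\<bar>C0\<bar> + 2 * b * x) * real N) * E2"
    proof -
      have "h \<le> \<bar>C0\<bar> * real N" using h(3) by (meson abs_ge_self mult_right_mono of_nat_0_le_iff order_trans)
      then have "\<bar>h - h0\<bar> \<le> (\<bar>C0\<bar> + 2 * b * x) * real N" using h h0 by (simp add: h0_def abs_le_iff algebra_simps)
      then have "\<bar>h - h0\<bar> * \<bar>a * real N - Lam1 N b h0\<bar> \<le> ((\<bar>C0\<bar> + 2 * b * x) * real N) * E2"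
        using d b x by (intro mult_mono) simp_all
      then show ?thesis using abs_ge_self[of "(h - h0) * (a * real N - Lam1 N b h0)"] unfolding abs_mult by (rule order_trans[rotated])
    qed
    finally have hi: "Lam_conj N b a \<le> (a * real N * h0 - Lam N b h0) + ((\<bar>C0\<bar> + 2 * b * x) * real N) * E2" by simp
    have "0 \<le> ((\<bar>C0\<bar> + 2 * b * x) * real N) * E2" using b x E2 by simp
    then show ?thesis using g0 lo hi by (simp add: C_def abs_le_iff algebra_simps)
  qed
  then show ?thesis by (auto simp: x_def)
qed


section \<open>The case of beta two\<close>

text \<open>
  Up to a constant and a linear term, \<open>Bf z\<close> is the asymptotic expansion of the logarithm of the Barnes
  function at \<open>z + 1\<close>.
\<close>

definition Bf :: "real \<Rightarrow> real" where "Bf z = z\<^sup>2 / 2 * ln z - ln z / 12 - 3 / 4 * z\<^sup>2"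

text \<open>The defect of \<open>Bf\<close> in the recursion satisfied by the logarithm of the
  Barnes function; it converges as \<open>z\<close> grows.\<close>

definition Dd :: "real \<Rightarrow> real" where "Dd z = Bf (z + 1) - Bf z - ln_Gamma (z + 1)"

text \<open>Taking a further difference of \<open>Dd\<close> eliminates the Gamma function and
  leaves a second difference of \<open>Bf\<close> against \<open>ln\<close>.\<close>

definition Ew :: "real \<Rightarrow> real" where "Ew w = Bf (w + 1) - 2 * Bf w + Bf (w - 1) - ln w"

lemma Dd_plus1: "z > 0 \<Longrightarrow> Dd (z + 1) - Dd z = Ew (z + 1)"
  using ln_Gamma_real_plus1[of "z + 1"] by (simp add: Dd_def Ew_def)

text \<open>The coefficient \<open>- 1 / 12\<close> in \<open>Bf\<close> cancels the term of order
  \<open>1 / w\<^sup>2\<close> in the second difference. On a bounded range compactness suffices;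
  \<open>w\<close> starts at \<open>1 + z0\<close> to keep \<open>w - 1\<close> away from 0.\<close>

lemma Ew_bound:
  assumes z0: "z0 > 0"
  obtains C where "C \<ge> 0" "\<And>w. w \<ge> 1 + z0 \<Longrightarrow> \<bar>Ew w\<bar> \<le> C / w ^ 3"
proof -
  have "Ew \<in> O(\<lambda>w. 1 / w ^ 3)" unfolding Ew_def[abs_def] Bf_def by real_asymp
  then obtain c where c: "c > 0" "\<forall>\<^sub>F w in at_top. norm (Ew w) \<le> c * norm (1 / w ^ 3)"
    by (elim landau_o.bigE)
  then obtain W where W': "\<forall>w\<ge>W. norm (Ew w) \<le> c * norm (1 / w ^ 3)"
    unfolding eventually_at_top_linorder by blast
  then have W: "\<bar>Ew w\<bar> \<le> c * \<bar>1 / w ^ 3\<bar>" if "w \<ge> W" for w using that by (simp only: real_norm_def)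
  have "continuous_on {1 + z0..max (1 + z0) W} (\<lambda>w. \<bar>Ew w\<bar> * w ^ 3)"
  proof -
    have "continuous_on {0<..} Bf" unfolding Bf_def[abs_def] by (intro continuous_intros) auto
    then have B: "continuous_on {1 + z0..max (1 + z0) W} (\<lambda>w. Bf (w + c))" if "c \<ge> -1" for c
      by (rule continuous_on_compose2) (use that z0 in \<open>auto intro!: continuous_intros\<close>)
    have "continuous_on {1 + z0..max (1 + z0) W} (\<lambda>w. \<bar>Bf (w + 1) - 2 * Bf (w + 0) + Bf (w + - 1) - ln w\<bar> * w ^ 3)"
      using z0 by (intro continuous_intros B) auto
    then show ?thesis by (simp add: Ew_def)
  qed
  then have "bounded ((\<lambda>w. \<bar>Ew w\<bar> * w ^ 3) ` {1 + z0..max (1 + z0) W})"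
    by (intro compact_imp_bounded compact_continuous_image) auto
  then obtain B where B': "\<forall>y\<in>(\<lambda>w. \<bar>Ew w\<bar> * w ^ 3) ` {1 + z0..max (1 + z0) W}. norm y \<le> B"
    unfolding bounded_iff by blast
  have B: "\<bar>Ew w\<bar> * w ^ 3 \<le> B" if "w \<in> {1 + z0..max (1 + z0) W}" for w
    using B'[rule_format, OF imageI[OF that]] unfolding real_norm_def by (rule order_trans[OF abs_ge_self])
  show thesis
  proof (rule that[of "max c B"])
    show "max c B \<ge> 0" using c by simp
    fix w assume w: "w \<ge> 1 + z0"
    then have w3: "w ^ 3 > 0" using z0 by simp
    show "\<bar>Ew w\<bar> \<le> max c B / w ^ 3"
    proof (cases "w \<ge> W")
      case True
      have "\<bar>Ew w\<bar> \<le> c / w ^ 3" using W[OF True] w3 by simp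
      also have "\<dots> \<le> max c B / w ^ 3" using w3 by (intro divide_right_mono) auto
      finally show ?thesis .
    next
      case False
      then have "\<bar>Ew w\<bar> * w ^ 3 \<le> B" using w by (intro B) auto
      then have "\<bar>Ew w\<bar> \<le> B / w ^ 3" using w3 by (simp add: le_divide_eq)
      also have "\<dots> \<le> max c B / w ^ 3" using w3 by (intro divide_right_mono) auto
      finally show ?thesis .
    qed
  qed
qed

lemma inverse_cube_le: "(x::real) > 0 \<Longrightarrow> 1 / (x + 1) ^ 3 \<le> 1 / x\<^sup>2 - 1 / (x + 1)\<^sup>2"
proof -
  assume x: "x > 0"
  have "1 / (x + 1) ^ 3 \<le> (2 * x + 1) / (x\<^sup>2 * (x + 1)\<^sup>2)"
    using x by (simp add: divide_simps) (simp add: power2_eq_square power3_eq_cube algebra_simps)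
  also have "\<dots> = 1 / x\<^sup>2 - 1 / (x + 1)\<^sup>2"
    using x by (simp add: divide_simps) (simp add: power2_eq_square algebra_simps)
  finally show ?thesis .
qed

lemma Dd_increment:
  assumes C: "C \<ge> 0" "\<And>w. w \<ge> 1 + z0 \<Longrightarrow> \<bar>Ew w\<bar> \<le> C / w ^ 3" and z: "z0 > 0" "z \<ge> z0"
  shows "\<bar>Dd (z + 1) - Dd z\<bar> \<le> C * (1 / z\<^sup>2 - 1 / (z + 1)\<^sup>2)"
proof -
  have "\<bar>Dd (z + 1) - Dd z\<bar> \<le> C * (1 / (z + 1) ^ 3)"
    using Dd_plus1[of z] C(2)[of "z + 1"] z by simp
  also have "\<dots> \<le> C * (1 / z\<^sup>2 - 1 / (z + 1)\<^sup>2)"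
    using inverse_cube_le[of z] z by (intro mult_left_mono C) auto
  finally show ?thesis .
qed

lemma Dd_increment_n:
  assumes C: "C \<ge> 0" "\<And>w. w \<ge> 1 + z0 \<Longrightarrow> \<bar>Ew w\<bar> \<le> C / w ^ 3" and z: "z0 > 0" "z \<ge> z0"
  shows "\<bar>Dd (z + real n) - Dd z\<bar> \<le> C * (1 / z\<^sup>2 - 1 / (z + real n)\<^sup>2)"
proof (induction n)
  case (Suc n)
  have "\<bar>Dd ((z + real n) + 1) - Dd (z + real n)\<bar> \<le> C * (1 / (z + real n)\<^sup>2 - 1 / ((z + real n) + 1)\<^sup>2)"
    by (rule Dd_increment[OF C z(1)]) (use z in auto)
  moreover have "(z + real n) + 1 = z + real (Suc n)" by simp
  ultimately have "\<bar>Dd (z + real (Suc n)) - Dd (z + real n)\<bar> \<le> C * (1 / (z + real n)\<^sup>2) - C * (1 / (z + real (Suc n))\<^sup>2)"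
    by (simp only: right_diff_distrib)
  with Suc show ?case unfolding right_diff_distrib by linarith
qed simp

text \<open>Euler's limit for Gamma takes the place of Stirling's formula: the growth of
  \<open>Bf (w + 1) - Bf w\<close> matches that of \<open>ln_Gamma\<close> up to a constant, and the
  constant cancels in the difference.\<close>

lemma Dd_diff_tendsto:
  assumes z: "z > 0"
  shows "(\<lambda>n. Dd (z + real n) - Dd (real n)) \<longlonglongrightarrow> 0"
proof -
  have B: "((\<lambda>w. Bf (w + 1) - Bf w - (w * ln w - w + ln w / 2)) \<longlongrightarrow> 0) at_top"
    unfolding Bf_def by real_asymp
  have B1: "(\<lambda>n. Bf (z + real n + 1) - Bf (z + real n) - ((z + real n) * ln (z + real n) - (z + real n) + ln (z + real n) / 2)) \<longlonglongrightarrow> 0"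
    by (rule filterlim_compose[OF B]) real_asymp
  have B2: "(\<lambda>n. Bf (real n + 1) - Bf (real n) - (real n * ln (real n) - real n + ln (real n) / 2)) \<longlonglongrightarrow> 0"
    by (rule filterlim_compose[OF B]) real_asymp
  have B3: "(\<lambda>n. (z + real n) * ln (z + real n) - real n * ln (real n) - z * ln (real n) - z + (ln (z + real n) - ln (real n)) / 2) \<longlonglongrightarrow> 0"
    using z by real_asymp
  have 1: "(\<lambda>n. Bf (z + real n + 1) - Bf (z + real n) - (Bf (real n + 1) - Bf (real n)) - z * ln (real n)) \<longlonglongrightarrow> 0"
    using tendsto_add[OF tendsto_diff[OF B1 B2] B3] by (simp add: algebra_simps diff_divide_distrib add_divide_distrib)
  have G: "Gamma z > 0" using z by simp
  have zn: "z \<notin> \<int>\<^sub>\<le>\<^sub>0" using z by (auto dest: nonpos_Ints_nonpos)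
  have "(\<lambda>n. ln (Gamma_series z n / Gamma z)) \<longlonglongrightarrow> ln (Gamma z / Gamma z)"
    using G by (intro tendsto_intros Gamma_series_LIMSEQ) auto
  then have "(\<lambda>n. ln (Gamma_series z n / Gamma z)) \<longlonglongrightarrow> 0" using G by simp
  moreover have "ln (Gamma_series z n / Gamma z) = ln_Gamma (real n + 1) + z * ln (real n) - ln_Gamma (z + real n + 1)" for n
  proof -
    have p: "pochhammer z (n + 1) = Gamma (z + real n + 1) / Gamma z"
      using pochhammer_Gamma[OF zn, of "n + 1"] by (simp add: add_ac)
    have f: "fact n = Gamma (real n + 1)" using Gamma_fact[of n, where 'a=real] by (simp add: add.commute)
    have "Gamma_series z n / Gamma z = Gamma (real n + 1) * exp (z * ln (real n)) / Gamma (z + real n + 1)"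
      unfolding Gamma_series_def p f using G by simp
    moreover have "Gamma (z + real n + 1) > 0" using z by simp
    moreover have "Gamma (real n + 1) > 0" by simp
    ultimately have "ln (Gamma_series z n / Gamma z) = ln (Gamma (real n + 1)) + z * ln (real n) - ln (Gamma (z + real n + 1))"
      by (simp add: ln_divide_pos ln_mult_pos)
    then show ?thesis using z by (simp add: ln_Gamma_real_pos)
  qed
  ultimately have "(\<lambda>n. ln_Gamma (real n + 1) + z * ln (real n) - ln_Gamma (z + real n + 1)) \<longlonglongrightarrow> 0" by simp
  from tendsto_add[OF 1 this] show ?thesis by (simp add: Dd_def algebra_simps)
qed

text \<open>Along the integers the increments of \<open>Dd\<close> are summable, and
  \<open>Dd_diff_tendsto\<close> carries the limit over to every shift \<open>z\<close>. The limit
  stays unevaluated: its multiples of \<open>N\<close> cancel in \<open>Lam\<close>.\<close>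

lemma Dd_limit: obtains Dinf where "\<And>z. z > 0 \<Longrightarrow> (\<lambda>n. Dd (z + real n)) \<longlonglongrightarrow> Dinf"
proof -
  obtain C where C: "C \<ge> 0" "\<And>w. w \<ge> 1 + 1 \<Longrightarrow> \<bar>Ew w\<bar> \<le> C / w ^ 3" using Ew_bound[of 1] by (metis zero_less_one)
  have "summable (\<lambda>n. Dd (1 + real (Suc n)) - Dd (1 + real n))"
  proof (rule summable_comparison_test')
    have "(\<lambda>n. C * (1 / (1 + real n)\<^sup>2) - C * (1 / (1 + real (Suc n))\<^sup>2)) sums (C * (1 / (1 + real 0)\<^sup>2) - 0)"
      by (rule telescope_sums') real_asymp
    then show "summable (\<lambda>n. C * (1 / (1 + real n)\<^sup>2) - C * (1 / (1 + real (Suc n))\<^sup>2))" by (rule sums_summable)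
    show "norm (Dd (1 + real (Suc n)) - Dd (1 + real n)) \<le> C * (1 / (1 + real n)\<^sup>2) - C * (1 / (1 + real (Suc n))\<^sup>2)" for n
    proof -
      have "\<bar>Dd ((1 + real n) + 1) - Dd (1 + real n)\<bar> \<le> C * (1 / (1 + real n)\<^sup>2 - 1 / ((1 + real n) + 1)\<^sup>2)"
        by (rule Dd_increment[OF C]) auto
      moreover have "(1 + real n) + 1 = 1 + real (Suc n)" by simp
      ultimately show ?thesis by (simp only: real_norm_def right_diff_distrib)
    qed
  qed
  then have "convergent (\<lambda>n. \<Sum>k<n. Dd (1 + real (Suc k)) - Dd (1 + real k))" by (simp add: summable_iff_convergent)
  then have "convergent (\<lambda>n. Dd (1 + real n) - Dd (1 + real 0))" by (simp only: sum_lessThan_telescope[of "\<lambda>k. Dd (1 + real k)"])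
  then obtain L where "(\<lambda>n. Dd (1 + real n) - Dd (1 + real 0)) \<longlonglongrightarrow> L" by (auto simp: convergent_def)
  from tendsto_add[OF this tendsto_const[of "Dd (1 + real 0)"]]
  have L: "(\<lambda>n. Dd (1 + real n)) \<longlonglongrightarrow> L + Dd 1" by simp
  from tendsto_diff[OF L Dd_diff_tendsto[of 1]] have L0: "(\<lambda>n. Dd (real n)) \<longlonglongrightarrow> L + Dd 1" by simp
  show thesis
  proof (rule that[of "L + Dd 1"])
    fix z :: real assume "z > 0"
    from tendsto_add[OF Dd_diff_tendsto[OF this] L0] show "(\<lambda>n. Dd (z + real n)) \<longlonglongrightarrow> L + Dd 1" by simp
  qed
qed

text \<open>The increments of \<open>Bf\<close> telescope. The errors \<open>Dd - Dinf\<close> decay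
  like an inverse square, so their sum is bounded uniformly in \<open>N\<close> and in
  \<open>z \<ge> z0\<close>.\<close>

lemma sum_ln_Gamma_asymp:
  obtains Dinf where "\<And>z0. z0 > 0 \<Longrightarrow> \<exists>C\<ge>0. \<forall>z\<ge>z0. \<forall>N. \<bar>(\<Sum>j<N. ln_Gamma (z + 1 + real j)) - (Bf (z + real N) - Bf z - real N * Dinf)\<bar> \<le> C"
proof -
  obtain Dinf where D: "\<And>z. z > 0 \<Longrightarrow> (\<lambda>n. Dd (z + real n)) \<longlonglongrightarrow> Dinf" using Dd_limit by blast
  show thesis
  proof (rule that[of Dinf])
    fix z0 :: real assume z0: "z0 > 0"
    obtain C where C: "C \<ge> 0" "\<And>w. w \<ge> 1 + z0 \<Longrightarrow> \<bar>Ew w\<bar> \<le> C / w ^ 3" using Ew_bound[OF z0] by blast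
    have d: "\<bar>Dd z - Dinf\<bar> \<le> C * (1 / z\<^sup>2)" if z: "z \<ge> z0" for z
    proof -
      have "(\<lambda>n. \<bar>Dd (z + real n) - Dd z\<bar>) \<longlonglongrightarrow> \<bar>Dinf - Dd z\<bar>" using z z0 by (intro tendsto_intros D) auto
      then have "\<bar>Dinf - Dd z\<bar> \<le> C * (1 / z\<^sup>2)"
      proof (rule LIMSEQ_le_const2)
        have "\<bar>Dd (z + real n) - Dd z\<bar> \<le> C * (1 / z\<^sup>2)" for n
        proof -
          have "C * (1 / z\<^sup>2 - 1 / (z + real n)\<^sup>2) \<le> C * (1 / z\<^sup>2)" using C(1) by (intro mult_left_mono) auto
          then show ?thesis using Dd_increment_n[OF C z0 z, of n] by linarith
        qed
        then show "\<exists>N. \<forall>n\<ge>N. \<bar>Dd (z + real n) - Dd z\<bar> \<le> C * (1 / z\<^sup>2)" by blast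
      qed
      then show ?thesis by (simp add: abs_minus_commute)
    qed
    have "\<bar>(\<Sum>j<N. ln_Gamma (z + 1 + real j)) - (Bf (z + real N) - Bf z - real N * Dinf)\<bar> \<le> C * (1 / z0 + 1 / z0\<^sup>2)" if z: "z \<ge> z0" for z N
    proof -
      have zp: "z > 0" using z z0 by simp
      have "(\<Sum>j<N. ln_Gamma (z + 1 + real j)) = (\<Sum>j<N. (Bf (z + real (Suc j)) - Bf (z + real j)) - Dd (z + real j))"
        by (intro sum.cong) (auto simp: Dd_def add_ac)
      also have "\<dots> = (Bf (z + real N) - Bf z) - (\<Sum>j<N. Dd (z + real j))"
        unfolding sum_subtractf using sum_lessThan_telescope[of "\<lambda>j. Bf (z + real j)" N] by (simp add: sum_subtractf)
      finally have "(\<Sum>j<N. ln_Gamma (z + 1 + real j)) - (Bf (z + real N) - Bf z - real N * Dinf) = - (\<Sum>j<N. Dd (z + real j) - Dinf)"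
        by (simp add: sum_subtractf)
      then have "\<bar>(\<Sum>j<N. ln_Gamma (z + 1 + real j)) - (Bf (z + real N) - Bf z - real N * Dinf)\<bar> \<le> (\<Sum>j<N. \<bar>Dd (z + real j) - Dinf\<bar>)"
        by (simp only: abs_minus_cancel sum_abs)
      also have "\<dots> \<le> (\<Sum>j<N. C * (1 / (z + real j)\<^sup>2))" using z by (intro sum_mono d) auto
      also have "\<dots> = C * (\<Sum>j<N. 1 / (z + real j)\<^sup>2)" by (simp only: sum_distrib_left)
      also have "\<dots> \<le> C * (1 / z0 + 1 / z0\<^sup>2)"
      proof (rule mult_left_mono[OF _ C(1)])
        have "(\<Sum>j<N. 1 / (z + real j)\<^sup>2) \<le> Polygamma 1 z"
          using sum_le_suminf[OF sums_summable[OF Polygamma_1_sums[OF zp]], of "{..<N}"] sums_unique[OF Polygamma_1_sums[OF zp]] by simp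
        also have "\<dots> \<le> Polygamma 1 z0" using z z0 by (intro Polygamma_1_antimono)
        also have "\<dots> \<le> 1 / z0 + 1 / z0\<^sup>2" using z0 by (rule Polygamma_1_le)
        finally show "(\<Sum>j<N. 1 / (z + real j)\<^sup>2) \<le> 1 / z0 + 1 / z0\<^sup>2" .
      qed
      finally show ?thesis .
    qed
    then show "\<exists>C\<ge>0. \<forall>z\<ge>z0. \<forall>N. \<bar>(\<Sum>j<N. ln_Gamma (z + 1 + real j)) - (Bf (z + real N) - Bf z - real N * Dinf)\<bar> \<le> C"
      using C(1) z0 by (intro exI[of _ "C * (1 / z0 + 1 / z0\<^sup>2)"]) simp
  qed
qed

lemma FF_eq: "x > 0 \<Longrightarrow> FF x = (1 + 2 * x)\<^sup>2 / 2 * ln (1 + 2 * x) - (1 + x)\<^sup>2 * ln (1 + x) - x\<^sup>2 * ln (4 * x)"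
proof -
  have "2 * x * ((1 + 2 * x) * A - (1 + x) * B - x * C) - (- ((1 - 4 * x\<^sup>2) / 2) * A - x\<^sup>2 * C + (1 - x\<^sup>2) * B)
    = (1 + 2 * x)\<^sup>2 / 2 * A - (1 + x)\<^sup>2 * B - x\<^sup>2 * C" for A B C :: real
    by (simp add: power2_eq_square field_simps)
  then show ?thesis by (simp only: FF_def theta_def rate_I_def)
qed

text \<open>In this combination the coefficients of the squares of the arguments add up to 0, which
  removes \<open>N\<^sup>2 * ln N\<close> and the terms \<open>3 / 4 * z\<^sup>2\<close>, while
  those of \<open>- ln z / 12\<close> add up to 1. This is the origin of the logarithmic
  correction.\<close>

lemma Bf_combination:
  assumes N: "N > 0" and x: "x > 0"
  shows "Bf N + Bf (2 * x * N + N) - Bf (2 * x * N) - 2 * Bf (x * N + N) + 2 * Bf (x * N) =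
     N\<^sup>2 * FF x - (ln N + (ln (1 + 2 * x) - ln (2 * x) - 2 * ln (1 + x) + 2 * ln x)) / 12"
proof -
  have l4: "ln 4 = 2 * ln (2::real)" using ln_realpow[of "2::real" 2] by simp
  have e: "2 * x * N + N = (1 + 2 * x) * N" "x * N + N = (1 + x) * N" by (simp_all add: algebra_simps)
  have l: "ln ((1 + 2 * x) * N) = ln (1 + 2 * x) + ln N" "ln ((1 + x) * N) = ln (1 + x) + ln N"
    "ln (2 * x * N) = ln 2 + ln x + ln N" "ln (x * N) = ln x + ln N" "ln (4 * x) = 2 * ln 2 + ln x" "ln (2 * x) = ln 2 + ln x"
    using N x by (simp_all add: ln_mult_pos l4)
  have "(N\<^sup>2 / 2 * n - n / 12 - 3 / 4 * N\<^sup>2) + (((1 + 2 * x) * N)\<^sup>2 / 2 * (A + n) - (A + n) / 12 - 3 / 4 * ((1 + 2 * x) * N)\<^sup>2)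
     - ((2 * x * N)\<^sup>2 / 2 * (t + L + n) - (t + L + n) / 12 - 3 / 4 * (2 * x * N)\<^sup>2)
     - 2 * (((1 + x) * N)\<^sup>2 / 2 * (B + n) - (B + n) / 12 - 3 / 4 * ((1 + x) * N)\<^sup>2)
     + 2 * ((x * N)\<^sup>2 / 2 * (L + n) - (L + n) / 12 - 3 / 4 * (x * N)\<^sup>2)
    = N\<^sup>2 * ((1 + 2 * x)\<^sup>2 / 2 * A - (1 + x)\<^sup>2 * B - x\<^sup>2 * (2 * t + L)) - (n + (A - (t + L) - 2 * B + 2 * L)) / 12"
    for n A B L t :: real
    by (simp add: power2_eq_square field_simps)
  then show ?thesis
    by (simp only: FF_eq[OF x] Bf_def e l)
qed

text \<open>For \<open>b = 1\<close> the Gamma arguments advance in unit steps, so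
  \<open>Lam\<close> combines three sums of the kind in \<open>sum_ln_Gamma_asymp\<close>, started
  at 0, \<open>h\<close> and \<open>h / 2\<close>.\<close>

theorem Lam_beta2_asymp:
  assumes x1: "x1 > 0"
  obtains C where "\<And>N x. N \<ge> 1 \<Longrightarrow> x \<ge> x1 \<Longrightarrow> \<bar>Lam N 1 (2 * x * real N) - ((real N)\<^sup>2 * FF x - ln (real N) / 12)\<bar> \<le> C"
proof -
  obtain Dinf where D: "\<And>z0. z0 > 0 \<Longrightarrow> \<exists>C\<ge>0. \<forall>z\<ge>z0. \<forall>N. \<bar>(\<Sum>j<N. ln_Gamma (z + 1 + real j)) - (Bf (z + real N) - Bf z - real N * Dinf)\<bar> \<le> C"
    using sum_ln_Gamma_asymp by blast
  define z0 where "z0 = min 1 x1"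
  have z0: "z0 > 0" "z0 \<le> 1" "z0 \<le> x1" using x1 by (auto simp: z0_def)
  obtain C where C: "C \<ge> 0" "\<And>z N. z \<ge> z0 \<Longrightarrow> \<bar>(\<Sum>j<N. ln_Gamma (z + 1 + real j)) - (Bf (z + real N) - Bf z - real N * Dinf)\<bar> \<le> C"
    using D[OF z0(1)] by blast
  define L1 where "L1 = 2 * ln ((1 + x1) / x1)"
  show thesis
  proof (rule that[of "4 * C + \<bar>Bf 1\<bar> + \<bar>Dinf\<bar> + L1 / 12"])
    fix N :: nat and x assume N: "N \<ge> 1" and x: "x \<ge> x1"
    define n where "n = real N"
    have n: "n \<ge> 1" using N by (simp add: n_def)
    define h where "h = 2 * x * n"
    have xp: "x > 0" using x x1 by simp
    have xn: "x \<le> x * n" using n xp by simp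
    have xz: "z0 \<le> x * n" using xn x z0 by linarith
    have h: "h / 2 = x * n" "h / 2 \<ge> z0" "h \<ge> z0" "h > -1" using xz z0 unfolding h_def by linarith+
    define S where "S z = (\<Sum>j<N. ln_Gamma (z + 1 + real j))" for z
    have S: "\<bar>S z - (Bf (z + n) - Bf z - n * Dinf)\<bar> \<le> C" if "z \<ge> z0" for z
      using C(2)[OF that, of N] by (simp add: S_def n_def)
    \<comment> \<open>The estimate requires a starting point bounded away from 0, so the first
      summand \<open>ln_Gamma 1 = 0\<close> is split off and the rest starts at 1.\<close>
    have S0: "\<bar>S 0 - (Bf n - Bf 1 - (n - 1) * Dinf)\<bar> \<le> C"
    proof -
      obtain M where M: "N = Suc M" using N by (cases N) auto
      have "S 0 = ln_Gamma 1 + (\<Sum>j<M. ln_Gamma (1 + 1 + real j))"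
        unfolding S_def M sum.lessThan_Suc_shift by (simp add: add_ac)
      moreover have "ln_Gamma (1::real) = 0" by (simp add: ln_Gamma_real_pos)
      moreover have "\<bar>(\<Sum>j<M. ln_Gamma (1 + 1 + real j)) - (Bf (1 + real M) - Bf 1 - real M * Dinf)\<bar> \<le> C"
        using z0 by (intro C) auto
      moreover have "1 + real M = n" "real M = n - 1" by (simp_all add: n_def M)
      ultimately show ?thesis by simp
    qed
    have "Lam N 1 h = S 0 + S h - 2 * S (h / 2)"
      using h(4) by (simp add: Lam_standard S_def sum.distrib sum_subtractf sum_distrib_left add_ac)
    then have 1: "\<bar>Lam N 1 h - (Bf n + Bf (h + n) - Bf h - 2 * Bf (h / 2 + n) + 2 * Bf (h / 2)) + Bf 1 - Dinf\<bar> \<le> 4 * C"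
      using S0 S[OF h(3)] S[OF h(2)] by (simp add: abs_le_iff algebra_simps)
    define R where "R = ln (1 + 2 * x) - ln (2 * x) - 2 * ln (1 + x) + 2 * ln x"
    have 2: "Bf n + Bf (h + n) - Bf h - 2 * Bf (h / 2 + n) + 2 * Bf (h / 2) = n\<^sup>2 * FF x - (ln n + R) / 12"
      unfolding h(1) unfolding h_def R_def using Bf_combination[of n x] n xp by simp
    \<comment> \<open>Uniform in \<open>x \<ge> x1\<close>, hence for levels up to
      \<open>ln 2\<close>: both quotients inside the logarithms decrease to 1 as \<open>x\<close>
      grows.\<close>
    have R: "\<bar>R\<bar> \<le> L1"
    proof -
      have R_eq: "R = ln ((1 + 2 * x) / (2 * x)) - 2 * ln ((1 + x) / x)"
        using xp by (simp add: R_def ln_divide_pos)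
      have q1: "(1 + 2 * x) / (2 * x) = 1 + 1 / (2 * x)" "(1 + x) / x = 1 + 1 / x" using xp by (simp_all add: field_simps)
      have a: "0 \<le> ln ((1 + 2 * x) / (2 * x))" unfolding q1 using xp by (intro ln_ge_zero) simp
      have b: "ln ((1 + 2 * x) / (2 * x)) \<le> ln ((1 + x) / x)"
        unfolding q1 using xp by (subst ln_le_cancel_iff) (auto simp: field_simps add_pos_pos)
      have c: "0 \<le> ln ((1 + x) / x)" using a b by simp
      have d: "ln ((1 + x) / x) \<le> ln ((1 + x1) / x1)"
        using x x1 xp by (subst ln_le_cancel_iff) (auto simp: divide_simps algebra_simps)
      show ?thesis unfolding R_eq L1_def using a b c d by (simp add: abs_le_iff)
    qed
    have "\<bar>Lam N 1 h - (n\<^sup>2 * FF x - ln n / 12)\<bar> \<le> 4 * C + \<bar>Bf 1\<bar> + \<bar>Dinf\<bar> + L1 / 12"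
    proof -
      have "Lam N 1 h - (n\<^sup>2 * FF x - ln n / 12) = (Lam N 1 h - (n\<^sup>2 * FF x - (ln n + R) / 12) + Bf 1 - Dinf) - Bf 1 + Dinf - R / 12"
        by (simp add: field_simps)
      also have "\<bar>\<dots>\<bar> \<le> \<bar>Lam N 1 h - (n\<^sup>2 * FF x - (ln n + R) / 12) + Bf 1 - Dinf\<bar> + \<bar>Bf 1\<bar> + \<bar>Dinf\<bar> + \<bar>R\<bar> / 12" by linarith
      also have "\<dots> \<le> 4 * C + \<bar>Bf 1\<bar> + \<bar>Dinf\<bar> + L1 / 12"
        using 1 R unfolding 2 by (intro add_mono divide_right_mono) auto
      finally show ?thesis .
    qed
    then show "\<bar>Lam N 1 (2 * x * real N) - ((real N)\<^sup>2 * FF x - ln (real N) / 12)\<bar> \<le> 4 * C + \<bar>Bf 1\<bar> + \<bar>Dinf\<bar> + L1 / 12"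
      by (simp add: h_def n_def)
  qed
qed

lemma FF_supporting:
  assumes "x > 0" "y > 0"
  shows "FF x + 2 * theta x * (y - x) \<le> FF y"
proof (cases x y rule: linorder_cases)
  case less
  obtain z where z: "x < z" "z < y" "FF y - FF x = (y - x) * (2 * theta z)"
    using MVT2[OF less, of FF "\<lambda>z. 2 * theta z"] FF_has_derivative assms by (metis less_le_trans)
  have "theta x \<le> theta z" using theta_strict_mono[of x z] z assms by simp
  then have "(y - x) * (2 * theta x) \<le> (y - x) * (2 * theta z)" using less by (intro mult_left_mono) auto
  then show ?thesis using z(3) by (simp add: mult_ac)
next
  case greater
  obtain z where z: "y < z" "z < x" "FF x - FF y = (x - y) * (2 * theta z)"
    using MVT2[OF greater, of FF "\<lambda>z. 2 * theta z"] FF_has_derivative assms by (metis less_le_trans)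
  have "theta z \<le> theta x" using theta_strict_mono[of z x] z assms by simp
  then have "(x - y) * (2 * theta z) \<le> (x - y) * (2 * theta x)" using greater by (intro mult_left_mono) auto
  then show ?thesis using z(3) by (simp add: algebra_simps)
qed simp

text \<open>The constant must be uniform up to \<open>ln 2\<close>, where the saddle point exceeds
  every fixed multiple of \<open>N\<close>, so the argument of \<open>Lam_conj_asymp\<close> is
  replaced by convexity: \<open>2 * a * y - FF y\<close> never exceeds \<open>rate_I x\<close>,
  wherever the saddle point lies.\<close>

theorem Lam_conj_beta2:
  assumes \<alpha>: "\<alpha> > 0"
  shows "\<exists>C. \<forall>a\<in>{\<alpha>..<ln 2}. \<forall>N\<ge>1. \<bar>Lam_conj N 1 a - ((real N)\<^sup>2 * rate_I (theta_inv a) + ln (real N) / 12)\<bar> \<le> C"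
proof (cases "\<alpha> < ln 2")
  case True
  \<comment> \<open>Halving \<open>\<alpha>\<close> leaves room: for large \<open>N\<close> the
    saddle points of all admissible levels lie above \<open>2 * x1 * N\<close>.\<close>
  define x1 where "x1 = theta_inv (\<alpha> / 2)"
  have x1: "x1 > 0" unfolding x1_def using \<alpha> True by (intro theta_inv_pos) auto
  have th1: "theta x1 = \<alpha> / 2" unfolding x1_def using \<alpha> True by (intro theta_inv) auto
  obtain C where C: "\<And>N x. N \<ge> 1 \<Longrightarrow> x \<ge> x1 \<Longrightarrow> \<bar>Lam N 1 (2 * x * real N) - ((real N)\<^sup>2 * FF x - ln (real N) / 12)\<bar> \<le> C"
    using Lam_beta2_asymp[OF x1] by blast
  define E where "E = KK 1 / sqrt x1"
  have "\<forall>\<^sub>F N in sequentially. E + ln 2 < \<alpha> / 2 * real N" using \<alpha> by real_asymp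
  then obtain N0 where N0: "\<And>N. N \<ge> N0 \<Longrightarrow> E + ln 2 < \<alpha> / 2 * real N" by (auto simp: eventually_sequentially)
  define C2 where "C2 = ln 2 * real N0 * (2 * x1 * real N0)"
  have "\<bar>Lam_conj N 1 a - ((real N)\<^sup>2 * rate_I (theta_inv a) + ln (real N) / 12)\<bar> \<le> max C C2" if a: "a \<in> {\<alpha>..<ln 2}" and N: "N \<ge> 1" for a N
  proof -
    define x where "x = theta_inv a"
    have a': "0 < a" "a < ln 2" using a \<alpha> by auto
    have x: "x \<ge> x1" "theta x = a"
      using theta_inv_strict_mono[of "\<alpha> / 2" a] theta_inv[of a] a a' \<alpha> by (auto simp: x_def x1_def)
    have xp: "x > 0" using x x1 by simp
    define h where "h = hsol N 1 a"
    have h: "h \<ge> 0" "Lam1 N 1 h = a * real N" unfolding h_def using hsol[of 1 N a] N a' by auto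
    have lo: "(real N)\<^sup>2 * rate_I x + ln (real N) / 12 - C \<le> Lam_conj N 1 a"
    proof -
      have "2 * x * real N > -1" using xp by (simp add: less_le_trans[of "-1" 0])
      then have "a * real N * (2 * x * real N) - Lam N 1 (2 * x * real N) \<le> Lam_conj N 1 a" using a' N by (intro Lam_conj_ge) auto
      moreover have "a * real N * (2 * x * real N) = (real N)\<^sup>2 * (2 * x * theta x)" by (simp add: x(2) power2_eq_square)
      moreover have "(real N)\<^sup>2 * (2 * x * theta x) = (real N)\<^sup>2 * rate_I x + (real N)\<^sup>2 * FF x" by (simp add: FF_def algebra_simps)
      ultimately show ?thesis using C[OF N x(1)] by (simp add: abs_le_iff)
    qed
    have hi: "Lam_conj N 1 a \<le> (real N)\<^sup>2 * rate_I x + ln (real N) / 12 + max C C2"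
    proof (cases "h \<ge> 2 * x1 * real N")
      case True
      define y where "y = h / (2 * real N)"
      have y: "h = 2 * y * real N" "y \<ge> x1" using N True by (auto simp: y_def field_simps)
      have "Lam_conj N 1 a = (real N)\<^sup>2 * (2 * a * y) - Lam N 1 (2 * y * real N)"
        unfolding Lam_conj_def h_def[symmetric] y(1) by (simp add: power2_eq_square)
      also have "\<dots> \<le> (real N)\<^sup>2 * (2 * a * y) - ((real N)\<^sup>2 * FF y - ln (real N) / 12) + C"
        using C[OF N y(2)] by (simp add: abs_le_iff)
      also have "\<dots> = (real N)\<^sup>2 * (2 * a * y - FF y) + ln (real N) / 12 + C" by (simp add: algebra_simps)
      also have "(real N)\<^sup>2 * (2 * a * y - FF y) \<le> (real N)\<^sup>2 * rate_I x"
      proof (rule mult_left_mono)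
        show "2 * a * y - FF y \<le> rate_I x"
          using FF_supporting[OF xp, of y] y x1 by (simp add: FF_def[of x] x(2) algebra_simps)
      qed simp
      finally show ?thesis by simp
    next
      \<comment> \<open>A saddle point below \<open>2 * x1 * N\<close> occurs only for
        \<open>N < N0\<close>, where \<open>N0\<close> depends on \<open>\<alpha>\<close> alone; the
        crude constant \<open>C2\<close> covers these finitely many \<open>N\<close>.\<close>
      case False
      have "N < N0"
      proof (rule ccontr)
        assume "\<not> N < N0"
        then have "E + ln 2 < \<alpha> / 2 * real N" by (intro N0) simp
        have "Lam1 N 1 (2 * x1 * real N) - real N * (\<alpha> / 2) \<le> E + ln 2"
          using Lam1_theta_bound[of 1 N x1, THEN abs_le_D1] N x1 by (simp add: th1 E_def)
        with \<open>E + ln 2 < \<alpha> / 2 * real N\<close> have "Lam1 N 1 (2 * x1 * real N) < \<alpha> / 2 * real N + real N * (\<alpha> / 2)" by linarith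
        then have "Lam1 N 1 (2 * x1 * real N) < \<alpha> * real N" by (simp add: field_simps)
        moreover have "Lam1 N 1 h \<le> Lam1 N 1 (2 * x1 * real N)" using False h by (intro Lam1_mono) auto
        moreover have "\<alpha> * real N \<le> a * real N" using a by (intro mult_right_mono) auto
        ultimately show False using h by simp
      qed
      then have n: "real N \<le> real N0" by simp
      have "Lam N 1 h \<ge> 0" using Lam_supporting[of 1 0 h N] h by (simp add: Lam_0 Lam1_0)
      then have "Lam_conj N 1 a \<le> a * real N * h" by (simp add: Lam_conj_def h_def)
      also have "\<dots> \<le> ln 2 * real N0 * (2 * x1 * real N0)"
      proof (intro mult_mono)
        have "2 * x1 * real N \<le> 2 * x1 * real N0" using n x1 by (intro mult_left_mono) auto
        then show "h \<le> 2 * x1 * real N0" using False by simp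
      qed (use a' n h x1 in auto)
      also have "\<dots> = C2" by (simp add: C2_def)
      also have "C2 \<le> (real N)\<^sup>2 * rate_I x + ln (real N) / 12 + max C C2"
      proof -
        have "0 \<le> (real N)\<^sup>2 * rate_I x + ln (real N) / 12"
          using rate_I_nonneg[of x] xp N by (intro add_nonneg_nonneg mult_nonneg_nonneg divide_nonneg_nonneg ln_ge_zero) auto
        then show ?thesis by linarith
      qed
      finally show ?thesis .
    qed
    show ?thesis using lo hi by (simp add: x_def abs_le_iff)
  qed
  then show ?thesis by blast
qed auto


section \<open>Local limits through Cauchy kernels\<close>

lemma exp_minus_le_inverse: fixes u :: real assumes "0 \<le> u" shows "exp (- u) \<le> 1 / (1 + u)"
  using exp_ge_add_one_self[of u] assms by (simp add: exp_minus field_simps)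

lemma exp_minus_le_inverse_square: fixes u :: real assumes "0 < u" shows "exp (- u) \<le> 2 / u\<^sup>2"
proof -
  have "u\<^sup>2 / 2 \<le> exp u" using exp_lower_Taylor_quadratic[of u] assms by linarith
  then show ?thesis using assms by (simp add: exp_minus field_simps)
qed

text \<open>The integrable majorant for dominated convergence. For \<open>|t| \<le> h\<close> the
  second factor is Gaussian. For larger \<open>t\<close> it is only known to be of order
  \<open>1 / h\<^sup>2\<close>, and the first factor contributes the missing
  \<open>h\<^sup>2 / t\<^sup>2\<close>.\<close>

lemma damped_gaussian_le:
  fixes v0 v h t :: real
  assumes v0: "0 < v0" "v0 \<le> v" and h: "1 \<le> h"
  shows "exp (- \<bar>t / h\<bar>) * exp (- v * (t\<^sup>2 / (1 + t\<^sup>2 / h\<^sup>2)) / 2) \<le> (1 + 16 / v0) * inverse (1 + t\<^sup>2)"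
proof (cases "\<bar>t\<bar> \<le> h")
  case True
  have t1: "t\<^sup>2 / h\<^sup>2 \<le> 1" using True h power2_le_iff_abs_le[of h t] by simp
  define r where "r = t\<^sup>2 / (1 + t\<^sup>2 / h\<^sup>2)"
  have r: "t\<^sup>2 / 2 \<le> r" unfolding r_def using t1 by (intro divide_left_mono) (auto intro!: mult_pos_pos add_pos_nonneg)
  have "v0 * (t\<^sup>2 / 2) \<le> v * r" using v0 r by (intro mult_mono) auto
  then have "exp (- v * r / 2) \<le> exp (- (v0 * t\<^sup>2 / 4))" by (simp add: field_simps)
  then have "exp (- v * (t\<^sup>2 / (1 + t\<^sup>2 / h\<^sup>2)) / 2) \<le> exp (- (v0 * t\<^sup>2 / 4))" by (simp only: r_def)
  also have "\<dots> \<le> 1 / (1 + v0 * t\<^sup>2 / 4)" using v0 by (intro exp_minus_le_inverse) auto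
  also have "\<dots> \<le> (1 + 16 / v0) * inverse (1 + t\<^sup>2)"
  proof -
    have "1 + t\<^sup>2 \<le> (1 + 16 / v0) * (1 + v0 * t\<^sup>2 / 4)" using v0 by (simp add: field_simps)
    moreover have "0 < 1 + v0 * t\<^sup>2 / 4" "0 < 1 + t\<^sup>2" using v0 by (auto intro: add_pos_nonneg)
    ultimately show ?thesis by (simp add: field_simps)
  qed
  finally have "exp (- v * (t\<^sup>2 / (1 + t\<^sup>2 / h\<^sup>2)) / 2) \<le> (1 + 16 / v0) * inverse (1 + t\<^sup>2)" .
  moreover have "exp (- \<bar>t / h\<bar>) * exp (- v * (t\<^sup>2 / (1 + t\<^sup>2 / h\<^sup>2)) / 2) \<le> 1 * exp (- v * (t\<^sup>2 / (1 + t\<^sup>2 / h\<^sup>2)) / 2)"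
    by (intro mult_right_mono) auto
  ultimately show ?thesis by linarith
next
  case False
  then have t: "h < \<bar>t\<bar>" "t \<noteq> 0" using h by auto
  have t2: "h\<^sup>2 < t\<^sup>2" using t h power2_strict_mono[of h t] by simp
  have h2: "1 \<le> h\<^sup>2" using h by simp
  have "t\<^sup>2 / (1 + t\<^sup>2 / h\<^sup>2) = t\<^sup>2 * h\<^sup>2 / (h\<^sup>2 + t\<^sup>2)" using h by (simp add: field_simps)
  moreover have "h\<^sup>2 / 2 \<le> t\<^sup>2 * h\<^sup>2 / (h\<^sup>2 + t\<^sup>2)"
  proof -
    have "h\<^sup>2 * (h\<^sup>2 + t\<^sup>2) \<le> h\<^sup>2 * (2 * t\<^sup>2)" using t2 by (intro mult_left_mono) auto
    then show ?thesis using h2 t2 by (simp add: field_simps)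
  qed
  ultimately have r: "h\<^sup>2 / 2 \<le> t\<^sup>2 / (1 + t\<^sup>2 / h\<^sup>2)" by simp
  define r where "r = t\<^sup>2 / (1 + t\<^sup>2 / h\<^sup>2)"
  have "v0 * (h\<^sup>2 / 2) \<le> v * r" using v0 r unfolding r_def by (intro mult_mono) auto
  then have "exp (- v * r / 2) \<le> exp (- (v0 * h\<^sup>2 / 4))" by (simp add: field_simps)
  then have "exp (- v * (t\<^sup>2 / (1 + t\<^sup>2 / h\<^sup>2)) / 2) \<le> exp (- (v0 * h\<^sup>2 / 4))" by (simp only: r_def)
  also have "\<dots> \<le> 1 / (1 + v0 * h\<^sup>2 / 4)" using v0 by (intro exp_minus_le_inverse) auto
  also have "\<dots> \<le> 1 / (v0 * h\<^sup>2 / 4)" using v0 h by (intro divide_left_mono) (auto intro!: mult_pos_pos add_pos_nonneg)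
  finally have A: "exp (- v * (t\<^sup>2 / (1 + t\<^sup>2 / h\<^sup>2)) / 2) \<le> 1 / (v0 * h\<^sup>2 / 4)" .
  have B: "exp (- \<bar>t / h\<bar>) \<le> 2 / \<bar>t / h\<bar>\<^sup>2" using t h by (intro exp_minus_le_inverse_square) auto
  have "exp (- \<bar>t / h\<bar>) * exp (- v * (t\<^sup>2 / (1 + t\<^sup>2 / h\<^sup>2)) / 2) \<le> 2 / \<bar>t / h\<bar>\<^sup>2 * (1 / (v0 * h\<^sup>2 / 4))"
    by (intro mult_mono A B) auto
  also have "\<dots> = 8 / v0 * (1 / t\<^sup>2)" using t h v0 by (simp add: power_divide)
  also have "\<dots> \<le> 8 / v0 * (2 * inverse (1 + t\<^sup>2))"
  proof (intro mult_left_mono)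
    have "1 + t\<^sup>2 \<le> 2 * t\<^sup>2" using h2 t2 by linarith
    moreover have "0 < 1 + t\<^sup>2" by (auto intro: add_pos_nonneg)
    ultimately show "1 / t\<^sup>2 \<le> 2 * inverse (1 + t\<^sup>2)" using t by (simp add: field_simps)
  qed (use v0 in auto)
  also have "\<dots> = 16 / v0 * inverse (1 + t\<^sup>2)" by simp
  also have "\<dots> \<le> (1 + 16 / v0) * inverse (1 + t\<^sup>2)" by (intro mult_right_mono) auto
  finally show ?thesis .
qed

lemma gaussian_integral:
  fixes v :: real assumes v: "0 < v"
  shows "has_bochner_integral lborel (\<lambda>t. exp (- v * t\<^sup>2 / 2)) (sqrt (2 * pi / v))"
proof -
  define s where "s = 1 / sqrt v"
  have s: "s > 0" "s\<^sup>2 = 1 / v" using v by (auto simp: s_def power_divide)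
  have e: "exp (- v * t\<^sup>2 / 2) = sqrt (2 * pi / v) * normal_density 0 s t" for t
    using v by (simp add: normal_density_def s(2) real_sqrt_divide real_sqrt_mult mult.commute)
  show ?thesis unfolding e has_bochner_integral_iff
    using integrable_normal_density[OF s(1), of 0] integral_normal_density[OF s(1), of 0] by simp
qed

lemma integrable_inverse_square_line: "integrable lborel (\<lambda>t::real. inverse (1 + t\<^sup>2))"
proof -
  have "einterval (-\<infinity>) \<infinity> = UNIV" by (auto simp: einterval_def)
  then show ?thesis using integrable_inverse_1_plus_square by (simp add: set_integrable_def)
qed

lemma cis_borel [measurable]: "cis \<in> borel_measurable borel"
  by (intro borel_measurable_continuous_onI continuous_intros)

lemma half_line_exponential:
  fixes w y :: real assumes w: "0 < w"
  shows "has_bochner_integral lborel (\<lambda>t. indicator {0<..} t *\<^sub>R exp (Complex (- w) y * of_real t)) (1 / Complex w (- y))"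
proof -
  let ?z = "Complex (- w) y"
  have z: "?z \<noteq> 0" using w by (simp add: complex_eq_iff)
  have int: "set_integrable lborel {0<..} (\<lambda>t. exp (?z * of_real t))"
    unfolding set_integrable_def
  proof (rule Bochner_Integration.integrable_bound)
    show "integrable lborel (\<lambda>t. indicator {0<..} t *\<^sub>R exp (- (t * w)))"
      using integrable_I0i_exp_mscale[OF w] by (simp add: set_integrable_def)
    show "AE t in lborel. norm (indicator {0<..} t *\<^sub>R exp (?z * of_real t)) \<le> norm (indicator {0<..} t *\<^sub>R exp (- (t * w)))"
      by (auto simp: indicator_def mult.commute)
    show "(\<lambda>t. indicator {0<..} t *\<^sub>R exp (?z * of_real t)) \<in> borel_measurable lborel"
      by (intro borel_measurable_scaleR borel_measurable_indicator)
         (auto intro!: borel_measurable_continuous_onI continuous_intros)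
  qed
  have ei: "einterval 0 \<infinity> = {0::real<..}" by (auto simp: einterval_def)
  have "(LBINT t=0..\<infinity>. exp (?z * of_real t)) = 0 - 1 / ?z"
  proof (rule interval_integral_FTC_integrable[where F = "\<lambda>t. exp (?z * of_real t) / ?z"])
    show "((\<lambda>t. exp (?z * complex_of_real t) / ?z) has_vector_derivative exp (?z * complex_of_real t)) (at t)" for t
    proof -
      have "((\<lambda>u. exp (?z * u) / ?z) has_field_derivative exp (?z * of_real t)) (at (of_real t))"
        by (rule derivative_eq_intros refl | use z in simp)+
      then show ?thesis by (rule has_vector_derivative_real_field)
    qed
    show "isCont (\<lambda>t. exp (?z * complex_of_real t)) t" for t by (intro continuous_intros)
    show "set_integrable lborel (einterval 0 \<infinity>) (\<lambda>t. exp (?z * complex_of_real t))" using int ei by simp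
    have "((\<lambda>t. exp (?z * complex_of_real t) / ?z) \<longlongrightarrow> exp (?z * complex_of_real 0) / ?z) (at_right 0)"
      by (intro tendsto_intros z)
    then show "(((\<lambda>t. exp (?z * complex_of_real t) / ?z) \<circ> real_of_ereal) \<longlongrightarrow> 1 / ?z) (at_right 0)"
      unfolding zero_ereal_def by (simp add: ereal_tendsto_simps1)
    have "((\<lambda>t. exp (?z * complex_of_real t) / ?z) \<longlongrightarrow> 0) at_top"
    proof (rule tendsto_norm_zero_cancel)
      have "((\<lambda>t. exp (- (w * t)) / cmod ?z) \<longlongrightarrow> 0) at_top" using w z by real_asymp
      then show "((\<lambda>t. norm (exp (?z * complex_of_real t) / ?z)) \<longlongrightarrow> 0) at_top" by (simp add: norm_divide)
    qed
    then show "(((\<lambda>t. exp (?z * complex_of_real t) / ?z) \<circ> real_of_ereal) \<longlongrightarrow> 0) (at_left \<infinity>)"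
      by (simp add: ereal_tendsto_simps1)
  qed auto
  moreover have "(LBINT t=0..\<infinity>. exp (?z * of_real t)) = (LINT t|lborel. indicator {0<..} t *\<^sub>R exp (?z * of_real t))"
    by (simp add: interval_lebesgue_integral_def set_lebesgue_integral_def ei)
  moreover have "0 - 1 / ?z = 1 / Complex w (- y)"
  proof -
    have "Complex w (- y) = - ?z" by (simp add: complex_eq_iff)
    then show ?thesis by simp
  qed
  ultimately show ?thesis using int by (simp add: has_bochner_integral_iff set_integrable_def)
qed

lemma laplace_kernel:
  fixes w y :: real assumes w: "0 < w"
  shows "has_bochner_integral lborel (\<lambda>t. of_real (exp (- (w * \<bar>t\<bar>))) * cis (t * y)) (complex_of_real (2 * w / (w\<^sup>2 + y\<^sup>2)))"
proof -
  have R: "has_bochner_integral lborel (\<lambda>t. indicator {0<..} (0 + (-1) * t) *\<^sub>R exp (Complex (- w) (- y) * of_real (0 + (-1) * t))) ((1 / Complex w (- (- y))) /\<^sub>R \<bar>-1\<bar>)"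
    using half_line_exponential[OF w, of "- y"] by (subst (asm) lborel_has_bochner_integral_real_affine_iff[of "-1" _ _ 0]) auto
  have S: "has_bochner_integral lborel (\<lambda>t. indicator {0<..} t *\<^sub>R exp (Complex (- w) y * of_real t)
      + indicator {0<..} (0 + (-1) * t) *\<^sub>R exp (Complex (- w) (- y) * of_real (0 + (-1) * t)))
      (1 / Complex w (- y) + (1 / Complex w (- (- y))) /\<^sub>R \<bar>-1\<bar>)"
    by (rule has_bochner_integral_add[OF half_line_exponential[OF w] R])
  have val: "1 / Complex w (- y) + (1 / Complex w (- (- y))) /\<^sub>R \<bar>-1\<bar> = complex_of_real (2 * w / (w\<^sup>2 + y\<^sup>2))"
  proof -
    have p: "w\<^sup>2 + y\<^sup>2 > 0" using w by (intro add_pos_nonneg) auto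
    have "Complex w (- y) * Complex w y = of_real (w\<^sup>2 + y\<^sup>2)" by (simp add: complex_eq_iff power2_eq_square)
    moreover have "Complex w (- y) \<noteq> 0" "Complex w y \<noteq> 0" using w by (auto simp: complex_eq_iff)
    moreover have "Complex w y + Complex w (- y) = of_real (2 * w)" by (simp add: complex_eq_iff)
    ultimately have "1 / Complex w (- y) + 1 / Complex w y = of_real (2 * w) / of_real (w\<^sup>2 + y\<^sup>2)"
      by (simp add: add_frac_eq mult.commute add.commute)
    then show ?thesis by simp
  qed
  have ex: "exp (Complex (- w) y * of_real t) = of_real (exp (- (w * t))) * cis (t * y)" for t
    by (simp add: exp_eq_polar mult.commute)
  have ex': "exp (Complex (- w) (- y) * of_real (- t)) = of_real (exp (w * t)) * cis (t * y)" for t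
    by (simp add: exp_eq_polar mult.commute)
  show ?thesis
  proof (rule has_bochner_integralI_AE)
    show "has_bochner_integral lborel (\<lambda>t. indicator {0<..} t *\<^sub>R exp (Complex (- w) y * of_real t)
      + indicator {0<..} (0 + (-1) * t) *\<^sub>R exp (Complex (- w) (- y) * of_real (0 + (-1) * t))) (complex_of_real (2 * w / (w\<^sup>2 + y\<^sup>2)))"
      using S unfolding val .
    show "(\<lambda>t. complex_of_real (exp (- (w * \<bar>t\<bar>))) * cis (t * y)) \<in> borel_measurable lborel" by measurable
    have "AE t in lborel. t \<noteq> (0::real)" by (rule AE_lborel_singleton)
    then show "AE t in lborel. indicator {0<..} t *\<^sub>R exp (Complex (- w) y * of_real t)
      + indicator {0<..} (0 + (-1) * t) *\<^sub>R exp (Complex (- w) (- y) * of_real (0 + (-1) * t)) = complex_of_real (exp (- (w * \<bar>t\<bar>))) * cis (t * y)"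
    proof eventually_elim
      case (elim t)
      then show ?case using ex[of t] ex'[of t] by (cases "t > 0") (auto simp: indicator_def)
    qed
  qed
qed

text \<open>Parseval's identity for the Cauchy kernel and the law of \<open>Y\<close>: Fubini,
  followed by rescaling the frequency by \<open>h\<close>.\<close>

lemma (in prob_space) integral_cauchy_kernel:
  fixes w c :: real
  assumes w: "0 < w" and Y [measurable]: "Y \<in> borel_measurable M" and h: "0 < h"
  shows "of_real (h * (\<integral>x. 2 * w / (w\<^sup>2 + (h * Y x - c)\<^sup>2) \<partial>M))
    = (\<integral>t. of_real (exp (- (w * \<bar>t / h\<bar>))) * cis (- (c * (t / h))) * (\<integral>x. cis (t * Y x) \<partial>M) \<partial>lborel)"
proof -
  interpret pair_sigma_finite M lborel by unfold_locales
  define f where "f x t = complex_of_real (exp (- (w * \<bar>t\<bar>))) * cis (t * (h * Y x - c))" for x t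
  have f_meas: "case_prod f \<in> borel_measurable (M \<Otimes>\<^sub>M lborel)" unfolding f_def by measurable
  have fint: "has_bochner_integral lborel (f x) (complex_of_real (2 * w / (w\<^sup>2 + (h * Y x - c)\<^sup>2)))" for x
    unfolding f_def by (rule laplace_kernel[OF w])
  have f_int: "integrable (M \<Otimes>\<^sub>M lborel) (case_prod f)"
  proof (rule Fubini_integrable[OF f_meas])
    show "integrable M (\<lambda>x. \<integral>t. norm (case_prod f (x, t)) \<partial>lborel)" by (simp add: f_def norm_mult)
    show "AE x in M. integrable lborel (\<lambda>t. case_prod f (x, t))" using fint by (auto simp: has_bochner_integral_iff)
  qed
  have "complex_of_real (\<integral>x. 2 * w / (w\<^sup>2 + (h * Y x - c)\<^sup>2) \<partial>M) = (\<integral>x. (\<integral>t. f x t \<partial>lborel) \<partial>M)"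
    using fint by (simp only: has_bochner_integral_iff integral_complex_of_real)
  also have "\<dots> = (\<integral>t. (\<integral>x. f x t \<partial>M) \<partial>lborel)" by (rule Fubini_integral[OF f_int, symmetric])
  also have "\<dots> = (\<integral>t. complex_of_real (exp (- (w * \<bar>t\<bar>))) * cis (- (c * t)) * (\<integral>x. cis ((h * t) * Y x) \<partial>M) \<partial>lborel)"
  proof (rule Bochner_Integration.integral_cong[OF refl])
    fix t :: real
    have "f x t = complex_of_real (exp (- (w * \<bar>t\<bar>))) * cis (- (c * t)) * cis ((h * t) * Y x)" for x
      by (simp add: f_def mult.assoc cis_mult algebra_simps)
    then show "(\<integral>x. f x t \<partial>M) = complex_of_real (exp (- (w * \<bar>t\<bar>))) * cis (- (c * t)) * (\<integral>x. cis ((h * t) * Y x) \<partial>M)" by simp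
  qed
  also have "\<dots> = \<bar>1 / h\<bar> *\<^sub>R (\<integral>t. complex_of_real (exp (- (w * \<bar>0 + 1 / h * t\<bar>))) * cis (- (c * (0 + 1 / h * t))) * (\<integral>x. cis ((h * (0 + 1 / h * t)) * Y x) \<partial>M) \<partial>lborel)"
    using h by (intro lborel_integral_real_affine) auto
  also have "\<dots> = (\<integral>t. of_real (exp (- (w * \<bar>t / h\<bar>))) * cis (- (c * (t / h))) * (\<integral>x. cis (t * Y x) \<partial>M) \<partial>lborel) / of_real h"
    using h by (simp add: scaleR_conv_of_real)
  finally show ?thesis using h by (simp add: field_simps)
qed

text \<open>On the Fourier side the kernel becomes \<open>q (t / h N)\<close>, which tends to 1, so
  only the integral of the Gaussian remains. The variances \<open>v N\<close> may fail to converge;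
  hence the comparison with \<open>sqrt (2 * pi / v N)\<close> in place of a limit.\<close>

theorem cauchy_kernel_local_limit:
  fixes M :: "nat \<Rightarrow> 'a measure" and Y :: "nat \<Rightarrow> 'a \<Rightarrow> real" and h v :: "nat \<Rightarrow> real" and w c :: real
  assumes M: "\<And>N. prob_space (M N)" and Y: "\<And>N. Y N \<in> borel_measurable (M N)" and w: "1 \<le> w"
    and h: "\<And>N. 1 \<le> h N" "filterlim h at_top sequentially" and v0: "0 < v0" "\<And>N. v0 \<le> v N"
    and bound: "\<And>N t. norm (\<integral>x. cis (t * Y N x) \<partial>M N) \<le> exp (- v N * (t\<^sup>2 / (1 + t\<^sup>2 / (h N)\<^sup>2)) / 2)"
    and lim: "\<And>t. (\<lambda>N. (\<integral>x. cis (t * Y N x) \<partial>M N) - of_real (exp (- v N * t\<^sup>2 / 2))) \<longlonglongrightarrow> 0"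
  shows "(\<lambda>N. h N * (\<integral>x. 2 * w / (w\<^sup>2 + (h N * Y N x - c)\<^sup>2) \<partial>M N) - sqrt (2 * pi / v N)) \<longlonglongrightarrow> 0"
proof -
  define \<phi> where "\<phi> N t = (\<integral>x. cis (t * Y N x) \<partial>M N)" for N t
  define q where "q s = complex_of_real (exp (- (w * \<bar>s\<bar>))) * cis (- (c * s))" for s
  define D where "D N t = q (t / h N) * \<phi> N t - of_real (exp (- v N * t\<^sup>2 / 2))" for N t
  have hpos: "0 < h N" for N using h(1)[of N] by linarith
  have vpos: "0 < v N" for N using v0(1) v0(2)[of N] by linarith
  have q0: "q 0 = 1" by (simp add: q_def)
  have q_meas [measurable]: "q \<in> borel_measurable borel" unfolding q_def by measurable
  have q_bound: "norm (q s) \<le> exp (- \<bar>s\<bar>)" for s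
    using w mult_right_mono[of 1 w "\<bar>s\<bar>"] by (simp add: q_def norm_mult)
  have \<phi>_meas: "\<phi> N \<in> borel_measurable lborel" for N
  proof -
    interpret prob_space "M N" by (rule M)
    note Y[of N, measurable]
    show ?thesis unfolding \<phi>_def by measurable
  qed
  have A: "norm (q (t / h N) * \<phi> N t) \<le> (1 + 16 / v0) * inverse (1 + t\<^sup>2)" for N t
  proof -
    have "norm (q (t / h N) * \<phi> N t) \<le> exp (- \<bar>t / h N\<bar>) * exp (- v N * (t\<^sup>2 / (1 + t\<^sup>2 / (h N)\<^sup>2)) / 2)"
      unfolding norm_mult \<phi>_def by (intro mult_mono q_bound bound) auto
    also have "\<dots> \<le> (1 + 16 / v0) * inverse (1 + t\<^sup>2)" by (rule damped_gaussian_le[OF v0 h(1)])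
    finally show ?thesis .
  qed
  have B: "exp (- v N * t\<^sup>2 / 2) \<le> (1 + 16 / v0) * inverse (1 + t\<^sup>2)" for N t
  proof -
    have "exp (- v N * t\<^sup>2 / 2) \<le> exp (- (v0 * t\<^sup>2 / 4))"
    proof -
      have "v0 * t\<^sup>2 \<le> v N * t\<^sup>2" using v0(2)[of N] by (intro mult_right_mono) auto
      moreover have "0 \<le> v0 * t\<^sup>2" using v0(1) by simp
      ultimately have "- v N * t\<^sup>2 / 2 \<le> - (v0 * t\<^sup>2 / 4)" unfolding minus_mult_left[symmetric] by linarith
      then show ?thesis by (simp only: exp_le_cancel_iff)
    qed
    also have "\<dots> \<le> 1 / (1 + v0 * t\<^sup>2 / 4)" using v0(1) by (intro exp_minus_le_inverse) auto
    also have "\<dots> \<le> (1 + 16 / v0) * inverse (1 + t\<^sup>2)"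
    proof -
      have "1 + t\<^sup>2 \<le> (1 + 16 / v0) * (1 + v0 * t\<^sup>2 / 4)" using v0(1) by (simp add: field_simps)
      moreover have "0 < 1 + v0 * t\<^sup>2 / 4" "0 < 1 + t\<^sup>2" using v0(1) by (auto intro: add_pos_nonneg)
      ultimately show ?thesis by (simp add: field_simps)
    qed
    finally show ?thesis .
  qed
  have iA: "integrable lborel (\<lambda>t. q (t / h N) * \<phi> N t)" for N
  proof (rule Bochner_Integration.integrable_bound)
    show "integrable lborel (\<lambda>t::real. (1 + 16 / v0) * inverse (1 + t\<^sup>2))"
      by (rule integrable_mult_right[OF integrable_inverse_square_line])
    show "AE t in lborel. norm (q (t / h N) * \<phi> N t) \<le> norm ((1 + 16 / v0) * inverse (1 + t\<^sup>2))"
      using A by (intro AE_I2) (auto intro: order.trans[OF _ abs_ge_self])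
    show "(\<lambda>t. q (t / h N) * \<phi> N t) \<in> borel_measurable lborel" using \<phi>_meas[of N] by measurable
  qed
  have G: "integrable lborel (\<lambda>t. complex_of_real (exp (- v N * t\<^sup>2 / 2)))"
      "(\<integral>t. complex_of_real (exp (- v N * t\<^sup>2 / 2)) \<partial>lborel) = of_real (sqrt (2 * pi / v N))" for N
    using gaussian_integral[OF vpos[of N]] by (auto simp: has_bochner_integral_iff simp del: of_real_exp)
  have DI: "(\<integral>t. D N t \<partial>lborel) = of_real (h N * (\<integral>x. 2 * w / (w\<^sup>2 + (h N * Y N x - c)\<^sup>2) \<partial>M N) - sqrt (2 * pi / v N))" for N
  proof -
    interpret prob_space "M N" by (rule M)
    have "(\<integral>t. D N t \<partial>lborel) = (\<integral>t. q (t / h N) * \<phi> N t \<partial>lborel) - of_real (sqrt (2 * pi / v N))"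
      unfolding D_def using iA[of N] G[of N] by simp
    also have "(\<integral>t. q (t / h N) * \<phi> N t \<partial>lborel) = of_real (h N * (\<integral>x. 2 * w / (w\<^sup>2 + (h N * Y N x - c)\<^sup>2) \<partial>M N))"
      using integral_cauchy_kernel[OF _ Y hpos, where w = w and c = c] w by (simp only: q_def \<phi>_def)
    finally show ?thesis by simp
  qed
  have "(\<lambda>N. \<integral>t. D N t \<partial>lborel) \<longlonglongrightarrow> (\<integral>t. 0 \<partial>(lborel :: real measure))"
  proof (rule integral_dominated_convergence[where w = "\<lambda>t. 2 * ((1 + 16 / v0) * inverse (1 + t\<^sup>2))"])
    show "D N \<in> borel_measurable lborel" for N unfolding D_def using \<phi>_meas[of N] by measurable
    show "integrable lborel (\<lambda>t::real. 2 * ((1 + 16 / v0) * inverse (1 + t\<^sup>2)))"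
      by (intro integrable_mult_right integrable_inverse_square_line)
    show "AE t in lborel. norm (D N t) \<le> 2 * ((1 + 16 / v0) * inverse (1 + t\<^sup>2))" for N
    proof (rule AE_I2)
      fix t
      have "norm (D N t) \<le> norm (q (t / h N) * \<phi> N t) + norm (complex_of_real (exp (- v N * t\<^sup>2 / 2)))"
        unfolding D_def by (rule norm_triangle_ineq4)
      also have "norm (complex_of_real (exp (- v N * t\<^sup>2 / 2))) = exp (- v N * t\<^sup>2 / 2)" by (simp del: of_real_exp)
      finally show "norm (D N t) \<le> 2 * ((1 + 16 / v0) * inverse (1 + t\<^sup>2))" using A[of t N] B[of N t] by linarith
    qed
    show "AE t in lborel. (\<lambda>N. D N t) \<longlonglongrightarrow> 0"
    proof (rule AE_I2)
      fix t :: real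
      have th: "(\<lambda>N. t / h N) \<longlonglongrightarrow> 0" by (rule real_tendsto_divide_at_top[OF tendsto_const h(2)])
      have "isCont q 0" unfolding q_def cis_conv_exp by (intro continuous_intros)
      then have "(\<lambda>N. q (t / h N)) \<longlonglongrightarrow> 1" using isCont_tendsto_compose[OF _ th] q0 by fastforce
      then have q1: "(\<lambda>N. q (t / h N) - 1) \<longlonglongrightarrow> 0" by (simp add: LIM_zero)
      have "(\<lambda>N. (q (t / h N) - 1) * \<phi> N t) \<longlonglongrightarrow> 0"
      proof (rule Lim_null_comparison[where g = "\<lambda>N. norm (q (t / h N) - 1)"])
        have "norm (\<phi> N t) \<le> 1" for N
        proof -
          have "norm (\<phi> N t) \<le> exp (- v N * (t\<^sup>2 / (1 + t\<^sup>2 / (h N)\<^sup>2)) / 2)" unfolding \<phi>_def by (rule bound)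
          also have "\<dots> \<le> 1" using vpos[of N] by simp
          finally show ?thesis .
        qed
        then show "\<forall>\<^sub>F N in sequentially. norm ((q (t / h N) - 1) * \<phi> N t) \<le> norm (q (t / h N) - 1)"
          by (intro always_eventually allI) (auto simp: norm_mult intro: mult_left_le)
        show "(\<lambda>N. norm (q (t / h N) - 1)) \<longlonglongrightarrow> 0" by (rule tendsto_norm_zero[OF q1])
      qed
      from tendsto_add[OF this lim[of t, folded \<phi>_def]] show "(\<lambda>N. D N t) \<longlonglongrightarrow> 0"
        by (simp add: D_def algebra_simps)
    qed
  qed auto
  then have "(\<lambda>N. complex_of_real (h N * (\<integral>x. 2 * w / (w\<^sup>2 + (h N * Y N x - c)\<^sup>2) \<partial>M N) - sqrt (2 * pi / v N))) \<longlonglongrightarrow> of_real 0"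
    unfolding DI by simp
  then show ?thesis by (simp only: tendsto_of_real_iff)
qed

text \<open>The quadratic Taylor bound of \<open>exp\<close>. The right-hand side keeps the shape of
  the kernel with \<open>w = 1\<close> and \<open>c = 0\<close>.\<close>

lemma exp_indicator_le_cauchy: fixes y :: real
  shows "exp (- y) * (if 0 \<le> y then 1 else 0) \<le> 2 * 1 / (1\<^sup>2 + (y - 0)\<^sup>2)"
proof (cases "0 \<le> y")
  case True
  then have "(1 + y\<^sup>2) / 2 \<le> exp y" using exp_lower_Taylor_quadratic[of y] by (simp add: field_simps)
  then show ?thesis using True by (simp add: exp_minus field_simps add_pos_nonneg)
qed (simp add: add_pos_nonneg)

text \<open>A combination of two Cauchy kernels that is positive only on a bounded interval of the positive half-line.\<close>

lemma cauchy_le_exp_indicator: fixes y :: real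
  shows "exp (- 6) * (1 / 2 * (2 * 1 / (1\<^sup>2 + (y - 3)\<^sup>2)) - 3 / 8 * (2 * 2 / (2\<^sup>2 + (y - 3)\<^sup>2)))
    \<le> exp (- y) * (if 0 \<le> y then 1 else 0)"
proof -
  define u where "u = (y - 3)\<^sup>2"
  have u: "0 \<le> u" by (simp add: u_def)
  \<comment> \<open>The two kernels have equal total mass, so their combination has mass
    proportional to \<open>1 / 2 - 3 / 8 = 1 / 8 > 0\<close>, although \<open>g\<close> is positive
    only for \<open>u < 5\<close>. On \<open>u < 9\<close> the point \<open>y\<close> lies between 0
    and 6, where \<open>exp (- 6)\<close> is at most \<open>exp (- y)\<close>.\<close>
  define g where "g = 1 / (1 + u) - (3 / 2) / (4 + u)"
  have eq: "1 / 2 * (2 * 1 / (1\<^sup>2 + (y - 3)\<^sup>2)) - 3 / 8 * (2 * 2 / (2\<^sup>2 + (y - 3)\<^sup>2)) = g"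
    by (simp add: g_def u_def)
  have "exp (- 6) * g \<le> exp (- y) * (if 0 \<le> y then 1 else 0)"
  proof (cases "u < 9")
    case True
    then have "\<bar>y - 3\<bar> < 3" unfolding u_def using power2_less_imp_less[of "\<bar>y - 3\<bar>" 3] by simp
    then have y: "0 \<le> y" "y \<le> 6" by auto
    have "1 / (1 + u) \<le> 1" "0 \<le> (3 / 2) / (4 + u)" using u by auto
    then have "g \<le> 1" unfolding g_def by linarith
    then have "exp (- 6) * g \<le> exp (- 6) * 1" by (intro mult_left_mono) auto
    also have "\<dots> \<le> exp (- y)" using y by simp
    finally show ?thesis using y by simp
  next
    case False
    then have "g \<le> 0" unfolding g_def using u by (simp add: field_simps) (rule divide_nonpos_pos, auto intro!: add_pos_nonneg)
    then have "exp (- 6) * g \<le> 0" by (simp add: mult_le_0_iff)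
    also have "0 \<le> exp (- y) * (if 0 \<le> y then 1 else 0)" by simp
    finally show ?thesis .
  qed
  then show ?thesis by (simp only: eq)
qed

section \<open>Exponential tilting and the local estimate of the tail\<close>

context cbe_ensemble
begin

text \<open>The supporting line of \<open>log_mgf\<close> at the saddle point bounds the expression
  for all \<open>h\<close> at once, with equality at the saddle point.\<close>

lemma log_mgf_conj_eq:
  assumes N: "N \<ge> 1" and a: "0 \<le> a" "a < ln 2"
  shows "log_mgf_conj N \<beta> (a * real N) = ereal (Lam_conj N b a)"
  unfolding log_mgf_conj_def
proof (rule antisym)
  have h: "0 \<le> hsol N b a" "Lam1 N b (hsol N b a) = a * real N" by (auto intro: hsol b_pos N a)
  show "(SUP h. ereal (a * real N * h) - log_mgf N \<beta> h) \<le> ereal (Lam_conj N b a)"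
  proof (rule SUP_least)
    fix k :: real
    have "ereal (Lam N b (hsol N b a) + (k - hsol N b a) * (a * real N)) \<le> log_mgf N \<beta> k"
      using log_mgf_ge[of "hsol N b a" k] h by simp
    then have "ereal (a * real N * k) - log_mgf N \<beta> k \<le> ereal (a * real N * k) - ereal (Lam N b (hsol N b a) + (k - hsol N b a) * (a * real N))"
      by (intro ereal_minus_mono) auto
    also have "\<dots> = ereal (Lam_conj N b a)" by (simp add: Lam_conj_def algebra_simps)
    finally show "ereal (a * real N * k) - log_mgf N \<beta> k \<le> ereal (Lam_conj N b a)" .
  qed
  have "ereal (Lam_conj N b a) = ereal (a * real N * hsol N b a) - log_mgf N \<beta> (hsol N b a)"
    using h by (simp add: log_mgf_eq Lam_conj_def)
  also have "\<dots> \<le> (SUP h. ereal (a * real N * h) - log_mgf N \<beta> h)" by (rule SUP_upper) simp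
  finally show "ereal (Lam_conj N b a) \<le> (SUP h. ereal (a * real N * h) - log_mgf N \<beta> h)" .
qed

definition tilt :: "real \<Rightarrow> (nat \<Rightarrow> complex) measure" where
  "tilt h = density P (\<lambda>x. ennreal (exp (h * X x - Lam N b h)))"

lemma sets_tilt [measurable_cong]: "sets (tilt h) = sets P" by (simp add: tilt_def)
lemma space_tilt [simp]: "space (tilt h) = space P" by (simp add: tilt_def)

lemma prob_space_tilt:
  assumes h: "h > -1" shows "prob_space (tilt h)"
proof (rule prob_spaceI)
  have "emeasure (tilt h) (space (tilt h)) = (\<integral>\<^sup>+ x. ennreal (exp (h * X x)) * ennreal (exp (- Lam N b h)) \<partial>P)"
    by (simp add: tilt_def emeasure_density ennreal_mult[symmetric] exp_add[symmetric] cong: nn_integral_cong)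
  also have "\<dots> = (\<integral>\<^sup>+ x. ennreal (exp (h * X x)) \<partial>P) * ennreal (exp (- Lam N b h))"
    by (rule nn_integral_multc) measurable
  also have "(\<integral>\<^sup>+ x. ennreal (exp (h * X x)) \<partial>P) = ennreal (E h)"
    unfolding E_def using integrable_exp_X[OF h] by (intro nn_integral_eq_integral) auto
  finally show "emeasure (tilt h) (space (tilt h)) = 1"
    by (simp add: E_formula[OF h] ennreal_mult[symmetric] exp_add[symmetric])
qed

lemma integral_tilt:
  fixes f :: "(nat \<Rightarrow> complex) \<Rightarrow> 'b::{banach, second_countable_topology}"
  assumes "f \<in> borel_measurable P"
  shows "(\<integral>x. f x \<partial>tilt h) = (\<integral>x. exp (h * X x - Lam N b h) *\<^sub>R f x \<partial>P)"
  unfolding tilt_def by (rule integral_density) (use assms in auto)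

lemma tail_tilt:
  assumes h: "h > -1"
  shows "upper_tail N \<beta> c * exp (c * h - Lam N b h) = (\<integral>x. exp (- (h * (X x - c))) * (if c \<le> X x then 1 else 0) \<partial>tilt h)"
proof -
  have s: "{x \<in> space P. c \<le> X x} \<in> sets P" by measurable
  have "(\<integral>x. exp (- (h * (X x - c))) * (if c \<le> X x then 1 else 0) \<partial>tilt h)
      = (\<integral>x. exp (h * X x - Lam N b h) *\<^sub>R (exp (- (h * (X x - c))) * (if c \<le> X x then 1 else 0)) \<partial>P)"
    by (rule integral_tilt) measurable
  also have "\<dots> = (\<integral>x. exp (c * h - Lam N b h) * indicator {x \<in> space P. c \<le> X x} x \<partial>P)"
  proof (rule Bochner_Integration.integral_cong[OF refl])
    fix x assume x: "x \<in> space P"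
    have "exp (h * X x - Lam N b h) * exp (- (h * (X x - c))) = exp (c * h - Lam N b h)"
      by (simp add: exp_add[symmetric] algebra_simps)
    then show "exp (h * X x - Lam N b h) *\<^sub>R (exp (- (h * (X x - c))) * (if c \<le> X x then 1 else 0)) = exp (c * h - Lam N b h) * indicator {x \<in> space P. c \<le> X x} x"
      using x by (simp add: indicator_def)
  qed
  also have "\<dots> = exp (c * h - Lam N b h) * measure P {x \<in> space P. c \<le> X x}" using s by simp
  finally show ?thesis by (simp add: upper_tail_def mult.commute)
qed

lemma tail_sandwich:
  fixes h c :: real
  assumes h: "h > 0"
  defines "Ik w d \<equiv> (\<integral>x. 2 * w / (w\<^sup>2 + (h * (X x - c) - d)\<^sup>2) \<partial>tilt h)"
  shows "upper_tail N \<beta> c * exp (c * h - Lam N b h) \<le> Ik 1 0"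
    and "exp (- 6) * (1 / 2 * Ik 1 3 - 3 / 8 * Ik 2 3) \<le> upper_tail N \<beta> c * exp (c * h - Lam N b h)"
proof -
  interpret T: prob_space "tilt h" by (rule prob_space_tilt) (use h in simp)
  have int: "integrable (tilt h) (\<lambda>x. 2 * w / (w\<^sup>2 + (h * (X x - c) - d)\<^sup>2))" if w: "w \<ge> 1" for w d
  proof (rule T.integrable_const_bound[where B = 2])
    show "AE x in tilt h. norm (2 * w / (w\<^sup>2 + (h * (X x - c) - d)\<^sup>2)) \<le> 2"
    proof (rule AE_I2)
      fix x
      have "2 * w \<le> 2 * w\<^sup>2" using w mult_right_mono[of 1 w w] by (simp add: power2_eq_square)
      also have "\<dots> \<le> 2 * (w\<^sup>2 + (h * (X x - c) - d)\<^sup>2)" by simp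
      finally have "2 * w \<le> 2 * (w\<^sup>2 + (h * (X x - c) - d)\<^sup>2)" .
      moreover have "0 < w\<^sup>2 + (h * (X x - c) - d)\<^sup>2" using w by (intro add_pos_nonneg) auto
      ultimately show "norm (2 * w / (w\<^sup>2 + (h * (X x - c) - d)\<^sup>2)) \<le> 2" using w by (simp add: divide_le_eq)
    qed
  qed measurable
  have intE: "integrable (tilt h) (\<lambda>x. exp (- (h * (X x - c))) * (if c \<le> X x then 1 else 0))"
    by (rule T.integrable_const_bound[where B = 1]) (use h in auto)
  have iff: "(0 \<le> h * (x - c)) = (c \<le> x)" for x :: real using h by (simp add: zero_le_mult_iff)
  have e: "upper_tail N \<beta> c * exp (c * h - Lam N b h) = (\<integral>x. exp (- (h * (X x - c))) * (if c \<le> X x then 1 else 0) \<partial>tilt h)"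
    by (rule tail_tilt) (use h in simp)
  show "upper_tail N \<beta> c * exp (c * h - Lam N b h) \<le> Ik 1 0"
    unfolding e Ik_def
    by (rule integral_mono[OF intE int]) (use exp_indicator_le_cauchy[of "h * (X _ - c)", unfolded iff] in auto)
  have "exp (- 6) * (1 / 2 * Ik 1 3 - 3 / 8 * Ik 2 3)
     = (\<integral>x. exp (- 6) * (1 / 2 * (2 * 1 / (1\<^sup>2 + (h * (X x - c) - 3)\<^sup>2)) - 3 / 8 * (2 * 2 / (2\<^sup>2 + (h * (X x - c) - 3)\<^sup>2))) \<partial>tilt h)"
    unfolding Ik_def using int[of 1 3] int[of 2 3]
    by (simp only: integral_mult_right_zero Bochner_Integration.integral_diff integrable_mult_right one_le_numeral order_refl)
  also have "\<dots> \<le> upper_tail N \<beta> c * exp (c * h - Lam N b h)"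
    unfolding e
  proof (rule integral_mono[OF _ intE])
    show "integrable (tilt h) (\<lambda>x. exp (- 6) * (1 / 2 * (2 * 1 / (1\<^sup>2 + (h * (X x - c) - 3)\<^sup>2)) - 3 / 8 * (2 * 2 / (2\<^sup>2 + (h * (X x - c) - 3)\<^sup>2))))"
      by (intro integrable_mult_right Bochner_Integration.integrable_diff int) auto
    fix x
    show "exp (- 6) * (1 / 2 * (2 * 1 / (1\<^sup>2 + (h * (X x - c) - 3)\<^sup>2)) - 3 / 8 * (2 * 2 / (2\<^sup>2 + (h * (X x - c) - 3)\<^sup>2)))
      \<le> exp (- (h * (X x - c))) * (if c \<le> X x then 1 else 0)"
      using cauchy_le_exp_indicator[of "h * (X x - c)", unfolded iff] .
  qed
  finally show "exp (- 6) * (1 / 2 * Ik 1 3 - 3 / 8 * Ik 2 3) \<le> upper_tail N \<beta> c * exp (c * h - Lam N b h)" .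
qed

lemma tilt_characteristic:
  assumes h: "h > -1"
  shows "(\<integral>x. cis (t * (X x - c)) \<partial>tilt h) = exp (LamC N b (Complex h t) - of_real (Lam N b h) - \<i> * of_real (t * c))"
proof -
  have m: "(\<lambda>x. cis (t * (X x - c))) \<in> borel_measurable P"
    using measurable_compose[OF _ cis_borel] by measurable
  have e: "exp (h * X x - Lam N b h) *\<^sub>R cis (t * (X x - c))
     = exp (Complex h t * of_real (X x)) * exp (- of_real (Lam N b h) - \<i> * of_real (t * c))" for x
  proof -
    have "exp (h * X x - Lam N b h) *\<^sub>R cis (t * (X x - c)) = exp (of_real (h * X x - Lam N b h)) * exp (\<i> * of_real (t * (X x - c)))"
      by (simp only: exp_of_real scaleR_conv_of_real cis_conv_exp)
    also have "\<dots> = exp (of_real (h * X x - Lam N b h) + \<i> * of_real (t * (X x - c)))" by (simp only: exp_add)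
    also have "of_real (h * X x - Lam N b h) + \<i> * of_real (t * (X x - c)) = Complex h t * of_real (X x) + (- of_real (Lam N b h) - \<i> * of_real (t * c))"
      by (simp add: complex_eq_iff algebra_simps)
    finally show ?thesis by (simp only: exp_add)
  qed
  have "(\<integral>x. cis (t * (X x - c)) \<partial>tilt h) = F (Complex h t) * exp (- of_real (Lam N b h) - \<i> * of_real (t * c))"
    unfolding integral_tilt[OF m] e F_def by simp
  also have "F (Complex h t) = exp (LamC N b (Complex h t))" by (rule F_formula) (use h in simp)
  finally show ?thesis by (simp add: exp_add[symmetric] algebra_simps)
qed

end

text \<open>\<open>tail_sandwich\<close> combined with \<open>cauchy_kernel_local_limit\<close> for
  the three kernels involved. The remaining conjuncts confine the variance and the saddle point by
  quantities that depend on \<open>a\<close> through \<open>theta_inv a\<close> only; they make the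
  later constants uniform in \<open>a\<close>.\<close>

lemma tail_local_limit:
  fixes \<beta> a y1 y2 :: real
  defines "b \<equiv> \<beta> / 2"
  assumes \<beta>: "\<beta> > 0" and a: "0 < a" "a < ln 2" and \<epsilon>: "\<epsilon> > 0"
  shows "\<forall>\<^sub>F N in sequentially.
    hsol N b a * (upper_tail N \<beta> (a * real N) * exp (Lam_conj N b a)) \<le> sqrt (2 * pi / Lam2 N b (hsol N b a)) + \<epsilon> \<and>
    exp (- 6) * (sqrt (2 * pi / Lam2 N b (hsol N b a)) / 8 - \<epsilon>) \<le> hsol N b a * (upper_tail N \<beta> (a * real N) * exp (Lam_conj N b a)) \<and>
    b / (32 * (1 + b + 2 * b * theta_inv a)\<^sup>2) \<le> Lam2 N b (hsol N b a) \<and>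
    Lam2 N b (hsol N b a) \<le> 1 / (b * theta_inv a) + 2 / (b * theta_inv a)\<^sup>2 \<and>
    b * theta_inv a * real N \<le> hsol N b a \<and> hsol N b a \<le> 4 * b * theta_inv a * real N \<and> N \<ge> 1"
proof -
  define x where "x = theta_inv a"
  have b: "b > 0" using \<beta> by (simp add: b_def)
  have x: "x > 0" unfolding x_def by (rule theta_inv_pos[OF a])
  \<comment> \<open>From \<open>Lam2_ge\<close>, using \<open>h N \<le> 4 * b * x * N\<close> and
    \<open>N * (N - 1) \<ge> N\<^sup>2 / 2\<close>.\<close>
  define v0 where "v0 = b / (32 * (1 + b + 2 * b * x)\<^sup>2)"
  have v0: "v0 > 0" unfolding v0_def using b x by (intro divide_pos_pos mult_pos_pos zero_less_power add_pos_pos) auto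
  define h where "h N = hsol N b a" for N
  define v where "v N = Lam2 N b (h N)" for N
  have ev0: "\<forall>\<^sub>F N in sequentially. b * x * real N \<le> h N \<and> h N \<le> 4 * b * x * real N"
    using hsol_eventually[OF b a, of "x / 2" "2 * x"] x by (simp add: h_def x_def[symmetric] mult.assoc)
  have ev1: "\<forall>\<^sub>F N in sequentially. 1 / (b * x) \<le> real N" by real_asymp
  have "\<forall>\<^sub>F N in sequentially. (b * x * real N \<le> h N \<and> h N \<le> 4 * b * x * real N) \<and> 1 / (b * x) \<le> real N \<and> N \<ge> 2"
    using ev0 ev1 eventually_ge_at_top[of 2] by eventually_elim auto
  then obtain N0 where N0: "\<And>N. N \<ge> N0 \<Longrightarrow> b * x * real N \<le> h N" "\<And>N. N \<ge> N0 \<Longrightarrow> h N \<le> 4 * b * x * real N"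
      "\<And>N. N \<ge> N0 \<Longrightarrow> 1 / (b * x) \<le> real N" "\<And>N. N \<ge> N0 \<Longrightarrow> N \<ge> 2"
    unfolding eventually_sequentially by blast
  have h1: "1 \<le> h N" if "N \<ge> N0" for N
  proof -
    have "1 \<le> b * x * real N" using N0(3)[OF that] b x by (simp add: field_simps)
    then show ?thesis using N0(1)[OF that] by linarith
  qed
  have vlo: "v0 \<le> v N" if n: "N \<ge> N0" for N
  proof -
    have N2: "real N \<ge> 2" using N0(4)[OF n] by simp
    have A: "(real N)\<^sup>2 / 2 \<le> real N * (real N - 1)"
    proof -
      have "2 * real N \<le> real N * real N" using N2 by (intro mult_right_mono) auto
      then show ?thesis by (simp add: power2_eq_square right_diff_distrib)
    qed
    have "1 + real N * b + h N / 2 \<le> real N * (1 + b + 2 * b * x)"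
      using N2 N0(2)[OF n] by (simp add: algebra_simps)
    moreover have pos: "0 < 1 + real N * b + h N / 2" using h1[OF n] b by (intro add_pos_pos add_pos_nonneg) auto
    ultimately have B: "(1 + real N * b + h N / 2)\<^sup>2 \<le> (real N * (1 + b + 2 * b * x))\<^sup>2" by (intro power_mono) auto
    have "v0 = b / 16 * ((real N)\<^sup>2 / 2) / (real N * (1 + b + 2 * b * x))\<^sup>2"
      using N2 by (simp add: v0_def power_mult_distrib)
    also have "\<dots> \<le> b / 16 * (real N * (real N - 1)) / (1 + real N * b + h N / 2)\<^sup>2"
      using A B b pos N2 by (intro frac_le mult_left_mono mult_nonneg_nonneg) auto
    also have "\<dots> \<le> v N" unfolding v_def by (rule Lam2_ge[OF b]) (use h1[OF n] in simp)
    finally show ?thesis .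
  qed
  have vhi: "v N \<le> 1 / (b * x) + 2 / (b * x)\<^sup>2" if n: "N \<ge> N0" for N
  proof -
    have N2: "real N \<ge> 2" using N0(4)[OF n] by simp
    have bx: "0 < b * x" "0 < b * x * real N" using b x N2 by auto
    have "v N \<le> real N / 2 * (2 / h N + 4 / (h N)\<^sup>2)" unfolding v_def by (rule Lam2_le[OF b]) (use h1[OF n] in simp)
    also have "\<dots> \<le> real N / 2 * (2 / (b * x * real N) + 4 / (b * x * real N)\<^sup>2)"
      using N0(1)[OF n] h1[OF n] bx b x N2 by (intro mult_left_mono add_mono divide_left_mono power_mono mult_pos_pos zero_less_power) auto
    also have "\<dots> = 1 / (b * x) + (2 / (b * x)\<^sup>2) / real N" using N2 b x by (simp add: field_simps power2_eq_square)
    also have "(2 / (b * x)\<^sup>2) / real N \<le> 2 / (b * x)\<^sup>2" 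
    proof -
      have "(2 / (b * x)\<^sup>2) / real N \<le> (2 / (b * x)\<^sup>2) / 1" using N2 by (intro divide_left_mono) auto
      then show ?thesis by simp
    qed
    finally show ?thesis by simp
  qed
  \<comment> \<open>The local limit asks for its bounds at every index, whereas they hold from
    \<open>N0\<close> on; hence the shifted sequence.\<close>
  define M where "M n = cbe_ensemble.tilt (N0 + n) \<beta> (h (N0 + n))" for n
  define Y where "Y n z = log_charpoly (N0 + n) z - a * real (N0 + n)" for n z
  interpret C: cbe_ensemble "N" \<beta> for N by unfold_locales (rule \<beta>)
  have M: "prob_space (M n)" for n unfolding M_def using h1[of "N0 + n"] by (intro C.prob_space_tilt) auto
  have Y: "Y n \<in> borel_measurable (M n)" for n unfolding M_def Y_def by measurable
  have hinf: "filterlim h at_top sequentially"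
  proof (rule filterlim_at_top_mono)
    show "filterlim (\<lambda>N. b * x * real N) at_top sequentially"
      using b x by (intro filterlim_tendsto_pos_mult_at_top[OF tendsto_const _ filterlim_real_sequentially]) auto
    show "\<forall>\<^sub>F N in sequentially. b * x * real N \<le> h N" using N0(1) by (auto simp: eventually_sequentially)
  qed
  have L1: "Lam1 N b (h N) = a * real N" if "N \<ge> N0" for N
    unfolding h_def using N0(4)[OF that] b a by (intro hsol) auto
  have chi: "(\<integral>z. cis (t * Y n z) \<partial>M n) = exp (LamC (N0 + n) b (Complex (h (N0 + n)) t) - of_real (Lam (N0 + n) b (h (N0 + n)))
       - \<i> * of_real (t * (a * real (N0 + n))))" for t n
    unfolding M_def Y_def using C.tilt_characteristic[of "h (N0 + n)" "N0 + n" t "a * real (N0 + n)"] h1[of "N0 + n"] by (simp add: b_def)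
  have "(\<lambda>n. h (N0 + n) * (\<integral>z. 2 * w / (w\<^sup>2 + (h (N0 + n) * Y n z - d)\<^sup>2) \<partial>M n) - sqrt (2 * pi / v (N0 + n))) \<longlonglongrightarrow> 0"
    if w: "1 \<le> w" for w d
  proof (rule cauchy_kernel_local_limit[OF M Y w])
    show "1 \<le> h (N0 + n)" for n by (rule h1) simp
    show "filterlim (\<lambda>n. h (N0 + n)) at_top sequentially"
      by (rule filterlim_compose[OF hinf]) (rule filterlim_at_top_mono[OF filterlim_ident], simp)
    show "0 < v0" by (rule v0)
    show "v0 \<le> v (N0 + n)" for n by (rule vlo) simp
    show "norm (\<integral>z. cis (t * Y n z) \<partial>M n) \<le> exp (- v (N0 + n) * (t\<^sup>2 / (1 + t\<^sup>2 / (h (N0 + n))\<^sup>2)) / 2)" for n t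
    proof -
      have "norm (\<integral>z. cis (t * Y n z) \<partial>M n) = norm (exp (LamC (N0 + n) b (Complex (h (N0 + n)) t) - of_real (Lam (N0 + n) b (h (N0 + n)))))"
        unfolding chi by (simp add: exp_diff[of _ "\<i> * _"] norm_divide)
      also have "\<dots> \<le> exp (- Lam2 (N0 + n) b (h (N0 + n)) * (t\<^sup>2 / (1 + t\<^sup>2 / (h (N0 + n))\<^sup>2)) / 2)"
        by (rule norm_exp_LamC_le[OF b]) (use h1[of "N0 + n"] in simp)
      finally show ?thesis by (simp add: v_def)
    qed
    fix t :: real
    \<comment> \<open>The Taylor remainder is of order \<open>N / h\<^sup>2\<close>, that is
      \<open>1 / N\<close>. The linear term will cancel against the centring, because
      \<open>Lam1\<close> equals \<open>a * N\<close> at the saddle point.\<close>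
    define r where "r n = LamC (N0 + n) b (Complex (h (N0 + n)) t) - (of_real (Lam (N0 + n) b (h (N0 + n)))
       + \<i> * of_real (t * Lam1 (N0 + n) b (h (N0 + n))) - of_real (Lam2 (N0 + n) b (h (N0 + n)) * t\<^sup>2 / 2))" for n
    have r0: "r \<longlonglongrightarrow> 0"
    proof (rule Lim_null_comparison)
      show "\<forall>\<^sub>F n in sequentially. norm (r n) \<le> 5 / (b * x)\<^sup>2 * \<bar>t\<bar> ^ 3 / real n"
        using eventually_gt_at_top[of 0]
      proof eventually_elim
        case (elim n)
        have hh: "1 \<le> h (N0 + n)" by (rule h1) simp
        have bx: "0 < b * x * real (N0 + n)" using b x elim by simp
        have "norm (r n) \<le> real (N0 + n) * (8 / h (N0 + n) ^ 3 + 2 / (h (N0 + n))\<^sup>2) * \<bar>t\<bar> ^ 3 / 2"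
          unfolding r_def by (rule LamC_taylor[OF b]) (use hh in simp)
        also have "\<dots> \<le> real (N0 + n) * (10 / (b * x * real (N0 + n))\<^sup>2) * \<bar>t\<bar> ^ 3 / 2"
        proof (intro divide_right_mono mult_right_mono mult_left_mono)
          have "8 / h (N0 + n) ^ 3 \<le> 8 / (h (N0 + n))\<^sup>2"
            using hh by (intro divide_left_mono power_increasing mult_pos_pos zero_less_power) auto
          then have "8 / h (N0 + n) ^ 3 + 2 / (h (N0 + n))\<^sup>2 \<le> 8 / (h (N0 + n))\<^sup>2 + 2 / (h (N0 + n))\<^sup>2" by simp
          also have "\<dots> = 10 / (h (N0 + n))\<^sup>2" by (simp add: add_divide_distrib[symmetric])
          also have "\<dots> \<le> 10 / (b * x * real (N0 + n))\<^sup>2"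
            using N0(1)[of "N0 + n"] bx hh b x elim by (intro divide_left_mono power_mono mult_pos_pos zero_less_power) auto
          finally show "8 / h (N0 + n) ^ 3 + 2 / (h (N0 + n))\<^sup>2 \<le> 10 / (b * x * real (N0 + n))\<^sup>2" .
        qed auto
        also have "\<dots> = (5 / (b * x)\<^sup>2 * \<bar>t\<bar> ^ 3) / real (N0 + n)"
        proof -
          have "R * (10 / (b * x * R)\<^sup>2) * T / 2 = (5 / (b * x)\<^sup>2 * T) / R" if "R > 0" for R T :: real
            using b x that by (simp add: field_simps power2_eq_square)
          then show ?thesis using elim by (simp del: of_nat_add)
        qed
        also have "\<dots> \<le> (5 / (b * x)\<^sup>2 * \<bar>t\<bar> ^ 3) / real n"
          using elim by (intro divide_left_mono) auto
        finally show ?case .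
      qed
      show "(\<lambda>n. 5 / (b * x)\<^sup>2 * \<bar>t\<bar> ^ 3 / real n) \<longlonglongrightarrow> 0" by real_asymp
    qed
    have er: "(\<lambda>n. exp (r n) - 1) \<longlonglongrightarrow> 0"
      using tendsto_diff[OF tendsto_exp[OF r0] tendsto_const[of 1]] by simp
    have ef: "(\<integral>z. cis (t * Y n z) \<partial>M n) - of_real (exp (- v (N0 + n) * t\<^sup>2 / 2)) = of_real (exp (- v (N0 + n) * t\<^sup>2 / 2)) * (exp (r n) - 1)" for n
    proof -
      have "LamC (N0 + n) b (Complex (h (N0 + n)) t) - of_real (Lam (N0 + n) b (h (N0 + n))) - \<i> * of_real (t * (a * real (N0 + n)))
         = of_real (- v (N0 + n) * t\<^sup>2 / 2) + r n"
        unfolding r_def L1[OF le_add1] v_def by simp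
      then show ?thesis unfolding chi by (simp only: exp_add exp_of_real right_diff_distrib mult_1_right)
    qed
    show "(\<lambda>n. (\<integral>z. cis (t * Y n z) \<partial>M n) - of_real (exp (- v (N0 + n) * t\<^sup>2 / 2))) \<longlonglongrightarrow> 0"
      unfolding ef
    proof (rule Lim_null_comparison)
      show "\<forall>\<^sub>F n in sequentially. norm (complex_of_real (exp (- v (N0 + n) * t\<^sup>2 / 2)) * (exp (r n) - 1)) \<le> norm (exp (r n) - 1)"
      proof (intro always_eventually allI)
        fix n
        have "exp (- v (N0 + n) * t\<^sup>2 / 2) \<le> 1" using vlo[of "N0 + n"] v0 by (simp add: mult_nonneg_nonneg)
        then show "norm (complex_of_real (exp (- v (N0 + n) * t\<^sup>2 / 2)) * (exp (r n) - 1)) \<le> norm (exp (r n) - 1)"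
          unfolding norm_mult norm_of_real by (intro mult_left_le_one_le) auto
      qed
      show "(\<lambda>n. norm (exp (r n) - 1)) \<longlonglongrightarrow> 0" by (rule tendsto_norm_zero[OF er])
    qed
  qed
  then have K: "\<forall>\<^sub>F n in sequentially. \<bar>h (N0 + n) * (\<integral>z. 2 * w / (w\<^sup>2 + (h (N0 + n) * Y n z - d)\<^sup>2) \<partial>M n) - sqrt (2 * pi / v (N0 + n))\<bar> < \<epsilon>"
    if "1 \<le> w" for w d using that \<epsilon> by (fastforce simp: tendsto_iff dist_real_def)
  define Pr where "Pr N \<longleftrightarrow>
    h N * (upper_tail N \<beta> (a * real N) * exp (Lam_conj N b a)) \<le> sqrt (2 * pi / v N) + \<epsilon> \<and>
    exp (- 6) * (sqrt (2 * pi / v N) / 8 - \<epsilon>) \<le> h N * (upper_tail N \<beta> (a * real N) * exp (Lam_conj N b a))" for N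
  have "(1::real) \<le> 2" by simp
  note K2 = K[OF this, of 3]
  have "\<forall>\<^sub>F n in sequentially.
    h (N0 + n) * (upper_tail (N0 + n) \<beta> (a * real (N0 + n)) * exp (Lam_conj (N0 + n) b a)) \<le> sqrt (2 * pi / v (N0 + n)) + \<epsilon> \<and>
    exp (- 6) * (sqrt (2 * pi / v (N0 + n)) / 8 - \<epsilon>) \<le> h (N0 + n) * (upper_tail (N0 + n) \<beta> (a * real (N0 + n)) * exp (Lam_conj (N0 + n) b a))"
    using K[OF order_refl, of 0] K[OF order_refl, of 3] K2
  proof eventually_elim
    case (elim n)
    define S where "S = sqrt (2 * pi / v (N0 + n))"
    define k where "k w d = (\<integral>z. 2 * w / (w\<^sup>2 + (h (N0 + n) * Y n z - d)\<^sup>2) \<partial>M n)" for w d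
    define T where "T = upper_tail (N0 + n) \<beta> (a * real (N0 + n)) * exp (Lam_conj (N0 + n) b a)"
    have hh: "1 \<le> h (N0 + n)" by (rule h1) simp
    have cj: "Lam_conj (N0 + n) b a = (a * real (N0 + n)) * h (N0 + n) - Lam (N0 + n) (\<beta> / 2) (h (N0 + n))" by (simp add: Lam_conj_def h_def b_def)
    have T1: "T \<le> k 1 0" and T2: "exp (- 6) * (1 / 2 * k 1 3 - 3 / 8 * k 2 3) \<le> T"
      unfolding T_def k_def M_def Y_def cj using C.tail_sandwich[of "h (N0 + n)" "N0 + n" "a * real (N0 + n)"] hh by auto
    have e1: "\<bar>h (N0 + n) * k 1 0 - S\<bar> < \<epsilon>" and e2: "\<bar>h (N0 + n) * k 1 3 - S\<bar> < \<epsilon>" and e3: "\<bar>h (N0 + n) * k 2 3 - S\<bar> < \<epsilon>"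
      using elim by (simp_all add: k_def S_def)
    have "h (N0 + n) * T \<le> h (N0 + n) * k 1 0" using T1 hh by (intro mult_left_mono) auto
    then have R1: "h (N0 + n) * T \<le> S + \<epsilon>" using e1 by linarith
    \<comment> \<open>\<open>1 / 2 - 3 / 8 = 1 / 8\<close>, and the two errors add up to at most
      \<open>7 / 8 * \<epsilon>\<close>.\<close>
    have "S / 8 - \<epsilon> \<le> 1 / 2 * (h (N0 + n) * k 1 3) - 3 / 8 * (h (N0 + n) * k 2 3)" using e2 e3 \<epsilon> by linarith
    then have "exp (- 6) * (S / 8 - \<epsilon>) \<le> exp (- 6) * (1 / 2 * (h (N0 + n) * k 1 3) - 3 / 8 * (h (N0 + n) * k 2 3))"
      by (intro mult_left_mono) auto
    also have "\<dots> = h (N0 + n) * (exp (- 6) * (1 / 2 * k 1 3 - 3 / 8 * k 2 3))" by (simp add: algebra_simps)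
    also have "\<dots> \<le> h (N0 + n) * T" using T2 hh by (intro mult_left_mono) auto
    finally show ?case using R1 by (simp add: S_def T_def)
  qed
  then have "\<forall>\<^sub>F n in sequentially. Pr (N0 + n)" unfolding Pr_def .
  then have "\<forall>\<^sub>F n in sequentially. Pr (n + N0)" by (simp only: add.commute)
  then have "\<forall>\<^sub>F N in sequentially. Pr N" by (simp only: eventually_sequentially_seg)
  moreover have "\<forall>\<^sub>F N in sequentially. N \<ge> N0" by (rule eventually_ge_at_top)
  ultimately show ?thesis
  proof eventually_elim
    case (elim N)
    then show ?case using vlo[of N] vhi[of N] N0(1,2,4)[of N] unfolding Pr_def h_def v_def v0_def x_def by auto
  qed
qed

section \<open>Tail estimates with constants uniform in the level\<close>

lemma exp_log_mgf_conj:
  assumes "\<beta> > 0" "N \<ge> 1" "0 \<le> a" "a < ln 2"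
  shows "exp_ereal (log_mgf_conj N \<beta> (a * real N)) = ereal (exp (Lam_conj N (\<beta> / 2) a))"
proof -
  interpret cbe_ensemble N \<beta> by unfold_locales (use assms in simp)
  show ?thesis using log_mgf_conj_eq[of a] assms by (simp add: exp_ereal_def)
qed

lemma theta_inv_mono: "0 \<le> a \<Longrightarrow> a \<le> a' \<Longrightarrow> a' < ln 2 \<Longrightarrow> theta_inv a \<le> theta_inv a'"
  using theta_inv_strict_mono[of a a'] by (cases "a = a'") auto

lemma upper_tail_nonneg: "0 \<le> upper_tail N \<beta> a" by (simp add: upper_tail_def)

text \<open>The bounds for \<open>sqrt (2 * pi / v)\<close> and for the saddle point both grow
  linearly in \<open>x\<close>. After division by \<open>x\<^sup>2\<close> every term decreases in
  \<open>x\<close>, so the smallest value \<open>x0\<close> gives the constant.\<close>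

lemma tail_upper_bound:
  assumes \<beta>: "\<beta> > 0" and \<alpha>: "\<alpha> > 0"
  shows "\<exists>M. \<forall>a\<in>{\<alpha>..<ln 2}. \<forall>\<^sub>F N in sequentially.
    real N * upper_tail N \<beta> (a * real N) / (theta_inv a)\<^sup>2 * exp (Lam_conj N (\<beta> / 2) a) \<le> M"
proof (cases "\<alpha> < ln 2")
  case True
  define b where "b = \<beta> / 2"
  have b: "b > 0" using \<beta> by (simp add: b_def)
  define x0 where "x0 = theta_inv \<alpha>"
  have x0: "x0 > 0" unfolding x0_def using \<alpha> True by (intro theta_inv_pos)
  define K where "K = sqrt (64 * pi / b)"
  have K: "K \<ge> 0" using b by (simp add: K_def)
  have "\<forall>\<^sub>F N in sequentially. real N * upper_tail N \<beta> (a * real N) / (theta_inv a)\<^sup>2 * exp (Lam_conj N b a)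
      \<le> (K * (1 + b) + 1) / (b * x0 ^ 3) + 2 * K / x0\<^sup>2" if a: "a \<in> {\<alpha>..<ln 2}" for a
  proof -
    define x where "x = theta_inv a"
    have a': "0 < a" "a < ln 2" using a \<alpha> by auto
    have x: "x0 \<le> x" unfolding x_def x0_def using a \<alpha> by (intro theta_inv_mono) auto
    have xp: "x > 0" using x x0 by linarith
    show ?thesis
      using tail_local_limit[OF \<beta> a', of 1, folded b_def, folded x_def, simplified]
      unfolding x_def[symmetric]
    proof eventually_elim
      case (elim N)
      define v where "v = Lam2 N b (hsol N b a)"
      define T where "T = upper_tail N \<beta> (a * real N) * exp (Lam_conj N b a)"
      have T: "T \<ge> 0" by (simp add: T_def upper_tail_nonneg)
      have p: "0 < 1 + b + 2 * b * x" using b xp by (intro add_pos_pos) auto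
      have v: "b / (32 * (1 + b + 2 * b * x)\<^sup>2) \<le> v" using elim by (simp add: v_def)
      have "2 * pi / v \<le> 2 * pi / (b / (32 * (1 + b + 2 * b * x)\<^sup>2))"
        using b p v by (intro divide_left_mono mult_pos_pos) (auto intro!: less_le_trans[OF _ v] divide_pos_pos mult_pos_pos)
      also have "\<dots> = (64 * pi / b) * (1 + b + 2 * b * x)\<^sup>2" using b by simp
      finally have "sqrt (2 * pi / v) \<le> sqrt ((64 * pi / b) * (1 + b + 2 * b * x)\<^sup>2)" by (rule real_sqrt_le_mono)
      also have "\<dots> = K * (1 + b + 2 * b * x)" using p by (subst real_sqrt_mult) (simp add: K_def)
      finally have S: "sqrt (2 * pi / v) \<le> K * (1 + b + 2 * b * x)" .
      have "b * x * real N * T \<le> hsol N b a * T" using elim T by (intro mult_right_mono) auto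
      also have "\<dots> \<le> sqrt (2 * pi / v) + 1" using elim by (simp add: T_def v_def)
      also have "\<dots> \<le> K * (1 + b + 2 * b * x) + 1" using S by simp
      finally have A: "b * x * real N * T \<le> K * (1 + b + 2 * b * x) + 1" .
      have "real N * T / x\<^sup>2 = b * x * real N * T / (b * x ^ 3)" using b xp by (simp add: power2_eq_square power3_eq_cube)
      also have "\<dots> \<le> (K * (1 + b + 2 * b * x) + 1) / (b * x ^ 3)" using A b xp by (intro divide_right_mono) auto
      also have "\<dots> = (K * (1 + b) + 1) / (b * x ^ 3) + 2 * K / x\<^sup>2"
        using b xp by (simp add: field_simps power2_eq_square power3_eq_cube)
      also have "\<dots> \<le> (K * (1 + b) + 1) / (b * x0 ^ 3) + 2 * K / x0\<^sup>2"
        using b x x0 xp K by (intro add_mono divide_left_mono mult_left_mono power_mono mult_pos_pos zero_less_power) auto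
      finally show ?case by (simp add: T_def algebra_simps)
    qed
  qed
  then show ?thesis unfolding b_def by blast
qed auto

text \<open>On \<open>[\<alpha>, \<alpha>']\<close> the variance is at most \<open>V\<close> and the
  saddle point at most \<open>4 * b * x1 * N\<close>. The tolerance \<open>c / 2\<close> is half of
  the lower bound \<open>c\<close> for the main term.\<close>

lemma tail_lower_bound:
  assumes \<beta>: "\<beta> > 0" and \<alpha>: "0 < \<alpha>" "\<alpha> \<le> \<alpha>'" "\<alpha>' < ln 2"
  shows "\<exists>m>0. \<forall>a\<in>{\<alpha>..\<alpha>'}. \<forall>\<^sub>F N in sequentially.
    m \<le> real N * upper_tail N \<beta> (a * real N) * exp (Lam_conj N (\<beta> / 2) a)"
proof -
  define b where "b = \<beta> / 2"
  have b: "b > 0" using \<beta> by (simp add: b_def)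
  define x0 x1 where "x0 = theta_inv \<alpha>" and "x1 = theta_inv \<alpha>'"
  have x0: "x0 > 0" and x1: "x1 > 0" unfolding x0_def x1_def using \<alpha> by (auto intro!: theta_inv_pos)
  define V where "V = 1 / (b * x0) + 2 / (b * x0)\<^sup>2"
  have V: "V > 0" unfolding V_def using b x0 by (intro add_pos_pos divide_pos_pos) auto
  define c where "c = sqrt (2 * pi / V) / 8"
  have c: "c > 0" using V by (simp add: c_def)
  define m where "m = exp (- 6) * (c / 2) / (4 * b * x1)"
  have m: "m > 0" using c b x1 by (simp add: m_def)
  have "\<forall>\<^sub>F N in sequentially. m \<le> real N * upper_tail N \<beta> (a * real N) * exp (Lam_conj N b a)" if a: "a \<in> {\<alpha>..\<alpha>'}" for a
  proof -
    define x where "x = theta_inv a"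
    have a': "0 < a" "a < ln 2" using a \<alpha> by auto
    have x: "x0 \<le> x" "x \<le> x1" unfolding x_def x0_def x1_def using a \<alpha> by (auto intro!: theta_inv_mono)
    have xp: "x > 0" using x x0 by linarith
    have c2: "c / 2 > 0" using c by simp
    show ?thesis
      using tail_local_limit[OF \<beta> a' c2, folded b_def]
      unfolding x_def[symmetric]
    proof eventually_elim
      case (elim N)
      define v where "v = Lam2 N b (hsol N b a)"
      define T where "T = upper_tail N \<beta> (a * real N) * exp (Lam_conj N b a)"
      have T: "T \<ge> 0" by (simp add: T_def upper_tail_nonneg)
      have p: "0 < 1 + b + 2 * b * x" using b xp by (intro add_pos_pos) auto
      have "0 < b / (32 * (1 + b + 2 * b * x)\<^sup>2)" using b p by (intro divide_pos_pos mult_pos_pos zero_less_power) auto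
      also have "\<dots> \<le> v" using elim by (simp add: v_def)
      finally have v: "v > 0" .
      have "v \<le> 1 / (b * x) + 2 / (b * x)\<^sup>2" using elim by (simp add: v_def)
      also have "\<dots> \<le> V" unfolding V_def
        using b x x0 xp by (intro add_mono divide_left_mono power_mono mult_left_mono mult_pos_pos zero_less_power) auto
      finally have "2 * pi / V \<le> 2 * pi / v" using v V by (intro divide_left_mono) auto
      then have S: "c \<le> sqrt (2 * pi / v) / 8" by (simp add: c_def)
      have "exp (- 6) * (c / 2) \<le> exp (- 6) * (sqrt (2 * pi / v) / 8 - c / 2)" using S by (intro mult_left_mono) auto
      also have "\<dots> \<le> hsol N b a * T" using elim by (simp add: T_def v_def)
      also have "\<dots> \<le> (4 * b * x * real N) * T" using elim T by (intro mult_right_mono) auto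
      also have "\<dots> = (4 * b * x) * (real N * T)" by simp
      also have "\<dots> \<le> (4 * b * x1) * (real N * T)" using x b T by (intro mult_right_mono) auto
      finally have "m \<le> real N * T" using b x1 by (simp add: m_def divide_le_eq mult.commute mult.left_commute)
      then show ?case by (simp add: T_def mult.assoc)
    qed
  qed
  then show ?thesis using m unfolding b_def by blast
qed

lemma upper_tail_limsup_le:
  assumes \<beta>: "\<beta> > 0" and \<alpha>: "\<alpha> > 0"
  shows "\<exists>M::real. \<forall>\<alpha>\<^sub>0\<in>{\<alpha>..<ln 2}.
        limsup (\<lambda>N. ereal (real N * upper_tail N \<beta> (\<alpha>\<^sub>0 * real N) / (theta_inv \<alpha>\<^sub>0)\<^sup>2)
                    * exp_ereal (log_mgf_conj N \<beta> (\<alpha>\<^sub>0 * real N))) \<le> ereal M"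
proof -
  obtain M where M: "\<And>a. a \<in> {\<alpha>..<ln 2} \<Longrightarrow> \<forall>\<^sub>F N in sequentially.
    real N * upper_tail N \<beta> (a * real N) / (theta_inv a)\<^sup>2 * exp (Lam_conj N (\<beta> / 2) a) \<le> M"
    using tail_upper_bound[OF \<beta> \<alpha>] by blast
  show ?thesis
  proof (intro exI[of _ M] ballI Limsup_bounded)
    fix a assume a: "a \<in> {\<alpha>..<ln 2}"
    show "\<forall>\<^sub>F N in sequentially. ereal (real N * upper_tail N \<beta> (a * real N) / (theta_inv a)\<^sup>2) * exp_ereal (log_mgf_conj N \<beta> (a * real N)) \<le> ereal M"
      using M[OF a] eventually_ge_at_top[of 1]
      by eventually_elim (use a \<alpha> \<beta> in \<open>simp add: exp_log_mgf_conj\<close>)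
  qed
qed

lemma upper_tail_liminf_ge:
  assumes \<beta>: "\<beta> > 0" and \<alpha>: "0 < \<alpha>" "\<alpha> \<le> \<alpha>'" "\<alpha>' < ln 2"
  shows "\<exists>m::real. 0 < m \<and> (\<forall>\<alpha>\<^sub>0\<in>{\<alpha>..\<alpha>'}.
             ereal m \<le> liminf (\<lambda>N. ereal (real N * upper_tail N \<beta> (\<alpha>\<^sub>0 * real N))
                                    * exp_ereal (log_mgf_conj N \<beta> (\<alpha>\<^sub>0 * real N))))"
proof -
  obtain m where m: "m > 0" "\<And>a. a \<in> {\<alpha>..\<alpha>'} \<Longrightarrow> \<forall>\<^sub>F N in sequentially.
    m \<le> real N * upper_tail N \<beta> (a * real N) * exp (Lam_conj N (\<beta> / 2) a)"
    using tail_lower_bound[OF \<beta> \<alpha>] by blast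
  show ?thesis
  proof (intro exI[of _ m] conjI ballI Liminf_bounded m(1))
    fix a assume a: "a \<in> {\<alpha>..\<alpha>'}"
    show "\<forall>\<^sub>F N in sequentially. ereal m \<le> ereal (real N * upper_tail N \<beta> (a * real N)) * exp_ereal (log_mgf_conj N \<beta> (a * real N))"
      using m(2)[OF a] eventually_ge_at_top[of 1]
      by eventually_elim (use a \<alpha> \<beta> in \<open>simp add: exp_log_mgf_conj\<close>)
  qed
qed

text \<open>The term \<open>ln N / 12\<close> of the conjugate turns into the additional power
  \<open>1 / 12\<close>.\<close>

lemma powr_13_12: "N \<ge> 1 \<Longrightarrow> real N powr (13 / 12) * exp (u) = real N * exp (u + ln (real N) / 12)"
proof -
  assume N: "N \<ge> 1"
  have "real N powr (13 / 12) = real N powr 1 * real N powr (1 / 12)" 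
    using powr_add[of "real N" 1 "1 / 12"] by simp
  also have "real N powr (1 / 12) = exp (ln (real N) / 12)" using N by (simp add: powr_def)
  finally show ?thesis using N by (simp add: exp_add)
qed

lemma log_mgf_conj_beta2:
  assumes \<alpha>: "\<alpha> > 0"
  shows "\<exists>C::real. \<forall>\<alpha>\<^sub>0\<in>{\<alpha>..<ln 2}. \<forall>N\<ge>1.
           \<bar>log_mgf_conj N 2 (\<alpha>\<^sub>0 * real N)
             - ereal ((real N)\<^sup>2 * rate_I (theta_inv \<alpha>\<^sub>0) + ln (real N) / 12)\<bar> \<le> ereal C"
proof -
  obtain C where C: "\<And>a N. a \<in> {\<alpha>..<ln 2} \<Longrightarrow> N \<ge> 1 \<Longrightarrow> \<bar>Lam_conj N 1 a - ((real N)\<^sup>2 * rate_I (theta_inv a) + ln (real N) / 12)\<bar> \<le> C"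
    using Lam_conj_beta2[OF \<alpha>] by blast
  show ?thesis
  proof (intro exI[of _ C] ballI allI impI)
    fix a :: real and N :: nat assume a: "a \<in> {\<alpha>..<ln 2}" and N: "N \<ge> 1"
    interpret cbe_ensemble N 2 by unfold_locales simp
    show "\<bar>log_mgf_conj N 2 (a * real N) - ereal ((real N)\<^sup>2 * rate_I (theta_inv a) + ln (real N) / 12)\<bar> \<le> ereal C"
      using log_mgf_conj_eq[of a] C[OF a N] a \<alpha> N by simp
  qed
qed

lemma upper_tail_limsup_beta2_le:
  assumes \<alpha>: "\<alpha> > 0"
  shows "\<exists>M::real. \<forall>\<alpha>\<^sub>0\<in>{\<alpha>..<ln 2}.
           limsup (\<lambda>N. ereal (real N powr (13 / 12) * upper_tail N 2 (\<alpha>\<^sub>0 * real N)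
                                / (theta_inv \<alpha>\<^sub>0)\<^sup>2
                              * exp ((real N)\<^sup>2 * rate_I (theta_inv \<alpha>\<^sub>0)))) \<le> ereal M"
proof -
  obtain C where C: "\<And>a N. a \<in> {\<alpha>..<ln 2} \<Longrightarrow> N \<ge> 1 \<Longrightarrow> \<bar>Lam_conj N 1 a - ((real N)\<^sup>2 * rate_I (theta_inv a) + ln (real N) / 12)\<bar> \<le> C"
    using Lam_conj_beta2[OF \<alpha>] by blast
  obtain M where M: "\<And>a. a \<in> {\<alpha>..<ln 2} \<Longrightarrow> \<forall>\<^sub>F N in sequentially.
    real N * upper_tail N 2 (a * real N) / (theta_inv a)\<^sup>2 * exp (Lam_conj N (2 / 2) a) \<le> M"
    using tail_upper_bound[OF zero_less_numeral[of "num.Bit0 num.One"] \<alpha>] by blast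
  show ?thesis
  proof (intro exI[of _ "M * exp C"] ballI Limsup_bounded)
    fix a assume a: "a \<in> {\<alpha>..<ln 2}"
    show "\<forall>\<^sub>F N in sequentially. ereal (real N powr (13 / 12) * upper_tail N 2 (a * real N) / (theta_inv a)\<^sup>2
        * exp ((real N)\<^sup>2 * rate_I (theta_inv a))) \<le> ereal (M * exp C)"
      using M[OF a] eventually_ge_at_top[of 1]
    proof eventually_elim
      case (elim N)
      define T where "T = upper_tail N 2 (a * real N) / (theta_inv a)\<^sup>2"
      have T: "T \<ge> 0" by (simp add: T_def upper_tail_nonneg)
      have "(real N)\<^sup>2 * rate_I (theta_inv a) + ln (real N) / 12 \<le> Lam_conj N 1 a + C" using C[OF a elim(2)] by linarith
      then have e: "exp ((real N)\<^sup>2 * rate_I (theta_inv a) + ln (real N) / 12) \<le> exp (Lam_conj N 1 a + C)" by (simp only: exp_le_cancel_iff)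
      have "real N powr (13 / 12) * upper_tail N 2 (a * real N) / (theta_inv a)\<^sup>2 * exp ((real N)\<^sup>2 * rate_I (theta_inv a))
         = T * (real N powr (13 / 12) * exp ((real N)\<^sup>2 * rate_I (theta_inv a)))" by (simp add: T_def)
      also have "\<dots> = T * (real N * exp ((real N)\<^sup>2 * rate_I (theta_inv a) + ln (real N) / 12))"
        by (simp only: powr_13_12[OF elim(2)])
      also have "\<dots> \<le> T * (real N * exp (Lam_conj N 1 a + C))" using e T by (intro mult_left_mono) auto
      also have "\<dots> = (real N * T * exp (Lam_conj N 1 a)) * exp C" by (simp add: exp_add)
      also have "\<dots> \<le> M * exp C" using elim(1) by (intro mult_right_mono) (auto simp: T_def)
      finally show ?case by simp
    qed
  qed
qed

lemma upper_tail_liminf_beta2_ge: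
  assumes \<alpha>: "0 < \<alpha>" "\<alpha> \<le> \<alpha>'" "\<alpha>' < ln 2"
  shows "\<exists>m::real. 0 < m \<and> (\<forall>\<alpha>\<^sub>0\<in>{\<alpha>..\<alpha>'}.
               ereal m \<le> liminf (\<lambda>N. ereal (real N powr (13 / 12) * upper_tail N 2 (\<alpha>\<^sub>0 * real N)
                                      * exp ((real N)\<^sup>2 * rate_I (theta_inv \<alpha>\<^sub>0)))))"
proof -
  obtain C where C: "\<And>a N. a \<in> {\<alpha>..<ln 2} \<Longrightarrow> N \<ge> 1 \<Longrightarrow> \<bar>Lam_conj N 1 a - ((real N)\<^sup>2 * rate_I (theta_inv a) + ln (real N) / 12)\<bar> \<le> C"
    using Lam_conj_beta2[OF \<alpha>(1)] by blast
  obtain m where m: "m > 0" "\<And>a. a \<in> {\<alpha>..\<alpha>'} \<Longrightarrow> \<forall>\<^sub>F N in sequentially.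
    m \<le> real N * upper_tail N 2 (a * real N) * exp (Lam_conj N (2 / 2) a)"
    using tail_lower_bound[OF zero_less_numeral[of "num.Bit0 num.One"] \<alpha>] by blast
  have m': "0 < m * exp (- C)" using m by simp
  show ?thesis
  proof (intro exI[of _ "m * exp (- C)"] conjI ballI Liminf_bounded m')
    fix a assume a: "a \<in> {\<alpha>..\<alpha>'}"
    then have a': "a \<in> {\<alpha>..<ln 2}" using \<alpha> by auto
    show "\<forall>\<^sub>F N in sequentially. ereal (m * exp (- C)) \<le> ereal (real N powr (13 / 12) * upper_tail N 2 (a * real N)
        * exp ((real N)\<^sup>2 * rate_I (theta_inv a)))"
      using m(2)[OF a] eventually_ge_at_top[of 1]
    proof eventually_elim
      case (elim N)
      define T where "T = upper_tail N 2 (a * real N)"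
      have T: "T \<ge> 0" by (simp add: T_def upper_tail_nonneg)
      have "Lam_conj N 1 a - C \<le> (real N)\<^sup>2 * rate_I (theta_inv a) + ln (real N) / 12" using C[OF a' elim(2)] by linarith
      then have e: "exp (Lam_conj N 1 a + - C) \<le> exp ((real N)\<^sup>2 * rate_I (theta_inv a) + ln (real N) / 12)" by simp
      have "m * exp (- C) \<le> (real N * T * exp (Lam_conj N 1 a)) * exp (- C)" using elim(1) by (intro mult_right_mono) (auto simp: T_def)
      also have "\<dots> = T * (real N * exp (Lam_conj N 1 a + - C))" by (simp only: exp_add mult_ac)
      also have "\<dots> \<le> T * (real N * exp ((real N)\<^sup>2 * rate_I (theta_inv a) + ln (real N) / 12))" using e T by (intro mult_left_mono) auto
      also have "\<dots> = T * (real N powr (13 / 12) * exp ((real N)\<^sup>2 * rate_I (theta_inv a)))"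
        by (simp only: powr_13_12[OF elim(2)])
      finally show ?case by (simp add: T_def mult_ac)
    qed
  qed
qed

lemma log_mgf_conj_asymp:
  assumes \<beta>: "\<beta> > 0" and a: "0 < a" "a < ln 2"
  shows "\<exists>C::real. \<forall>N\<ge>1. \<bar>log_mgf_conj N \<beta> (a * real N)
             - ereal ((real N)\<^sup>2 * (\<beta> / 2) * rate_I (theta_inv a))\<bar> \<le> ereal (C * real N)"
proof -
  have "\<beta> / 2 > 0" using \<beta> by simp
  then obtain C where C: "\<And>N. N \<ge> 1 \<Longrightarrow> \<bar>Lam_conj N (\<beta> / 2) a - (real N)\<^sup>2 * (\<beta> / 2) * rate_I (theta_inv a)\<bar> \<le> C * real N"
    using Lam_conj_asymp[OF _ a] by blast
  show ?thesis
  proof (intro exI[of _ C] allI impI)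
    fix N :: nat assume N: "N \<ge> 1"
    interpret cbe_ensemble N \<beta> by unfold_locales (rule \<beta>)
    have "log_mgf_conj N \<beta> (a * real N) = ereal (Lam_conj N (\<beta> / 2) a)" using a N by (intro log_mgf_conj_eq) auto
    then show "\<bar>log_mgf_conj N \<beta> (a * real N) - ereal ((real N)\<^sup>2 * (\<beta> / 2) * rate_I (theta_inv a))\<bar> \<le> ereal (C * real N)"
      using C[OF N] by simp
  qed
qed


section \<open>The large deviation principle\<close>

lemma ln_Gamma_increment_bounds:
  fixes u w :: real
  assumes u: "0 < u" "u \<le> w"
  shows "(w - u) * (ln u - 1 / u) \<le> ln_Gamma w - ln_Gamma u" "ln_Gamma w - ln_Gamma u \<le> (w - u) * ln w"
proof -
  have "(w - u) * (ln u - 1 / u) \<le> ln_Gamma w - ln_Gamma u \<and> ln_Gamma w - ln_Gamma u \<le> (w - u) * ln w"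
  proof (cases "u = w")
    case False
    then have uw: "u < w" using u by simp
    obtain \<xi> where \<xi>: "u < \<xi>" "\<xi> < w" "ln_Gamma w - ln_Gamma u = (w - u) * Digamma \<xi>"
      using MVT2[OF uw, of ln_Gamma Digamma] u by (force intro!: has_field_derivative_ln_Gamma_real)
    have p: "\<xi> > 0" using \<xi> u by linarith
    have "ln u \<le> ln \<xi>" "ln \<xi> \<le> ln w" using \<xi> u p by auto
    moreover have "1 / \<xi> \<le> 1 / u" using \<xi> u by (intro divide_left_mono) auto
    ultimately have "ln u - 1 / u \<le> Digamma \<xi>" "Digamma \<xi> \<le> ln w" using Digamma_real_bounds[OF p] by linarith+
    then show ?thesis unfolding \<xi>(3) using uw by (auto intro!: mult_left_mono)
  qed simp
  then show "(w - u) * (ln u - 1 / u) \<le> ln_Gamma w - ln_Gamma u" "ln_Gamma w - ln_Gamma u \<le> (w - u) * ln w" by auto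
qed

text \<open>Both increments, the second after doubling, are \<open>k * s\<close> times a value of
  Digamma between \<open>A\<close> and \<open>A + k + 1\<close>. The bounds for Digamma on this
  range differ by at most \<open>(k + 2) / A\<close>, so the increments nearly cancel.\<close>

lemma ln_Gamma_double_increment:
  fixes A k s :: real
  assumes A: "A > 0" and k: "k \<ge> 0" and s: "0 < s" "s \<le> 1"
  shows "\<bar>(ln_Gamma (A + (k + 1) * s) - ln_Gamma (A + s)) - 2 * (ln_Gamma (A + 1 / 2 + (k + 1) * s / 2) - ln_Gamma (A + 1 / 2 + s / 2))\<bar>
    \<le> k * s * ((k + 2) / A)"
proof -
  have ks: "0 \<le> k * s" using k s by simp
  have ks': "k * s \<le> k" using k s by (simp add: mult_left_le)
  have bd: "(w - u) * (ln A - 1 / A) \<le> ln_Gamma w - ln_Gamma u \<and> ln_Gamma w - ln_Gamma u \<le> (w - u) * ln (A + k + 1)"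
    if uw: "A \<le> u" "u \<le> w" "w \<le> A + k + 1" for u w
  proof -
    have u: "u > 0" using A uw by linarith
    have "ln A \<le> ln u" using A u uw by simp
    moreover have "1 / u \<le> 1 / A" using A u uw by (intro divide_left_mono) auto
    ultimately have "(w - u) * (ln A - 1 / A) \<le> (w - u) * (ln u - 1 / u)" using uw by (intro mult_left_mono) auto
    moreover have "(w - u) * ln w \<le> (w - u) * ln (A + k + 1)" using uw u by (intro mult_left_mono) auto
    ultimately show ?thesis using ln_Gamma_increment_bounds[OF u uw(2)] by linarith
  qed
  have 1: "k * s * (ln A - 1 / A) \<le> ln_Gamma (A + (k + 1) * s) - ln_Gamma (A + s)"
       "ln_Gamma (A + (k + 1) * s) - ln_Gamma (A + s) \<le> k * s * ln (A + k + 1)"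
  proof -
    have e: "A + (k + 1) * s - (A + s) = k * s" by (simp add: algebra_simps)
    have "A + (k + 1) * s \<le> A + k + 1" using ks' s by (simp add: algebra_simps)
    moreover have "A + s \<le> A + (k + 1) * s" using ks by (simp add: algebra_simps)
    ultimately show "k * s * (ln A - 1 / A) \<le> ln_Gamma (A + (k + 1) * s) - ln_Gamma (A + s)"
       "ln_Gamma (A + (k + 1) * s) - ln_Gamma (A + s) \<le> k * s * ln (A + k + 1)"
      using bd[of "A + s" "A + (k + 1) * s"] s unfolding e by auto
  qed
  have 2: "k * s * (ln A - 1 / A) \<le> 2 * (ln_Gamma (A + 1 / 2 + (k + 1) * s / 2) - ln_Gamma (A + 1 / 2 + s / 2))"
       "2 * (ln_Gamma (A + 1 / 2 + (k + 1) * s / 2) - ln_Gamma (A + 1 / 2 + s / 2)) \<le> k * s * ln (A + k + 1)"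
  proof -
    have e: "A + 1 / 2 + (k + 1) * s / 2 - (A + 1 / 2 + s / 2) = k * s / 2" by (simp add: field_simps)
    have le: "A + 1 / 2 + (k + 1) * s / 2 \<le> A + k + 1" using ks' s k by (simp add: field_simps)
    have "A + 1 / 2 + s / 2 \<le> A + 1 / 2 + (k + 1) * s / 2" using ks by (simp add: field_simps)
    then have "k * s / 2 * (ln A - 1 / A) \<le> ln_Gamma (A + 1 / 2 + (k + 1) * s / 2) - ln_Gamma (A + 1 / 2 + s / 2) \<and>
       ln_Gamma (A + 1 / 2 + (k + 1) * s / 2) - ln_Gamma (A + 1 / 2 + s / 2) \<le> k * s / 2 * ln (A + k + 1)"
      using bd[of "A + 1 / 2 + s / 2" "A + 1 / 2 + (k + 1) * s / 2", OF _ _ le] s unfolding e by simp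
    then show "k * s * (ln A - 1 / A) \<le> 2 * (ln_Gamma (A + 1 / 2 + (k + 1) * s / 2) - ln_Gamma (A + 1 / 2 + s / 2))"
       "2 * (ln_Gamma (A + 1 / 2 + (k + 1) * s / 2) - ln_Gamma (A + 1 / 2 + s / 2)) \<le> k * s * ln (A + k + 1)"
      by simp_all
  qed
  have e: "1 + (k + 1) / A = (A + k + 1) / A" using A by (simp add: field_simps)
  have "ln (A + k + 1) - ln A = ln (1 + (k + 1) / A)" unfolding e using A k by (simp add: ln_div)
  also have "\<dots> \<le> (k + 1) / A" using A k by (intro ln_add_one_self_le_self) auto
  finally have "ln (A + k + 1) - (ln A - 1 / A) \<le> (k + 2) / A" using A by (simp add: add_divide_distrib)
  then have "k * s * (ln (A + k + 1) - (ln A - 1 / A)) \<le> k * s * ((k + 2) / A)" using ks by (intro mult_left_mono)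
  then have "k * s * ln (A + k + 1) - k * s * (ln A - 1 / A) \<le> k * s * ((k + 2) / A)" by (simp only: right_diff_distrib)
  moreover have "\<bar>x - y\<bar> \<le> d" if "lo \<le> x" "x \<le> hi" "lo \<le> y" "y \<le> hi" "hi - lo \<le> d" for x y lo hi d :: real
    using that by linarith
  ultimately show ?thesis using 1 2 by blast
qed

text \<open>The limit is the logarithm of \<open>1 / (k + 1)\<close>, a moment of the uniform law.
  It comes from the summand \<open>j = 0\<close> alone, where Gamma is evaluated close to its pole
  at 0. The other summands are of order \<open>1 / (j * N)\<close> and vanish in the sum.\<close>

lemma Lam_near_minus_one:
  fixes b k :: real
  assumes b: "b > 0" and k: "k \<ge> 0"
  shows "(\<lambda>N. Lam N b (-1 + (k + 1) / real N) - Lam N b (-1 + 1 / real N)) \<longlonglongrightarrow> - ln (k + 1)"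
proof -
  define T where "T j s = (ln_Gamma (real j * b + (k + 1) * s) - ln_Gamma (real j * b + s))
      - 2 * (ln_Gamma (real j * b + 1 / 2 + (k + 1) * s / 2) - ln_Gamma (real j * b + 1 / 2 + s / 2))" for j s
  have cont: "(\<lambda>N. ln_Gamma (c + d / real N)) \<longlonglongrightarrow> ln_Gamma c" if c: "c > 0" for c d :: real
  proof (rule isCont_tendsto_compose[of _ ln_Gamma])
    show "isCont ln_Gamma c" by (rule DERIV_isCont[OF has_field_derivative_ln_Gamma_real]) (rule c)
    show "(\<lambda>N. c + d / real N) \<longlonglongrightarrow> c" by real_asymp
  qed
  have eq: "Lam N b (-1 + (k + 1) / real N) - Lam N b (-1 + 1 / real N) = T 0 (1 / real N) + (\<Sum>j<N-1. T (Suc j) (1 / real N))"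
    if N: "N \<ge> 1" for N
  proof -
    have h: "-1 + (k + 1) / real N > -1" "-1 + 1 / real N > -1" using N k by auto
    have a1: "1 + x + (-1 + y / real N) = x + y * (1 / real N)" for x y :: real by simp
    have a2: "1 + x + (-1 + y / real N) / 2 = x + 1 / 2 + y * (1 / real N) / 2" for x y :: real by (simp add: field_simps)
    have "Lam N b (-1 + (k + 1) / real N) - Lam N b (-1 + 1 / real N) = (\<Sum>j<N. T j (1 / real N))"
      unfolding Lam_standard[OF b h(1)] Lam_standard[OF b h(2)] a1 a2 sum_subtractf[symmetric]
      by (intro sum.cong refl) (simp add: T_def)
    also have "\<dots> = (\<Sum>j<Suc (N - 1). T j (1 / real N))" using N by simp
    finally show ?thesis unfolding sum.lessThan_Suc_shift .
  qed
  have T0: "(\<lambda>N. T 0 (1 / real N)) \<longlonglongrightarrow> - ln (k + 1)"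
  proof (rule Lim_transform_eventually)
    show "(\<lambda>N. (ln_Gamma (1 + (k + 1) / real N) - ln_Gamma (1 + 1 / real N) - ln (k + 1))
       - 2 * (ln_Gamma (1 / 2 + ((k + 1) / 2) / real N) - ln_Gamma (1 / 2 + (1 / 2) / real N))) \<longlonglongrightarrow> - ln (k + 1)"
      by (rule tendsto_eq_intros cont refl | simp)+
    show "\<forall>\<^sub>F N in sequentially. (ln_Gamma (1 + (k + 1) / real N) - ln_Gamma (1 + 1 / real N) - ln (k + 1))
       - 2 * (ln_Gamma (1 / 2 + ((k + 1) / 2) / real N) - ln_Gamma (1 / 2 + (1 / 2) / real N)) = T 0 (1 / real N)"
      using eventually_ge_at_top[of 1]
    proof eventually_elim
      case (elim N)
      have p: "0 < (k + 1) / real N" "0 < 1 / real N" using elim k by auto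
      have "ln_Gamma (1 + (k + 1) / real N) = ln_Gamma ((k + 1) / real N) + ln ((k + 1) / real N)"
        using ln_Gamma_real_plus1[OF p(1)] by (simp add: add.commute)
      moreover have "ln_Gamma (1 + 1 / real N) = ln_Gamma (1 / real N) + ln (1 / real N)"
        using ln_Gamma_real_plus1[OF p(2)] by (simp add: add.commute)
      moreover have "ln ((k + 1) / real N) = ln (k + 1) + ln (1 / real N)" using elim k by (simp add: ln_div)
      ultimately show ?case by (simp add: T_def mult.commute)
    qed
  qed
  have R: "(\<lambda>N. \<Sum>j<N-1. T (Suc j) (1 / real N)) \<longlonglongrightarrow> 0"
  proof (rule Lim_null_comparison)
    show "(\<lambda>N. k * (k + 2) / b * (2 * sqrt (real N)) / real N) \<longlonglongrightarrow> 0" by real_asymp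
    show "\<forall>\<^sub>F N in sequentially. norm (\<Sum>j<N-1. T (Suc j) (1 / real N)) \<le> k * (k + 2) / b * (2 * sqrt (real N)) / real N"
      using eventually_ge_at_top[of 1]
    proof eventually_elim
      case (elim N)
      have "norm (\<Sum>j<N-1. T (Suc j) (1 / real N)) \<le> (\<Sum>j<N-1. k * (k + 2) / b / real N * (1 / sqrt (real j + 1)))"
      proof (rule sum_norm_le)
        fix j
        have "norm (T (Suc j) (1 / real N)) \<le> k * (1 / real N) * ((k + 2) / (real (Suc j) * b))"
          unfolding T_def real_norm_def using b k elim by (intro ln_Gamma_double_increment) auto
        also have "\<dots> = k * (k + 2) / b / real N * (1 / (real j + 1))" by (simp add: field_simps)
        \<comment> \<open>\<open>1 / (j + 1)\<close> is weakened so that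
          \<open>sum_inverse_sqrt_le\<close> can be reused; \<open>sqrt N / N\<close> still tends to
          0.\<close>
        also have "\<dots> \<le> k * (k + 2) / b / real N * (1 / sqrt (real j + 1))"
        proof (intro mult_left_mono divide_left_mono)
          show "sqrt (real j + 1) \<le> real j + 1" by (rule real_le_lsqrt) (auto simp: power2_eq_square algebra_simps)
        qed (use b k in auto)
        finally show "norm (T (Suc j) (1 / real N)) \<le> k * (k + 2) / b / real N * (1 / sqrt (real j + 1))" .
      qed
      also have "\<dots> = k * (k + 2) / b / real N * (\<Sum>j<N-1. 1 / sqrt (real j + 1))" by (simp only: sum_distrib_left)
      also have "\<dots> \<le> k * (k + 2) / b / real N * (2 * sqrt (real (N - 1)))"
        using b k by (intro mult_left_mono sum_inverse_sqrt_le) auto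
      also have "\<dots> \<le> k * (k + 2) / b / real N * (2 * sqrt (real N))" using b k by (intro mult_left_mono) auto
      finally show ?case by simp
    qed
  qed
  show ?thesis
  proof (rule Lim_transform_eventually)
    show "(\<lambda>N. T 0 (1 / real N) + (\<Sum>j<N-1. T (Suc j) (1 / real N))) \<longlonglongrightarrow> - ln (k + 1)"
      using tendsto_add[OF T0 R] by simp
    show "\<forall>\<^sub>F N in sequentially. T 0 (1 / real N) + (\<Sum>j<N-1. T (Suc j) (1 / real N)) = Lam N b (-1 + (k + 1) / real N) - Lam N b (-1 + 1 / real N)"
      using eventually_ge_at_top[of 1] by eventually_elim (rule eq[symmetric])
  qed
qed

lemma (in cbe_ensemble) tilt_exp_moment:
  assumes h: "h > -1" "h + c > -1"
  shows "integrable (tilt h) (\<lambda>x. exp (c * X x))" "(\<integral>x. exp (c * X x) \<partial>tilt h) = exp (Lam N b (h + c) - Lam N b h)"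
proof -
  have e: "exp (h * X x - Lam N b h) * exp (c * X x) = exp (- Lam N b h) * exp ((h + c) * X x)" for x
    by (simp add: exp_add[symmetric] algebra_simps)
  show "integrable (tilt h) (\<lambda>x. exp (c * X x))"
    unfolding tilt_def by (subst integrable_density) (auto simp: e intro!: integrable_exp_X h)
  have "(\<integral>x. exp (c * X x) \<partial>tilt h) = (\<integral>x. exp (- Lam N b h) * exp ((h + c) * X x) \<partial>P)"
    by (subst integral_tilt) (auto simp: e)
  also have "\<dots> = exp (- Lam N b h) * E (h + c)" unfolding E_def by simp
  also have "E (h + c) = exp (Lam N b (h + c))" by (rule E_formula[OF h(2)])
  finally show "(\<integral>x. exp (c * X x) \<partial>tilt h) = exp (Lam N b (h + c) - Lam N b h)"
    by (simp add: exp_add[symmetric])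
qed

lemma ge_derivative_imp_increment_ge:
  fixes F p :: "real \<Rightarrow> real"
  assumes "u \<le> w" "\<And>x. (F has_real_derivative p x) (at x)" "\<And>x. u \<le> x \<Longrightarrow> x \<le> w \<Longrightarrow> c \<le> p x"
  shows "c * (w - u) \<le> F w - F u"
proof -
  have "(\<lambda>x. F x - c * x) u \<le> (\<lambda>x. F x - c * x) w"
  proof (rule DERIV_nonneg_imp_nondecreasing[OF assms(1)])
    fix x assume x: "u \<le> x" "x \<le> w"
    have "((\<lambda>x. F x - c * x) has_real_derivative p x - c * 1) (at x)" by (intro DERIV_diff assms(2) DERIV_cmult DERIV_ident)
    then show "\<exists>y. ((\<lambda>x. F x - c * x) has_real_derivative y) (at x) \<and> 0 \<le> y" using assms(3)[OF x] by (intro exI[of _ "p x - c * 1"]) auto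
  qed
  then show ?thesis by (simp add: algebra_simps)
qed

text \<open>Tilting by \<open>-1 + 1/N\<close> makes \<open>exp (X/N)\<close> asymptotically uniform on \<open>[0, 1]\<close>, by convergence of moments.\<close>

lemma tilt_interval_mass:
  fixes \<beta> v0 \<rho> :: real
  assumes \<beta>: "\<beta> > 0" and \<rho>: "0 < \<rho>" "\<rho> \<le> v0" "v0 + \<rho> \<le> 1"
  shows "\<forall>\<^sub>F N in sequentially. \<rho> / 8 \<le> measure (cbe_ensemble.tilt N \<beta> (-1 + 1 / real N))
      {x \<in> space (cbe N \<beta>). \<bar>exp (log_charpoly N x / real N) - v0\<bar> < \<rho>}"
proof -
  interpret C: cbe_ensemble N \<beta> for N by unfold_locales (rule \<beta>)
  \<comment> \<open>A tent of height 1 below the indicator of the target interval; being continuous,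
    it is approximated by a polynomial. The range \<open>[0, 2]\<close> below comes from
    \<open>X \<le> N * ln 2\<close>.\<close>
  define f where "f v = max 0 (1 - \<bar>v - v0\<bar> / \<rho>)" for v :: real
  have "continuous_on {0..2} f" unfolding f_def using \<rho> by (intro continuous_intros) auto
  moreover have "0 < \<rho> / 8" using \<rho> by simp
  ultimately obtain p where p: "real_polynomial_function p" "\<And>x. x \<in> {0..2} \<Longrightarrow> \<bar>f x - p x\<bar> < \<rho> / 8"
    using Stone_Weierstrass_real_polynomial_function[of "{0..2}" f "\<rho> / 8"] by auto
  obtain a n where pa: "p = (\<lambda>x. \<Sum>i\<le>n. a i * x ^ i)" using p(1) by (auto simp: real_polynomial_function_iff_sum)
  \<comment> \<open>The integral of \<open>p\<close> over \<open>[0, 1]\<close>, that is, its mean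
    under the uniform law.\<close>
  define L where "L = (\<Sum>i\<le>n. a i * (1 / (real i + 1)))"
  have L: "\<rho> / 2 - \<rho> / 8 \<le> L"
  proof -
    define F where "F x = (\<Sum>i\<le>n. a i * (x ^ Suc i / (real i + 1)))" for x
    have dF: "(F has_real_derivative p x) (at x)" for x
    proof -
      have d: "((\<lambda>x. a i * (x ^ Suc i / (real i + 1))) has_real_derivative a i * x ^ i) (at x)" for i
      proof -
        have "((\<lambda>x. x ^ Suc i) has_real_derivative real (Suc i) * x ^ i) (at x)" using DERIV_pow[of "Suc i" x] by simp
        then have "((\<lambda>x. a i * (x ^ Suc i / (real i + 1))) has_real_derivative a i * (real (Suc i) * x ^ i / (real i + 1))) (at x)"
          by (intro DERIV_cmult DERIV_cdivide)
        moreover have "real i + 1 > 0" by simp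
        then have "real (Suc i) * x ^ i / (real i + 1) = x ^ i" by (simp add: divide_eq_eq add.commute)
        ultimately show ?thesis by (simp only:)
      qed
      show ?thesis unfolding F_def pa by (rule DERIV_sum) (rule d)
    qed
    have pge: "f x - \<rho> / 8 \<le> p x" if "0 \<le> x" "x \<le> 1" for x
    proof -
      have "\<bar>f x - p x\<bar> < \<rho> / 8" using that by (intro p(2)) auto
      then show ?thesis by linarith
    qed
    \<comment> \<open>On the middle half of the interval the tent is at least \<open>1 / 2\<close>,
      elsewhere it is nonnegative; the approximation error \<open>\<rho> / 8\<close> is lost over
      all of \<open>[0, 1]\<close>.\<close>
    have "(- (\<rho> / 8)) * ((v0 - \<rho> / 2) - 0) \<le> F (v0 - \<rho> / 2) - F 0"
    proof (rule ge_derivative_imp_increment_ge[OF _ dF])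
      fix x assume x: "0 \<le> x" "x \<le> v0 - \<rho> / 2"
      have "0 \<le> f x" by (simp add: f_def)
      then show "- (\<rho> / 8) \<le> p x" using pge[of x] x \<rho> by linarith
    qed (use \<rho> in linarith)
    moreover have "(1 / 2 - \<rho> / 8) * ((v0 + \<rho> / 2) - (v0 - \<rho> / 2)) \<le> F (v0 + \<rho> / 2) - F (v0 - \<rho> / 2)"
    proof (rule ge_derivative_imp_increment_ge[OF _ dF])
      fix x assume x: "v0 - \<rho> / 2 \<le> x" "x \<le> v0 + \<rho> / 2"
      have "\<bar>x - v0\<bar> \<le> \<rho> / 2" using x by linarith
      then have "\<bar>x - v0\<bar> / \<rho> \<le> 1 / 2" using \<rho> by (simp add: divide_le_eq)
      then have "1 / 2 \<le> 1 - \<bar>x - v0\<bar> / \<rho>" by linarith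
      then have "1 / 2 \<le> f x" unfolding f_def by (rule order.trans) (rule max.cobounded2)
      then show "1 / 2 - \<rho> / 8 \<le> p x" using pge[of x] x \<rho> by linarith
    qed (use \<rho> in linarith)
    moreover have "(- (\<rho> / 8)) * (1 - (v0 + \<rho> / 2)) \<le> F 1 - F (v0 + \<rho> / 2)"
    proof (rule ge_derivative_imp_increment_ge[OF _ dF])
      fix x assume x: "v0 + \<rho> / 2 \<le> x" "x \<le> 1"
      have "0 \<le> f x" by (simp add: f_def)
      then show "- (\<rho> / 8) \<le> p x" using pge[of x] x \<rho> by linarith
    qed (use \<rho> in linarith)
    moreover have "(- (\<rho> / 8)) * ((v0 - \<rho> / 2) - 0) + (1 / 2 - \<rho> / 8) * ((v0 + \<rho> / 2) - (v0 - \<rho> / 2)) + (- (\<rho> / 8)) * (1 - (v0 + \<rho> / 2))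
       = \<rho> / 2 - \<rho> / 8" by (simp add: field_simps)
    moreover have "F 0 = 0" "F 1 = L" by (simp_all add: F_def L_def)
    ultimately show ?thesis by linarith
  qed
  define Q where "Q N = cbe_ensemble.tilt N \<beta> (-1 + 1 / real N)" for N
  define V where "V N x = exp (log_charpoly N x / real N)" for N x
  have mom: "integrable (Q N) (\<lambda>x. V N x ^ i)" "(\<integral>x. V N x ^ i \<partial>Q N) = exp (Lam N (\<beta> / 2) (-1 + (real i + 1) / real N) - Lam N (\<beta> / 2) (-1 + 1 / real N))"
    if N: "N \<ge> 1" for N i
  proof -
    have e: "V N x ^ i = exp (real i / real N * log_charpoly N x)" for x by (simp add: V_def exp_of_nat_mult[symmetric])
    have e2: "-1 + 1 / real N + real i / real N = -1 + (real i + 1) / real N" by (simp add: add_divide_distrib)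
    have "-1 + 1 / real N > -1" "-1 + (real i + 1) / real N > -1" using N by auto
    then show "integrable (Q N) (\<lambda>x. V N x ^ i)" "(\<integral>x. V N x ^ i \<partial>Q N) = exp (Lam N (\<beta> / 2) (-1 + (real i + 1) / real N) - Lam N (\<beta> / 2) (-1 + 1 / real N))"
      unfolding e Q_def using C.tilt_exp_moment[where h = "-1 + 1 / real N" and c = "real i / real N" and N = N] unfolding e2 by auto
  qed
  have conv: "(\<lambda>N. \<Sum>i\<le>n. a i * exp (Lam N (\<beta> / 2) (-1 + (real i + 1) / real N) - Lam N (\<beta> / 2) (-1 + 1 / real N))) \<longlonglongrightarrow> L"
    unfolding L_def
  proof (intro tendsto_sum tendsto_mult tendsto_const)
    fix i
    have "(\<lambda>N. exp (Lam N (\<beta> / 2) (-1 + (real i + 1) / real N) - Lam N (\<beta> / 2) (-1 + 1 / real N))) \<longlonglongrightarrow> exp (- ln (real i + 1))"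
      by (intro tendsto_exp Lam_near_minus_one) (use \<beta> in auto)
    moreover have "exp (- ln (real i + 1)) = 1 / (real i + 1)" by (simp add: exp_minus inverse_eq_divide)
    ultimately show "(\<lambda>N. exp (Lam N (\<beta> / 2) (-1 + (real i + 1) / real N) - Lam N (\<beta> / 2) (-1 + 1 / real N))) \<longlonglongrightarrow> 1 / (real i + 1)" by simp
  qed
  \<comment> \<open>Of the area \<open>\<rho> / 2\<close> three portions \<open>\<rho> / 8\<close>
    are given away: in the bound for \<open>L\<close>, in the convergence of the moments, and in
    comparing \<open>p\<close> with the tent.\<close>
  have "L - \<rho> / 8 < L" using \<rho> by simp
  from order_tendstoD(1)[OF conv this] eventually_ge_at_top[of 1] show ?thesis
  proof eventually_elim
    case (elim N)
    have hN: "-1 + 1 / real N > -1" using elim by simp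
    interpret T: prob_space "Q N" unfolding Q_def by (rule C.prob_space_tilt[OF hN])
    have spQ: "space (Q N) = space (cbe N \<beta>)" by (simp add: Q_def C.space_tilt)
    have Vm [measurable]: "V N \<in> borel_measurable (Q N)" unfolding V_def Q_def by measurable
    define G where "G = {x \<in> space (Q N). \<bar>V N x - v0\<bar> < \<rho>}"
    have Gm: "G \<in> sets (Q N)" unfolding G_def by measurable
    have pint: "integrable (Q N) (\<lambda>x. p (V N x))" unfolding pa
      using mom(1)[OF elim(2)] by (intro Bochner_Integration.integrable_sum integrable_mult_right)
    have pval: "(\<integral>x. p (V N x) \<partial>Q N) = (\<Sum>i\<le>n. a i * exp (Lam N (\<beta> / 2) (-1 + (real i + 1) / real N) - Lam N (\<beta> / 2) (-1 + 1 / real N)))"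
      unfolding pa using mom(2)[OF elim(2)]
      by (subst Bochner_Integration.integral_sum) (auto intro!: integrable_mult_right mom(1)[OF elim(2)])
    have ae: "AE x in Q N. V N x \<le> 2"
    proof -
      have "AE x in cbe N \<beta>. V N x \<le> 2" using C.AE_X_le[of N]
      proof eventually_elim
        case (elim x)
        then have "log_charpoly N x / real N \<le> ln 2" using \<open>1 \<le> N\<close> by (simp add: divide_le_eq mult.commute)
        then have "V N x \<le> exp (ln 2)" unfolding V_def by (simp only: exp_le_cancel_iff)
        then show ?case by simp
      qed
      then show ?thesis unfolding Q_def C.tilt_def by (subst AE_density) auto
    qed
    have "(\<integral>x. p (V N x) - \<rho> / 8 \<partial>Q N) \<le> (\<integral>x. indicator G x \<partial>Q N)"
    proof (rule integral_mono_AE)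
      show "integrable (Q N) (\<lambda>x. p (V N x) - \<rho> / 8)" using pint by simp
      show "integrable (Q N) (indicator G :: _ \<Rightarrow> real)" using Gm by (simp add: T.emeasure_eq_measure)
      show "AE x in Q N. p (V N x) - \<rho> / 8 \<le> indicator G x"
        using ae AE_space
      proof eventually_elim
        case (elim x)
        have "V N x \<in> {0..2}" using elim by (simp add: V_def)
        from p(2)[OF this] have le: "p (V N x) - \<rho> / 8 \<le> f (V N x)" by linarith
        also have "f (V N x) \<le> indicator G x"
        proof (cases "\<bar>V N x - v0\<bar> < \<rho>")
          case True
          then show ?thesis using elim \<rho> by (simp add: f_def G_def)
        next
          case False
          then have "1 \<le> \<bar>V N x - v0\<bar> / \<rho>" using \<rho> by (simp add: le_divide_eq)
          then show ?thesis by (simp add: f_def)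
        qed
        finally show ?case .
      qed
    qed
    then have "(\<integral>x. p (V N x) \<partial>Q N) - \<rho> / 8 \<le> measure (Q N) G"
      using pint Gm by (simp add: T.prob_space)
    then have "\<rho> / 8 \<le> measure (Q N) G" using elim(1) L \<rho> unfolding pval by linarith
    then show ?case by (simp add: G_def V_def spQ Q_def)
  qed
qed

text \<open>Undoes the tilt of \<open>tilt_interval_mass\<close>. On the event \<open>X\<close> lies
  between \<open>- (\<epsilon> - x) * N\<close> and 0, while \<open>h\<close> is at least -1 and
  \<open>Lam N (\<beta> / 2) h\<close> is nonnegative, so the density is at most
  \<open>exp ((\<epsilon> - x) * N)\<close>.\<close>

lemma negative_interval_mass:
  fixes \<beta> x \<epsilon> :: real
  assumes \<beta>: "\<beta> > 0" and x: "\<epsilon> > 0" "x + \<epsilon> \<le> 0"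
  shows "\<exists>q>0. \<forall>\<^sub>F N in sequentially. q * exp (- ((\<epsilon> - x) * real N))
    \<le> measure (cbe N \<beta>) {z \<in> space (cbe N \<beta>). \<bar>log_charpoly N z / real N - x\<bar> < \<epsilon>}"
proof -
  interpret C: cbe_ensemble N \<beta> for N by unfold_locales (rule \<beta>)
  define v0 where "v0 = exp x"
  \<comment> \<open>The largest radius for which the interval around \<open>exp x\<close> stays
    inside the image under \<open>exp\<close> of the interval around \<open>x\<close>.\<close>
  define \<rho> where "\<rho> = min (v0 - exp (x - \<epsilon>)) (exp (x + \<epsilon>) - v0)"
  have \<rho>: "0 < \<rho>" "\<rho> \<le> v0" "v0 + \<rho> \<le> 1"
  proof -
    show "0 < \<rho>" using x by (simp add: \<rho>_def v0_def)
    have "0 < exp (x - \<epsilon>)" by simp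
    moreover have "\<rho> \<le> v0 - exp (x - \<epsilon>)" "\<rho> \<le> exp (x + \<epsilon>) - v0" by (simp_all add: \<rho>_def)
    moreover have "exp (x + \<epsilon>) \<le> 1" using x by simp
    ultimately show "\<rho> \<le> v0" "v0 + \<rho> \<le> 1" by linarith+
  qed
  have "\<forall>\<^sub>F N in sequentially. \<rho> / 8 * exp (- ((\<epsilon> - x) * real N))
    \<le> measure (cbe N \<beta>) {z \<in> space (cbe N \<beta>). \<bar>log_charpoly N z / real N - x\<bar> < \<epsilon>}"
    using tilt_interval_mass[OF \<beta> \<rho>] eventually_ge_at_top[of 1]
  proof eventually_elim
    case (elim N)
    define h where "h = -1 + 1 / real N"
    have h: "h > -1" "h \<le> 0" using elim by (auto simp: h_def)
    interpret T: prob_space "C.tilt N h" by (rule C.prob_space_tilt[OF h(1)])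
    define G where "G = {z \<in> space (cbe N \<beta>). \<bar>exp (log_charpoly N z / real N) - v0\<bar> < \<rho>}"
    define H where "H = {z \<in> space (cbe N \<beta>). \<bar>log_charpoly N z / real N - x\<bar> < \<epsilon>}"
    have Gm: "G \<in> sets (cbe N \<beta>)" and Hm: "H \<in> sets (cbe N \<beta>)" unfolding G_def H_def by measurable
    have GH: "G \<subseteq> H"
    proof
      fix z assume z: "z \<in> G"
      have "exp (x - \<epsilon>) < exp (log_charpoly N z / real N)" "exp (log_charpoly N z / real N) < exp (x + \<epsilon>)"
        using z by (auto simp: G_def \<rho>_def abs_less_iff)
      then have "x - \<epsilon> < log_charpoly N z / real N" "log_charpoly N z / real N < x + \<epsilon>" by (simp_all only: exp_less_cancel_iff)
      then show "z \<in> H" using z by (auto simp: H_def G_def abs_less_iff)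
    qed
    have Lam_ge: "0 \<le> Lam N (\<beta> / 2) h"
      using Lam_supporting[of "\<beta> / 2" 0 h N] \<beta> h by (simp add: Lam_0 Lam1_0)
    have sT: "sets (C.tilt N h) = sets (cbe N \<beta>)" by (rule C.sets_tilt)
    have "\<rho> / 8 \<le> measure (C.tilt N h) G" using elim by (simp add: h_def G_def)
    also have "\<dots> \<le> measure (C.tilt N h) H" using GH Hm by (intro T.finite_measure_mono) (auto simp: sT)
    also have "\<dots> = (\<integral>z. indicator H z \<partial>C.tilt N h)" using Hm sT by simp
    also have "\<dots> = (\<integral>z. exp (h * log_charpoly N z - Lam N (\<beta> / 2) h) *\<^sub>R indicator H z \<partial>cbe N \<beta>)"
      using Hm by (intro C.integral_tilt) auto
    also have "\<dots> \<le> (\<integral>z. exp ((\<epsilon> - x) * real N) * indicator H z \<partial>cbe N \<beta>)"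
    proof (rule integral_mono)
      have pw: "exp (h * log_charpoly N z - Lam N (\<beta> / 2) h) *\<^sub>R indicator H z \<le> exp ((\<epsilon> - x) * real N) * (indicator H z :: real)" for z
      proof (cases "z \<in> H")
        case True
        have N: "real N > 0" using elim by simp
        have "- (\<epsilon> - x) \<le> log_charpoly N z / real N" "log_charpoly N z / real N \<le> 0" using True x by (auto simp: H_def abs_less_iff)
        then have y: "- ((\<epsilon> - x) * real N) \<le> log_charpoly N z" "log_charpoly N z \<le> 0"
          using N by (auto simp: field_simps)
        have "h * log_charpoly N z \<le> - log_charpoly N z"
          using mult_right_mono_neg[of "-1" h "log_charpoly N z"] h y by simp
        then have "h * log_charpoly N z - Lam N (\<beta> / 2) h \<le> (\<epsilon> - x) * real N" using y Lam_ge by linarith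
        then show ?thesis using True by simp
      qed simp
      show "exp (h * log_charpoly N z - Lam N (\<beta> / 2) h) *\<^sub>R indicator H z \<le> exp ((\<epsilon> - x) * real N) * (indicator H z :: real)" for z by (rule pw)
      show iH: "integrable (cbe N \<beta>) (\<lambda>z. exp ((\<epsilon> - x) * real N) * (indicator H z :: real))"
        using Hm by (simp add: C.emeasure_eq_measure)
      show "integrable (cbe N \<beta>) (\<lambda>z. exp (h * log_charpoly N z - Lam N (\<beta> / 2) h) *\<^sub>R (indicator H z :: real))"
      proof (rule Bochner_Integration.integrable_bound[OF iH])
        show "(\<lambda>z. exp (h * log_charpoly N z - Lam N (\<beta> / 2) h) *\<^sub>R (indicator H z :: real)) \<in> borel_measurable (cbe N \<beta>)"
          using Hm by measurable
        show "AE z in cbe N \<beta>. norm (exp (h * log_charpoly N z - Lam N (\<beta> / 2) h) *\<^sub>R (indicator H z :: real))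
            \<le> norm (exp ((\<epsilon> - x) * real N) * (indicator H z :: real))"
          using pw by (intro AE_I2) (simp add: abs_mult)
      qed
    qed
    also have "\<dots> = exp ((\<epsilon> - x) * real N) * measure (cbe N \<beta>) H" using Hm by simp
    finally have "\<rho> / 8 \<le> exp ((\<epsilon> - x) * real N) * measure (cbe N \<beta>) H" .
    then have "\<rho> / 8 * exp (- ((\<epsilon> - x) * real N)) \<le> exp ((\<epsilon> - x) * real N) * measure (cbe N \<beta>) H * exp (- ((\<epsilon> - x) * real N))"
      by (intro mult_right_mono) auto
    also have "\<dots> = measure (cbe N \<beta>) H" by (simp add: exp_minus)
    finally show ?case by (simp add: H_def)
  qed
  then show ?thesis using \<rho> by (intro exI[of _ "\<rho> / 8"]) auto
qed

section \<open>The rate function and the two large deviation bounds\<close>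

lemma ln_ennreal_mono: "x \<le> y \<Longrightarrow> ln_ennreal x \<le> ln_ennreal y"
proof -
  assume xy: "x \<le> y"
  consider "x = 0" | "y = \<infinity>" | "x \<noteq> 0" "y \<noteq> \<infinity>" by blast
  then show ?thesis
  proof cases
    case 3
    then obtain r where r: "y = ennreal r" "r \<ge> 0" by (cases y) auto
    then obtain q where q: "x = ennreal q" "q \<ge> 0" using xy by (cases x) (auto simp: top_unique)
    have "q \<noteq> 0" using 3 q by auto
    then have "0 < q" "q \<le> r" using q r xy by auto
    then show ?thesis using q r by (simp add: ln_ennreal_def)
  qed (auto simp: ln_ennreal_def)
qed

lemma ln_ennreal_exp [simp]: "ln_ennreal (ennreal (exp u)) = ereal u"
  by (simp add: ln_ennreal_def)

lemma ln_ennreal_zero [simp]: "ln_ennreal 0 = -\<infinity>" by (simp add: ln_ennreal_def)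

text \<open>Chernoff's bound: the integrand in \<open>tail_tilt\<close> is at most 1. It serves in
  \<open>ldp_upper\<close> and for the right endpoint in
  \<open>positive_interval_mass\<close>.\<close>

lemma upper_tail_le_exp_conj:
  assumes \<beta>: "\<beta> > 0" and N: "N \<ge> 1" and a: "0 \<le> a" "a < ln 2"
  shows "upper_tail N \<beta> (a * real N) \<le> exp (- Lam_conj N (\<beta> / 2) a)"
proof -
  interpret cbe_ensemble N \<beta> by unfold_locales (rule \<beta>)
  define h where "h = hsol N b a"
  have h: "h \<ge> 0" unfolding h_def using b_pos N a by (intro hsol) auto
  interpret T: prob_space "tilt h" by (rule prob_space_tilt) (use h in simp)
  let ?f = "\<lambda>x. exp (- (h * (X x - a * real N))) * (if a * real N \<le> X x then 1 else 0)"
  have f: "?f x \<le> 1" for x using h by simp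
  have "integrable (tilt h) ?f"
    by (rule T.integrable_const_bound[where B = 1]) (use f in auto)
  then have "(\<integral>x. ?f x \<partial>tilt h) \<le> 1" by (rule T.integral_le_const) (use f in auto)
  then have "upper_tail N \<beta> (a * real N) * exp (a * real N * h - Lam N b h) \<le> 1"
    using tail_tilt[of h "a * real N"] h by simp
  moreover have "a * real N * h - Lam N b h = Lam_conj N b a" by (simp add: Lam_conj_def h_def)
  ultimately have "upper_tail N \<beta> (a * real N) * exp (Lam_conj N b a) * exp (- Lam_conj N b a) \<le> 1 * exp (- Lam_conj N b a)"
    by (intro mult_right_mono) auto
  then show ?thesis by (simp add: mult.assoc exp_minus)
qed

lemma cbe_rate_nonneg: "\<beta> > 0 \<Longrightarrow> 0 \<le> cbe_rate \<beta> a"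
  using theta_inv(1)[of a] rate_I_nonneg[of "theta_inv a"] by (auto simp: cbe_rate_def)

lemma cbe_rate_theta: "0 \<le> u \<Longrightarrow> cbe_rate \<beta> (theta u) = ereal (\<beta> / 2 * rate_I u)"
  using theta_mono_iff[of u 0] theta_less[of u] by (simp add: cbe_rate_def theta_inv_theta)

lemma cbe_rate_mono:
  assumes \<beta>: "\<beta> > 0" and "x \<le> y"
  shows "cbe_rate \<beta> x \<le> cbe_rate \<beta> y"
proof -
  consider "x < 0" | "0 \<le> x" "y < ln 2" | "ln 2 \<le> y" by linarith
  then show ?thesis
  proof cases
    case 1
    then show ?thesis using cbe_rate_nonneg[OF \<beta>, of y] by (simp add: cbe_rate_def)
  next
    case 2
    then have "theta_inv x \<le> theta_inv y" "0 \<le> theta_inv x" using assms by (auto intro!: theta_inv_mono theta_inv(1))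
    then have "rate_I (theta_inv x) \<le> rate_I (theta_inv y)"
      using rate_I_strict_mono[of "theta_inv x" "theta_inv y"] by (cases "theta_inv x = theta_inv y") auto
    then show ?thesis using 2 assms by (simp add: cbe_rate_def)
  next
    case 3
    then have "\<not> y < 0" using ln_gt_zero[of "2::real"] by linarith
    then show ?thesis using 3 by (simp add: cbe_rate_def)
  qed
qed

text \<open>Chernoff's bound is available for levels below \<open>ln 2\<close>, so the upper bound
  moves slightly to the left. From \<open>ln 2\<close> on, where the rate is infinite, this succeeds
  because \<open>rate_I\<close> is unbounded.\<close>

lemma cbe_rate_left:
  assumes \<beta>: "\<beta> > 0" and c: "ereal c < cbe_rate \<beta> x"
  shows "\<exists>y<x. y < ln 2 \<and> ereal c < cbe_rate \<beta> y"
proof -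
  consider "x \<le> 0" | "0 < x" "x < ln 2" | "ln 2 \<le> x" by linarith
  then show ?thesis
  proof cases
    case 1
    then have "cbe_rate \<beta> x = 0" by (cases "x = 0") (auto simp: cbe_rate_def)
    moreover have "cbe_rate \<beta> (x - 1) = 0" using 1 by (simp add: cbe_rate_def)
    moreover have "x - 1 < ln 2" using 1 ln_gt_zero[of "2::real"] by linarith
    ultimately show ?thesis using c by (intro exI[of _ "x - 1"]) auto
  next
    case 2
    define u where "u = theta_inv x"
    have u: "u > 0" "theta u = x" using theta_inv_pos[of x] theta_inv(2)[of x] 2 by (auto simp: u_def)
    have cu: "c < \<beta> / 2 * rate_I u" using c cbe_rate_theta[of u \<beta>] u by simp
    have "isCont rate_I u" using rate_I_continuous u by (intro continuous_on_interior[of "{0..}"]) (auto simp: interior_Ici[of "-1"])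
    then have "((\<lambda>v. \<beta> / 2 * rate_I v) \<longlongrightarrow> \<beta> / 2 * rate_I u) (at_left u)"
      by (intro tendsto_mult tendsto_const) (auto simp: isCont_def intro: tendsto_within_subset)
    then have "\<forall>\<^sub>F v in at_left u. c < \<beta> / 2 * rate_I v" using cu by (rule order_tendstoD)
    moreover have "\<forall>\<^sub>F v in at_left u. v \<in> {0<..<u}" by (rule eventually_at_leftI[OF _ u(1)])
    ultimately have "\<forall>\<^sub>F v in at_left u. c < \<beta> / 2 * rate_I v \<and> v \<in> {0<..<u}" by (rule eventually_conj)
    then obtain v where v: "c < \<beta> / 2 * rate_I v" "0 < v" "v < u"
      using eventually_happens'[OF trivial_limit_at_left_real] by fastforce
    have "theta v < x" using v u theta_mono_iff[of v u] by simp
    then show ?thesis using v theta_less[of v] cbe_rate_theta[of v \<beta>] by (intro exI[of _ "theta v"]) auto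
  next
    case 3
    have "filterlim (\<lambda>v. \<beta> / 2 * rate_I v) at_top at_top"
      using \<beta> by (intro filterlim_tendsto_pos_mult_at_top[OF tendsto_const _ rate_I_at_top]) auto
    then have "\<forall>\<^sub>F v in at_top. c < \<beta> / 2 * rate_I v" by (simp add: filterlim_at_top_dense)
    then have "\<forall>\<^sub>F v in at_top. c < \<beta> / 2 * rate_I v \<and> v \<ge> 0" by (rule eventually_conj[OF _ eventually_ge_at_top])
    then obtain v where v: "c < \<beta> / 2 * rate_I v" "0 \<le> v" using eventually_happens'[OF trivial_limit_at_top_linorder] by blast
    then show ?thesis using 3 theta_less[of v] cbe_rate_theta[of v \<beta>] by (intro exI[of _ "theta v"]) auto
  qed
qed

text \<open>The counterpart for the lower bound, which needs a strictly positive level with room to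
  its right; it rests on right continuity of \<open>theta\<close> and \<open>rate_I\<close>.\<close>

lemma cbe_rate_right:
  assumes x: "0 \<le> x" "x < ln 2" and c: "cbe_rate \<beta> x < ereal c" and \<epsilon>: "\<epsilon> > 0"
  shows "\<exists>y>x. y < x + \<epsilon> \<and> y < ln 2 \<and> cbe_rate \<beta> y < ereal c"
proof -
  define u where "u = theta_inv x"
  have u: "u \<ge> 0" "theta u = x" using theta_inv[of x] x by (auto simp: u_def)
  have cu: "\<beta> / 2 * rate_I u < c" using c cbe_rate_theta[of u \<beta>] u by simp
  have t1: "(rate_I \<longlongrightarrow> rate_I u) (at_right u)" and t2: "(theta \<longlongrightarrow> theta u) (at_right u)"
    using rate_I_continuous theta_continuous u(1)
    by (auto simp: continuous_on_def intro!: tendsto_within_subset[where S = "{0..}" and T = "{u<..}"])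
  have "((\<lambda>v. \<beta> / 2 * rate_I v) \<longlongrightarrow> \<beta> / 2 * rate_I u) (at_right u)"
    by (intro tendsto_mult tendsto_const t1)
  then have "\<forall>\<^sub>F v in at_right u. \<beta> / 2 * rate_I v < c" using cu by (rule order_tendstoD)
  moreover have "\<forall>\<^sub>F v in at_right u. theta v < x + \<epsilon>" using order_tendstoD(2)[OF t2, of "x + \<epsilon>"] \<epsilon> u by simp
  moreover have "\<forall>\<^sub>F v in at_right u. v \<in> {u<..<u + 1}" by (rule eventually_at_rightI[of u "u + 1"]) auto
  ultimately have "\<forall>\<^sub>F v in at_right u. \<beta> / 2 * rate_I v < c \<and> theta v < x + \<epsilon> \<and> v \<in> {u<..<u + 1}"
    by (intro eventually_conj)
  then obtain v where v: "\<beta> / 2 * rate_I v < c" "theta v < x + \<epsilon>" "u < v"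
    using eventually_happens'[OF trivial_limit_at_right_real] by fastforce
  have "x < theta v" using v u theta_mono_iff[of u v] by simp
  then show ?thesis using v u theta_less[of v] cbe_rate_theta[of v \<beta>] by (intro exI[of _ "theta v"]) auto
qed

text \<open>The superlevel sets are open: by \<open>cbe_rate_left\<close> the level is exceeded
  already to the left of a given point, and the rate is monotone.\<close>

lemma closed_cbe_rate_sublevel:
  assumes \<beta>: "\<beta> > 0"
  shows "closed {x. cbe_rate \<beta> x \<le> c}"
proof (cases c)
  case (real r)
  have "open {x. ereal r < cbe_rate \<beta> x}"
  proof (subst open_subopen, intro ballI)
    fix x assume "x \<in> {x. ereal r < cbe_rate \<beta> x}"
    then obtain y where y: "y < x" "ereal r < cbe_rate \<beta> y" using cbe_rate_left[OF \<beta>, of r x] by auto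
    have "{y<..} \<subseteq> {x. ereal r < cbe_rate \<beta> x}" using y(2) cbe_rate_mono[OF \<beta>] by (auto intro: less_le_trans)
    then show "\<exists>T. open T \<and> x \<in> T \<and> T \<subseteq> {x. ereal r < cbe_rate \<beta> x}" using y(1) by (intro exI[of _ "{y<..}"]) auto
  qed
  then have "closed (- {x. ereal r < cbe_rate \<beta> x})" by (rule closed_Compl)
  moreover have "- {x. ereal r < cbe_rate \<beta> x} = {x. cbe_rate \<beta> x \<le> c}" using real by (auto simp: not_less)
  ultimately show ?thesis by simp
next
  case MInf
  have "\<not> cbe_rate \<beta> x \<le> c" for x using cbe_rate_nonneg[OF \<beta>, of x] MInf by auto
  then show ?thesis by simp
qed auto

lemma emeasure_law:
  assumes \<beta>: "\<beta> > 0" and A: "A \<in> sets borel"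
  shows "emeasure (distr (cbe N \<beta>) borel (\<lambda>z. log_charpoly N z / real N)) A
     = ennreal (measure (cbe N \<beta>) {z \<in> space (cbe N \<beta>). log_charpoly N z / real N \<in> A})"
proof -
  interpret cbe_ensemble N \<beta> by unfold_locales (rule \<beta>)
  have m: "(\<lambda>z. log_charpoly N z / real N) \<in> measurable (cbe N \<beta>) borel" by measurable
  have e: "(\<lambda>z. log_charpoly N z / real N) -` A \<inter> space (cbe N \<beta>) = {z \<in> space (cbe N \<beta>). log_charpoly N z / real N \<in> A}" by auto
  show ?thesis unfolding emeasure_distr[OF m A] e by (rule emeasure_eq_measure)
qed

lemma Lam_conj_lower_asymp:
  assumes \<beta>: "\<beta> > 0" and a: "0 < a" "a < ln 2" and c: "ereal c < cbe_rate \<beta> a"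
  shows "\<forall>\<^sub>F N in sequentially. c * (real N)\<^sup>2 \<le> Lam_conj N (\<beta> / 2) a"
proof -
  define r where "r = \<beta> / 2 * rate_I (theta_inv a)"
  have r: "0 < r - c" using c a by (simp add: cbe_rate_def r_def)
  have "\<beta> / 2 > 0" using \<beta> by simp
  then obtain C where C: "\<And>N. N \<ge> 1 \<Longrightarrow> \<bar>Lam_conj N (\<beta> / 2) a - (real N)\<^sup>2 * (\<beta> / 2) * rate_I (theta_inv a)\<bar> \<le> C * real N"
    using Lam_conj_asymp[OF _ a] by blast
  have "\<forall>\<^sub>F N in sequentially. 0 \<le> (r - c) * (real N)\<^sup>2 - C * real N" using r by real_asymp
  then show ?thesis using eventually_ge_at_top[of 1]
  proof eventually_elim
    case (elim N)
    have e: "(real N)\<^sup>2 * (\<beta> / 2) * rate_I (theta_inv a) = r * (real N)\<^sup>2" by (simp add: r_def)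
    have "\<bar>Lam_conj N (\<beta> / 2) a - r * (real N)\<^sup>2\<bar> \<le> C * real N" using C[OF elim(2)] unfolding e .
    then show ?case using elim(1) unfolding left_diff_distrib by linarith
  qed
qed

text \<open>As the rate is monotone, it is enough to bound a set by the half-line from its infimum
  and to apply Chernoff's bound just left of it. Every real \<open>c\<close> below the infimum of
  the rate yields an asymptotic bound, and the supremum over such \<open>c\<close> is taken at the
  end.\<close>

lemma ldp_upper:
  assumes \<beta>: "\<beta> > 0" and A: "A \<in> sets borel"
  shows "limsup (\<lambda>N. ln_ennreal (emeasure (distr (cbe N \<beta>) borel (\<lambda>z. log_charpoly N z / real N)) A) / ereal ((real N)\<^sup>2))
     \<le> - (INF x\<in>closure A. cbe_rate \<beta> x)" (is "limsup ?S \<le> - ?I")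
proof -
  have S: "limsup ?S \<le> ereal (- c)" if c: "ereal c < ?I" for c
  proof (rule Limsup_bounded)
    show "\<forall>\<^sub>F N in sequentially. ?S N \<le> ereal (- c)"
    proof (cases "A = {}")
      case True
      show ?thesis using eventually_ge_at_top[of 1] by eventually_elim (use True in simp)
    next
      case ne: False
      have pc: "ereal c < cbe_rate \<beta> x" if "x \<in> closure A" for x
        using c INF_lower[OF that, of "cbe_rate \<beta>"] by (rule less_le_trans)
      show ?thesis
      \<comment> \<open>A negative \<open>c\<close> carries no information about the closure of
        \<open>A\<close>, but then the trivial bound 1 on the probability suffices. For
        \<open>c \<ge> 0\<close> the closure consists of positive points, to which Chernoff's bound
        applies.\<close>
      proof (cases "c < 0")
        case True
        show ?thesis using eventually_ge_at_top[of 1]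
        proof eventually_elim
          case (elim N)
          have "emeasure (distr (cbe N \<beta>) borel (\<lambda>z. log_charpoly N z / real N)) A \<le> ennreal (exp 0)"
            unfolding emeasure_law[OF \<beta> A] using prob_space.prob_le_1[OF prob_space_cbe[OF \<beta>]] by (intro ennreal_leI) simp
          from ln_ennreal_mono[OF this]
          have "ln_ennreal (emeasure (distr (cbe N \<beta>) borel (\<lambda>z. log_charpoly N z / real N)) A) \<le> ereal 0" by (simp only: ln_ennreal_exp)
          then have "?S N \<le> ereal 0 / ereal ((real N)\<^sup>2)" using elim by (intro ereal_divide_right_mono) auto
          also have "\<dots> \<le> ereal (- c)" using True by simp
          finally show ?case .
        qed
      next
        case False
        have pos: "x > 0" if "x \<in> closure A" for x
        proof (rule ccontr)
          assume "\<not> x > 0"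
          then have "cbe_rate \<beta> x = 0" by (cases "x = 0") (auto simp: cbe_rate_def)
          then show False using pc[OF that] False by simp
        qed
        have bdd: "bdd_below A" using pos closure_subset[of A] by (intro bdd_belowI[of _ 0]) (auto intro: less_imp_le)
        have inf: "Inf A \<in> closure A" by (rule closure_contains_Inf[OF ne bdd])
        obtain y where y: "y < Inf A" "y < ln 2" "ereal c < cbe_rate \<beta> y" using cbe_rate_left[OF \<beta> pc[OF inf]] by blast
        have y0: "y > 0"
        proof (rule ccontr)
          assume "\<not> y > 0"
          then have "cbe_rate \<beta> y = 0" by (cases "y = 0") (auto simp: cbe_rate_def)
          then show False using y False by simp
        qed
        show ?thesis using Lam_conj_lower_asymp[OF \<beta> y0 y(2,3)] eventually_ge_at_top[of 1]
        proof eventually_elim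
          case (elim N)
          interpret cbe_ensemble N \<beta> by unfold_locales (rule \<beta>)
          have N: "real N > 0" using elim by simp
          have "measure (cbe N \<beta>) {z \<in> space (cbe N \<beta>). log_charpoly N z / real N \<in> A} \<le> upper_tail N \<beta> (y * real N)"
            unfolding upper_tail_def
          proof (rule finite_measure_mono)
            show "{z \<in> space (cbe N \<beta>). log_charpoly N z / real N \<in> A} \<subseteq> {z \<in> space (cbe N \<beta>). y * real N \<le> log_charpoly N z}"
            proof safe
              fix z assume "log_charpoly N z / real N \<in> A"
              then have "Inf A \<le> log_charpoly N z / real N" using bdd by (rule cInf_lower)
              then have "y \<le> log_charpoly N z / real N" using y by linarith
              then show "y * real N \<le> log_charpoly N z" using N by (simp add: le_divide_eq)
            qed
            show "{z \<in> space (cbe N \<beta>). y * real N \<le> log_charpoly N z} \<in> events" by measurable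
          qed
          also have "\<dots> \<le> exp (- Lam_conj N (\<beta> / 2) y)" using \<beta> elim y0 y by (intro upper_tail_le_exp_conj) auto
          also have "\<dots> \<le> exp (- (c * (real N)\<^sup>2))" using elim by simp
          finally have "emeasure (distr (cbe N \<beta>) borel (\<lambda>z. log_charpoly N z / real N)) A \<le> ennreal (exp (- (c * (real N)\<^sup>2)))"
            unfolding emeasure_law[OF \<beta> A] by (rule ennreal_leI)
          from ln_ennreal_mono[OF this]
          have "ln_ennreal (emeasure (distr (cbe N \<beta>) borel (\<lambda>z. log_charpoly N z / real N)) A) \<le> ereal (- (c * (real N)\<^sup>2))"
            by (simp only: ln_ennreal_exp)
          then have "?S N \<le> ereal (- (c * (real N)\<^sup>2)) / ereal ((real N)\<^sup>2)" using N by (intro ereal_divide_right_mono) auto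
          also have "\<dots> = ereal (- c)" using N by simp
          finally show ?case .
        qed
      qed
    qed
  qed
  have "?I \<le> - limsup ?S"
  proof (rule dense_le)
    fix y assume y: "y < ?I"
    show "y \<le> - limsup ?S"
    proof (cases y)
      case (real c)
      then have "limsup ?S \<le> ereal (- c)" using S y by simp
      then have "- ereal (- c) \<le> - limsup ?S" by (simp only: ereal_minus_le_minus)
      then show ?thesis using real by simp
    qed (use y in auto)
  qed
  then have "- (- limsup ?S) \<le> - ?I" by (simp only: ereal_minus_le_minus)
  then show ?thesis by simp
qed

text \<open>A difference of two tails. The rate at \<open>a'\<close> is strictly larger, so the
  second tail is smaller by a factor exponential in \<open>N\<^sup>2\<close>, which beats the
  polynomial factor of the first.\<close>

lemma positive_interval_mass:
  assumes \<beta>: "\<beta> > 0" and a: "0 < a" "a < a'" "a' < ln 2" and c: "cbe_rate \<beta> a < ereal c"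
  shows "\<forall>\<^sub>F N in sequentially. exp (- (c * (real N)\<^sup>2))
    \<le> measure (cbe N \<beta>) {z \<in> space (cbe N \<beta>). a * real N \<le> log_charpoly N z \<and> log_charpoly N z < a' * real N}"
proof -
  define r where "r = (\<lambda>a. \<beta> / 2 * rate_I (theta_inv a))"
  have rc: "0 < c - r a" using c a by (simp add: cbe_rate_def r_def)
  have "rate_I (theta_inv a) < rate_I (theta_inv a')"
    using a by (intro rate_I_strict_mono theta_inv_strict_mono theta_inv(1)) auto
  then have d: "0 < r a' - r a" using \<beta> by (simp add: r_def)
  have b: "\<beta> / 2 > 0" using \<beta> by simp
  obtain C where C: "\<And>N. N \<ge> 1 \<Longrightarrow> \<bar>Lam_conj N (\<beta> / 2) a - (real N)\<^sup>2 * (\<beta> / 2) * rate_I (theta_inv a)\<bar> \<le> C * real N"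
    using Lam_conj_asymp[OF b, of a] a by auto
  obtain C' where C': "\<And>N. N \<ge> 1 \<Longrightarrow> \<bar>Lam_conj N (\<beta> / 2) a' - (real N)\<^sup>2 * (\<beta> / 2) * rate_I (theta_inv a')\<bar> \<le> C' * real N"
    using Lam_conj_asymp[OF b, of a'] a by auto
  have "\<exists>m>0. \<forall>x\<in>{a..a}. \<forall>\<^sub>F N in sequentially. m \<le> real N * upper_tail N \<beta> (x * real N) * exp (Lam_conj N (\<beta> / 2) x)"
    by (rule tail_lower_bound[OF \<beta>]) (use a in auto)
  then obtain m where m: "m > 0" "\<forall>\<^sub>F N in sequentially. m \<le> real N * upper_tail N \<beta> (a * real N) * exp (Lam_conj N (\<beta> / 2) a)" by auto
  \<comment> \<open>Makes the second tail at most half of the lower bound for the first;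
    \<open>ev2\<close> compares the remaining half with
    \<open>exp (- (c * N\<^sup>2))\<close>.\<close>
  have ev1: "\<forall>\<^sub>F N in sequentially. 0 \<le> (r a' - r a) * (real N)\<^sup>2 - (C + C') * real N + ln (m / (2 * real N))"
    using d m(1) by real_asymp
  have ev2: "\<forall>\<^sub>F N in sequentially. 0 \<le> (c - r a) * (real N)\<^sup>2 - C * real N + ln (m / (2 * real N))"
    using rc m(1) by real_asymp
  show ?thesis using m(2) ev1 ev2 eventually_ge_at_top[of 1]
  proof eventually_elim
    case (elim N)
    interpret cbe_ensemble N \<beta> by unfold_locales (rule \<beta>)
    have N: "real N > 0" using elim by simp
    have q: "m / (2 * real N) > 0" using m N by simp
    define k k' where "k = Lam_conj N (\<beta> / 2) a" and "k' = Lam_conj N (\<beta> / 2) a'"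
    have re: "(real N)\<^sup>2 * (\<beta> / 2) * rate_I (theta_inv a) = r a * (real N)\<^sup>2" "(real N)\<^sup>2 * (\<beta> / 2) * rate_I (theta_inv a') = r a' * (real N)\<^sup>2"
      by (simp_all add: r_def)
    have kk: "\<bar>k - r a * (real N)\<^sup>2\<bar> \<le> C * real N" "\<bar>k' - r a' * (real N)\<^sup>2\<bar> \<le> C' * real N"
      using C[OF elim(4)] C'[OF elim(4)] unfolding re k_def k'_def by auto
    have "- k' \<le> ln (m / (2 * real N)) - k"
      using elim(2) kk unfolding left_diff_distrib distrib_right by linarith
    then have "exp (- k') \<le> exp (ln (m / (2 * real N)) - k)" by simp
    also have "\<dots> = m / (2 * real N) * exp (- k)" using q by (simp only: exp_diff exp_ln exp_minus divide_inverse)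
    finally have A1: "exp (- k') \<le> m / (2 * real N) * exp (- k)" .
    have "- (c * (real N)\<^sup>2) \<le> ln (m / (2 * real N)) - k"
      using elim(3) kk unfolding left_diff_distrib by linarith
    then have "exp (- (c * (real N)\<^sup>2)) \<le> exp (ln (m / (2 * real N)) - k)" by simp
    also have "\<dots> = m / (2 * real N) * exp (- k)" using q by (simp only: exp_diff exp_ln exp_minus divide_inverse)
    finally have A2: "exp (- (c * (real N)\<^sup>2)) \<le> m / (2 * real N) * exp (- k)" .
    have "m * exp (- k) \<le> real N * upper_tail N \<beta> (a * real N) * exp k * exp (- k)"
      using elim(1) by (intro mult_right_mono) (auto simp: k_def)
    also have "\<dots> = real N * upper_tail N \<beta> (a * real N)" by (simp add: exp_minus)
    finally have A3: "2 * (m / (2 * real N) * exp (- k)) \<le> upper_tail N \<beta> (a * real N)"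
      using N by (simp add: divide_le_eq mult.commute)
    have A4: "upper_tail N \<beta> (a' * real N) \<le> exp (- k')"
      unfolding k'_def using \<beta> elim a by (intro upper_tail_le_exp_conj) auto
    have "measure (cbe N \<beta>) {z \<in> space (cbe N \<beta>). a * real N \<le> log_charpoly N z \<and> log_charpoly N z < a' * real N}
       = measure (cbe N \<beta>) ({z \<in> space (cbe N \<beta>). a * real N \<le> log_charpoly N z} - {z \<in> space (cbe N \<beta>). a' * real N \<le> log_charpoly N z})"
      by (rule arg_cong[where f = "measure (cbe N \<beta>)"]) auto
    also have "\<dots> = upper_tail N \<beta> (a * real N) - upper_tail N \<beta> (a' * real N)"
      unfolding upper_tail_def
    proof (rule finite_measure_Diff)
      show "{z \<in> space (cbe N \<beta>). a * real N \<le> log_charpoly N z} \<in> events" "{z \<in> space (cbe N \<beta>). a' * real N \<le> log_charpoly N z} \<in> events"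
        by measurable
      have "a * real N \<le> a' * real N" using a by (intro mult_right_mono) auto
      then show "{z \<in> space (cbe N \<beta>). a' * real N \<le> log_charpoly N z} \<subseteq> {z \<in> space (cbe N \<beta>). a * real N \<le> log_charpoly N z}" by auto
    qed
    finally show ?case using A1 A2 A3 A4 by linarith
  qed
qed

text \<open>Local at a point of the interior. Left of 0 the cost \<open>exp (- O(N))\<close> is
  invisible at speed \<open>N\<^sup>2\<close>; from 0 on, an interval slightly to the right of the
  point is used. Points from \<open>ln 2\<close> on have infinite rate and impose no
  condition.\<close>

lemma ldp_lower:
  assumes \<beta>: "\<beta> > 0" and A: "A \<in> sets borel"
  shows "- (INF x\<in>interior A. cbe_rate \<beta> x)
    \<le> liminf (\<lambda>N. ln_ennreal (emeasure (distr (cbe N \<beta>) borel (\<lambda>z. log_charpoly N z / real N)) A) / ereal ((real N)\<^sup>2))"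
    (is "- ?I \<le> liminf ?S")
proof -
  have key: "ereal (- c) \<le> liminf ?S" if x: "x \<in> interior A" and c: "cbe_rate \<beta> x < ereal c" for x c
  proof (rule Liminf_bounded)
    \<comment> \<open>Strict positivity lets \<open>c * N\<^sup>2\<close> outgrow the linear cost in
      the negative case, where the rate itself is 0.\<close>
    have c0: "0 < c" using c cbe_rate_nonneg[OF \<beta>, of x] by (simp add: order.strict_trans1 flip: ereal_less(2))
    have suff: "ereal (- c) \<le> ?S N"
      if N: "N \<ge> 1" and m: "exp (- (c * (real N)\<^sup>2)) \<le> measure (cbe N \<beta>) H" and H: "H \<subseteq> {z \<in> space (cbe N \<beta>). log_charpoly N z / real N \<in> A}" for N H
    proof -
      interpret cbe_ensemble N \<beta> by unfold_locales (rule \<beta>)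
      have "{z \<in> space (cbe N \<beta>). log_charpoly N z / real N \<in> A} \<in> events" using A by measurable
      then have "measure (cbe N \<beta>) H \<le> measure (cbe N \<beta>) {z \<in> space (cbe N \<beta>). log_charpoly N z / real N \<in> A}"
        by (rule finite_measure_mono[OF H])
      with m have "ennreal (exp (- (c * (real N)\<^sup>2))) \<le> emeasure (distr (cbe N \<beta>) borel (\<lambda>z. log_charpoly N z / real N)) A"
        unfolding emeasure_law[OF \<beta> A] by (intro ennreal_leI) linarith
      from ln_ennreal_mono[OF this]
      have "ereal (- (c * (real N)\<^sup>2)) \<le> ln_ennreal (emeasure (distr (cbe N \<beta>) borel (\<lambda>z. log_charpoly N z / real N)) A)"
        by (simp only: ln_ennreal_exp)
      then have "ereal (- (c * (real N)\<^sup>2)) / ereal ((real N)\<^sup>2) \<le> ?S N" using N by (intro ereal_divide_right_mono) auto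
      moreover have "ereal (- (c * (real N)\<^sup>2)) / ereal ((real N)\<^sup>2) = ereal (- c)" using N by simp
      ultimately show ?thesis by simp
    qed
    obtain e where e: "e > 0" "ball x e \<subseteq> A" using x by (auto simp: mem_interior)
    show "\<forall>\<^sub>F N in sequentially. ereal (- c) \<le> ?S N"
    proof (cases "x < 0")
      case True
      define \<epsilon> where "\<epsilon> = min e (- x)"
      have \<epsilon>: "\<epsilon> > 0" "x + \<epsilon> \<le> 0" "\<epsilon> \<le> e" using e True by (auto simp: \<epsilon>_def)
      obtain q where q: "q > 0" "\<forall>\<^sub>F N in sequentially. q * exp (- ((\<epsilon> - x) * real N))
          \<le> measure (cbe N \<beta>) {z \<in> space (cbe N \<beta>). \<bar>log_charpoly N z / real N - x\<bar> < \<epsilon>}"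
        using negative_interval_mass[OF \<beta> \<epsilon>(1,2)] by blast
      have ev: "\<forall>\<^sub>F N in sequentially. 0 \<le> c * (real N)\<^sup>2 - (\<epsilon> - x) * real N + ln q" using c0 by real_asymp
      show ?thesis using q(2) ev eventually_ge_at_top[of 1]
      proof eventually_elim
        case (elim N)
        have "exp (- (c * (real N)\<^sup>2)) \<le> exp (ln q + - ((\<epsilon> - x) * real N))" using elim(2) by simp
        also have "\<dots> = q * exp (- ((\<epsilon> - x) * real N))" using q(1) by (simp only: exp_add exp_ln)
        also have "\<dots> \<le> measure (cbe N \<beta>) {z \<in> space (cbe N \<beta>). \<bar>log_charpoly N z / real N - x\<bar> < \<epsilon>}" by (rule elim(1))
        finally show ?case
        proof (rule suff[OF elim(3)])
          show "{z \<in> space (cbe N \<beta>). \<bar>log_charpoly N z / real N - x\<bar> < \<epsilon>} \<subseteq> {z \<in> space (cbe N \<beta>). log_charpoly N z / real N \<in> A}"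
          proof safe
            fix z assume "\<bar>log_charpoly N z / real N - x\<bar> < \<epsilon>"
            then have "log_charpoly N z / real N \<in> ball x e" using \<epsilon> by (simp add: dist_real_def)
            then show "log_charpoly N z / real N \<in> A" using e by blast
          qed
        qed
      qed
    next
      case False
      then have x0: "0 \<le> x" "x < ln 2" using c by (auto simp: cbe_rate_def split: if_splits)
      obtain a where a: "x < a" "a < x + e" "a < ln 2" "cbe_rate \<beta> a < ereal c" using cbe_rate_right[OF x0 c e(1)] by blast
      define a' where "a' = (a + min (x + e) (ln 2)) / 2"
      have a': "a < a'" "a' < ln 2" "a' < x + e" using a by (auto simp: a'_def min_def)
      have a0: "0 < a" using a x0 by linarith
      show ?thesis using positive_interval_mass[OF \<beta> a0 a'(1,2) a(4)] eventually_ge_at_top[of 1]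
      proof eventually_elim
        case (elim N)
        show ?case
        proof (rule suff[OF elim(2,1)])
          show "{z \<in> space (cbe N \<beta>). a * real N \<le> log_charpoly N z \<and> log_charpoly N z < a' * real N} \<subseteq> {z \<in> space (cbe N \<beta>). log_charpoly N z / real N \<in> A}"
          proof safe
            fix z assume z: "a * real N \<le> log_charpoly N z" "log_charpoly N z < a' * real N"
            have "a \<le> log_charpoly N z / real N" "log_charpoly N z / real N < a'"
              using z elim(2) by (simp_all add: le_divide_eq divide_less_eq)
            then have "log_charpoly N z / real N \<in> ball x e" using a a' by (simp add: dist_real_def abs_less_iff)
            then show "log_charpoly N z / real N \<in> A" using e by blast
          qed
        qed
      qed
    qed
  qed
  have "- liminf ?S \<le> ?I"
  proof (rule INF_greatest)
    fix x assume x: "x \<in> interior A"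
    show "- liminf ?S \<le> cbe_rate \<beta> x"
    proof (rule dense_ge)
      fix y assume y: "cbe_rate \<beta> x < y"
      show "- liminf ?S \<le> y"
      proof (cases y)
        case (real c)
        then have "ereal (- c) \<le> liminf ?S" using key[OF x] y by simp
        then have "- liminf ?S \<le> - ereal (- c)" by (simp only: ereal_minus_le_minus)
        then show ?thesis using real by simp
      qed (use y in auto)
    qed
  qed
  then have "- ?I \<le> - (- liminf ?S)" by (simp only: ereal_minus_le_minus)
  then show ?thesis by simp
qed

lemma cbe_large_deviation_principle:
  assumes \<beta>: "\<beta> > 0"
  shows "large_deviation_principle
          (\<lambda>N. distr (cbe N \<beta>) borel (\<lambda>z. log_charpoly N z / real N)) (\<lambda>N. (real N)\<^sup>2) (cbe_rate \<beta>)"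
  unfolding large_deviation_principle_def
proof (intro conjI allI ballI)
  show "filterlim (\<lambda>N. (real N)\<^sup>2) at_top sequentially" by real_asymp
qed (auto intro: cbe_rate_nonneg closed_cbe_rate_sublevel ldp_lower ldp_upper \<beta>)

theorem theorem2:
  fixes \<beta> :: real
  assumes "\<beta> > 0"
  shows
    "(\<forall>\<alpha>>0. \<exists>M::real. \<forall>\<alpha>\<^sub>0\<in>{\<alpha>..<ln 2}.
        limsup (\<lambda>N. ereal (real N * upper_tail N \<beta> (\<alpha>\<^sub>0 * real N) / (theta_inv \<alpha>\<^sub>0)\<^sup>2)
                    * exp_ereal (log_mgf_conj N \<beta> (\<alpha>\<^sub>0 * real N))) \<le> ereal M)
     \<and>
     (\<exists>\<alpha>\<^sub>m. 0 < \<alpha>\<^sub>m \<and> \<alpha>\<^sub>m \<le> ln 2 \<and>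
        (\<forall>\<alpha> \<alpha>'. 0 < \<alpha> \<and> \<alpha> \<le> \<alpha>' \<and> \<alpha>' < \<alpha>\<^sub>m \<longrightarrow>
          (\<exists>m::real. 0 < m \<and> (\<forall>\<alpha>\<^sub>0\<in>{\<alpha>..\<alpha>'}.
             ereal m \<le> liminf (\<lambda>N. ereal (real N * upper_tail N \<beta> (\<alpha>\<^sub>0 * real N))
                                    * exp_ereal (log_mgf_conj N \<beta> (\<alpha>\<^sub>0 * real N)))))))
     \<and>
     (\<beta> = 2 \<longrightarrow>
        (\<forall>\<alpha>>0. \<exists>C::real. \<forall>\<alpha>\<^sub>0\<in>{\<alpha>..<ln 2}. \<forall>N\<ge>1.
           \<bar>log_mgf_conj N 2 (\<alpha>\<^sub>0 * real N)
             - ereal ((real N)\<^sup>2 * rate_I (theta_inv \<alpha>\<^sub>0) + ln (real N) / 12)\<bar> \<le> ereal C)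
        \<and>
        (\<forall>\<alpha>>0. \<exists>M::real. \<forall>\<alpha>\<^sub>0\<in>{\<alpha>..<ln 2}.
           limsup (\<lambda>N. ereal (real N powr (13 / 12) * upper_tail N 2 (\<alpha>\<^sub>0 * real N)
                                / (theta_inv \<alpha>\<^sub>0)\<^sup>2
                              * exp ((real N)\<^sup>2 * rate_I (theta_inv \<alpha>\<^sub>0)))) \<le> ereal M)
        \<and>
        (\<exists>\<alpha>\<^sub>m. 0 < \<alpha>\<^sub>m \<and> \<alpha>\<^sub>m \<le> ln 2 \<and>
          (\<forall>\<alpha> \<alpha>'. 0 < \<alpha> \<and> \<alpha> \<le> \<alpha>' \<and> \<alpha>' < \<alpha>\<^sub>m \<longrightarrow>
            (\<exists>m::real. 0 < m \<and> (\<forall>\<alpha>\<^sub>0\<in>{\<alpha>..\<alpha>'}.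
               ereal m \<le> liminf (\<lambda>N. ereal (real N powr (13 / 12) * upper_tail N 2 (\<alpha>\<^sub>0 * real N)
                                      * exp ((real N)\<^sup>2 * rate_I (theta_inv \<alpha>\<^sub>0)))))))))
     \<and>
     (\<beta> \<noteq> 2 \<longrightarrow>
        (\<forall>\<alpha>>0. \<forall>\<alpha>\<^sub>0\<in>{\<alpha>..<ln 2}. \<exists>C::real. \<forall>N\<ge>1.
           \<bar>log_mgf_conj N \<beta> (\<alpha>\<^sub>0 * real N)
             - ereal ((real N)\<^sup>2 * (\<beta> / 2) * rate_I (theta_inv \<alpha>\<^sub>0))\<bar> \<le> ereal (C * real N))
        \<and>
        large_deviation_principle
          (\<lambda>N. distr (cbe N \<beta>) borel (\<lambda>z. log_charpoly N z / real N))
          (\<lambda>N. (real N)\<^sup>2)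
          (cbe_rate \<beta>))"
proof (intro conjI impI)
  have ln2: "0 < ln (2::real)" by simp
  show "\<forall>\<alpha>>0. \<exists>M::real. \<forall>\<alpha>\<^sub>0\<in>{\<alpha>..<ln 2}.
        limsup (\<lambda>N. ereal (real N * upper_tail N \<beta> (\<alpha>\<^sub>0 * real N) / (theta_inv \<alpha>\<^sub>0)\<^sup>2)
                    * exp_ereal (log_mgf_conj N \<beta> (\<alpha>\<^sub>0 * real N))) \<le> ereal M"
    using upper_tail_limsup_le[OF assms] by blast
  show "\<exists>\<alpha>\<^sub>m. 0 < \<alpha>\<^sub>m \<and> \<alpha>\<^sub>m \<le> ln 2 \<and>
        (\<forall>\<alpha> \<alpha>'. 0 < \<alpha> \<and> \<alpha> \<le> \<alpha>' \<and> \<alpha>' < \<alpha>\<^sub>m \<longrightarrow>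
          (\<exists>m::real. 0 < m \<and> (\<forall>\<alpha>\<^sub>0\<in>{\<alpha>..\<alpha>'}.
             ereal m \<le> liminf (\<lambda>N. ereal (real N * upper_tail N \<beta> (\<alpha>\<^sub>0 * real N))
                                    * exp_ereal (log_mgf_conj N \<beta> (\<alpha>\<^sub>0 * real N))))))"
    \<comment> \<open>The lower bound holds up to any level below \<open>ln 2\<close>, so the
      threshold can be taken as large as the statement allows.\<close>
    by (intro exI[of _ "ln 2"] conjI allI impI ln2 order_refl upper_tail_liminf_ge[OF assms]) auto
  show "\<forall>\<alpha>>0. \<exists>C::real. \<forall>\<alpha>\<^sub>0\<in>{\<alpha>..<ln 2}. \<forall>N\<ge>1.
           \<bar>log_mgf_conj N 2 (\<alpha>\<^sub>0 * real N)
             - ereal ((real N)\<^sup>2 * rate_I (theta_inv \<alpha>\<^sub>0) + ln (real N) / 12)\<bar> \<le> ereal C"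
    using log_mgf_conj_beta2 by blast
  show "\<forall>\<alpha>>0. \<exists>M::real. \<forall>\<alpha>\<^sub>0\<in>{\<alpha>..<ln 2}.
           limsup (\<lambda>N. ereal (real N powr (13 / 12) * upper_tail N 2 (\<alpha>\<^sub>0 * real N)
                                / (theta_inv \<alpha>\<^sub>0)\<^sup>2
                              * exp ((real N)\<^sup>2 * rate_I (theta_inv \<alpha>\<^sub>0)))) \<le> ereal M"
    using upper_tail_limsup_beta2_le by blast
  show "\<exists>\<alpha>\<^sub>m. 0 < \<alpha>\<^sub>m \<and> \<alpha>\<^sub>m \<le> ln 2 \<and>
          (\<forall>\<alpha> \<alpha>'. 0 < \<alpha> \<and> \<alpha> \<le> \<alpha>' \<and> \<alpha>' < \<alpha>\<^sub>m \<longrightarrow>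
            (\<exists>m::real. 0 < m \<and> (\<forall>\<alpha>\<^sub>0\<in>{\<alpha>..\<alpha>'}.
               ereal m \<le> liminf (\<lambda>N. ereal (real N powr (13 / 12) * upper_tail N 2 (\<alpha>\<^sub>0 * real N)
                                      * exp ((real N)\<^sup>2 * rate_I (theta_inv \<alpha>\<^sub>0)))))))"
    by (intro exI[of _ "ln 2"] conjI allI impI ln2 order_refl upper_tail_liminf_beta2_ge) auto
  show "\<forall>\<alpha>>0. \<forall>\<alpha>\<^sub>0\<in>{\<alpha>..<ln 2}. \<exists>C::real. \<forall>N\<ge>1.
           \<bar>log_mgf_conj N \<beta> (\<alpha>\<^sub>0 * real N)
             - ereal ((real N)\<^sup>2 * (\<beta> / 2) * rate_I (theta_inv \<alpha>\<^sub>0))\<bar> \<le> ereal (C * real N)"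
    using log_mgf_conj_asymp[OF assms] by auto
  show "large_deviation_principle
          (\<lambda>N. distr (cbe N \<beta>) borel (\<lambda>z. log_charpoly N z / real N)) (\<lambda>N. (real N)\<^sup>2) (cbe_rate \<beta>)"
    by (rule cbe_large_deviation_principle[OF assms])
qed

end
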